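(* Fix $\gamma>0$, let $\jmath$ satisfy Hypotheses J1–J3 with $\jmath$ increasing on $(0,\infty)$, and let $k>0$ be an admissible wavenumber with $$k^2\left(\jmath(k)-\jmath(k/2)\right)>3\gamma .$$ Then sufficiently small amplitude periodic traveling waves $\eta_{\mathfrak g}(\varepsilon;k)$ of the gRMKP equation are transversely unstable with respect to non-periodic (localized or bounded) perturbations in the direction of propagation and periodic, finite wavelength perturbations in the transverse direction. That is: there are $\rho_0>0$ and $\varepsilon_0>0$ such that for every $0<|\varepsilon|<\varepsilon_0$ there is $\rho$ with $|\rho|\ge\rho_0$ at which the wave has a non-periodic instability.
   Context: Let $\mathbb T=\mathbb R/2\pi\mathbb Z$. The generalized rotation-modified Kadomtsev-Petviashvili (gRMKP) equation for $u=u(x,y,t)$ is $(u_t+\mathcal Ju_x+\alpha_1(u^2)_x+\alpha_2(u^3)_x)_x-\gamma u+u_{yy}=0$, $\gamma>0$, $\alpha_1\in\{0,1\}$, $\alpha_2\in\{-1,0\}$, where $\widehat{\mathcal Jf}(k)=\jmath(k)\widehat f(k)$ ($x$-variable) and: (J1) $\jmath$ is real valued, even, $\jmath(0)=1$; (J2) for some $\mathfrak b\ge-1$ and $A_1,A_2>0$, $A_1k^{\mathfrak b}\le\jmath(k)\le A_2k^{\mathfrak b}$ for $k\gg1$; (J3) $\jmath$ is strictly monotonic on $k>0$. Admissible wavenumbers: if $\jmath$ is increasing, all $k>0$ such that $k^2(\jmath(kn)-\jmath(k))\neq\gamma(n^2-1)/n^2$ for every integer $n\ge2$. For these there is a one-parameter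 family of $y$-independent solutions $u=\eta_{\mathfrak g}(\varepsilon;k)(k(x-c_{\mathfrak g}(\varepsilon;k)t))$, $|\varepsilon|$ small, with $\eta_{\mathfrak g}$ $2\pi$-periodic, even and smooth in $z=k(x-c_{\mathfrak g}t)$, $c_{\mathfrak g}$ even in $\varepsilon$, analytic dependence on $\varepsilon,k$, and $\eta_{\mathfrak g}(z)=\varepsilon\cos z+\varepsilon^2\eta_{\mathfrak g_2}\cos2z+\varepsilon^3\eta_{\mathfrak g_3}\cos3z+O(\varepsilon^4)$, $c_{\mathfrak g}=c_{\mathfrak g_0}+\varepsilon^2c_{\mathfrak g_2}+O(\varepsilon^4)$, where $c_{\mathfrak g_0}=\jmath(k)+\frac{\gamma}{k^2}$, $\eta_{\mathfrak g_2}=\frac{2\alpha_1k^2}{3\gamma+4k^2(\jmath(k)-\jmath(2k))}$, $\eta_{\mathfrak g_3}=\frac{9\alpha_1k^2\eta_{\mathfrak g_2}+\frac94\alpha_2k^2}{8\gamma+9k^2(\jmath(k)-\jmath(3k))}$, $c_{\mathfrak g_2}=\alpha_1\eta_{\mathfrak g_2}+\frac34\alpha_2$. Spectral problem. Linearizing about $\eta_{\mathfrak g}$ and taking perturbations $e^{\lambda t/k+i\rho y}\varphi(z)$ gives $\mathcal G^{\mathfrak g}_\varepsilon(\lambda,\rho)\varphi=0$ with $\mathcal G^{\mathfrak g}_\varepsilon(\lambda,\rho)=\lambda\partial_z-k^2\partial_z^2(c_{\mathfrak g}-\mathcal J_k-2\alpha_1\eta_{\mathfrak g}-3\alpha_2\eta_{\mathfrak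 g}^2)-\rho^2-\gamma$, where $\mathcal J_k$ is the Fourier multiplier in $z$ with $\mathcal J_ke^{isz}=\jmath(ks)e^{isz}$. For localized or bounded perturbations the operator acts in $L^2(\mathbb R)$ or $C_b(\mathbb R)$; by Floquet theory its invertibility there is equivalent to invertibility in $L^2(\mathbb T)$, with domain $H^{2+\max(\mathfrak b,0)}(\mathbb T)$, of all operators $\mathcal G^{\mathfrak g}_{\varepsilon,\xi}(\lambda,\rho)=e^{-i\xi z}\mathcal G^{\mathfrak g}_\varepsilon(\lambda,\rho)e^{i\xi z}$, $\xi\in(-\frac12,\frac12]$ (replace $\partial_z$ by $\partial_z+i\xi$ and let $\mathcal J_k$ multiply $e^{inz}$ by $\jmath(k(n+\xi))$). The value $\xi=0$ is the periodic case, and "non-periodic" refers to $\xi\ne0$. For $\rho\ne0$ the wave has a non-periodic instability at $\rho$ if there are $\xi\in(-\frac12,\frac12]\setminus\{0\}$ and $\lambda\in\mathbb C$ with $\operatorname{Re}\lambda>0$ such that $\mathcal G^{\mathfrak g}_{\varepsilon,\xi}(\lambda,\rho)$ is not invertible in $L^2(\mathbb T)$.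
   Formalization: The formal theorem assumes α₁ ≠ 0, i.e. α₁ = 1; for α₁ = 0 the claim fails, e.g. α₁ = α₂ = 0, ȷ(k) = 1 + k², k⁴ > 4γ, η = ε cos z: the operator is diagonal and invertible whenever Re λ > 0, ξ ≠ 0. *)

theory Defs
  imports "HOL-Analysis.Analysis"
begin

section \<open>The dispersion symbol and admissible wavenumbers\<close>

definition hyp_J1 :: "(real \<Rightarrow> real) \<Rightarrow> bool" where
  "hyp_J1 j \<longleftrightarrow> (\<forall>\<kappa>. j (- \<kappa>) = j \<kappa>) \<and> j 0 = 1"

definition hyp_J2 :: "(real \<Rightarrow> real) \<Rightarrow> real \<Rightarrow> bool" where
  "hyp_J2 j b \<longleftrightarrow> b \<ge> - 1 \<and>
     (\<exists>A1 > 0. \<exists>A2 > 0. \<forall>\<^sub>F \<kappa> in at_top. A1 * \<kappa> powr b \<le> j \<kappa> \<and> j \<kappa> \<le> A2 * \<kappa> powr b)"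

definition hyp_J3 :: "(real \<Rightarrow> real) \<Rightarrow> bool" where
  "hyp_J3 j \<longleftrightarrow> strict_mono_on {0<..} j \<or> strict_antimono_on {0<..} j"

text \<open>Admissibility in the case of an increasing symbol.\<close>

definition admissible :: "(real \<Rightarrow> real) \<Rightarrow> real \<Rightarrow> real \<Rightarrow> bool" where
  "admissible j \<gamma> k \<longleftrightarrow> k > 0 \<and>
     (\<forall>n::nat. n \<ge> 2 \<longrightarrow> k\<^sup>2 * (j (k * real n) - j k) \<noteq> \<gamma> * ((real n)\<^sup>2 - 1) / (real n)\<^sup>2)"

section \<open>Function spaces on the circle\<close>

text \<open>Functions on the circle are $2\pi$-periodic functions on the line; elements of
  $L^2(\mathbb{T})$ are not quotiented, so equality in that space is equality almost everywhere.\<close>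

definition periodic_2pi :: "(real \<Rightarrow> 'a) \<Rightarrow> bool" where
  "periodic_2pi f \<longleftrightarrow> (\<forall>z. f (z + 2 * pi) = f z)"

definition smooth :: "(real \<Rightarrow> real) \<Rightarrow> bool" where
  "smooth f \<longleftrightarrow> (\<forall>m z. (deriv ^^ m) f differentiable at z)"

definition fourier_coeff :: "(real \<Rightarrow> complex) \<Rightarrow> int \<Rightarrow> complex" where
  "fourier_coeff f n =
     (LINT z:{0..2 * pi}|lborel. cis (- (real_of_int n * z)) * f z) / complex_of_real (2 * pi)"

definition L2T :: "(real \<Rightarrow> complex) set" where
  "L2T = {f. periodic_2pi f \<and> f \<in> borel_measurable lborel \<and>
             set_integrable lborel {0..2 * pi} (\<lambda>z. (norm (f z))\<^sup>2)}"

definition L2norm :: "(real \<Rightarrow> complex) \<Rightarrow> real" where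
  "L2norm f = sqrt (LINT z:{0..2 * pi}|lborel. (norm (f z))\<^sup>2)"

definition HsT :: "real \<Rightarrow> (real \<Rightarrow> complex) set" where
  "HsT s = {f \<in> L2T.
     (\<lambda>n::int. (1 + (real_of_int n)\<^sup>2) powr s * (norm (fourier_coeff f n))\<^sup>2) summable_on UNIV}"

section \<open>The equation and the periodic traveling waves\<close>

text \<open>The operator $\mathcal{J}$ on functions of $x$ that are $2\pi/k$-periodic. The series is real
  for a real-valued argument, because the symbol is real and even.\<close>

definition J_op :: "(real \<Rightarrow> real) \<Rightarrow> real \<Rightarrow> (real \<Rightarrow> real) \<Rightarrow> real \<Rightarrow> real" where
  "J_op j k f x = Re (\<Sum>\<^sub>\<infinity>n::int. complex_of_real (j (k * real_of_int n))
       * fourier_coeff (\<lambda>z. complex_of_real (f (z / k))) n * cis (real_of_int n * k * x))"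

text \<open>The equation for a function \<open>u x y t\<close> that is $2\pi/k$-periodic in \<open>x\<close>. Differentiability is
  not part of this predicate; it is only used for smooth waves.\<close>

definition solves_gRMKP ::
  "(real \<Rightarrow> real) \<Rightarrow> real \<Rightarrow> real \<Rightarrow> real \<Rightarrow> real \<Rightarrow> (real \<Rightarrow> real \<Rightarrow> real \<Rightarrow> real) \<Rightarrow> bool" where
  "solves_gRMKP j \<gamma> \<alpha>\<^sub>1 \<alpha>\<^sub>2 k u \<longleftrightarrow> (\<forall>x y t.
     deriv (\<lambda>x. deriv (\<lambda>t. u x y t) t
              + J_op j k (\<lambda>x. deriv (\<lambda>x. u x y t) x) x
              + \<alpha>\<^sub>1 * deriv (\<lambda>x. (u x y t)\<^sup>2) x
              + \<alpha>\<^sub>2 * deriv (\<lambda>x. (u x y t) ^ 3) x) x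
       - \<gamma> * u x y t + (deriv ^^ 2) (\<lambda>y. u x y t) y = 0)"

definition wave_c0 :: "(real \<Rightarrow> real) \<Rightarrow> real \<Rightarrow> real \<Rightarrow> real" where
  "wave_c0 j \<gamma> k = j k + \<gamma> / k\<^sup>2"

definition wave_eta2 :: "(real \<Rightarrow> real) \<Rightarrow> real \<Rightarrow> real \<Rightarrow> real \<Rightarrow> real" where
  "wave_eta2 j \<gamma> \<alpha>\<^sub>1 k = 2 * \<alpha>\<^sub>1 * k\<^sup>2 / (3 * \<gamma> + 4 * k\<^sup>2 * (j k - j (2 * k)))"

definition wave_eta3 :: "(real \<Rightarrow> real) \<Rightarrow> real \<Rightarrow> real \<Rightarrow> real \<Rightarrow> real \<Rightarrow> real" where
  "wave_eta3 j \<gamma> \<alpha>\<^sub>1 \<alpha>\<^sub>2 k =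
     (9 * \<alpha>\<^sub>1 * k\<^sup>2 * wave_eta2 j \<gamma> \<alpha>\<^sub>1 k + 9 / 4 * \<alpha>\<^sub>2 * k\<^sup>2) /
     (8 * \<gamma> + 9 * k\<^sup>2 * (j k - j (3 * k)))"

definition wave_c2 :: "(real \<Rightarrow> real) \<Rightarrow> real \<Rightarrow> real \<Rightarrow> real \<Rightarrow> real \<Rightarrow> real" where
  "wave_c2 j \<gamma> \<alpha>\<^sub>1 \<alpha>\<^sub>2 k = \<alpha>\<^sub>1 * wave_eta2 j \<gamma> \<alpha>\<^sub>1 k + 3 / 4 * \<alpha>\<^sub>2"

text \<open>Analytic dependence on the amplitude near 0: $\varepsilon \mapsto \eta(\varepsilon)$ is given by
  a power series that converges in $C^m(\mathbb{T})$ for every $m$, with a radius that may depend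
  on $m$ (the first bound is the Cauchy estimate for its coefficients).\<close>

definition analytic_profile :: "(real \<Rightarrow> real \<Rightarrow> real) \<Rightarrow> bool" where
  "analytic_profile \<eta> \<longleftrightarrow> (\<exists>h :: nat \<Rightarrow> real \<Rightarrow> real.
     (\<forall>n. smooth (h n) \<and> periodic_2pi (h n)) \<and>
     (\<forall>m. \<exists>r > 0. \<exists>B.
        (\<forall>n z. \<bar>(deriv ^^ m) (h n) z\<bar> * r ^ n \<le> B) \<and>
        (\<forall>\<epsilon> z. \<bar>\<epsilon>\<bar> < r \<longrightarrow>
           (\<lambda>n. \<epsilon> ^ n * (deriv ^^ m) (h n) z) sums (deriv ^^ m) (\<eta> \<epsilon>) z)))"

definition analytic_speed :: "(real \<Rightarrow> real) \<Rightarrow> bool" where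
  "analytic_speed c \<longleftrightarrow> (\<exists>a :: nat \<Rightarrow> real. \<exists>r > 0. \<forall>\<epsilon>. \<bar>\<epsilon>\<bar> < r \<longrightarrow> (\<lambda>n. a n * \<epsilon> ^ n) sums c \<epsilon>)"

text \<open>\<open>\<eta> \<epsilon>\<close> is the profile and \<open>c \<epsilon>\<close> the speed of the wave of amplitude parameter \<open>\<epsilon>\<close>, at a
  fixed wavenumber \<open>k\<close>; only small \<open>\<bar>\<epsilon>\<bar>\<close> is constrained.\<close>

definition wave_family ::
  "(real \<Rightarrow> real) \<Rightarrow> real \<Rightarrow> real \<Rightarrow> real \<Rightarrow> real \<Rightarrow> (real \<Rightarrow> real \<Rightarrow> real) \<Rightarrow> (real \<Rightarrow> real) \<Rightarrow> bool" where
  "wave_family j \<gamma> \<alpha>\<^sub>1 \<alpha>\<^sub>2 k \<eta> c \<longleftrightarrow>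
     (\<exists>\<epsilon>1 > 0. \<exists>C.
        \<forall>\<epsilon>. \<bar>\<epsilon>\<bar> < \<epsilon>1 \<longrightarrow>
          periodic_2pi (\<eta> \<epsilon>) \<and> smooth (\<eta> \<epsilon>) \<and> (\<forall>z. \<eta> \<epsilon> (- z) = \<eta> \<epsilon> z) \<and>
          c (- \<epsilon>) = c \<epsilon> \<and>
          solves_gRMKP j \<gamma> \<alpha>\<^sub>1 \<alpha>\<^sub>2 k (\<lambda>x y t. \<eta> \<epsilon> (k * (x - c \<epsilon> * t))) \<and>
          (\<forall>z. \<bar>\<eta> \<epsilon> z - (\<epsilon> * cos z + \<epsilon>\<^sup>2 * wave_eta2 j \<gamma> \<alpha>\<^sub>1 k * cos (2 * z)
                 + \<epsilon> ^ 3 * wave_eta3 j \<gamma> \<alpha>\<^sub>1 \<alpha>\<^sub>2 k * cos (3 * z))\<bar> \<le> C * \<epsilon> ^ 4) \<and>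
          \<bar>c \<epsilon> - (wave_c0 j \<gamma> k + \<epsilon>\<^sup>2 * wave_c2 j \<gamma> \<alpha>\<^sub>1 \<alpha>\<^sub>2 k)\<bar> \<le> C * \<epsilon> ^ 4) \<and>
     analytic_profile \<eta> \<and> analytic_speed c"

section \<open>The spectral problem\<close>

text \<open>\<open>G_op \<dots> \<phi> \<psi>\<close> says that $\psi = \mathcal{G}_{\varepsilon,\xi}(\lambda,\rho)\varphi$ in
  $L^2(\mathbb{T})$ for the wave with profile \<open>p\<close> and speed \<open>c\<close>. It is stated through Fourier
  coefficients, where $\partial_z + i\xi$ acts as multiplication by $i(n+\xi)$; the product of
  \<open>p\<close> and $\varphi$ is a product of functions.\<close>

definition G_op ::
  "(real \<Rightarrow> real) \<Rightarrow> real \<Rightarrow> real \<Rightarrow> real \<Rightarrow> real \<Rightarrow> (real \<Rightarrow> real) \<Rightarrow> real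
    \<Rightarrow> real \<Rightarrow> complex \<Rightarrow> real \<Rightarrow> (real \<Rightarrow> complex) \<Rightarrow> (real \<Rightarrow> complex) \<Rightarrow> bool" where
  "G_op j \<gamma> \<alpha>\<^sub>1 \<alpha>\<^sub>2 k p c \<xi> lam \<rho> \<phi> \<psi> \<longleftrightarrow> \<psi> \<in> L2T \<and>
     (\<forall>n::int. let s = real_of_int n + \<xi>; D = \<i> * complex_of_real s in
        fourier_coeff \<psi> n =
          lam * D * fourier_coeff \<phi> n
          - (complex_of_real k)\<^sup>2 * D\<^sup>2 *
              (complex_of_real (c - j (k * s)) * fourier_coeff \<phi> n
               - fourier_coeff (\<lambda>z. complex_of_real (2 * \<alpha>\<^sub>1 * p z + 3 * \<alpha>\<^sub>2 * (p z)\<^sup>2) * \<phi> z) n)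
          - complex_of_real (\<rho>\<^sup>2 + \<gamma>) * fourier_coeff \<phi> n)"

text \<open>Bounded invertibility in $L^2(\mathbb{T})$ of the operator with domain
  $H^{2+\max(b,0)}(\mathbb{T})$.\<close>

definition G_invertible ::
  "(real \<Rightarrow> real) \<Rightarrow> real \<Rightarrow> real \<Rightarrow> real \<Rightarrow> real \<Rightarrow> real \<Rightarrow> (real \<Rightarrow> real) \<Rightarrow> real
    \<Rightarrow> real \<Rightarrow> complex \<Rightarrow> real \<Rightarrow> bool" where
  "G_invertible j b \<gamma> \<alpha>\<^sub>1 \<alpha>\<^sub>2 k p c \<xi> lam \<rho> \<longleftrightarrow>
     (\<exists>C. \<forall>\<psi> \<in> L2T. \<exists>\<phi> \<in> HsT (2 + max b 0).
        G_op j \<gamma> \<alpha>\<^sub>1 \<alpha>\<^sub>2 k p c \<xi> lam \<rho> \<phi> \<psi> \<and>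
        (\<forall>\<phi>' \<in> HsT (2 + max b 0). G_op j \<gamma> \<alpha>\<^sub>1 \<alpha>\<^sub>2 k p c \<xi> lam \<rho> \<phi>' \<psi> \<longrightarrow>
           (AE z in lborel. \<phi>' z = \<phi> z)) \<and>
        L2norm \<phi> \<le> C * L2norm \<psi>)"

definition nonperiodic_instability ::
  "(real \<Rightarrow> real) \<Rightarrow> real \<Rightarrow> real \<Rightarrow> real \<Rightarrow> real \<Rightarrow> real \<Rightarrow> (real \<Rightarrow> real) \<Rightarrow> real
    \<Rightarrow> real \<Rightarrow> bool" where
  "nonperiodic_instability j b \<gamma> \<alpha>\<^sub>1 \<alpha>\<^sub>2 k p c \<rho> \<longleftrightarrow>
     (\<exists>\<xi> \<in> {- 1 / 2 <.. 1 / 2} - {0}. \<exists>lam :: complex. Re lam > 0 \<and>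
        \<not> G_invertible j b \<gamma> \<alpha>\<^sub>1 \<alpha>\<^sub>2 k p c \<xi> lam \<rho>)"

end

(* At Floquet exponent 1/2 the modes carry the wavenumbers s = n + 1/2. Dividing the mode n of the
   eigenvalue equation by s^2 gives (d_n + i lambda / s) w_n = k^2 (q * w)_n, where q holds the Fourier
   coefficients of the potential and d_n = k^2 (c - j (k s)) - (rho^2 + gamma) / s^2. The hypothesis on k
   says precisely that rho^2 > 0 solves d_0 = 0 at zero amplitude; then d_0 = d_{-1} = 0, because j is
   even, and the potential couples these two modes at order epsilon.

   If d_n stays away from 0 for large n, a real eigenvalue is found on the space of w with
   w_{-n-1} = cnj w_n. The modes after 0 are eliminated by the Lax-Milgram theorem and the remaining
   complex equation, a real-linear map of the plane depending on lambda, has a nontrivial solution for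
   some lambda > 0 by the intermediate value theorem. If the modes 0, ..., p are all resonant, rho is
   first shifted by an amount of order epsilon, chosen as a root of a three-term recursion, so that the
   block has an approximate null vector.

   Otherwise j (k s) tends to c_0, because j is monotone. Then far out the operator is close to
   multiplication by c - c_0 - P(z), P being the potential; P takes the value c - c_0 for small
   epsilon, so the operator is not onto whatever lambda and rho are. *)

theory Submission
  imports Defs
begin

section \<open>Complex square summable sequences as a real Hilbert space\<close>

section \<open>Square summable sequences\<close>

text \<open>The reflection w_{-n-1} = cnj w_n leaves a Toeplitz part q(n - m) and a Hankel part q(n
  + m + 1) acting on cnj w, so the problem is only real-linear. The single Hankel entry of order
  \<epsilon> is q(1) at n = m = 0; the others are O(\<epsilon>^2). That entry is cut out and
  replaced by a free source \<zeta> in row 0. The truncated system is solved for every \<zeta>, and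
  an eigenvector is a solution with \<zeta> = K q(1) cnj w_0. The bracket for lambda has both ends
  of order |\<epsilon>|. Pairing with w and taking imaginary parts removes the self-adjoint Toeplitz
  part and makes w_0 small at the upper end; pairing with an approximate null vector makes w_0 large
  at the lower end. The obstacle is that coercivity on the low modes is then itself only of order
  |\<epsilon>|: a rotation by -i removes the low-low coupling exactly, and coupling to the high
  modes costs only \<epsilon>^2. Several resonances can occur because c_0 - \<mu> / (k s)^2
  increases in s, as j(k s) does, so the two may meet at further half-integers.\<close>

typedef ell2 = "{f :: nat \<Rightarrow> complex. summable (\<lambda>n. (cmod (f n))\<^sup>2)}"
  morphisms coord Abs_ell2
  by (rule exI[of _ "\<lambda>_. 0"]) auto

lemma coord_summable: "summable (\<lambda>n. (cmod (coord x n))\<^sup>2)"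
  using coord[of x] by simp

lemma coord_Abs: "summable (\<lambda>n. (cmod (f n))\<^sup>2) \<Longrightarrow> coord (Abs_ell2 f) = f"
  by (simp add: Abs_ell2_inverse)

lemma ell2_eqI: "(\<And>n. coord x n = coord y n) \<Longrightarrow> x = y"
  by (metis coord_inject ext)

lemma cmod_add_sq: "(cmod (a + b))\<^sup>2 \<le> 2 * (cmod a)\<^sup>2 + 2 * (cmod b)\<^sup>2"
proof -
  have "(cmod (a + b))\<^sup>2 \<le> (cmod a + cmod b)\<^sup>2"
    by (intro power_mono norm_triangle_ineq) auto
  also have "\<dots> \<le> 2 * (cmod a)\<^sup>2 + 2 * (cmod b)\<^sup>2"
    using sum_squares_bound[of "cmod a" "cmod b"] by (simp add: power2_sum)
  finally show ?thesis .
qed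

lemma sq_summable_add:
  assumes "summable (\<lambda>n. (cmod (f n))\<^sup>2)" "summable (\<lambda>n. (cmod (g n))\<^sup>2)"
  shows "summable (\<lambda>n. (cmod (f n + g n))\<^sup>2)"
proof (rule summable_comparison_test'[where N = 0])
  show "summable (\<lambda>n. 2 * (cmod (f n))\<^sup>2 + 2 * (cmod (g n))\<^sup>2)"
    by (intro summable_add summable_mult assms)
  show "norm ((cmod (f n + g n))\<^sup>2) \<le> 2 * (cmod (f n))\<^sup>2 + 2 * (cmod (g n))\<^sup>2" for n
    using cmod_add_sq[of "f n" "g n"] by simp
qed

lemma sq_summable_cmult:
  assumes "summable (\<lambda>n. (cmod (f n))\<^sup>2)" "\<And>n. cmod (b n) \<le> B"
  shows "summable (\<lambda>n. (cmod (b n * f n))\<^sup>2)"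
proof (rule summable_comparison_test'[where g = "\<lambda>n. B\<^sup>2 * (cmod (f n))\<^sup>2" and N = 0])
  show "summable (\<lambda>n. B\<^sup>2 * (cmod (f n))\<^sup>2)" using assms(1) by (rule summable_mult)
  fix n
  show "norm ((cmod (b n * f n))\<^sup>2) \<le> B\<^sup>2 * (cmod (f n))\<^sup>2"
    using mult_right_mono[OF power_mono[OF assms(2)[of n], of 2], of "(cmod (f n))\<^sup>2"]
    by (simp add: norm_mult power_mult_distrib)
qed

lemma inner_summable:
  assumes "summable (\<lambda>n. (cmod (f n))\<^sup>2)" "summable (\<lambda>n. (cmod (g n))\<^sup>2)"
  shows "summable (\<lambda>n. f n \<bullet> g n)"
proof (rule summable_comparison_test'[where g = "\<lambda>n. (cmod (f n))\<^sup>2 + (cmod (g n))\<^sup>2" and N = 0])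
  show "summable (\<lambda>n. (cmod (f n))\<^sup>2 + (cmod (g n))\<^sup>2)" using assms by (rule summable_add)
  fix n
  have "norm (f n \<bullet> g n) \<le> cmod (f n) * cmod (g n)" by (simp add: Cauchy_Schwarz_ineq2)
  also have "\<dots> \<le> (cmod (f n))\<^sup>2 + (cmod (g n))\<^sup>2"
    using sum_squares_bound[of "cmod (f n)" "cmod (g n)"] mult_nonneg_nonneg[OF norm_ge_zero[of "f n"] norm_ge_zero[of "g n"]]
    by linarith
  finally show "norm (f n \<bullet> g n) \<le> (cmod (f n))\<^sup>2 + (cmod (g n))\<^sup>2" .
qed

text \<open>Only a real structure is built, since the operators below involve complex conjugation.
  The inner product is the real part of the usual Hermitian one.\<close>

instantiation ell2 :: real_inner
begin

definition "0 = Abs_ell2 (\<lambda>_. 0)"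
definition "x + y = Abs_ell2 (\<lambda>n. coord x n + coord y n)"
definition "- x = Abs_ell2 (\<lambda>n. - coord x n)"
definition "x - y = Abs_ell2 (\<lambda>n. coord x n - coord y n)"
definition "r *\<^sub>R x = Abs_ell2 (\<lambda>n. r *\<^sub>R coord x n)"
definition "x \<bullet> y = (\<Sum>n. coord x n \<bullet> coord y n)"
definition "norm (x :: ell2) = sqrt (x \<bullet> x)"
definition "dist (x :: ell2) y = norm (x - y)"
definition "sgn (x :: ell2) = inverse (norm x) *\<^sub>R x"
definition "(uniformity :: (ell2 \<times> ell2) filter) = (INF e\<in>{0<..}. principal {(x, y). dist x y < e})"
definition "open (U :: ell2 set) \<longleftrightarrow> (\<forall>x\<in>U. eventually (\<lambda>(x', y). x' = x \<longrightarrow> y \<in> U) uniformity)"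

lemma coord_zero [simp]: "coord 0 n = 0"
  by (simp add: zero_ell2_def coord_Abs)
lemma coord_add [simp]: "coord (x + y) n = coord x n + coord y n"
  by (simp add: plus_ell2_def coord_Abs sq_summable_add coord_summable)
lemma coord_uminus [simp]: "coord (- x) n = - coord x n"
  by (simp add: uminus_ell2_def coord_Abs coord_summable)
lemma coord_diff [simp]: "coord (x - y) n = coord x n - coord y n"
  using sq_summable_add[OF coord_summable[of x] coord_summable[of "- y"]]
  by (simp add: minus_ell2_def coord_Abs)
lemma coord_scaleR [simp]: "coord (r *\<^sub>R x) n = r *\<^sub>R coord x n"
  using sq_summable_cmult[OF coord_summable[of x], of "\<lambda>_. of_real r" "\<bar>r\<bar>"]
  by (simp add: scaleR_ell2_def coord_Abs scaleR_conv_of_real)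

instance
proof
  fix x y z :: ell2 and a b :: real
  have sm: "summable (\<lambda>n. coord u n \<bullet> coord v n)" for u v :: ell2
    by (rule inner_summable[OF coord_summable coord_summable])
  show "x + y + z = x + (y + z)"
    by (rule ell2_eqI) (simp add: algebra_simps)
  show "x + y = y + x"
    by (rule ell2_eqI) (simp add: algebra_simps)
  show "0 + x = x"
    by (rule ell2_eqI) (simp add: algebra_simps)
  show "- x + x = 0"
    by (rule ell2_eqI) (simp add: algebra_simps)
  show "x - y = x + - y"
    by (rule ell2_eqI) (simp add: algebra_simps)
  show "a *\<^sub>R (x + y) = a *\<^sub>R x + a *\<^sub>R y"
    by (rule ell2_eqI) (simp add: algebra_simps)
  show "(a + b) *\<^sub>R x = a *\<^sub>R x + b *\<^sub>R x"
    by (rule ell2_eqI) (simp add: algebra_simps)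
  show "a *\<^sub>R b *\<^sub>R x = (a * b) *\<^sub>R x"
    by (rule ell2_eqI) (simp add: algebra_simps)
  show "1 *\<^sub>R x = x"
    by (rule ell2_eqI) (simp add: algebra_simps)
  show "dist x y = norm (x - y)" by (rule dist_ell2_def)
  show "sgn x = inverse (norm x) *\<^sub>R x" by (rule sgn_ell2_def)
  show "(uniformity :: (ell2 \<times> ell2) filter) = (INF e\<in>{0<..}. principal {(x, y). dist x y < e})"
    by (rule uniformity_ell2_def)
  show "open U = (\<forall>x\<in>U. \<forall>\<^sub>F (x', y) in uniformity. x' = x \<longrightarrow> y \<in> U)" for U :: "ell2 set"
    by (rule open_ell2_def)
  show "x \<bullet> y = y \<bullet> x" by (simp add: inner_ell2_def inner_commute)
  show "(x + y) \<bullet> z = x \<bullet> z + y \<bullet> z"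
    by (simp add: inner_ell2_def inner_add_left suminf_add[OF sm sm])
  show "(a *\<^sub>R x) \<bullet> y = a * (x \<bullet> y)"
    by (simp add: inner_ell2_def suminf_mult[OF sm])
  show "0 \<le> x \<bullet> x"
    by (simp add: inner_ell2_def suminf_nonneg[OF sm])
  show "(x \<bullet> x = 0) = (x = 0)"
  proof
    assume "x \<bullet> x = 0"
    then have "coord x n = 0" for n
      using suminf_eq_zero_iff[OF sm[of x x]] by (simp add: inner_ell2_def)
    then show "x = 0" by (intro ell2_eqI) simp
  qed (simp add: inner_ell2_def)
  show "norm x = sqrt (x \<bullet> x)" by (simp only: norm_ell2_def)
qed

end

lemma ell2_norm_sq: "(norm x)\<^sup>2 = (\<Sum>n. (cmod (coord x n))\<^sup>2)"
  by (simp add: power2_norm_eq_inner inner_ell2_def)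

lemma ell2_sum_le: "finite A \<Longrightarrow> (\<Sum>n\<in>A. (cmod (coord x n))\<^sup>2) \<le> (norm x)\<^sup>2"
  unfolding ell2_norm_sq by (intro sum_le_suminf coord_summable) auto

lemma coord_le_norm: "cmod (coord x n) \<le> norm x"
  by (rule power2_le_imp_le[OF _ norm_ge_zero]) (use ell2_sum_le[of "{n}" x] in simp)

text \<open>Membership and norm bound come from one estimate on partial sums, which is the form in
  which the Schur test below delivers its result.\<close>

lemma ell2_bounded_sums:
  assumes "\<And>N. (\<Sum>n<N. (cmod (f n))\<^sup>2) \<le> B\<^sup>2" "B \<ge> 0"
  shows "summable (\<lambda>n. (cmod (f n))\<^sup>2)" "norm (Abs_ell2 f) \<le> B"
proof -
  show s: "summable (\<lambda>n. (cmod (f n))\<^sup>2)"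
  proof (rule bounded_imp_summable[of _ "B\<^sup>2"])
    show "(\<Sum>k\<le>n. (cmod (f k))\<^sup>2) \<le> B\<^sup>2" for n
      using assms(1)[of "Suc n"] by (simp only: lessThan_Suc_atMost)
  qed simp
  have "(norm (Abs_ell2 f))\<^sup>2 \<le> B\<^sup>2"
    unfolding ell2_norm_sq coord_Abs[OF s] by (intro suminf_le_const s assms)
  then show "norm (Abs_ell2 f) \<le> B" using assms(2) by (rule power2_le_imp_le)
qed

instance ell2 :: complete_space
proof
  fix X :: "nat \<Rightarrow> ell2" assume X: "Cauchy X"
  have "Cauchy (\<lambda>i. coord (X i) n)" for n
  proof (rule metric_CauchyI)
    fix e :: real assume "e > 0"
    from metric_CauchyD[OF X this] obtain M where M: "\<forall>i\<ge>M. \<forall>l\<ge>M. dist (X i) (X l) < e" ..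
    have "dist (coord (X i) n) (coord (X l) n) < e" if "i \<ge> M" "l \<ge> M" for i l
      using coord_le_norm[of "X i - X l" n] M[rule_format, OF that] by (simp add: dist_norm)
    then show "\<exists>M. \<forall>i\<ge>M. \<forall>l\<ge>M. dist (coord (X i) n) (coord (X l) n) < e" by blast
  qed
  then have "convergent (\<lambda>i. coord (X i) n)" for n
    by (rule Cauchy_convergent)
  define f where "f n = lim (\<lambda>i. coord (X i) n)" for n
  have f: "(\<lambda>i. coord (X i) n) \<longlonglongrightarrow> f n" for n
    unfolding f_def convergent_LIMSEQ_iff[symmetric] by fact
  \<comment> \<open>For fixed \<open>N\<close> the finite sum passes to the limit in
    \<open>l\<close>; the resulting bound is uniform in \<open>N\<close>, so no limits are
    interchanged.\<close>
  have tail: "(\<Sum>n<N. (cmod (coord (X i) n - f n))\<^sup>2) \<le> e\<^sup>2"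
    if "\<And>l. l \<ge> M \<Longrightarrow> dist (X i) (X l) < e" for i M e N
  proof (rule LIMSEQ_le_const2)
    show "(\<lambda>l. \<Sum>n<N. (cmod (coord (X i) n - coord (X l) n))\<^sup>2) \<longlonglongrightarrow> (\<Sum>n<N. (cmod (coord (X i) n - f n))\<^sup>2)"
      by (intro tendsto_intros f)
    have "(\<Sum>n<N. (cmod (coord (X i) n - coord (X l) n))\<^sup>2) \<le> e\<^sup>2" if "l \<ge> M" for l
    proof -
      have "(\<Sum>n<N. (cmod (coord (X i) n - coord (X l) n))\<^sup>2) \<le> (norm (X i - X l))\<^sup>2"
        using ell2_sum_le[of "{..<N}" "X i - X l"] by simp
      also have "\<dots> \<le> e\<^sup>2"
        using \<open>\<And>l. l \<ge> M \<Longrightarrow> dist (X i) (X l) < e\<close>[OF that] by (intro power_mono) (auto simp: dist_norm)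
      finally show ?thesis .
    qed
    then show "\<exists>M. \<forall>l\<ge>M. (\<Sum>n<N. (cmod (coord (X i) n - coord (X l) n))\<^sup>2) \<le> e\<^sup>2" by blast
  qed
  from metric_CauchyD[OF X zero_less_one] obtain M0
    where "\<forall>i\<ge>M0. \<forall>l\<ge>M0. dist (X i) (X l) < 1" ..
  then have "summable (\<lambda>n. (cmod (coord (X M0) n - f n))\<^sup>2)"
    by (intro ell2_bounded_sums(1)[of _ 1] tail[of M0]) auto
  \<comment> \<open>\<open>f\<close> is recovered as \<open>X M0 - (X M0 - f)\<close>, a difference
    of two square summable sequences.\<close>
  then have "summable (\<lambda>n. (cmod (coord (X M0) n + - (coord (X M0) n - f n)))\<^sup>2)"
    by (intro sq_summable_add coord_summable) (simp add: norm_minus_commute)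
  then have sf: "summable (\<lambda>n. (cmod (f n))\<^sup>2)" by simp
  have "X \<longlonglongrightarrow> Abs_ell2 f"
  proof (rule metric_LIMSEQ_I)
    fix r :: real assume r: "r > 0"
    from metric_CauchyD[OF X half_gt_zero[OF r]] obtain M
      where M: "\<forall>i\<ge>M. \<forall>l\<ge>M. dist (X i) (X l) < r / 2" ..
    have "dist (X i) (Abs_ell2 f) < r" if "i \<ge> M" for i
    proof -
      have eq: "Abs_ell2 (\<lambda>n. coord (X i) n - f n) = X i - Abs_ell2 f"
        by (simp add: minus_ell2_def coord_Abs[OF sf])
      have "norm (Abs_ell2 (\<lambda>n. coord (X i) n - f n)) \<le> r / 2"
        using tail[of M i "r / 2"] M that r by (intro ell2_bounded_sums(2)) auto
      then show ?thesis using r by (simp add: eq dist_norm)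
    qed
    then show "\<exists>M. \<forall>i\<ge>M. dist (X i) (Abs_ell2 f) < r" by blast
  qed
  then show "convergent X" by (rule convergentI)
qed

section \<open>Lax-Milgram, with continuous dependence on a parameter\<close>

section \<open>Coercive operators\<close>

text \<open>Solutions are the fixed points of \<open>x - t T x + t y\<close>. Coercivity makes the
  linear part a contraction; \<open>t = c / M^2\<close> minimises the squared factor 1 - 2 t c + t^2
  M^2.\<close>

lemma lax_milgram:
  fixes T :: "'a::{real_inner,complete_space} \<Rightarrow> 'a"
  assumes T: "bounded_linear T" and c: "c > 0" and coercive: "\<And>x. c * (norm x)\<^sup>2 \<le> x \<bullet> T x"
  shows "\<exists>!x. T x = y"
proof -
  interpret T: bounded_linear T by fact
  obtain M0 where M0: "M0 > 0" "\<And>x. norm (T x) \<le> norm x * M0"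
    using T.pos_bounded by blast
  \<comment> \<open>Adding \<open>c\<close> to the operator bound forces \<open>c < M\<close>, so 1
    - (c / M)^2 is positive and has a square root below 1.\<close>
  define M where "M = M0 + c"
  have M: "M > 0" "c < M" and TM: "norm (T x) \<le> norm x * M" for x
    using M0(1) M0(2)[of x] c mult_left_mono[of M0 M "norm x"] by (auto simp: M_def)
  define t where "t = c / M\<^sup>2"
  define q where "q = sqrt (1 - (c / M)\<^sup>2)"
  have cM: "(c / M)\<^sup>2 < 1" "0 < (c / M)\<^sup>2"
    using M c by (auto simp: power_less_one_iff)
  have t: "t > 0" and tq: "1 - 2 * t * c + t\<^sup>2 * M\<^sup>2 = 1 - (c / M)\<^sup>2"
    using c M by (auto simp: t_def power2_eq_square field_simps)
  have contr: "norm (x - t *\<^sub>R T x) \<le> q * norm x" for x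
  proof (rule power2_le_imp_le)
    have "(norm (x - t *\<^sub>R T x))\<^sup>2 = (norm x)\<^sup>2 - 2 * t * (x \<bullet> T x) + t\<^sup>2 * (norm (T x))\<^sup>2"
      unfolding power2_norm_eq_inner by (simp add: inner_diff inner_commute power2_eq_square algebra_simps)
    also have "\<dots> \<le> (norm x)\<^sup>2 - 2 * t * (c * (norm x)\<^sup>2) + t\<^sup>2 * (norm x * M)\<^sup>2"
      using coercive[of x] t TM[of x]
      by (intro add_mono diff_mono mult_left_mono power_mono) auto
    also have "\<dots> = (1 - 2 * t * c + t\<^sup>2 * M\<^sup>2) * (norm x)\<^sup>2"
      by (simp add: algebra_simps power_mult_distrib)
    also have "\<dots> = (q * norm x)\<^sup>2"
      unfolding tq using cM by (simp add: q_def power_mult_distrib)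
    finally show "(norm (x - t *\<^sub>R T x))\<^sup>2 \<le> (q * norm x)\<^sup>2" .
    show "0 \<le> q * norm x" using cM by (simp add: q_def)
  qed
  have "\<exists>!x. x - t *\<^sub>R T x + t *\<^sub>R y = x"
  proof (rule banach_fix_type)
    show "0 \<le> q" "q < 1" using cM by (auto simp: q_def)
    have "dist (u - t *\<^sub>R T u + t *\<^sub>R y) (v - t *\<^sub>R T v + t *\<^sub>R y) = norm ((u - v) - t *\<^sub>R T (u - v))" for u v
      by (simp add: dist_norm T.diff scaleR_diff_right algebra_simps)
    then show "\<forall>u v. dist (u - t *\<^sub>R T u + t *\<^sub>R y) (v - t *\<^sub>R T v + t *\<^sub>R y) \<le> q * dist u v"
      using contr by (simp add: dist_norm)
  qed
  moreover have "(x - t *\<^sub>R T x + t *\<^sub>R y = x) \<longleftrightarrow> T x = y" for x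
    using t by (auto simp: algebra_simps)
  ultimately show ?thesis by simp
qed

lemma coercive_norm_le:
  assumes c: "c > 0" and coercive: "c * (norm x)\<^sup>2 \<le> x \<bullet> y"
  shows "norm x \<le> norm y / c"
proof (cases "norm x = 0")
  case False
  have "c * (norm x)\<^sup>2 \<le> norm x * norm y"
    using coercive norm_cauchy_schwarz[of x y] by linarith
  then have "c * norm x \<le> norm y" using False by (simp add: power2_eq_square)
  then show ?thesis using c by (simp add: field_simps)
qed (use c in auto)

text \<open>Coercivity uniform in \<open>l\<close> bounds all inverses by 1 / c. The difference
  \<open>w l' - w l\<close> solves the equation at \<open>l'\<close> with right side
  \<open>(l - l') B (w l)\<close>, which gives continuity.\<close>

lemma lax_milgram_pencil:
  fixes A B :: "'a::{real_inner,complete_space} \<Rightarrow> 'a" and S :: "real set"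
  assumes A: "bounded_linear A" and B: "bounded_linear B" and c: "c > 0"
    and coercive: "\<And>l x. l \<in> S \<Longrightarrow> c * (norm x)\<^sup>2 \<le> x \<bullet> (A x + l *\<^sub>R B x)"
  obtains w where "\<And>l. l \<in> S \<Longrightarrow> A (w l) + l *\<^sub>R B (w l) = y" "continuous_on S w"
proof -
  interpret A: bounded_linear A by fact
  interpret B: bounded_linear B by fact
  have bl: "bounded_linear (\<lambda>x. A x + l *\<^sub>R B x)" for l
    by (intro bounded_linear_add A bounded_linear_const_scaleR B)
  have "\<exists>x. A x + l *\<^sub>R B x = y" if "l \<in> S" for l
    by (rule ex1_implies_ex[OF lax_milgram[OF bl c coercive[OF that]]])
  then obtain w where w: "\<And>l. l \<in> S \<Longrightarrow> A (w l) + l *\<^sub>R B (w l) = y" by metis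
  have "continuous_on S w"
    unfolding continuous_on_def
  proof
    fix l assume l: "l \<in> S"
    have "norm (w l' - w l) \<le> norm ((l - l') *\<^sub>R B (w l)) / c" if "l' \<in> S" for l'
    proof (rule coercive_norm_le[OF c])
      have "A (w l' - w l) + l' *\<^sub>R B (w l' - w l) = (l - l') *\<^sub>R B (w l)"
        using w[OF that] w[OF l] by (simp add: A.diff B.diff algebra_simps)
      then show "c * (norm (w l' - w l))\<^sup>2 \<le> (w l' - w l) \<bullet> ((l - l') *\<^sub>R B (w l))"
        using coercive[OF that, of "w l' - w l"] by simp
    qed
    then have "\<forall>\<^sub>F l' in at l within S. norm (w l' - w l) \<le> \<bar>l - l'\<bar> * (norm (B (w l)) / c)"
      by (auto simp: eventually_at_filter)
    moreover have "((\<lambda>l'. \<bar>l - l'\<bar> * (norm (B (w l)) / c)) \<longlongrightarrow> 0) (at l within S)"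
      by (rule tendsto_eq_rhs[where x = "\<bar>l - l\<bar> * (norm (B (w l)) / c)"]) (intro tendsto_intros, simp)
    ultimately have "((\<lambda>l'. w l' - w l) \<longlongrightarrow> 0) (at l within S)"
      by (rule Lim_null_comparison)
    then show "(w \<longlongrightarrow> w l) (at l within S)" by (rule LIM_zero_cancel)
  qed
  with w show ?thesis by (rule that)
qed

section \<open>Multipliers, conjugation and kernels bounded by their row sums\<close>

section \<open>Operators on square summable sequences\<close>

text \<open>The operators are total. Without a bounded multiplier, or a Schur bound for a kernel,
  \<open>Abs_ell2\<close> may meet a sequence outside the type; the coordinate lemmas therefore
  assume these bounds.\<close>

definition ell2_mult :: "(nat \<Rightarrow> complex) \<Rightarrow> ell2 \<Rightarrow> ell2" where
  "ell2_mult b x = Abs_ell2 (\<lambda>n. b n * coord x n)"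

definition ell2_cnj :: "ell2 \<Rightarrow> ell2" where
  "ell2_cnj x = Abs_ell2 (\<lambda>n. cnj (coord x n))"

definition ell2_kernel :: "(nat \<Rightarrow> nat \<Rightarrow> real) \<Rightarrow> ell2 \<Rightarrow> ell2" where
  "ell2_kernel K x = Abs_ell2 (\<lambda>n. \<Sum>m. of_real (K n m) * coord x m)"

lemma norm_le_of_coord:
  assumes "\<And>n. cmod (coord y n) \<le> B * cmod (coord x n)" "B \<ge> 0"
  shows "norm y \<le> B * norm x"
proof (rule power2_le_imp_le)
  have "(norm y)\<^sup>2 \<le> (\<Sum>n. B\<^sup>2 * (cmod (coord x n))\<^sup>2)"
    unfolding ell2_norm_sq
  proof (rule suminf_le)
    show "(cmod (coord y n))\<^sup>2 \<le> B\<^sup>2 * (cmod (coord x n))\<^sup>2" for n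
      using power_mono[OF assms(1)[of n] norm_ge_zero, of 2] by (simp only: power_mult_distrib)
  qed (intro coord_summable summable_mult)+
  also have "\<dots> = (B * norm x)\<^sup>2"
    by (simp only: suminf_mult[OF coord_summable] ell2_norm_sq power_mult_distrib)
  finally show "(norm y)\<^sup>2 \<le> (B * norm x)\<^sup>2" .
  show "0 \<le> B * norm x" using assms(2) by simp
qed

context
  fixes b :: "nat \<Rightarrow> complex" and B :: real
  assumes b: "\<And>n. cmod (b n) \<le> B"
begin

lemma coord_mult: "coord (ell2_mult b x) n = b n * coord x n"
  unfolding ell2_mult_def by (subst coord_Abs) (rule sq_summable_cmult[OF coord_summable b], rule refl)

lemma norm_mult_le: "norm (ell2_mult b x) \<le> B * norm x"
proof (rule norm_le_of_coord)
  show "cmod (coord (ell2_mult b x) n) \<le> B * cmod (coord x n)" for n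
    unfolding coord_mult norm_mult by (rule mult_right_mono[OF b]) simp
  show "B \<ge> 0" using b[of 0] norm_ge_zero[of "b 0"] by linarith
qed

lemma bounded_linear_mult: "bounded_linear (ell2_mult b)"
proof (rule bounded_linear_intro[where K = B])
  show "ell2_mult b (x + y) = ell2_mult b x + ell2_mult b y" for x y
    by (rule ell2_eqI) (simp add: coord_mult algebra_simps)
  show "ell2_mult b (r *\<^sub>R x) = r *\<^sub>R ell2_mult b x" for r x
    by (rule ell2_eqI) (simp add: coord_mult)
  show "norm (ell2_mult b x) \<le> norm x * B" for x
    using norm_mult_le[of x] by (simp add: mult.commute)
qed

end

lemma coord_cnj [simp]: "coord (ell2_cnj x) n = cnj (coord x n)"
  unfolding ell2_cnj_def by (subst coord_Abs) (simp_all add: coord_summable)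

lemma norm_cnj [simp]: "norm (ell2_cnj x) = norm x"
  by (simp add: norm_ell2_def inner_ell2_def dot_square_norm)

lemma bounded_linear_ell2_cnj: "bounded_linear ell2_cnj"
proof (rule bounded_linear_intro[where K = 1])
  show "ell2_cnj (x + y) = ell2_cnj x + ell2_cnj y" for x y by (rule ell2_eqI) simp
  show "ell2_cnj (r *\<^sub>R x) = r *\<^sub>R ell2_cnj x" for r x
    by (rule ell2_eqI) (simp add: scaleR_conv_of_real)
qed simp

subsection \<open>Symmetric kernels\<close>

text \<open>Symmetry turns the row bound into a column bound as well, so the Schur test gives
  operator norm at most \<open>C\<close>.\<close>

definition schur_kernel :: "(nat \<Rightarrow> nat \<Rightarrow> real) \<Rightarrow> real \<Rightarrow> bool" where
  "schur_kernel K C \<longleftrightarrow> (\<forall>n m. K n m = K m n) \<and>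
     (\<forall>n. summable (\<lambda>m. \<bar>K n m\<bar>) \<and> (\<Sum>m. \<bar>K n m\<bar>) \<le> C)"

text \<open>Transported from the inner product of \<open>ell2\<close> by viewing the real sequences
  as complex ones.\<close>

lemma Cauchy_Schwarz_suminf:
  fixes a b :: "nat \<Rightarrow> real"
  assumes a: "summable (\<lambda>n. (a n)\<^sup>2)" and b: "summable (\<lambda>n. (b n)\<^sup>2)"
  shows "summable (\<lambda>n. a n * b n)" "(\<Sum>n. a n * b n)\<^sup>2 \<le> (\<Sum>n. (a n)\<^sup>2) * (\<Sum>n. (b n)\<^sup>2)"
proof -
  have a': "summable (\<lambda>n. (cmod (of_real (a n)))\<^sup>2)" and b': "summable (\<lambda>n. (cmod (of_real (b n)))\<^sup>2)"
    using a b by (simp_all only: norm_of_real power2_abs)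
  have dot: "complex_of_real (a n) \<bullet> of_real (b n) = a n * b n" for n
    by (simp add: inner_complex_def)
  show "summable (\<lambda>n. a n * b n)"
    using inner_summable[OF a' b'] unfolding dot .
  define x where "x = Abs_ell2 (\<lambda>n. of_real (a n))"
  define y where "y = Abs_ell2 (\<lambda>n. of_real (b n))"
  have x: "coord x = (\<lambda>n. of_real (a n))" and y: "coord y = (\<lambda>n. of_real (b n))"
    unfolding x_def y_def by (rule coord_Abs[OF a'], rule coord_Abs[OF b'])
  have "x \<bullet> y = (\<Sum>n. a n * b n)" "x \<bullet> x = (\<Sum>n. (a n)\<^sup>2)" "y \<bullet> y = (\<Sum>n. (b n)\<^sup>2)"
    unfolding inner_ell2_def x y dot by (simp_all add: inner_complex_def power2_eq_square)
  then show "(\<Sum>n. a n * b n)\<^sup>2 \<le> (\<Sum>n. (a n)\<^sup>2) * (\<Sum>n. (b n)\<^sup>2)"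
    using Cauchy_Schwarz_ineq[of x y] by simp
qed

context
  fixes K :: "nat \<Rightarrow> nat \<Rightarrow> real" and C :: real
  assumes K: "schur_kernel K C"
begin

lemma schur_sym: "K n m = K m n"
  and schur_summable: "summable (\<lambda>m. \<bar>K n m\<bar>)" and schur_bound: "(\<Sum>m. \<bar>K n m\<bar>) \<le> C"
  using K by (auto simp: schur_kernel_def)

lemma schur_nonneg: "C \<ge> 0"
  using schur_bound[of 0] suminf_nonneg[OF schur_summable[of 0]] by simp

lemma kernel_abs_summable: "summable (\<lambda>m. \<bar>K n m\<bar> * cmod (coord x m))"
proof (rule summable_comparison_test'[where N = 0])
  show "summable (\<lambda>m. \<bar>K n m\<bar> * norm x)" by (intro summable_mult2 schur_summable)
  show "norm (\<bar>K n m\<bar> * cmod (coord x m)) \<le> \<bar>K n m\<bar> * norm x" for m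
    by (simp add: abs_mult mult_left_mono coord_le_norm)
qed

lemma kernel_summable: "summable (\<lambda>m. of_real (K n m) * coord x m)"
  by (rule summable_norm_cancel) (use kernel_abs_summable in \<open>simp add: norm_mult\<close>)

text \<open>The Schur test: write |K| as a product of two square roots, use Cauchy-Schwarz in each
  row with the row bound, then interchange the sums and use the column bound.\<close>

lemma kernel_sums_le: "(\<Sum>n<N. (cmod (\<Sum>m. of_real (K n m) * coord x m))\<^sup>2) \<le> (C * norm x)\<^sup>2"
proof -
  have s2: "summable (\<lambda>m. \<bar>K n m\<bar> * (cmod (coord x m))\<^sup>2)" for n
  proof (rule summable_comparison_test'[where N = 0])
    show "summable (\<lambda>m. \<bar>K n m\<bar> * (norm x)\<^sup>2)" by (intro summable_mult2 schur_summable)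
    show "norm (\<bar>K n m\<bar> * (cmod (coord x m))\<^sup>2) \<le> \<bar>K n m\<bar> * (norm x)\<^sup>2" for m
      by (simp add: abs_mult mult_left_mono power_mono coord_le_norm)
  qed
  have row: "(cmod (\<Sum>m. of_real (K n m) * coord x m))\<^sup>2 \<le> C * (\<Sum>m. \<bar>K n m\<bar> * (cmod (coord x m))\<^sup>2)" for n
  proof -
    have sq: "(sqrt \<bar>K n m\<bar>)\<^sup>2 = \<bar>K n m\<bar>"
      "(sqrt \<bar>K n m\<bar> * cmod (coord x m))\<^sup>2 = \<bar>K n m\<bar> * (cmod (coord x m))\<^sup>2"
      "sqrt \<bar>K n m\<bar> * (sqrt \<bar>K n m\<bar> * cmod (coord x m)) = \<bar>K n m\<bar> * cmod (coord x m)" for m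
      by (simp_all add: power_mult_distrib flip: mult.assoc)
    have "cmod (\<Sum>m. of_real (K n m) * coord x m) \<le> (\<Sum>m. cmod (of_real (K n m) * coord x m))"
      by (rule summable_norm) (use kernel_abs_summable in \<open>simp add: norm_mult\<close>)
    also have "\<dots> = (\<Sum>m. \<bar>K n m\<bar> * cmod (coord x m))" by (simp add: norm_mult)
    finally have "(cmod (\<Sum>m. of_real (K n m) * coord x m))\<^sup>2 \<le> (\<Sum>m. \<bar>K n m\<bar> * cmod (coord x m))\<^sup>2"
      by (rule power_mono) simp
    also have "\<dots> \<le> (\<Sum>m. \<bar>K n m\<bar>) * (\<Sum>m. \<bar>K n m\<bar> * (cmod (coord x m))\<^sup>2)"
      using Cauchy_Schwarz_suminf(2)[of "\<lambda>m. sqrt \<bar>K n m\<bar>" "\<lambda>m. sqrt \<bar>K n m\<bar> * cmod (coord x m)"]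
      unfolding sq using schur_summable s2 by simp
    also have "\<dots> \<le> C * (\<Sum>m. \<bar>K n m\<bar> * (cmod (coord x m))\<^sup>2)"
      by (intro mult_right_mono schur_bound suminf_nonneg s2) simp
    finally show ?thesis .
  qed
  have "(\<Sum>n<N. (cmod (\<Sum>m. of_real (K n m) * coord x m))\<^sup>2)
      \<le> (\<Sum>n<N. C * (\<Sum>m. \<bar>K n m\<bar> * (cmod (coord x m))\<^sup>2))"
    by (intro sum_mono row)
  also have "\<dots> = C * (\<Sum>m. \<Sum>n<N. \<bar>K n m\<bar> * (cmod (coord x m))\<^sup>2)"
    using s2 by (simp add: suminf_sum sum_distrib_left)
  also have "\<dots> \<le> C * (\<Sum>m. C * (cmod (coord x m))\<^sup>2)"
  proof (intro mult_left_mono schur_nonneg suminf_le)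
    show "(\<Sum>n<N. \<bar>K n m\<bar> * (cmod (coord x m))\<^sup>2) \<le> C * (cmod (coord x m))\<^sup>2" for m
    proof -
      have "(\<Sum>n<N. \<bar>K n m\<bar>) = (\<Sum>n<N. \<bar>K m n\<bar>)" by (subst schur_sym) (rule refl)
      also have "\<dots> \<le> (\<Sum>n. \<bar>K m n\<bar>)" by (rule sum_le_suminf[OF schur_summable]) auto
      finally show ?thesis
        unfolding sum_distrib_right[symmetric] using schur_bound[of m]
        by (intro mult_right_mono) auto
    qed
    show "summable (\<lambda>m. \<Sum>n<N. \<bar>K n m\<bar> * (cmod (coord x m))\<^sup>2)" by (rule summable_sum) (rule s2)
    show "summable (\<lambda>m. C * (cmod (coord x m))\<^sup>2)" by (intro summable_mult coord_summable)
  qed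
  also have "\<dots> = (C * norm x)\<^sup>2"
    by (simp only: suminf_mult[OF coord_summable] power_mult_distrib ell2_norm_sq power2_eq_square[of C] mult.assoc)
  finally show ?thesis .
qed

lemma coord_kernel: "coord (ell2_kernel K x) n = (\<Sum>m. of_real (K n m) * coord x m)"
  and norm_kernel_le: "norm (ell2_kernel K x) \<le> C * norm x"
proof -
  have C: "C * norm x \<ge> 0" using schur_nonneg by simp
  show "coord (ell2_kernel K x) n = (\<Sum>m. of_real (K n m) * coord x m)"
    unfolding ell2_kernel_def
    by (simp only: coord_Abs[OF ell2_bounded_sums(1)[OF kernel_sums_le C]])
  show "norm (ell2_kernel K x) \<le> C * norm x"
    unfolding ell2_kernel_def by (rule ell2_bounded_sums(2)[OF kernel_sums_le C])
qed

lemma bounded_linear_kernel: "bounded_linear (ell2_kernel K)"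
proof (rule bounded_linear_intro[where K = C])
  show "ell2_kernel K (x + y) = ell2_kernel K x + ell2_kernel K y" for x y
    by (rule ell2_eqI) (simp add: coord_kernel distrib_left suminf_add kernel_summable)
  show "ell2_kernel K (r *\<^sub>R x) = r *\<^sub>R ell2_kernel K x" for r x
    using suminf_scaleR_right[OF kernel_summable, of r _ x]
    by (intro ell2_eqI) (simp add: coord_kernel mult_scaleR_right)
  show "norm (ell2_kernel K x) \<le> norm x * C" for x
    using norm_kernel_le[of x] by (simp add: mult.commute)
qed

end

definition low :: "nat \<Rightarrow> ell2 \<Rightarrow> ell2" where
  "low N = ell2_mult (\<lambda>n. if n < N then 1 else 0)"

lemma coord_low [simp]: "coord (low N x) n = (if n < N then coord x n else 0)"
  unfolding low_def by (subst coord_mult[where B = 1]) auto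

lemma norm_low_high: "(norm x)\<^sup>2 = (norm (low N x))\<^sup>2 + (norm (x - low N x))\<^sup>2"
proof -
  have "(norm (low N x))\<^sup>2 + (norm (x - low N x))\<^sup>2 =
      (\<Sum>n. (cmod (coord (low N x) n))\<^sup>2 + (cmod (coord (x - low N x) n))\<^sup>2)"
    unfolding ell2_norm_sq by (rule suminf_add[OF coord_summable coord_summable])
  also have "\<dots> = (norm x)\<^sup>2"
    unfolding ell2_norm_sq by (intro suminf_cong) simp
  finally show ?thesis by simp
qed

lemma norm_low_sq: "(norm (low N x))\<^sup>2 = (\<Sum>n<N. (cmod (coord x n))\<^sup>2)"
  unfolding ell2_norm_sq by (subst suminf_finite[where N = "{..<N}"]) auto

lemma low_tendsto: "(\<lambda>N. low N x) \<longlonglongrightarrow> x"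
proof -
  have "(\<lambda>N. (norm (x - low N x))\<^sup>2) = (\<lambda>N. (norm x)\<^sup>2 - (\<Sum>n<N. (cmod (coord x n))\<^sup>2))"
  proof
    show "(norm (x - low N x))\<^sup>2 = (norm x)\<^sup>2 - (\<Sum>n<N. (cmod (coord x n))\<^sup>2)" for N
      using norm_low_high[of x N] norm_low_sq[of N x] by linarith
  qed
  moreover have "(\<lambda>N. (norm x)\<^sup>2 - (\<Sum>n<N. (cmod (coord x n))\<^sup>2)) \<longlonglongrightarrow> (norm x)\<^sup>2 - (norm x)\<^sup>2"
    unfolding ell2_norm_sq by (intro tendsto_diff tendsto_const summable_LIMSEQ coord_summable)
  ultimately have "(\<lambda>N. (norm (x - low N x))\<^sup>2) \<longlonglongrightarrow> 0" by simp
  then have "(\<lambda>N. sqrt ((norm (x - low N x))\<^sup>2)) \<longlonglongrightarrow> sqrt 0" by (rule tendsto_real_sqrt)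
  then have "(\<lambda>N. norm (low N x - x)) \<longlonglongrightarrow> 0" by (simp add: norm_minus_commute)
  then show ?thesis by (simp add: LIM_zero_iff tendsto_norm_zero_iff)
qed

text \<open>If \<open>x\<close> is truncated, only a finite and an infinite sum are interchanged;
  continuity and \<open>low N x\<close> tending to \<open>x\<close> give the general case without a
  double series.\<close>

lemma kernel_selfadjoint:
  assumes K: "schur_kernel K C"
  shows "x \<bullet> ell2_kernel K y = ell2_kernel K x \<bullet> y"
proof -
  note ks = kernel_summable[OF K] and ck = coord_kernel[OF K]
  have fin: "low N x \<bullet> ell2_kernel K y = ell2_kernel K (low N x) \<bullet> y" for N
  proof -
    have s: "summable (\<lambda>m. coord x n \<bullet> (of_real (K n m) * coord y m))" for n
      by (rule bounded_linear.summable[OF bounded_linear_inner_right ks])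
    have "low N x \<bullet> ell2_kernel K y = (\<Sum>n<N. coord x n \<bullet> (\<Sum>m. of_real (K n m) * coord y m))"
      unfolding inner_ell2_def by (subst suminf_finite[where N = "{..<N}"]) (auto simp: ck)
    also have "\<dots> = (\<Sum>n<N. \<Sum>m. coord x n \<bullet> (of_real (K n m) * coord y m))"
      by (intro sum.cong refl bounded_linear.suminf[OF bounded_linear_inner_right ks])
    also have "\<dots> = (\<Sum>m. \<Sum>n<N. coord x n \<bullet> (of_real (K n m) * coord y m))"
      using s by (simp add: suminf_sum)
    also have "\<dots> = (\<Sum>m. (\<Sum>n. of_real (K m n) * coord (low N x) n) \<bullet> coord y m)"
    proof (rule suminf_cong)
      fix m
      have "(\<Sum>n. of_real (K m n) * coord (low N x) n) = (\<Sum>n<N. of_real (K m n) * coord x n)"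
        by (subst suminf_finite[where N = "{..<N}"]) auto
      then show "(\<Sum>n<N. coord x n \<bullet> (of_real (K n m) * coord y m)) =
          (\<Sum>n. of_real (K m n) * coord (low N x) n) \<bullet> coord y m"
        by (simp add: inner_sum_left schur_sym[OF K, of _ m] flip: scaleR_conv_of_real)
    qed
    also have "\<dots> = ell2_kernel K (low N x) \<bullet> y"
      unfolding inner_ell2_def ck ..
    finally show ?thesis .
  qed
  have "(\<lambda>N. low N x \<bullet> ell2_kernel K y) \<longlonglongrightarrow> x \<bullet> ell2_kernel K y"
    by (intro tendsto_inner low_tendsto tendsto_const)
  moreover have "(\<lambda>N. ell2_kernel K (low N x) \<bullet> y) \<longlonglongrightarrow> ell2_kernel K x \<bullet> y"
    by (intro tendsto_inner tendsto_const bounded_linear.tendsto[OF bounded_linear_kernel[OF K]] low_tendsto)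
  ultimately show ?thesis unfolding fin by (rule LIMSEQ_unique)
qed

text \<open>A self-adjoint kernel with real entries commutes with multiplication by
  \<open>\<i>\<close>, while \<open>\<i>\<close> is skew, so the quantity equals its negative. In
  Hermitian terms: the quadratic form of the kernel is real.\<close>

lemma kernel_inner_rotated:
  assumes K: "schur_kernel K C"
  shows "ell2_mult (\<lambda>_. \<i>) x \<bullet> ell2_kernel K x = 0"
proof -
  have i: "coord (ell2_mult (\<lambda>_. \<i>) z) n = \<i> * coord z n" for z n
    by (rule coord_mult[where B = 1]) simp
  have "ell2_kernel K (ell2_mult (\<lambda>_. \<i>) x) = ell2_mult (\<lambda>_. \<i>) (ell2_kernel K x)"
    by (rule ell2_eqI)
       (simp only: coord_kernel[OF K] i mult.left_commute[of _ \<i>] suminf_mult[OF kernel_summable[OF K]])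
  then have "ell2_mult (\<lambda>_. \<i>) x \<bullet> ell2_kernel K x = ell2_mult (\<lambda>_. \<i>) (ell2_kernel K x) \<bullet> x"
    by (simp add: kernel_selfadjoint[OF K])
  also have "\<dots> = - (ell2_mult (\<lambda>_. \<i>) x \<bullet> ell2_kernel K x)"
  proof -
    have rot: "ell2_mult (\<lambda>_. \<i>) z \<bullet> y = - (z \<bullet> ell2_mult (\<lambda>_. \<i>) y)" for z y
    proof -
      have "(\<i> * coord z n) \<bullet> coord y n = - (coord z n \<bullet> (\<i> * coord y n))" for n
        by (simp add: inner_complex_def)
      then show ?thesis
        unfolding inner_ell2_def i
        using suminf_minus[OF inner_summable[OF coord_summable[of z] coord_summable[of "ell2_mult (\<lambda>_. \<i>) y"]]]
        by (simp add: i)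
    qed
    show ?thesis
      using rot[of "ell2_kernel K x" x] by (simp only: inner_commute[of "ell2_kernel K x"])
  qed
  finally show ?thesis by simp
qed

section \<open>Real-linear planar maps and an intermediate value argument\<close>

section \<open>A fixed point of a path of real-linear planar maps\<close>

text \<open>For unit \<open>z\<close> the phase of \<open>z^2\<close> is arbitrary, so
  \<open>q * z^2\<close> can be pointed in any prescribed direction.\<close>

lemma unit_rotation:
  assumes "cmod u = 1"
  obtains z where "cmod z = 1" "q * z\<^sup>2 = of_real (cmod q) * u"
proof (cases "q = 0")
  case False
  define z where "z = csqrt (u * cnj (sgn q))"
  have "cmod (z\<^sup>2) = 1" using False assms by (simp add: z_def norm_mult norm_sgn)
  then have "cmod z = 1" using power2_eq_imp_eq[of "cmod z" 1] by (simp add: norm_power)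
  moreover have "q * z\<^sup>2 = of_real (cmod q) * u"
  proof -
    have "q * cnj (sgn q) = of_real (cmod q)"
      using False complex_norm_square[of q] by (simp add: sgn_eq power2_eq_square nonzero_divide_eq_eq)
    then show ?thesis by (simp add: z_def mult.left_commute)
  qed
  ultimately show ?thesis by (rule that)
qed (use that[of 1] in simp)

text \<open>Writing the map as \<open>z \<mapsto> P \<bar>z + Q z\<close>, a nonzero fixed point exists iff \<open>|1 - Q| = |P|\<close>; the
  orientation condition rules out \<open>|Q| \<ge> |P|\<close> at the expanding end.\<close>

lemma planar_fixed_point:
  fixes g :: "real \<Rightarrow> complex \<Rightarrow> complex"
  assumes ab: "a \<le> b"
    and lin: "\<And>l x y. l \<in> {a..b} \<Longrightarrow> g l (Complex x y) = of_real x * g l 1 + of_real y * g l \<i>"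
    and cont: "continuous_on {a..b} (\<lambda>l. g l 1)" "continuous_on {a..b} (\<lambda>l. g l \<i>)"
    and expand: "\<And>z. cmod z \<le> cmod (g a z)"
    and orient: "\<And>z. z \<noteq> 0 \<Longrightarrow> \<kappa> * Im (z * g a z) > 0"
    and contract: "\<And>z. cmod (g b z) \<le> cmod z"
  obtains l z where "l \<in> {a..b}" "z \<noteq> 0" "g l z = z"
proof -
  define P where "P l = (g l 1 + \<i> * g l \<i>) / 2" for l
  define Q where "Q l = (g l 1 - \<i> * g l \<i>) / 2" for l
  have g: "g l z = P l * cnj z + Q l * z" if "l \<in> {a..b}" for l z
  proof -
    have "g l z = of_real (Re z) * g l 1 + of_real (Im z) * g l \<i>"
      using lin[OF that, of "Re z" "Im z"] by (simp only: complex_surj)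
    also have "\<dots> = P l * (of_real (Re z) - \<i> * of_real (Im z)) + Q l * (of_real (Re z) + \<i> * of_real (Im z))"
      by (simp add: P_def Q_def field_simps)
    also have "of_real (Re z) - \<i> * of_real (Im z) = cnj z" by (simp add: complex_eq_iff)
    also have "of_real (Re z) + \<i> * of_real (Im z) = z" by (simp add: complex_eq_iff)
    finally show ?thesis .
  qed
  \<comment> \<open>Multiplication by a unit \<open>z\<close> turns the values of the map into the
    points P + Q z^2, which run over a circle of radius |Q| about P.\<close>
  have unit: "z * g l z = P l + Q l * z\<^sup>2" "cmod (g l z) = cmod (P l + Q l * z\<^sup>2)"
    if "l \<in> {a..b}" "cmod z = 1" for l z
  proof -
    have zz: "z * cnj z = 1" using that(2) complex_norm_square[of z] by simp
    have "z * g l z = P l * (z * cnj z) + Q l * z\<^sup>2"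
      unfolding g[OF that(1)] by (simp add: algebra_simps power2_eq_square)
    then show 1: "z * g l z = P l + Q l * z\<^sup>2" unfolding zz by simp
    show "cmod (g l z) = cmod (P l + Q l * z\<^sup>2)"
      unfolding 1[symmetric] norm_mult that(2) by simp
  qed
  have dir: "\<exists>u. cmod u = 1 \<and> P l = of_real (cmod (P l)) * u" for l
  proof (cases "P l = 0")
    case False
    then show ?thesis
      by (intro exI[of _ "sgn (P l)"] conjI) (simp add: norm_sgn, simp add: sgn_eq)
  qed (auto intro: exI[of _ 1])
  define F where "F l = cmod (1 - Q l) - cmod (P l)" for l
  have "F a \<le> 0"
  proof -
    have a: "a \<in> {a..b}" using ab by simp
    have gt: "cmod (Q a) < cmod (P a)"
    proof -
      have \<kappa>: "\<kappa> \<noteq> 0" using orient[of 1] by auto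
      then have "cmod (- of_real (sgn \<kappa>) * \<i>) = 1" by (simp add: norm_mult sgn_if)
      \<comment> \<open>\<open>Q a * z^2\<close> is pointed against the direction in which the
        orientation condition measures \<open>P a\<close>, so that the condition at this
        \<open>z\<close> reads |\<kappa>| |Q| < \<kappa> Im P.\<close>
      then obtain z where z: "cmod z = 1" "Q a * z\<^sup>2 = of_real (cmod (Q a)) * (- of_real (sgn \<kappa>) * \<i>)"
        by (rule unit_rotation)
      have "0 < \<kappa> * Im (P a + Q a * z\<^sup>2)"
        using orient[of z] z(1) unit(1)[OF a z(1)] by fastforce
      also have "\<dots> = \<kappa> * Im (P a) - \<bar>\<kappa>\<bar> * cmod (Q a)"
        unfolding z(2) by (simp add: algebra_simps sgn_if)
      finally have "\<bar>\<kappa>\<bar> * cmod (Q a) < \<kappa> * Im (P a)" by simp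
      also have "\<dots> \<le> \<bar>\<kappa>\<bar> * cmod (P a)"
        using abs_Im_le_cmod[of "P a"] by (metis abs_ge_self abs_mult abs_ge_zero mult_left_mono order_trans)
      finally show ?thesis by (simp add: mult_less_cancel_left)
    qed
    obtain u where u: "cmod u = 1" "P a = of_real (cmod (P a)) * u" using dir by blast
    \<comment> \<open>The point of the circle nearest to the origin; its modulus |P| - |Q| is at
      least 1 by \<open>expand\<close>.\<close>
    obtain z where z: "cmod z = 1" "Q a * z\<^sup>2 = of_real (cmod (Q a)) * (- u)"
      using unit_rotation[of "- u" "Q a"] u(1) by auto
    have "1 \<le> cmod (P a + Q a * z\<^sup>2)"
      using expand[of z] unit(2)[OF a z(1)] z(1) by simp
    also have "P a + Q a * z\<^sup>2 = of_real (cmod (P a) - cmod (Q a)) * u"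
      using u(2) z(2) by (simp add: algebra_simps)
    also have "cmod \<dots> = cmod (P a) - cmod (Q a)"
      using gt u(1) by (simp only: norm_mult norm_of_real) simp
    finally have "cmod (P a) \<ge> 1 + cmod (Q a)" by simp
    moreover have "cmod (1 - Q a) \<le> 1 + cmod (Q a)" using norm_triangle_ineq4[of 1 "Q a"] by simp
    ultimately show ?thesis by (simp add: F_def)
  qed
  moreover have "0 \<le> F b"
  proof -
    have b: "b \<in> {a..b}" using ab by simp
    obtain u where u: "cmod u = 1" "P b = of_real (cmod (P b)) * u" using dir by blast
    \<comment> \<open>The point of the circle farthest from the origin; its modulus |P| + |Q| is at
      most 1 by \<open>contract\<close>.\<close>
    obtain z where z: "cmod z = 1" "Q b * z\<^sup>2 = of_real (cmod (Q b)) * u"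
      using unit_rotation[of u "Q b"] u(1) by auto
    have "cmod (P b) + cmod (Q b) = cmod (of_real (cmod (P b) + cmod (Q b)) * u)"
      using u(1) by (simp only: norm_mult norm_of_real) simp
    also have "of_real (cmod (P b) + cmod (Q b)) * u = P b + Q b * z\<^sup>2"
      using u(2) z(2) by (simp add: algebra_simps)
    also have "cmod \<dots> \<le> 1"
      using contract[of z] unit(2)[OF b z(1)] z(1) by simp
    finally have "cmod (P b) \<le> 1 - cmod (Q b)" by simp
    moreover have "1 - cmod (Q b) \<le> cmod (1 - Q b)" using norm_triangle_ineq2[of 1 "Q b"] by simp
    ultimately show ?thesis by (simp add: F_def)
  qed
  moreover have "continuous_on {a..b} F"
    unfolding F_def P_def Q_def by (intro continuous_intros cont) auto
  ultimately obtain l where l: "l \<in> {a..b}" "F l = 0"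
    using IVT'[of F a 0 b] ab by auto
  then have eq: "cmod (1 - Q l) = cmod (P l)" by (simp add: F_def)
  obtain u where u: "cmod u = 1" "P l = of_real (cmod (P l)) * u" using dir by blast
  \<comment> \<open>With equal moduli some unit \<open>z\<close> solves (1 - Q) z^2 = P, which is
    the fixed point equation multiplied by \<open>z\<close>.\<close>
  obtain z where z: "cmod z = 1" "(1 - Q l) * z\<^sup>2 = of_real (cmod (1 - Q l)) * u"
    using unit_rotation[OF u(1)] by blast
  have P: "P l = (1 - Q l) * z\<^sup>2" unfolding z(2) eq u(2)[symmetric] ..
  have "P l + Q l * z\<^sup>2 = z * z" unfolding P by (simp add: algebra_simps power2_eq_square)
  with unit(1)[OF l(1) z(1)] have "z * g l z = z * z" by (rule trans)
  moreover have "z \<noteq> 0" using z(1) by auto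
  ultimately have "g l z = z" using mult_left_cancel by blast
  with l(1) \<open>z \<noteq> 0\<close> show ?thesis by (intro that)
qed

section \<open>Sturm-type separation of roots for a Jacobi recursion\<close>

section \<open>A three-term recursion\<close>

text \<open>The leading principal minors of the tridiagonal matrix with diagonal
  \<open>\<beta> i * t\<close> and off-diagonal entries 1. A zero of index \<open>Suc p\<close>
  makes the values of index 0 to \<open>p\<close> a vector satisfying the three-term relation with
  zero boundary values.\<close>

fun three_term :: "(nat \<Rightarrow> real) \<Rightarrow> real \<Rightarrow> nat \<Rightarrow> real" where
  "three_term \<beta> t 0 = 1"
| "three_term \<beta> t (Suc 0) = \<beta> 0 * t"
| "three_term \<beta> t (Suc (Suc n)) = \<beta> (Suc n) * t * three_term \<beta> t (Suc n) - three_term \<beta> t n"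

lemma three_term_continuous: "continuous_on S (\<lambda>t. three_term \<beta> t n)"
  by (induction n rule: induct_nat_012) (auto intro!: continuous_intros)

text \<open>A coefficient of at least 2 makes the sequence convex, so an initial increase persists.
  Hence there are no roots for large \<open>t\<close>.\<close>

lemma three_term_increasing:
  assumes "\<And>i. i \<le> n \<Longrightarrow> 2 \<le> \<beta> i * t"
  shows "0 < three_term \<beta> t n \<and> three_term \<beta> t n \<le> three_term \<beta> t (Suc n)"
  using assms
proof (induction n)
  case (Suc n)
  then have IH: "0 < three_term \<beta> t n" "three_term \<beta> t n \<le> three_term \<beta> t (Suc n)" and 2: "2 \<le> \<beta> (Suc n) * t"
    by auto
  have "2 * three_term \<beta> t (Suc n) \<le> \<beta> (Suc n) * t * three_term \<beta> t (Suc n)"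
    using IH 2 by (intro mult_right_mono) auto
  then show ?case using IH by (simp only: three_term.simps) linarith
qed (use assms[of 0] in simp)

text \<open>At the largest root \<open>t\<close> of one polynomial the recursion gives the next one
  the value \<open>- three_term \<beta> t p < 0\<close>, while it is positive for large arguments;
  so its largest root lies further right. The sign conditions carry this through the
  induction.\<close>

lemma three_term_root:
  assumes \<beta>: "\<And>n. \<beta> n > 0"
  shows "\<exists>t\<ge>0. three_term \<beta> t (Suc p) = 0 \<and> (\<forall>t'\<ge>t. three_term \<beta> t' p > 0) \<and>
    (\<forall>t'>t. three_term \<beta> t' (Suc p) > 0)"
proof (induction p)
  case 0
  show ?case using \<beta>[of 0] by (intro exI[of _ 0]) auto
next
  case (Suc p)
  let ?v = "\<lambda>t. three_term \<beta> t (Suc (Suc p))"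
  obtain t where t: "t \<ge> 0" "three_term \<beta> t (Suc p) = 0" "\<And>t'. t' \<ge> t \<Longrightarrow> three_term \<beta> t' p > 0"
    "\<And>t'. t' > t \<Longrightarrow> three_term \<beta> t' (Suc p) > 0"
    using Suc.IH by blast
  have neg: "?v t < 0" using t(2) t(3)[of t] by simp
  \<comment> \<open>Beyond \<open>T\<close> every coefficient \<open>\<beta> i * t'\<close> is at
    least 2, so the convexity lemma applies.\<close>
  define T where "T = (\<Sum>i\<le>Suc p. 2 / \<beta> i)"
  have big: "?v t' > 0" if "t' \<ge> T" for t'
  proof -
    have two: "2 \<le> \<beta> i * t'" if "i \<le> Suc p" for i
    proof -
      have "2 / \<beta> i \<le> T"
        unfolding T_def using that \<beta> by (intro member_le_sum) (auto intro: less_imp_le)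
      then have "2 / \<beta> i \<le> t'" using \<open>t' \<ge> T\<close> by simp
      then show ?thesis using \<beta>[of i] by (simp add: field_simps)
    qed
    show ?thesis using three_term_increasing[of "Suc p" \<beta> t', OF two] by linarith
  qed
  have tT: "t < T" using big[of t] neg by linarith
  \<comment> \<open>The new root is the last point up to \<open>T\<close> where the next polynomial
    is nonpositive; continuity makes it a zero.\<close>
  let ?S = "{t..T} \<inter> {t'. ?v t' \<le> 0}"
  have "closed {t'. ?v t' \<le> 0}"
    by (intro closed_Collect_le three_term_continuous continuous_on_const)
  then have "compact ?S" by (intro compact_Int_closed compact_Icc)
  moreover have "t \<in> ?S" using tT neg by simp
  then have "?S \<noteq> {}" by blast
  ultimately obtain s where s: "s \<in> ?S" "\<And>y. y \<in> ?S \<Longrightarrow> y \<le> s"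
    using compact_attains_sup by metis
  have pos: "?v t' > 0" if "t' > s" for t'
  proof (rule ccontr)
    assume "\<not> ?v t' > 0"
    then have "t' < T" using big[of t'] by (meson not_le_imp_less)
    then have "t' \<in> ?S" using s(1) that \<open>\<not> ?v t' > 0\<close> by auto
    then show False using s(2) that by fastforce
  qed
  have zero: "?v s = 0"
  proof (rule ccontr)
    assume "?v s \<noteq> 0"
    then have "?v s \<le> 0" "s \<le> T" using s(1) by auto
    obtain y where y: "s \<le> y" "y \<le> T + 1" "?v y = 0"
      using IVT'[of ?v s 0 "T + 1"] \<open>?v s \<le> 0\<close> \<open>s \<le> T\<close> big[of "T + 1"] three_term_continuous by fastforce
    then show False using pos[of y] \<open>?v s \<noteq> 0\<close> by (cases "y = s") auto
  qed
  have st: "s > t" using s(1) zero neg by (cases "s = t") auto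
  show ?case
    using st t zero pos by (intro exI[of _ s]) auto
qed

section \<open>The half-line system: solvability, energy, lower bound and decay\<close>

section \<open>The mode equations at Floquet exponent one half\<close>

text \<open>Only the positive half is kept: the mode \<open>- n - 1\<close> carries the wavenumber
  \<open>- wavenum n\<close> and is recovered by conjugation.\<close>

definition wavenum :: "nat \<Rightarrow> real" where
  "wavenum n = real n + 1 / 2"

lemma wavenum_pos [simp]: "wavenum n > 0" "wavenum n \<ge> 0" "wavenum n \<noteq> 0"
  by (simp_all add: wavenum_def add_nonneg_eq_0_iff)

lemma wavenum_ge_half: "1 / 2 \<le> wavenum n"
  by (simp add: wavenum_def)

definition sum_inv_sq :: real where
  "sum_inv_sq = (\<Sum>l. 1 / (1 + real l)\<^sup>2)"

definition sum_inv_cube :: real where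
  "sum_inv_cube = (\<Sum>n. 1 / wavenum n ^ 3)"

lemma summable_inv_sq: "summable (\<lambda>l. 1 / (1 + real l)\<^sup>2)"
proof -
  have "summable (\<lambda>l. inverse (real (Suc l) ^ 2))"
    by (rule summable_ignore_initial_segment[of _ 1, simplified]) (rule inverse_power_summable, simp)
  then show ?thesis by (simp add: field_simps)
qed

lemma summable_inv_cube: "summable (\<lambda>n. 1 / wavenum n ^ 3)"
proof (rule summable_comparison_test'[where N = 0])
  show "summable (\<lambda>n. 8 * (1 / (1 + real n)\<^sup>2))" by (intro summable_mult summable_inv_sq)
  fix n
  have "(1 + real n)\<^sup>2 \<le> (1 + real n) ^ 3" by (rule power_increasing) auto
  also have "\<dots> \<le> (2 * wavenum n) ^ 3" by (rule power_mono) (auto simp: wavenum_def)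
  also have "\<dots> = 8 * wavenum n ^ 3" by (simp add: power_mult_distrib)
  finally show "norm (1 / wavenum n ^ 3) \<le> 8 * (1 / (1 + real n)\<^sup>2)"
    by (simp add: frac_le_eq divide_simps)
qed

lemma sum_inv_sq_nonneg: "sum_inv_sq \<ge> 0"
  unfolding sum_inv_sq_def by (intro suminf_nonneg summable_inv_sq) simp

lemma sum_inv_cube_nonneg: "sum_inv_cube \<ge> 0"
  unfolding sum_inv_cube_def by (intro suminf_nonneg summable_inv_cube) simp

lemma inv_sq_sums_le: "(\<Sum>m<N. 1 / (1 + real m)\<^sup>2) \<le> sum_inv_sq"
  unfolding sum_inv_sq_def by (intro sum_le_suminf summable_inv_sq) auto

lemma sum_shift_le:
  fixes f :: "nat \<Rightarrow> real"
  assumes "\<And>n. f n \<ge> 0" "\<And>N. (\<Sum>n<N. f n) \<le> C"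
  shows "(\<Sum>m<N. f (m + a)) \<le> C"
proof -
  have "(\<Sum>m<N. f (m + a)) = sum f ((\<lambda>m. m + a) ` {..<N})"
    by (subst sum.reindex) (auto simp: inj_on_def)
  also have "\<dots> \<le> (\<Sum>n<N + a. f n)" using assms(1) by (intro sum_mono2) auto
  also have "\<dots> \<le> C" by (rule assms(2))
  finally show ?thesis .
qed

text \<open>Each distance from \<open>n\<close> is met at most twice, once for
  \<open>m \<le> n\<close> and once for \<open>m > n\<close>.\<close>

lemma sum_absdiff_le:
  fixes f :: "nat \<Rightarrow> real"
  assumes f: "\<And>n. f n \<ge> 0" and C: "\<And>N. (\<Sum>n<N. f n) \<le> C"
  shows "(\<Sum>m<N. f (nat \<bar>int n - int m\<bar>)) \<le> 2 * C"
proof -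
  have "(\<Sum>m<N. f (nat \<bar>int n - int m\<bar>)) =
      (\<Sum>m\<in>{..<N} \<inter> {..n}. f (nat \<bar>int n - int m\<bar>)) + (\<Sum>m\<in>{..<N} - {..n}. f (nat \<bar>int n - int m\<bar>))"
    by (rule sum.Int_Diff) simp
  also have "(\<Sum>m\<in>{..<N} \<inter> {..n}. f (nat \<bar>int n - int m\<bar>)) = sum f ((\<lambda>m. nat \<bar>int n - int m\<bar>) ` ({..<N} \<inter> {..n}))"
    by (subst sum.reindex) (auto simp: inj_on_def)
  also have "\<dots> \<le> (\<Sum>l<Suc n. f l)" using f by (intro sum_mono2) auto
  also have "\<dots> \<le> C" by (rule C)
  also have "(\<Sum>m\<in>{..<N} - {..n}. f (nat \<bar>int n - int m\<bar>)) = sum f ((\<lambda>m. nat \<bar>int n - int m\<bar>) ` ({..<N} - {..n}))"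
    by (subst sum.reindex) (auto simp: inj_on_def)
  also have "\<dots> \<le> (\<Sum>l<N. f l)" using f by (intro sum_mono2) auto
  also have "\<dots> \<le> C" by (rule C)
  finally show ?thesis by simp
qed

lemma one_plus_le_mult:
  fixes x y d :: real
  assumes "x \<le> y + d" "0 \<le> d" "0 \<le> y"
  shows "1 + x \<le> (1 + d) * (1 + y)"
proof -
  have "0 \<le> d * y" using assms by simp
  then show ?thesis using assms(1) unfolding distrib_left distrib_right by linarith
qed

lemma summable_sum_le:
  fixes f :: "nat \<Rightarrow> real"
  assumes "\<And>n. f n \<ge> 0" "\<And>N. (\<Sum>n<N. f n) \<le> C"
  shows "summable f" "suminf f \<le> C"
proof -
  show "summable f"
  proof (rule bounded_imp_summable)
    show "(\<Sum>k\<le>n. f k) \<le> C" for n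
      using assms(2)[of "Suc n"] by (simp only: lessThan_Suc_atMost)
  qed (rule assms(1))
  then show "suminf f \<le> C" by (rule suminf_le_const) (rule assms(2))
qed

locale mode_equations =
  fixes K Q \<delta> \<epsilon> :: real and q :: "int \<Rightarrow> real" and D :: "nat \<Rightarrow> real" and L r :: nat
  assumes K: "K > 0" and Q: "Q \<ge> 0" and \<delta>: "\<delta> > 0" and eps: "\<epsilon> \<noteq> 0" "\<bar>\<epsilon>\<bar> \<le> 1"
    and q_even: "\<And>l. q (- l) = q l"
    and q_approx: "\<And>l. \<bar>q l - (if \<bar>l\<bar> = 1 then \<epsilon> else 0)\<bar> \<le> Q * \<epsilon>\<^sup>2 / (1 + real_of_int \<bar>l\<bar>) ^ (r + 2)"
    and r: "r \<ge> 2" and L: "L \<ge> 1" and D_large: "\<And>n. n \<ge> L \<Longrightarrow> \<delta> \<le> \<bar>D n\<bar>"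
begin

text \<open>Chosen so that the weights below sum to at most \<kappa> |\<epsilon>| / 2; a row of the
  Toeplitz kernel meets each distance twice, which gives it the bound \<kappa> |\<epsilon>|.\<close>

definition \<kappa> :: real where "\<kappa> = 2 * (2 ^ r + Q * sum_inv_sq)"

text \<open>A summable majorant of |q l| (1 + |l|)^r, as a function of |l|; the factor
  \<open>2 ^ r\<close> is (1 + |l|)^r at |l| = 1.\<close>

definition weight :: "nat \<Rightarrow> real" where
  "weight l = (if l = 1 then 2 ^ r * \<bar>\<epsilon>\<bar> else 0) + Q * \<epsilon>\<^sup>2 * (1 / (1 + real l)\<^sup>2)"

lemma weight_nonneg: "weight l \<ge> 0"
  using Q by (simp add: weight_def)

lemma kappa_ge: "2 \<le> \<kappa>" "Q * sum_inv_sq \<le> \<kappa>"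
proof -
  define X where "X = 2 ^ r + Q * sum_inv_sq"
  have "0 \<le> Q * sum_inv_sq" using Q sum_inv_sq_nonneg by simp
  moreover have "1 + Q * sum_inv_sq \<le> X" by (simp add: X_def)
  moreover have "\<kappa> = 2 * X" by (simp add: \<kappa>_def X_def)
  ultimately show "2 \<le> \<kappa>" "Q * sum_inv_sq \<le> \<kappa>" by linarith+
qed

lemma eps_sq_le: "\<epsilon>\<^sup>2 \<le> \<bar>\<epsilon>\<bar>"
proof -
  have "\<bar>\<epsilon>\<bar> * \<bar>\<epsilon>\<bar> \<le> \<bar>\<epsilon>\<bar> * 1" using eps by (intro mult_left_mono) auto
  then show ?thesis by (simp add: power2_eq_square)
qed

lemma weight_sums: "(\<Sum>l<N. weight l) \<le> \<kappa> * \<bar>\<epsilon>\<bar> / 2"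
proof -
  have "(\<Sum>l<N. weight l) = (\<Sum>l<N. if l = 1 then 2 ^ r * \<bar>\<epsilon>\<bar> else 0) + Q * \<epsilon>\<^sup>2 * (\<Sum>l<N. 1 / (1 + real l)\<^sup>2)"
    by (simp add: weight_def sum.distrib sum_distrib_left)
  also have "\<dots> \<le> 2 ^ r * \<bar>\<epsilon>\<bar> + Q * \<epsilon>\<^sup>2 * sum_inv_sq"
    using Q by (intro add_mono mult_left_mono inv_sq_sums_le) (auto simp: sum.delta)
  also have "\<dots> \<le> 2 ^ r * \<bar>\<epsilon>\<bar> + Q * \<bar>\<epsilon>\<bar> * sum_inv_sq"
    using Q sum_inv_sq_nonneg eps_sq_le by (intro add_mono mult_right_mono mult_left_mono) auto
  also have "\<dots> = \<kappa> * \<bar>\<epsilon>\<bar> / 2" by (simp add: \<kappa>_def algebra_simps)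
  finally show ?thesis .
qed

lemma q_weighted: "\<bar>q l\<bar> * (1 + real_of_int \<bar>l\<bar>) ^ r \<le> weight (nat \<bar>l\<bar>)"
proof -
  let ?x = "1 + real_of_int \<bar>l\<bar>"
  have x: "?x > 0" by (simp add: add_pos_nonneg)
  have "\<bar>q l\<bar> \<le> \<bar>if \<bar>l\<bar> = 1 then \<epsilon> else 0\<bar> + Q * \<epsilon>\<^sup>2 / ?x ^ (r + 2)"
    using q_approx[of l] by linarith
  then have "\<bar>q l\<bar> * ?x ^ r \<le> (\<bar>if \<bar>l\<bar> = 1 then \<epsilon> else 0\<bar> + Q * \<epsilon>\<^sup>2 / ?x ^ (r + 2)) * ?x ^ r"
    using x by (intro mult_right_mono) auto
  also have "\<dots> = \<bar>if \<bar>l\<bar> = 1 then \<epsilon> else 0\<bar> * ?x ^ r + Q * \<epsilon>\<^sup>2 * (1 / ?x\<^sup>2)"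
  proof -
    have cancel: "A / (X * Y) * X = A * (1 / Y)" if "X > 0" for A X Y :: real using that by simp
    have "Q * \<epsilon>\<^sup>2 / ?x ^ (r + 2) * ?x ^ r = Q * \<epsilon>\<^sup>2 * (1 / ?x\<^sup>2)"
      unfolding power_add by (rule cancel[OF zero_less_power[OF x]])
    then show ?thesis by (simp only: distrib_right)
  qed
  also have "\<dots> = weight (nat \<bar>l\<bar>)"
  proof (cases "\<bar>l\<bar> = 1")
    case True
    then have "real_of_int \<bar>l\<bar> = 1" by simp
    then show ?thesis using True by (simp only: weight_def) simp
  qed (auto simp: weight_def nat_eq_iff)
  finally show ?thesis .
qed

lemma q_abs_le: "\<bar>q l\<bar> \<le> weight (nat \<bar>l\<bar>)"
proof -
  have "\<bar>q l\<bar> * 1 \<le> \<bar>q l\<bar> * (1 + real_of_int \<bar>l\<bar>) ^ r"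
    by (intro mult_left_mono one_le_power) auto
  then show ?thesis using q_weighted[of l] by linarith
qed

definition Tk :: "nat \<Rightarrow> nat \<Rightarrow> real" where
  "Tk n m = q (int n - int m)"

text \<open>After the reflection, mode \<open>n\<close> sees the modes \<open>- m - 1\<close>
  through the Hankel kernel q(n + m + 1). Removing the corner entry, the only one with |n + m + 1| =
  1, leaves a kernel of size O(\<epsilon>^2).\<close>

definition Rk :: "nat \<Rightarrow> nat \<Rightarrow> real" where
  "Rk n m = q (int n + int m + 1) - (if n = 0 \<and> m = 0 then q 1 else 0)"

lemma Tk_schur: "schur_kernel Tk (\<kappa> * \<bar>\<epsilon>\<bar>)"
  unfolding schur_kernel_def
proof (intro conjI allI)
  show "Tk n m = Tk m n" for n m
    using q_even[of "int n - int m"] by (simp add: Tk_def)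
  fix n
  have "(\<Sum>m<N. \<bar>Tk n m\<bar>) \<le> \<kappa> * \<bar>\<epsilon>\<bar>" for N
  proof -
    have "(\<Sum>m<N. \<bar>Tk n m\<bar>) \<le> (\<Sum>m<N. weight (nat \<bar>int n - int m\<bar>))"
      unfolding Tk_def by (intro sum_mono q_abs_le)
    also have "\<dots> \<le> 2 * (\<kappa> * \<bar>\<epsilon>\<bar> / 2)" by (rule sum_absdiff_le[OF weight_nonneg weight_sums])
    finally show ?thesis by simp
  qed
  then show "summable (\<lambda>m. \<bar>Tk n m\<bar>)" "(\<Sum>m. \<bar>Tk n m\<bar>) \<le> \<kappa> * \<bar>\<epsilon>\<bar>"
    by (intro summable_sum_le[where C = "\<kappa> * \<bar>\<epsilon>\<bar>"]; simp)+
qed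

lemma Rk_le: "\<bar>Rk n m\<bar> \<le> Q * \<epsilon>\<^sup>2 / (real n + real m + 2) ^ (r + 2)"
proof (cases "n = 0 \<and> m = 0")
  case True
  then show ?thesis using Q by (simp add: Rk_def)
next
  case False
  then have "\<bar>int n + int m + 1\<bar> \<noteq> 1" by auto
  with False show ?thesis using q_approx[of "int n + int m + 1"]
    by (auto simp: Rk_def add.commute add.left_commute)
qed

lemma Rk_schur: "schur_kernel Rk (\<kappa> * \<epsilon>\<^sup>2)"
  unfolding schur_kernel_def
proof (intro conjI allI)
  show "Rk n m = Rk m n" for n m by (simp add: Rk_def add.commute conj_commute)
  fix n
  have "(\<Sum>m<N. \<bar>Rk n m\<bar>) \<le> \<kappa> * \<epsilon>\<^sup>2" for N
  proof -
    have "\<bar>Rk n m\<bar> \<le> Q * \<epsilon>\<^sup>2 * (1 / (1 + real m)\<^sup>2)" for m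
    proof -
      have "\<bar>Rk n m\<bar> \<le> Q * \<epsilon>\<^sup>2 / (real n + real m + 2) ^ (r + 2)" by (rule Rk_le)
      also have "\<dots> \<le> Q * \<epsilon>\<^sup>2 / (1 + real m)\<^sup>2"
      proof (intro divide_left_mono)
        have "(1 + real m)\<^sup>2 \<le> (real n + real m + 2)\<^sup>2" by (intro power_mono) auto
        also have "\<dots> \<le> (real n + real m + 2) ^ (r + 2)" by (rule power_increasing) auto
        finally show "(1 + real m)\<^sup>2 \<le> (real n + real m + 2) ^ (r + 2)" .
      qed (use Q in \<open>auto intro!: mult_pos_pos zero_less_power\<close>)
      finally show ?thesis by simp
    qed
    then have "(\<Sum>m<N. \<bar>Rk n m\<bar>) \<le> (\<Sum>m<N. Q * \<epsilon>\<^sup>2 * (1 / (1 + real m)\<^sup>2))" by (intro sum_mono)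
    also have "\<dots> = \<epsilon>\<^sup>2 * (Q * (\<Sum>m<N. 1 / (1 + real m)\<^sup>2))"
      by (simp add: sum_distrib_left mult_ac)
    also have "\<dots> \<le> \<epsilon>\<^sup>2 * (Q * sum_inv_sq)"
      using Q by (intro mult_left_mono inv_sq_sums_le) auto
    also have "\<dots> \<le> \<epsilon>\<^sup>2 * \<kappa>" using kappa_ge by (intro mult_left_mono) auto
    finally show ?thesis by (simp add: mult.commute)
  qed
  then show "summable (\<lambda>m. \<bar>Rk n m\<bar>)" "(\<Sum>m. \<bar>Rk n m\<bar>) \<le> \<kappa> * \<epsilon>\<^sup>2"
    by (intro summable_sum_le[where C = "\<kappa> * \<epsilon>\<^sup>2"]; simp)+
qed

subsection \<open>Coercivity\<close>

text \<open>Rotating the low rows by \<open>- \<i>\<close> turns the term \<open>\<i> l / wavenum n\<close> into a positive one and the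
  symmetric low-low coupling into an imaginary one; the high rows are divided by \<open>D\<close>.\<close>

definition \<sigma> :: "nat \<Rightarrow> complex" where
  "\<sigma> n = (if n < L then - \<i> else of_real (1 / D n))"

definition Sg :: real where "Sg = 1 + 1 / \<delta>"

lemma Sg_ge: "1 \<le> Sg"
  using \<delta> by (simp add: Sg_def)

lemma sigma_le: "cmod (\<sigma> n) \<le> Sg"
proof (cases "n < L")
  case False
  then have "\<delta> \<le> \<bar>D n\<bar>" using D_large by simp
  then have "1 / \<bar>D n\<bar> \<le> 1 / \<delta>" using \<delta> by (intro divide_left_mono) auto
  then show ?thesis using False by (simp add: \<sigma>_def Sg_def norm_divide)
qed (use Sg_ge in \<open>simp add: \<sigma>_def\<close>)

lemma sigma_nonzero: "\<sigma> n \<noteq> 0"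
proof (cases "n < L")
  case False
  then have "D n \<noteq> 0" using D_large[of n] \<delta> by auto
  then show ?thesis using False by (simp add: \<sigma>_def)
qed (simp add: \<sigma>_def)

lemma sigma_D_le: "cmod (\<sigma> n * of_real (D n)) \<le> 1 + (\<Sum>i<L. \<bar>D i\<bar>)"
proof (cases "n < L")
  case True
  then have "\<bar>D n\<bar> \<le> (\<Sum>i<L. \<bar>D i\<bar>)" by (intro member_le_sum) auto
  then show ?thesis using True by (simp add: \<sigma>_def norm_mult)
next
  case False
  then have "D n \<noteq> 0" using D_large[of n] \<delta> by auto
  then show ?thesis using False by (simp add: \<sigma>_def norm_mult norm_divide sum_nonneg)
qed

lemma sigma_inv_le: "cmod (\<i> * \<sigma> n / of_real (wavenum n)) \<le> 2 * Sg"
proof -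
  have "cmod (\<sigma> n) * 1 \<le> Sg * (2 * wavenum n)"
    using sigma_le[of n] Sg_ge wavenum_ge_half[of n] by (intro mult_mono) auto
  then show ?thesis by (simp add: norm_mult norm_divide divide_le_eq mult_ac)
qed

text \<open>The system with row \<open>n\<close> multiplied by the nonzero number
  \<open>\<sigma> n\<close>, split so that the dependence on \<open>l\<close> is affine:
  \<open>A0 + l B0\<close>.\<close>

definition A0 :: "ell2 \<Rightarrow> ell2" where
  "A0 x = ell2_mult (\<lambda>n. \<sigma> n * of_real (D n)) x -
     K *\<^sub>R ell2_mult \<sigma> (ell2_kernel Tk x + ell2_kernel Rk (ell2_cnj x))"

definition B0 :: "ell2 \<Rightarrow> ell2" where
  "B0 = ell2_mult (\<lambda>n. \<i> * \<sigma> n / of_real (wavenum n))"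

lemma bounded_linear_A0: "bounded_linear A0"
proof -
  have "bounded_linear (\<lambda>x. ell2_mult \<sigma> (ell2_kernel Tk x + ell2_kernel Rk (ell2_cnj x)))"
    by (intro bounded_linear_compose[OF bounded_linear_mult[OF sigma_le]] bounded_linear_add
        bounded_linear_kernel[OF Tk_schur] bounded_linear_compose[OF bounded_linear_kernel[OF Rk_schur]]
        bounded_linear_ell2_cnj)
  then show ?thesis
    unfolding A0_def
    by (intro bounded_linear_sub bounded_linear_const_scaleR bounded_linear_mult[OF sigma_D_le])
qed

lemma bounded_linear_B0: "bounded_linear B0"
  unfolding B0_def by (rule bounded_linear_mult[OF sigma_inv_le])

text \<open>The source \<open>\<zeta>\<close> stands in for the corner entry missing from
  \<open>Rk\<close>; the full equations hold when it equals
  \<open>K * q 1 * cnj (coord w 0)\<close>.\<close>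

definition mode_sol :: "real \<Rightarrow> complex \<Rightarrow> ell2 \<Rightarrow> bool" where
  "mode_sol l \<zeta> w \<longleftrightarrow> (\<forall>n. (of_real (D n) + \<i> * of_real (l / wavenum n)) * coord w n
      - of_real K * (coord (ell2_kernel Tk w) n + coord (ell2_kernel Rk (ell2_cnj w)) n)
      = (if n = 0 then \<zeta> else 0))"

lemma coord_operator:
  "coord (A0 x + l *\<^sub>R B0 x) n = \<sigma> n * ((of_real (D n) + \<i> * of_real (l / wavenum n)) * coord x n
      - of_real K * (coord (ell2_kernel Tk x) n + coord (ell2_kernel Rk (ell2_cnj x)) n))"
  unfolding A0_def B0_def coord_add coord_diff coord_scaleR coord_mult[OF sigma_D_le]
    coord_mult[OF sigma_le] coord_mult[OF sigma_inv_le]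
  by (simp add: scaleR_conv_of_real algebra_simps)

text \<open>Young's inequality is weighted unevenly: the cross term of size \<open>e X Y\<close> is
  charged as \<open>e^2 X^2\<close> to the weak low part and as \<open>Y^2 / 2\<close> to the strong
  high part. This permits \<open>a\<close> as small as order \<open>e\<close>.\<close>

lemma coercive_estimate:
  fixes X Y G a e :: real
  assumes "X \<ge> 0" "Y \<ge> 0" "G \<ge> 0" "e \<ge> 0" "(2 * G\<^sup>2 + G) * e\<^sup>2 \<le> a / 2" "2 * G * e \<le> 1 / 4" "e \<le> 1"
  shows "a / 2 * X\<^sup>2 + 1 / 4 * Y\<^sup>2 \<le> a * X\<^sup>2 + Y\<^sup>2 - G * (2 * e * X * Y + e * Y\<^sup>2 + e\<^sup>2 * (X\<^sup>2 + Y\<^sup>2))"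
proof -
  have "0 \<le> (2 * G * e * X - Y)\<^sup>2" by simp
  then have 1: "2 * G * e * X * Y \<le> 2 * (G * e * X)\<^sup>2 + Y\<^sup>2 / 2"
    by (simp add: power2_eq_square algebra_simps)
  have 2: "(2 * G\<^sup>2 + G) * e\<^sup>2 * X\<^sup>2 \<le> a / 2 * X\<^sup>2"
    by (rule mult_right_mono[OF assms(5)]) simp
  have "e\<^sup>2 \<le> e" using assms by (simp add: power2_eq_square mult_left_le)
  then have "G * e\<^sup>2 \<le> G * e" using assms by (intro mult_left_mono) auto
  then have "G * e + G * e\<^sup>2 \<le> 1 / 4" using assms by linarith
  then have 3: "(G * e + G * e\<^sup>2) * Y\<^sup>2 \<le> 1 / 4 * Y\<^sup>2" by (rule mult_right_mono) simp
  have "G * (2 * e * X * Y + e * Y\<^sup>2 + e\<^sup>2 * (X\<^sup>2 + Y\<^sup>2)) =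
      2 * G * e * X * Y + (G * e + G * e\<^sup>2) * Y\<^sup>2 + G * e\<^sup>2 * X\<^sup>2" by (simp add: algebra_simps)
  moreover have "(2 * G\<^sup>2 + G) * e\<^sup>2 * X\<^sup>2 = 2 * (G * e * X)\<^sup>2 + G * e\<^sup>2 * X\<^sup>2"
    by (simp add: algebra_simps power2_eq_square)
  ultimately show ?thesis using 1 2 3 by linarith
qed

text \<open>Low modes contribute l / s, at least \<open>a\<close>, and high modes contribute 1. As
  \<open>a\<close> will be of order |\<epsilon>|, a low-low Toeplitz term of that order could not be
  absorbed; after the rotation it vanishes.\<close>

lemma coercive:
  assumes l: "l \<ge> a * real L" and a: "a > 0"
    and small: "(2 * (K * Sg * \<kappa>)\<^sup>2 + K * Sg * \<kappa>) * \<epsilon>\<^sup>2 \<le> a / 2" "2 * (K * Sg * \<kappa>) * \<bar>\<epsilon>\<bar> \<le> 1 / 4"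
  shows "min (a / 2) (1 / 4) * (norm x)\<^sup>2 \<le> x \<bullet> (A0 x + l *\<^sub>R B0 x)"
proof -
  define u where "u = low L x"
  define v where "v = x - u"
  define X where "X = norm u"
  define Y where "Y = norm v"
  define G where "G = K * Sg * \<kappa>"
  let ?T = "ell2_kernel Tk" and ?R = "\<lambda>x. ell2_kernel Rk (ell2_cnj x)" and ?M = "ell2_mult \<sigma>"
  interpret T: bounded_linear ?T by (rule bounded_linear_kernel[OF Tk_schur])
  interpret M: bounded_linear ?M by (rule bounded_linear_mult[OF sigma_le])
  have xuv: "x = u + v" by (simp add: v_def)
  have norm_x: "(norm x)\<^sup>2 = X\<^sup>2 + Y\<^sup>2"
    unfolding X_def Y_def v_def u_def by (rule norm_low_high)
  have KG: "K \<ge> 0" "Sg \<ge> 1" "\<kappa> \<ge> 0" using K Sg_ge kappa_ge by auto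
  have diag: "a * X\<^sup>2 + Y\<^sup>2 \<le> x \<bullet> (ell2_mult (\<lambda>n. \<sigma> n * of_real (D n)) x + l *\<^sub>R B0 x)"
  proof -
    have cd: "coord (ell2_mult (\<lambda>n. \<sigma> n * of_real (D n)) x + l *\<^sub>R B0 x) n =
        (\<sigma> n * of_real (D n) + of_real l * (\<i> * \<sigma> n / of_real (wavenum n))) * coord x n" for n
      unfolding B0_def coord_add coord_scaleR coord_mult[OF sigma_D_le] coord_mult[OF sigma_inv_le]
      by (simp add: scaleR_conv_of_real distrib_right)
    have "a * X\<^sup>2 + Y\<^sup>2 = (\<Sum>n. a * (cmod (coord u n))\<^sup>2 + (cmod (coord v n))\<^sup>2)"
      unfolding X_def Y_def ell2_norm_sq
      by (simp add: suminf_mult[OF coord_summable] suminf_add[OF summable_mult[OF coord_summable] coord_summable, symmetric])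
    also have "\<dots> \<le> (\<Sum>n. coord x n \<bullet> coord (ell2_mult (\<lambda>n. \<sigma> n * of_real (D n)) x + l *\<^sub>R B0 x) n)"
    proof (rule suminf_le)
      show "a * (cmod (coord u n))\<^sup>2 + (cmod (coord v n))\<^sup>2
          \<le> coord x n \<bullet> coord (ell2_mult (\<lambda>n. \<sigma> n * of_real (D n)) x + l *\<^sub>R B0 x) n" for n
      proof (cases "n < L")
        case True
        have "a * wavenum n \<le> a * real L" using True a by (intro mult_left_mono) (auto simp: wavenum_def)
        then have "a \<le> l / wavenum n" using l by (simp add: pos_le_divide_eq)
        then have "a * (cmod (coord x n))\<^sup>2 \<le> l / wavenum n * (cmod (coord x n))\<^sup>2"
          by (rule mult_right_mono) simp
        also have "\<dots> = coord x n \<bullet> ((- \<i> * of_real (D n) + of_real (l / wavenum n)) * coord x n)"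
          unfolding cmod_power2 by (simp add: inner_complex_def power2_eq_square algebra_simps)
        finally show ?thesis
          using True unfolding cd by (simp add: u_def v_def \<sigma>_def)
      next
        case False
        then have "D n \<noteq> 0" using D_large[of n] \<delta> by auto
        have "(cmod (coord x n))\<^sup>2 = coord x n \<bullet> ((1 + \<i> * of_real (l / (D n * wavenum n))) * coord x n)"
          unfolding cmod_power2 by (simp add: inner_complex_def power2_eq_square algebra_simps)
        then show ?thesis
          using False \<open>D n \<noteq> 0\<close> unfolding cd
          by (simp add: u_def v_def \<sigma>_def mult.commute[of _ \<i>])
      qed
      show "summable (\<lambda>n. a * (cmod (coord u n))\<^sup>2 + (cmod (coord v n))\<^sup>2)"
        by (intro summable_add summable_mult coord_summable)
      show "summable (\<lambda>n. coord x n \<bullet> coord (ell2_mult (\<lambda>n. \<sigma> n * of_real (D n)) x + l *\<^sub>R B0 x) n)"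
        by (intro inner_summable coord_summable)
    qed
    finally show ?thesis unfolding inner_ell2_def .
  qed
  \<comment> \<open>On the support of \<open>u\<close> the multiplier \<open>\<sigma>\<close> is
    \<open>- \<i>\<close>, whose adjoint is multiplication by \<open>\<i>\<close>.\<close>
  have rot: "u \<bullet> ?M z = ell2_mult (\<lambda>_. \<i>) u \<bullet> z" for z
    unfolding inner_ell2_def
  proof (rule suminf_cong)
    show "coord u n \<bullet> coord (?M z) n = coord (ell2_mult (\<lambda>_. \<i>) u) n \<bullet> coord z n" for n
      by (subst coord_mult[where B = 1])
         (auto simp: coord_mult[OF sigma_le] \<sigma>_def u_def inner_complex_def)
  qed
  have TT: "norm (?T z) \<le> \<kappa> * \<bar>\<epsilon>\<bar> * norm z" for z by (rule norm_kernel_le[OF Tk_schur])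
  have uu: "u \<bullet> ?M (?T u) = 0"
    unfolding rot by (rule kernel_inner_rotated[OF Tk_schur])
  have uv: "u \<bullet> ?M (?T v) \<le> Sg * \<kappa> * (\<bar>\<epsilon>\<bar> * X * Y)"
  proof -
    have "u \<bullet> ?M (?T v) \<le> norm u * norm (?M (?T v))" by (rule norm_cauchy_schwarz)
    also have "\<dots> \<le> X * (Sg * (\<kappa> * \<bar>\<epsilon>\<bar> * Y))"
      unfolding X_def Y_def using KG
      by (intro mult_left_mono order_trans[OF norm_mult_le[OF sigma_le]] TT) auto
    finally show ?thesis by (simp add: mult_ac)
  qed
  have vx: "v \<bullet> ?M (?T x) \<le> Sg * \<kappa> * (\<bar>\<epsilon>\<bar> * X * Y + \<bar>\<epsilon>\<bar> * Y\<^sup>2)"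
  proof -
    have "norm x \<le> X + Y" unfolding X_def Y_def xuv by (rule norm_triangle_ineq)
    have "v \<bullet> ?M (?T x) \<le> norm v * norm (?M (?T x))" by (rule norm_cauchy_schwarz)
    also have "\<dots> \<le> Y * (Sg * (\<kappa> * \<bar>\<epsilon>\<bar> * norm x))"
      unfolding Y_def using KG
      by (intro mult_left_mono order_trans[OF norm_mult_le[OF sigma_le]] TT) auto
    also have "\<dots> \<le> Y * (Sg * (\<kappa> * \<bar>\<epsilon>\<bar> * (X + Y)))"
      using KG \<open>norm x \<le> X + Y\<close> by (intro mult_left_mono) (auto simp: Y_def)
    finally show ?thesis by (simp add: algebra_simps power2_eq_square)
  qed
  have xR: "x \<bullet> ?M (?R x) \<le> Sg * \<kappa> * (\<epsilon>\<^sup>2 * (X\<^sup>2 + Y\<^sup>2))"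
  proof -
    have "x \<bullet> ?M (?R x) \<le> norm x * norm (?M (?R x))" by (rule norm_cauchy_schwarz)
    also have "\<dots> \<le> norm x * (Sg * (\<kappa> * \<epsilon>\<^sup>2 * norm (ell2_cnj x)))"
      using KG
      by (intro mult_left_mono order_trans[OF norm_mult_le[OF sigma_le]] norm_kernel_le[OF Rk_schur]) auto
    also have "\<dots> = Sg * \<kappa> * (\<epsilon>\<^sup>2 * (norm x)\<^sup>2)" by (simp add: power2_eq_square)
    finally show ?thesis unfolding norm_x .
  qed
  have "x \<bullet> ?M (?T x + ?R x) = u \<bullet> ?M (?T u) + u \<bullet> ?M (?T v) + v \<bullet> ?M (?T x) + x \<bullet> ?M (?R x)"
  proof -
    have Tx: "?T x = ?T u + ?T v" by (subst xuv) (rule T.add)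
    have split: "x \<bullet> z = u \<bullet> z + v \<bullet> z" for z by (subst xuv) (rule inner_add_left)
    have "x \<bullet> ?M (?T x + ?R x) = u \<bullet> ?M (?T x) + v \<bullet> ?M (?T x) + x \<bullet> ?M (?R x)"
      unfolding M.add inner_add_right by (simp only: split[of "?M (?T x)"])
    moreover have "u \<bullet> ?M (?T x) = u \<bullet> ?M (?T u) + u \<bullet> ?M (?T v)"
      unfolding Tx M.add inner_add_right ..
    ultimately show ?thesis by simp
  qed
  also have "\<dots> \<le> Sg * \<kappa> * (2 * \<bar>\<epsilon>\<bar> * X * Y + \<bar>\<epsilon>\<bar> * Y\<^sup>2 + \<epsilon>\<^sup>2 * (X\<^sup>2 + Y\<^sup>2))"
    using uu uv vx xR by (simp add: algebra_simps)
  finally have "K * (x \<bullet> ?M (?T x + ?R x)) \<le>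
      K * (Sg * \<kappa> * (2 * \<bar>\<epsilon>\<bar> * X * Y + \<bar>\<epsilon>\<bar> * Y\<^sup>2 + \<epsilon>\<^sup>2 * (X\<^sup>2 + Y\<^sup>2)))"
    using K by (intro mult_left_mono) auto
  then have off: "K * (x \<bullet> ?M (?T x + ?R x)) \<le> G * (2 * \<bar>\<epsilon>\<bar> * X * Y + \<bar>\<epsilon>\<bar> * Y\<^sup>2 + \<bar>\<epsilon>\<bar>\<^sup>2 * (X\<^sup>2 + Y\<^sup>2))"
    by (simp add: G_def mult_ac)
  have "a / 2 * X\<^sup>2 + 1 / 4 * Y\<^sup>2 \<le>
      a * X\<^sup>2 + Y\<^sup>2 - G * (2 * \<bar>\<epsilon>\<bar> * X * Y + \<bar>\<epsilon>\<bar> * Y\<^sup>2 + \<bar>\<epsilon>\<bar>\<^sup>2 * (X\<^sup>2 + Y\<^sup>2))"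
    by (rule coercive_estimate) (use small eps KG in \<open>auto simp: X_def Y_def G_def\<close>)
  also have "\<dots> \<le> x \<bullet> (A0 x + l *\<^sub>R B0 x)"
    using diag off unfolding A0_def by (simp add: inner_diff_right inner_add_right)
  finally have main: "a / 2 * X\<^sup>2 + 1 / 4 * Y\<^sup>2 \<le> x \<bullet> (A0 x + l *\<^sub>R B0 x)" .
  have "min (a / 2) (1 / 4) * (X\<^sup>2 + Y\<^sup>2) \<le> a / 2 * X\<^sup>2 + 1 / 4 * Y\<^sup>2"
    unfolding distrib_left by (intro add_mono mult_right_mono) auto
  then show ?thesis unfolding norm_x using main by linarith
qed

lemma mode_solutions:
  assumes a: "a > 0" and L1: "a * real L \<le> l1"
    and small: "(2 * (K * Sg * \<kappa>)\<^sup>2 + K * Sg * \<kappa>) * \<epsilon>\<^sup>2 \<le> a / 2" "2 * (K * Sg * \<kappa>) * \<bar>\<epsilon>\<bar> \<le> 1 / 4"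
  obtains w where "\<And>l. l \<in> {l1..l2} \<Longrightarrow> mode_sol l \<zeta> (w l)" "continuous_on {l1..l2} w"
proof -
  define y where "y = Abs_ell2 (\<lambda>n. if n = 0 then \<sigma> 0 * \<zeta> else 0)"
  have y: "coord y = (\<lambda>n. if n = 0 then \<sigma> 0 * \<zeta> else 0)"
    unfolding y_def by (rule coord_Abs, rule summable_finite[of "{0}"]) auto
  have pos: "min (a / 2) (1 / 4) > 0" using a by simp
  have coer: "min (a / 2) (1 / 4) * (norm x)\<^sup>2 \<le> x \<bullet> (A0 x + l *\<^sub>R B0 x)" if "l \<in> {l1..l2}" for l x
    using that L1 by (intro coercive[OF _ a small]) auto
  obtain w where w: "\<And>l. l \<in> {l1..l2} \<Longrightarrow> A0 (w l) + l *\<^sub>R B0 (w l) = y" "continuous_on {l1..l2} w"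
    using lax_milgram_pencil[OF bounded_linear_A0 bounded_linear_B0 pos coer] by blast
  have "mode_sol l \<zeta> (w l)" if "l \<in> {l1..l2}" for l
    unfolding mode_sol_def
  proof
    fix n
    have "\<sigma> n * ((of_real (D n) + \<i> * of_real (l / wavenum n)) * coord (w l) n
      - of_real K * (coord (ell2_kernel Tk (w l)) n + coord (ell2_kernel Rk (ell2_cnj (w l))) n))
      = \<sigma> n * (if n = 0 then \<zeta> else 0)"
      unfolding coord_operator[symmetric] w(1)[OF that] y by simp
    then show "(of_real (D n) + \<i> * of_real (l / wavenum n)) * coord (w l) n
      - of_real K * (coord (ell2_kernel Tk (w l)) n + coord (ell2_kernel Rk (ell2_cnj (w l))) n)
      = (if n = 0 then \<zeta> else 0)"
      using sigma_nonzero[of n] by (simp only: mult_cancel_left) simp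
  qed
  then show ?thesis using w(2) by (rule that)
qed

subsection \<open>The energy identity\<close>

text \<open>The weight is that of the term \<open>\<i> * l / wavenum n\<close>, so
  \<open>l * V w\<close> is what the imaginary part of the pairing with \<open>w\<close> produces.
  It is weaker than the squared norm.\<close>

definition V :: "ell2 \<Rightarrow> real" where
  "V w = (\<Sum>n. (cmod (coord w n))\<^sup>2 / wavenum n)"

definition U :: "ell2 \<Rightarrow> real" where
  "U w = (\<Sum>n. cmod (coord w n) / (wavenum n)\<^sup>2)"

lemma V_summable: "summable (\<lambda>n. (cmod (coord w n))\<^sup>2 / wavenum n)"
proof (rule summable_comparison_test'[where N = 0])
  show "summable (\<lambda>n. 2 * (cmod (coord w n))\<^sup>2)" by (intro summable_mult coord_summable)
  fix n
  have "(cmod (coord w n))\<^sup>2 * 1 \<le> (cmod (coord w n))\<^sup>2 * (2 * wavenum n)"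
    using wavenum_ge_half[of n] by (intro mult_left_mono) auto
  then show "norm ((cmod (coord w n))\<^sup>2 / wavenum n) \<le> 2 * (cmod (coord w n))\<^sup>2"
    by (simp add: divide_le_eq mult_ac)
qed

text \<open>Cauchy-Schwarz with s^(-2) = s^(-1/2) s^(-3/2), which is where
  \<open>sum_inv_cube\<close> comes from.\<close>

lemma U_facts: "summable (\<lambda>n. cmod (coord w n) / (wavenum n)\<^sup>2)" "(U w)\<^sup>2 \<le> V w * sum_inv_cube"
proof -
  define a where "a n = cmod (coord w n) / sqrt (wavenum n)" for n
  define b where "b n = 1 / (wavenum n * sqrt (wavenum n))" for n
  have a: "(a n)\<^sup>2 = (cmod (coord w n))\<^sup>2 / wavenum n" for n
    by (simp add: a_def power_divide)
  have b: "(b n)\<^sup>2 = 1 / wavenum n ^ 3" for n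
    by (simp add: b_def power_divide power_mult_distrib power3_eq_cube power2_eq_square)
  have ab: "a n * b n = cmod (coord w n) / (wavenum n)\<^sup>2" for n
    by (simp add: a_def b_def power2_eq_square)
  note cs = Cauchy_Schwarz_suminf[of a b, unfolded a b ab, OF V_summable summable_inv_cube]
  show "summable (\<lambda>n. cmod (coord w n) / (wavenum n)\<^sup>2)" by (rule cs(1))
  show "(U w)\<^sup>2 \<le> V w * sum_inv_cube"
    unfolding U_def V_def sum_inv_cube_def by (rule cs(2))
qed

lemma U_nonneg: "U w \<ge> 0"
  unfolding U_def by (intro suminf_nonneg U_facts) simp

lemma V_ge: "2 * (cmod (coord w 0))\<^sup>2 \<le> V w"
proof -
  have "(\<Sum>n\<in>{0}. (cmod (coord w n))\<^sup>2 / wavenum n) \<le> V w"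
    unfolding V_def by (intro sum_le_suminf V_summable) auto
  then show ?thesis by (simp add: wavenum_def)
qed

text \<open>Since \<open>r \<ge> 2\<close>, the power (n + m + 2)^(r + 2) dominates the product of
  the squared wavenumbers. The remainder kernel is thus bounded by a product kernel and controlled
  by \<open>U\<close>, hence by \<open>V\<close>, rather than by the norm.\<close>

lemma remainder_le:
  "cmod (coord (ell2_kernel Rk (ell2_cnj w)) n) \<le> Q * \<epsilon>\<^sup>2 * U w / (wavenum n)\<^sup>2"
proof -
  have Rk: "\<bar>Rk n m\<bar> \<le> Q * \<epsilon>\<^sup>2 / (wavenum n)\<^sup>2 / (wavenum m)\<^sup>2" for m
  proof -
    have "(wavenum n)\<^sup>2 * (wavenum m)\<^sup>2 \<le> (real n + real m + 2)\<^sup>2 * (real n + real m + 2)\<^sup>2"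
      by (intro mult_mono power_mono) (auto simp: wavenum_def)
    also have "\<dots> = (real n + real m + 2) ^ (2 + 2)" by (rule power_add[symmetric])
    also have "\<dots> \<le> (real n + real m + 2) ^ (r + 2)" using r by (intro power_increasing) auto
    finally have le: "(wavenum n)\<^sup>2 * (wavenum m)\<^sup>2 \<le> (real n + real m + 2) ^ (r + 2)" .
    have "\<bar>Rk n m\<bar> \<le> Q * \<epsilon>\<^sup>2 / (real n + real m + 2) ^ (r + 2)" by (rule Rk_le)
    also have "\<dots> \<le> Q * \<epsilon>\<^sup>2 / ((wavenum n)\<^sup>2 * (wavenum m)\<^sup>2)"
      using Q by (intro divide_left_mono le) (auto intro!: mult_pos_pos zero_less_power)
    finally show ?thesis by simp
  qed
  have s: "summable (\<lambda>m. Q * \<epsilon>\<^sup>2 / (wavenum n)\<^sup>2 * (cmod (coord w m) / (wavenum m)\<^sup>2))"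
    by (intro summable_mult U_facts)
  have le: "cmod (of_real (Rk n m) * coord (ell2_cnj w) m) \<le> Q * \<epsilon>\<^sup>2 / (wavenum n)\<^sup>2 * (cmod (coord w m) / (wavenum m)\<^sup>2)" for m
    using mult_right_mono[OF Rk[of m], of "cmod (coord w m)"] by (simp add: norm_mult)
  have "cmod (coord (ell2_kernel Rk (ell2_cnj w)) n) \<le>
      (\<Sum>m. Q * \<epsilon>\<^sup>2 / (wavenum n)\<^sup>2 * (cmod (coord w m) / (wavenum m)\<^sup>2))"
    unfolding coord_kernel[OF Rk_schur] by (rule norm_suminf_le[OF le s])
  also have "\<dots> = Q * \<epsilon>\<^sup>2 / (wavenum n)\<^sup>2 * U w"
    unfolding U_def by (rule suminf_mult[OF U_facts(1)])
  finally show ?thesis by simp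
qed

text \<open>Pair row \<open>n\<close> with \<open>w\<close> and take imaginary parts: the real
  diagonal and the self-adjoint Toeplitz part disappear. What is left is the \<open>l\<close> term,
  the source, and the remainder, which costs a multiple of \<epsilon>^2 V.\<close>

lemma energy:
  assumes sol: "mode_sol l \<zeta> w"
  shows "(l - K * (Q * \<epsilon>\<^sup>2 * sum_inv_cube)) * V w \<le> Im (cnj (coord w 0) * \<zeta>)"
proof -
  let ?T = "ell2_kernel Tk w" and ?R = "ell2_kernel Rk (ell2_cnj w)" and ?iw = "ell2_mult (\<lambda>_. \<i>) w"
  have iw: "coord ?iw n \<bullet> z = Im (cnj (coord w n) * z)" for n z
    by (subst coord_mult[where B = 1]) (simp_all add: inner_complex_def)
  have T: "(\<lambda>n. Im (cnj (coord w n) * coord ?T n)) sums 0"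
  proof -
    have "(\<Sum>n. coord ?iw n \<bullet> coord ?T n) = 0"
      using kernel_inner_rotated[OF Tk_schur, of w] unfolding inner_ell2_def .
    then show ?thesis
      using summable_sums[OF inner_summable[OF coord_summable[of ?iw] coord_summable[of ?T]]]
      unfolding iw by simp
  qed
  have Rs: "summable (\<lambda>n. Im (cnj (coord w n) * coord ?R n))"
    using inner_summable[OF coord_summable[of ?iw] coord_summable[of ?R]] unfolding iw .
  have s: "summable (\<lambda>n. Q * \<epsilon>\<^sup>2 * U w * (cmod (coord w n) / (wavenum n)\<^sup>2))"
    by (intro summable_mult U_facts)
  have le: "norm (Im (cnj (coord w n) * coord ?R n)) \<le> Q * \<epsilon>\<^sup>2 * U w * (cmod (coord w n) / (wavenum n)\<^sup>2)" for n
  proof -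
    have "norm (Im (cnj (coord w n) * coord ?R n)) \<le> cmod (cnj (coord w n) * coord ?R n)"
      unfolding real_norm_def by (rule abs_Im_le_cmod)
    also have "\<dots> = cmod (coord w n) * cmod (coord ?R n)" by (simp add: norm_mult)
    also have "\<dots> \<le> cmod (coord w n) * (Q * \<epsilon>\<^sup>2 * U w / (wavenum n)\<^sup>2)"
      by (intro mult_left_mono remainder_le) simp
    finally show ?thesis by (simp add: mult_ac)
  qed
  have "norm (\<Sum>n. Im (cnj (coord w n) * coord ?R n)) \<le> (\<Sum>n. Q * \<epsilon>\<^sup>2 * U w * (cmod (coord w n) / (wavenum n)\<^sup>2))"
    by (rule norm_suminf_le[OF le s])
  also have "\<dots> = Q * \<epsilon>\<^sup>2 * (U w)\<^sup>2"
    unfolding suminf_mult[OF U_facts(1)] U_def[symmetric] by (simp add: power2_eq_square)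
  also have "\<dots> \<le> Q * \<epsilon>\<^sup>2 * (V w * sum_inv_cube)"
    using Q by (intro mult_left_mono U_facts) auto
  finally have R: "(\<Sum>n. Im (cnj (coord w n) * coord ?R n)) \<le> Q * \<epsilon>\<^sup>2 * (V w * sum_inv_cube)"
    by simp
  have modewise: "l * ((cmod (coord w n))\<^sup>2 / wavenum n) - K * Im (cnj (coord w n) * coord ?T n)
      - K * Im (cnj (coord w n) * coord ?R n) = (if n = 0 then Im (cnj (coord w 0) * \<zeta>) else 0)" for n
  proof -
    have cancel: "cnj z * ((of_real d + \<i> * of_real m) * z - of_real K * (x + y)) =
        of_real d * (cnj z * z) + \<i> * of_real m * (cnj z * z) - of_real K * (cnj z * x) - of_real K * (cnj z * y)"
      for z x y :: complex and d m
      by (simp add: algebra_simps)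
    have zz: "cnj z * z = of_real ((cmod z)\<^sup>2)" for z
      using complex_norm_square[of z] by (simp add: mult.commute)
    have "Im (cnj (coord w n) * ((of_real (D n) + \<i> * of_real (l / wavenum n)) * coord w n
      - of_real K * (coord ?T n + coord ?R n))) = Im (cnj (coord w n) * (if n = 0 then \<zeta> else 0))"
      using sol[unfolded mode_sol_def, rule_format, of n] by (simp only:)
    then have "l / wavenum n * (cmod (coord w n))\<^sup>2 - K * Im (cnj (coord w n) * coord ?T n)
      - K * Im (cnj (coord w n) * coord ?R n) = Im (cnj (coord w n) * (if n = 0 then \<zeta> else 0))"
      unfolding cancel zz
      by (simp only: minus_complex.simps plus_complex.simps Im_complex_of_real times_complex.simps
          Re_complex_of_real imaginary_unit.simps) (simp add: algebra_simps)
    then show ?thesis by (cases "n = 0") auto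
  qed
  have "(\<lambda>n. l * ((cmod (coord w n))\<^sup>2 / wavenum n) - K * Im (cnj (coord w n) * coord ?T n)
      - K * Im (cnj (coord w n) * coord ?R n)) sums
      (l * V w - K * 0 - K * (\<Sum>n. Im (cnj (coord w n) * coord ?R n)))"
    unfolding V_def by (intro sums_diff sums_mult T summable_sums[OF V_summable] summable_sums[OF Rs])
  moreover have "(\<lambda>n. if n = 0 then Im (cnj (coord w 0) * \<zeta>) else 0) sums Im (cnj (coord w 0) * \<zeta>)"
    by (rule sums_single)
  ultimately have "l * V w - K * (\<Sum>n. Im (cnj (coord w n) * coord ?R n)) = Im (cnj (coord w 0) * \<zeta>)"
    unfolding modewise using sums_unique2 by fastforce
  moreover have "K * (\<Sum>n. Im (cnj (coord w n) * coord ?R n)) \<le> K * (Q * \<epsilon>\<^sup>2 * (V w * sum_inv_cube))"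
    using K by (intro mult_left_mono R) auto
  ultimately show ?thesis by (simp add: algebra_simps)
qed

subsection \<open>A lower bound from an approximate null vector\<close>

text \<open>Pairing with the real vector \<open>v\<close> and moving the symmetric Toeplitz part
  onto \<open>v\<close> leaves the residual, the \<open>l\<close> term and the remainder, all
  estimated by \<open>U w\<close>. A small \<open>l\<close> thus forces a large response
  \<open>w\<close> to a given source.\<close>

lemma test_vector:
  assumes sol: "mode_sol l \<zeta> w"
    and v: "\<And>n. n > M \<Longrightarrow> v n = 0" "v 0 = 1" "\<And>n. \<bar>v n\<bar> \<le> E / wavenum n"
    and res: "\<And>m. \<bar>D m * v m - K * (\<Sum>n\<le>M. q (int m - int n) * v n)\<bar> \<le> E * \<epsilon>\<^sup>2 / (wavenum m)\<^sup>2"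
  shows "cmod \<zeta> \<le> E * (\<bar>l\<bar> + (1 + K * Q * sum_inv_cube) * \<epsilon>\<^sup>2) * U w"
proof -
  let ?R = "ell2_kernel Rk (ell2_cnj w)"
  define \<rho> where "\<rho> m = D m * v m - K * (\<Sum>n\<le>M. q (int m - int n) * v n)" for m
  have "1 \<le> E / wavenum 0" using v(3)[of 0] v(2) by simp
  then have "wavenum 0 \<le> E" by (simp add: pos_le_divide_eq)
  then have E: "E \<ge> 0" using wavenum_pos(2)[of 0] by linarith
  have Ts: "summable (\<lambda>m. of_real (Tk n m) * coord w m)" for n by (rule kernel_summable[OF Tk_schur])
  have col: "(\<Sum>n\<le>M. of_real (v n) * (of_real (Tk n m) * coord w m)) =
      of_real (\<Sum>n\<le>M. q (int m - int n) * v n) * coord w m" for m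
    unfolding of_real_sum sum_distrib_right
    using schur_sym[OF Tk_schur, of _ m] by (intro sum.cong refl) (simp add: Tk_def mult_ac)
  have T: "(\<Sum>n\<le>M. of_real (v n) * coord (ell2_kernel Tk w) n)
      = (\<Sum>m. of_real (\<Sum>n\<le>M. q (int m - int n) * v n) * coord w m)"
  proof -
    have "(\<Sum>n\<le>M. of_real (v n) * coord (ell2_kernel Tk w) n) = (\<Sum>n\<le>M. \<Sum>m. of_real (v n) * (of_real (Tk n m) * coord w m))"
      unfolding coord_kernel[OF Tk_schur] by (intro sum.cong refl suminf_mult[symmetric] Ts)
    also have "\<dots> = (\<Sum>m. \<Sum>n\<le>M. of_real (v n) * (of_real (Tk n m) * coord w m))"
      by (rule suminf_sum[symmetric]) (intro summable_mult Ts)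
    finally show ?thesis by (simp only: col)
  qed
  have Tsum: "summable (\<lambda>m. of_real (\<Sum>n\<le>M. q (int m - int n) * v n) * coord w m)"
    unfolding col[symmetric] by (intro summable_sum summable_mult Ts)
  have Dv: "(\<lambda>m. of_real (D m * v m) * coord w m) sums (\<Sum>n\<le>M. of_real (D n * v n) * coord w n)"
    by (rule sums_finite) (auto simp: v(1))
  have "(\<lambda>m. of_real (D m * v m) * coord w m - of_real K * (of_real (\<Sum>n\<le>M. q (int m - int n) * v n) * coord w m))
      sums ((\<Sum>n\<le>M. of_real (D n * v n) * coord w n) - of_real K * (\<Sum>n\<le>M. of_real (v n) * coord (ell2_kernel Tk w) n))"
    unfolding T by (intro sums_diff Dv sums_mult summable_sums[OF Tsum])
  also have "(\<lambda>m. of_real (D m * v m) * coord w m - of_real K * (of_real (\<Sum>n\<le>M. q (int m - int n) * v n) * coord w m))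
      = (\<lambda>m. of_real (\<rho> m) * coord w m)"
    by (simp add: \<rho>_def algebra_simps)
  finally have \<rho>: "(\<Sum>n\<le>M. of_real (D n * v n) * coord w n) - of_real K * (\<Sum>n\<le>M. of_real (v n) * coord (ell2_kernel Tk w) n)
      = (\<Sum>m. of_real (\<rho> m) * coord w m)" by (rule sums_unique)
  have Us: "summable (\<lambda>m. E * \<epsilon>\<^sup>2 * (cmod (coord w m) / (wavenum m)\<^sup>2))"
    by (intro summable_mult U_facts)
  have "cmod (of_real (\<rho> m) * coord w m) \<le> E * \<epsilon>\<^sup>2 * (cmod (coord w m) / (wavenum m)\<^sup>2)" for m
    using mult_right_mono[OF res[of m, folded \<rho>_def], of "cmod (coord w m)"] by (simp add: norm_mult)
  then have "cmod (\<Sum>m. of_real (\<rho> m) * coord w m) \<le> (\<Sum>m. E * \<epsilon>\<^sup>2 * (cmod (coord w m) / (wavenum m)\<^sup>2))"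
    by (rule norm_suminf_le[OF _ Us])
  then have b1: "cmod (\<Sum>m. of_real (\<rho> m) * coord w m) \<le> E * \<epsilon>\<^sup>2 * U w"
    unfolding suminf_mult[OF U_facts(1)] U_def[symmetric] .
  have b2: "cmod (\<Sum>n\<le>M. of_real (v n) * (\<i> * of_real (l / wavenum n) * coord w n)) \<le> \<bar>l\<bar> * E * U w"
  proof -
    have "cmod (of_real (v n) * (\<i> * of_real (l / wavenum n) * coord w n)) \<le>
        \<bar>l\<bar> * E * (cmod (coord w n) / (wavenum n)\<^sup>2)" for n
    proof -
      have "\<bar>v n\<bar> * (\<bar>l\<bar> / wavenum n * cmod (coord w n)) \<le> E / wavenum n * (\<bar>l\<bar> / wavenum n * cmod (coord w n))"
        by (intro mult_right_mono v) auto
      then show ?thesis by (simp add: norm_mult norm_divide power2_eq_square mult_ac)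
    qed
    then have "cmod (\<Sum>n\<le>M. of_real (v n) * (\<i> * of_real (l / wavenum n) * coord w n)) \<le>
        (\<Sum>n\<le>M. \<bar>l\<bar> * E * (cmod (coord w n) / (wavenum n)\<^sup>2))"
      by (rule sum_norm_le)
    also have "\<dots> = \<bar>l\<bar> * E * (\<Sum>n\<le>M. cmod (coord w n) / (wavenum n)\<^sup>2)" by (simp only: sum_distrib_left)
    also have "\<dots> \<le> \<bar>l\<bar> * E * U w"
      unfolding U_def using E by (intro mult_left_mono sum_le_suminf U_facts) auto
    finally show ?thesis .
  qed
  have b3: "cmod (\<Sum>n\<le>M. of_real (v n) * coord ?R n) \<le> E * (Q * \<epsilon>\<^sup>2 * U w) * sum_inv_cube"
  proof -
    have "cmod (of_real (v n) * coord ?R n) \<le> E * (Q * \<epsilon>\<^sup>2 * U w) * (1 / wavenum n ^ 3)" for n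
    proof -
      have "\<bar>v n\<bar> * cmod (coord ?R n) \<le> E / wavenum n * (Q * \<epsilon>\<^sup>2 * U w / (wavenum n)\<^sup>2)"
        using E by (intro mult_mono v remainder_le) auto
      then show ?thesis by (simp add: norm_mult power3_eq_cube power2_eq_square mult_ac)
    qed
    then have "cmod (\<Sum>n\<le>M. of_real (v n) * coord ?R n) \<le> (\<Sum>n\<le>M. E * (Q * \<epsilon>\<^sup>2 * U w) * (1 / wavenum n ^ 3))"
      by (rule sum_norm_le)
    also have "\<dots> = E * (Q * \<epsilon>\<^sup>2 * U w) * (\<Sum>n\<le>M. 1 / wavenum n ^ 3)" by (simp only: sum_distrib_left)
    also have "\<dots> \<le> E * (Q * \<epsilon>\<^sup>2 * U w) * sum_inv_cube"
      unfolding sum_inv_cube_def using E Q U_nonneg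
      by (intro mult_left_mono sum_le_suminf summable_inv_cube) auto
    finally show ?thesis .
  qed
  have "(\<Sum>n\<le>M. of_real (v n) * (if n = 0 then \<zeta> else 0)) = \<zeta>"
    by (subst sum.remove[of _ 0]) (auto simp: v(2))
  moreover have "(\<Sum>n\<le>M. of_real (v n) * (if n = 0 then \<zeta> else 0)) =
     (\<Sum>n\<le>M. of_real (v n) * ((of_real (D n) + \<i> * of_real (l / wavenum n)) * coord w n
      - of_real K * (coord (ell2_kernel Tk w) n + coord ?R n)))"
    using sol[unfolded mode_sol_def, rule_format] by (simp only:)
  moreover have "\<dots> = ((\<Sum>n\<le>M. of_real (D n * v n) * coord w n) - of_real K * (\<Sum>n\<le>M. of_real (v n) * coord (ell2_kernel Tk w) n))
      + (\<Sum>n\<le>M. of_real (v n) * (\<i> * of_real (l / wavenum n) * coord w n)) - of_real K * (\<Sum>n\<le>M. of_real (v n) * coord ?R n)"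
    unfolding sum_distrib_left sum_subtractf[symmetric] sum.distrib[symmetric]
    by (intro sum.cong refl) (simp add: algebra_simps)
  ultimately have \<zeta>: "\<zeta> = (\<Sum>m. of_real (\<rho> m) * coord w m)
      + (\<Sum>n\<le>M. of_real (v n) * (\<i> * of_real (l / wavenum n) * coord w n)) - of_real K * (\<Sum>n\<le>M. of_real (v n) * coord ?R n)"
    unfolding \<rho> by simp
  have "cmod \<zeta> \<le> cmod (\<Sum>m. of_real (\<rho> m) * coord w m)
      + cmod (\<Sum>n\<le>M. of_real (v n) * (\<i> * of_real (l / wavenum n) * coord w n)) + cmod (of_real K * (\<Sum>n\<le>M. of_real (v n) * coord ?R n))"
    unfolding \<zeta> by (rule order_trans[OF norm_triangle_ineq4 add_right_mono[OF norm_triangle_ineq]])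
  also have "\<dots> \<le> E * \<epsilon>\<^sup>2 * U w + \<bar>l\<bar> * E * U w + K * (E * (Q * \<epsilon>\<^sup>2 * U w) * sum_inv_cube)"
  proof (intro add_mono b1 b2)
    show "cmod (of_real K * (\<Sum>n\<le>M. of_real (v n) * coord ?R n)) \<le> K * (E * (Q * \<epsilon>\<^sup>2 * U w) * sum_inv_cube)"
      unfolding norm_mult norm_of_real abs_of_pos[OF K] using K by (intro mult_left_mono b3) simp
  qed
  finally show ?thesis by (simp add: algebra_simps)
qed

subsection \<open>Decay\<close>

text \<open>The weight is truncated at the index \<open>n\<close> under study, so that its supremum
  \<open>S\<close> is finite a priori. Rows from \<open>L\<close> on give at most
  \<open>S / 2\<close>, so \<open>S\<close> is controlled by the rows below \<open>L\<close>, with a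
  bound free of the truncation.\<close>

lemma decay:
  fixes w :: "nat \<Rightarrow> complex"
  assumes bound: "\<And>n. cmod (w n) \<le> C"
    and le: "\<And>n. n \<ge> L \<Longrightarrow> \<delta> * cmod (w n) \<le> K * (\<Sum>m. (\<bar>q (int n - int m)\<bar> + \<bar>q (int n + int m + 1)\<bar>) * cmod (w m))"
    and small: "K * (3 / 2 * \<kappa> * \<bar>\<epsilon>\<bar>) \<le> \<delta> / 2"
  shows "(1 + real n) ^ r * cmod (w n) \<le> real L ^ r * C"
proof -
  define \<omega> where "\<omega> n' = min (1 + real n') (1 + real n) ^ r" for n'
  define S where "S = (SUP n'. \<omega> n' * cmod (w n'))"
  have \<omega>: "0 < \<omega> m" "\<omega> m \<le> (1 + real n) ^ r" for m
    unfolding \<omega>_def by (auto intro!: zero_less_power power_mono)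
  have C: "C \<ge> 0" using bound[of 0] norm_ge_zero[of "w 0"] by linarith
  have bdd: "bdd_above (range (\<lambda>n'. \<omega> n' * cmod (w n')))"
    by (rule bdd_aboveI2[where M = "(1 + real n) ^ r * C"])
       (intro mult_mono \<omega> bound; simp)
  have S: "\<omega> m * cmod (w m) \<le> S" for m
    unfolding S_def by (rule cSUP_upper[OF _ bdd]) simp
  have S0: "S \<ge> 0" using S[of 0] \<omega>(1)[of 0] 
    mult_nonneg_nonneg[OF less_imp_le[OF \<omega>(1)[of 0]] norm_ge_zero[of "w 0"]] by linarith
  have high: "\<omega> i * cmod (w i) \<le> S / 2" if "i \<ge> L" for i
  proof -
    let ?k = "\<lambda>m. (\<bar>q (int i - int m)\<bar> + \<bar>q (int i + int m + 1)\<bar>)"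
    let ?h = "\<lambda>m. weight (nat \<bar>int i - int m\<bar>) + weight (m + (i + 1))"
    have k: "?k m * (1 + real_of_int \<bar>int i - int m\<bar>) ^ r \<le> ?h m" for m
    proof -
      \<comment> \<open>As i + m + 1 is at least |i - m|, the Hankel entry can carry the same
        distance factor as the Toeplitz entry.\<close>
      have "\<bar>q (int i + int m + 1)\<bar> * (1 + real_of_int \<bar>int i - int m\<bar>) ^ r
          \<le> \<bar>q (int i + int m + 1)\<bar> * (1 + real_of_int \<bar>int i + int m + 1\<bar>) ^ r"
        by (intro mult_left_mono power_mono) auto
      also have "\<dots> \<le> weight (nat \<bar>int i + int m + 1\<bar>)" by (rule q_weighted)
      also have "nat \<bar>int i + int m + 1\<bar> = m + (i + 1)" by simp
      finally show ?thesis using q_weighted[of "int i - int m"] by (simp add: distrib_right)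
    qed
    have kn: "?k m \<le> ?h m" for m
      using k[of m] mult_left_mono[of 1 "(1 + real_of_int \<bar>int i - int m\<bar>) ^ r" "?k m"] by simp
    have hs: "(\<Sum>m<N. ?h m) \<le> 3 / 2 * \<kappa> * \<bar>\<epsilon>\<bar>" for N
    proof -
      have "(\<Sum>m<N. ?h m) = (\<Sum>m<N. weight (nat \<bar>int i - int m\<bar>)) + (\<Sum>m<N. weight (m + (i + 1)))"
        by (rule sum.distrib)
      also have "\<dots> \<le> 2 * (\<kappa> * \<bar>\<epsilon>\<bar> / 2) + \<kappa> * \<bar>\<epsilon>\<bar> / 2"
        by (intro add_mono sum_absdiff_le sum_shift_le weight_nonneg weight_sums)
      also have "\<dots> = 3 / 2 * \<kappa> * \<bar>\<epsilon>\<bar>" by simp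
      finally show ?thesis .
    qed
    have h: "summable ?h" "suminf ?h \<le> 3 / 2 * \<kappa> * \<bar>\<epsilon>\<bar>"
      by (rule summable_sum_le[OF _ hs], simp add: weight_nonneg)+
    have hS: "summable (\<lambda>m. ?h m * S)" by (intro summable_mult2 h)
    have "summable (\<lambda>m. ?k m * cmod (w m))"
    proof (rule summable_comparison_test'[where N = 0])
      show "summable (\<lambda>m. ?h m * C)" by (intro summable_mult2 h)
      show "norm (?k m * cmod (w m)) \<le> ?h m * C" for m
        using mult_mono[OF kn[of m] bound[of m]] weight_nonneg by (simp add: abs_mult)
    qed
    then have ks: "summable (\<lambda>m. \<omega> i * (?k m * cmod (w m)))" by (rule summable_mult)
    have "\<omega> i * (?k m * cmod (w m)) \<le> ?h m * S" for m
    proof -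
      \<comment> \<open>The truncated weight still varies slowly: passing from \<open>m\<close> to
        \<open>i\<close> costs at most the factor (1 + |i - m|)^r, which the coefficients
        \<open>q\<close> pay for.\<close>
      have "\<omega> i \<le> (1 + real_of_int \<bar>int i - int m\<bar>) ^ r * \<omega> m"
        unfolding \<omega>_def power_mult_distrib[symmetric]
      proof (intro power_mono)
        let ?d = "real_of_int \<bar>int i - int m\<bar>"
        have d: "real i \<le> real m + ?d" "?d \<ge> 0" by auto
        have "1 + real i \<le> (1 + ?d) * (1 + real m)"
          by (rule one_plus_le_mult) (use d in auto)
        moreover have "1 + real n \<le> (1 + ?d) * (1 + real n)"
          using d by (simp add: algebra_simps)
        ultimately have "min (1 + real i) (1 + real n) \<le> min ((1 + ?d) * (1 + real m)) ((1 + ?d) * (1 + real n))"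
          by (rule min.mono)
        also have "\<dots> = (1 + ?d) * min (1 + real m) (1 + real n)"
          using d(2) by (simp add: min_mult_distrib_left)
        finally show "min (1 + real i) (1 + real n) \<le> (1 + ?d) * min (1 + real m) (1 + real n)" .
      qed simp
      then have "\<omega> i * (?k m * cmod (w m)) \<le> ((1 + real_of_int \<bar>int i - int m\<bar>) ^ r * \<omega> m) * (?k m * cmod (w m))"
        by (rule mult_right_mono) simp
      also have "\<dots> = (?k m * (1 + real_of_int \<bar>int i - int m\<bar>) ^ r) * (\<omega> m * cmod (w m))"
        by (simp only: mult_ac)
      also have "\<dots> \<le> ?h m * S"
        using \<omega>(1)[of m] weight_nonneg by (intro mult_mono k S) (auto simp: less_imp_le)
      finally show ?thesis .
    qed
    then have "(\<Sum>m. \<omega> i * (?k m * cmod (w m))) \<le> (\<Sum>m. ?h m * S)"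
      by (rule suminf_le[OF _ ks hS])
    also have "\<dots> = suminf ?h * S" by (rule suminf_mult2[OF h(1), symmetric])
    also have "\<dots> \<le> 3 / 2 * \<kappa> * \<bar>\<epsilon>\<bar> * S" by (intro mult_right_mono h S0)
    finally have *: "\<omega> i * (\<Sum>m. ?k m * cmod (w m)) \<le> 3 / 2 * \<kappa> * \<bar>\<epsilon>\<bar> * S"
      unfolding suminf_mult[OF \<open>summable (\<lambda>m. ?k m * cmod (w m))\<close>] .
    have "\<delta> * (\<omega> i * cmod (w i)) = \<omega> i * (\<delta> * cmod (w i))" by simp
    also have "\<dots> \<le> \<omega> i * (K * (\<Sum>m. ?k m * cmod (w m)))"
      using \<omega>(1)[of i] by (intro mult_left_mono le that) auto
    also have "\<dots> \<le> K * (3 / 2 * \<kappa> * \<bar>\<epsilon>\<bar> * S)"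
      using mult_left_mono[OF *, of K] K by (simp add: mult_ac)
    also have "\<dots> \<le> \<delta> / 2 * S"
      using mult_right_mono[OF small S0] by (simp add: mult_ac)
    finally show ?thesis using \<delta> by (simp add: field_simps)
  qed
  have "\<omega> i * cmod (w i) \<le> max (S / 2) (real L ^ r * C)" for i
  proof (cases "i \<ge> L")
    case False
    then have "\<omega> i \<le> real L ^ r" unfolding \<omega>_def by (intro power_mono) auto
    then have "\<omega> i * cmod (w i) \<le> real L ^ r * C" by (intro mult_mono bound) auto
    then show ?thesis by simp
  qed (use high in \<open>simp add: le_max_iff_disj\<close>)
  then have "S \<le> max (S / 2) (real L ^ r * C)"
    unfolding S_def by (intro cSUP_least) auto
  moreover have "0 \<le> real L ^ r * C" using C by simp
  ultimately have "S \<le> real L ^ r * C" using S0 by (auto simp: le_max_iff_disj)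
  then show ?thesis using S[of n] by (simp add: \<omega>_def)
qed

section \<open>Closing the equation: existence of the unstable mode\<close>

lemma q1_bounds:
  assumes "Q * \<bar>\<epsilon>\<bar> \<le> 1 / 2"
  shows "\<bar>\<epsilon>\<bar> / 2 \<le> \<bar>q 1\<bar>" "\<bar>q 1\<bar> \<le> 2 * \<bar>\<epsilon>\<bar>"
proof -
  have "\<bar>q 1 - \<epsilon>\<bar> \<le> Q * \<epsilon>\<^sup>2 / (1 + real_of_int \<bar>1\<bar>) ^ (r + 2)" using q_approx[of 1] by simp
  also have "\<dots> \<le> Q * \<epsilon>\<^sup>2 / 1"
  proof (rule divide_left_mono)
    show "1 \<le> (1 + real_of_int \<bar>1\<bar>) ^ (r + 2)" by (rule one_le_power) simp
  qed (use Q in simp_all)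
  also have "\<dots> = Q * \<bar>\<epsilon>\<bar> * \<bar>\<epsilon>\<bar>" by (simp add: power2_eq_square)
  also have "\<dots> \<le> 1 / 2 * \<bar>\<epsilon>\<bar>" using assms by (intro mult_right_mono) auto
  finally show "\<bar>\<epsilon>\<bar> / 2 \<le> \<bar>q 1\<bar>" "\<bar>q 1\<bar> \<le> 2 * \<bar>\<epsilon>\<bar>" by linarith+
qed

text \<open>Because of the conjugation only real combinations are allowed, so the solutions for the
  sources 1 and \<open>\<i>\<close> are both needed to span all sources.\<close>

lemma mode_sol_combine:
  assumes "mode_sol l 1 u" "mode_sol l \<i> v"
  shows "mode_sol l (Complex x y) (x *\<^sub>R u + y *\<^sub>R v)"
proof -
  interpret T: bounded_linear "ell2_kernel Tk" by (rule bounded_linear_kernel[OF Tk_schur])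
  interpret R: bounded_linear "ell2_kernel Rk" by (rule bounded_linear_kernel[OF Rk_schur])
  interpret C: bounded_linear ell2_cnj by (rule bounded_linear_ell2_cnj)
  have comb: "a * (of_real x * u1 + of_real y * v1) - k * ((of_real x * u2 + of_real y * v2) + (of_real x * u3 + of_real y * v3))
      = of_real x * (a * u1 - k * (u2 + u3)) + of_real y * (a * v1 - k * (v2 + v3))"
    for a k u1 v1 u2 v2 u3 v3 :: complex
    by (simp add: algebra_simps)
  have "of_real x * (if n = 0 then 1 else 0) + of_real y * (if n = 0 then \<i> else 0) = (if n = 0 then Complex x y else 0)" for n :: nat
    by (simp add: complex_eq_iff)
  then show ?thesis
    using assms unfolding mode_sol_def T.add T.scaleR C.add C.scaleR R.add R.scaleR coord_add coord_scaleR scaleR_conv_of_real comb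
    by simp
qed

text \<open>Sending a source \<open>z\<close> to \<open>K * q 1 * cnj (w 0)\<close>, with
  \<open>w\<close> the response, is a real-linear map of the plane that expands at \<open>l1\<close>
  and contracts at \<open>l2\<close>. A nonzero fixed point in between restores the missing corner
  entry.\<close>

lemma unstable_mode:
  assumes v: "\<And>n. n > M \<Longrightarrow> v n = 0" "v 0 = 1" "\<And>n. \<bar>v n\<bar> \<le> E / wavenum n"
    and res: "\<And>m. \<bar>D m * v m - K * (\<Sum>n\<le>M. q (int m - int n) * v n)\<bar> \<le> E * \<epsilon>\<^sup>2 / (wavenum m)\<^sup>2"
    and \<tau>: "\<tau> > 0" "\<tau> \<le> K" "16 * E\<^sup>2 * sum_inv_cube * \<tau> \<le> K"
    and small: "(2 * (K * Sg * \<kappa>)\<^sup>2 + K * Sg * \<kappa>) * \<epsilon>\<^sup>2 \<le> \<tau> * \<bar>\<epsilon>\<bar> / real L / 2" "2 * (K * Sg * \<kappa>) * \<bar>\<epsilon>\<bar> \<le> 1 / 4"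
      "(1 + K * Q * sum_inv_cube) * \<bar>\<epsilon>\<bar> \<le> \<tau> / 2" "Q * \<bar>\<epsilon>\<bar> \<le> 1 / 2" "K * (3 / 2 * \<kappa> * \<bar>\<epsilon>\<bar>) \<le> \<delta> / 2"
  shows "\<exists>l>0. \<exists>w :: nat \<Rightarrow> complex. w 0 \<noteq> 0 \<and> (\<exists>C. \<forall>n. (1 + real n) ^ r * cmod (w n) \<le> C) \<and>
    (\<forall>n. (of_real (D n) + \<i> * of_real (l / wavenum n)) * w n =
      of_real K * ((\<Sum>m. of_real (q (int n - int m)) * w m) + (\<Sum>m. of_real (q (int n + int m + 1)) * cnj (w m))))"
proof -
  define c where "c = 1 + K * Q * sum_inv_cube"
  \<comment> \<open>\<open>\<tau>\<close> is small enough for expansion at this end. At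
    \<open>l2\<close> the energy bound with \<open>V \<ge> 2 |w 0|^2\<close> and |q 1| at most 2
    |\<epsilon>| yields contraction.\<close>
  define l1 where "l1 = \<tau> * \<bar>\<epsilon>\<bar>"
  define l2 where "l2 = 2 * K * \<bar>\<epsilon>\<bar>"
  have e: "\<bar>\<epsilon>\<bar> > 0" using eps by simp
  have l1: "l1 > 0" using \<tau> e by (simp add: l1_def)
  have l12: "l1 \<le> l2" unfolding l1_def l2_def using \<tau> K by (intro mult_right_mono) auto
  have Kc: "K * (Q * \<epsilon>\<^sup>2 * sum_inv_cube) \<le> c * \<epsilon>\<^sup>2" by (simp add: c_def algebra_simps)
  have ce: "c * \<epsilon>\<^sup>2 \<le> l1 / 2"
  proof -
    have "c * \<epsilon>\<^sup>2 = c * \<bar>\<epsilon>\<bar> * \<bar>\<epsilon>\<bar>" by (simp add: power2_eq_square)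
    also have "\<dots> \<le> \<tau> / 2 * \<bar>\<epsilon>\<bar>" unfolding c_def by (intro mult_right_mono small) simp
    finally show ?thesis by (simp add: l1_def)
  qed
  note q1 = q1_bounds[OF small(4)]
  have q1n: "q 1 \<noteq> 0" using q1(1) e by auto
  have a: "\<tau> * \<bar>\<epsilon>\<bar> / real L > 0" "\<tau> * \<bar>\<epsilon>\<bar> / real L * real L \<le> l1" using \<tau> e L by (auto simp: l1_def)
  obtain w1 where w1: "\<And>l. l \<in> {l1..l2} \<Longrightarrow> mode_sol l 1 (w1 l)" "continuous_on {l1..l2} w1"
    using mode_solutions[OF a small(1,2), of l2 1] by blast
  obtain wi where wi: "\<And>l. l \<in> {l1..l2} \<Longrightarrow> mode_sol l \<i> (wi l)" "continuous_on {l1..l2} wi"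
    using mode_solutions[OF a small(1,2), of l2 \<i>] by blast
  define W where "W l z = Re z *\<^sub>R w1 l + Im z *\<^sub>R wi l" for l z
  have W: "mode_sol l z (W l z)" if "l \<in> {l1..l2}" for l z
    unfolding W_def using mode_sol_combine[OF w1(1)[OF that] wi(1)[OF that], of "Re z" "Im z"] by simp
  define g where "g l z = of_real (K * q 1) * cnj (coord (W l z) 0)" for l z
  have en: "(l - c * \<epsilon>\<^sup>2) * V (W l z) \<le> Im (cnj (coord (W l z) 0) * z)" if "l \<in> {l1..l2}" for l z
  proof -
    have "0 \<le> V (W l z)" using V_ge[of "W l z"] zero_le_power2[of "cmod (coord (W l z) 0)"] by linarith
    then have "(l - c * \<epsilon>\<^sup>2) * V (W l z) \<le> (l - K * (Q * \<epsilon>\<^sup>2 * sum_inv_cube)) * V (W l z)"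
      using Kc by (intro mult_right_mono) auto
    then show ?thesis using energy[OF W[OF that]] by (rule order_trans)
  qed
  have Im_le: "Im (cnj a * z) \<le> cmod a * cmod z" for a z
    using abs_Im_le_cmod[of "cnj a * z"] by (simp add: norm_mult)
  have lower: "cmod z \<le> cmod (g l1 z)" for z
  proof (cases "z = 0")
    case False
    define y where "y = cmod (coord (W l1 z) 0)"
    have m: "l1 \<in> {l1..l2}" using l12 by simp
    have "1 \<le> E / wavenum 0" using v(3)[of 0] v(2) by simp
    then have "wavenum 0 \<le> E" by (simp add: pos_le_divide_eq)
    then have E: "E \<ge> 0" using wavenum_pos(2)[of 0] by linarith
    \<comment> \<open>The lower bound gives |z| of order \<open>l1 U\<close>, then U^2 is at most a
      multiple of V, and the energy bounds \<open>l1 V\<close> by |w 0| |z|. One factor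
      \<open>l1\<close>, hence \<open>\<tau>\<close>, survives and beats the constants.\<close>
    have "cmod z \<le> E * (\<bar>l1\<bar> + c * \<epsilon>\<^sup>2) * U (W l1 z)"
      unfolding c_def by (rule test_vector[OF W[OF m] v res])
    also have "\<dots> \<le> E * (2 * l1) * U (W l1 z)"
      using ce l1 E U_nonneg by (intro mult_right_mono mult_left_mono) auto
    finally have "(cmod z)\<^sup>2 \<le> (E * (2 * l1) * U (W l1 z))\<^sup>2" by (intro power_mono) auto
    also have "\<dots> = 4 * E\<^sup>2 * l1\<^sup>2 * (U (W l1 z))\<^sup>2" by (simp add: power_mult_distrib)
    also have "\<dots> \<le> 4 * E\<^sup>2 * l1\<^sup>2 * (V (W l1 z) * sum_inv_cube)"
      by (intro mult_left_mono U_facts) auto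
    also have "\<dots> = (8 * E\<^sup>2 * l1 * sum_inv_cube) * (l1 / 2 * V (W l1 z))" by (simp add: power2_eq_square)
    also have "\<dots> \<le> (8 * E\<^sup>2 * l1 * sum_inv_cube) * (y * cmod z)"
    proof (rule mult_left_mono)
      have "0 \<le> V (W l1 z)" using V_ge[of "W l1 z"] zero_le_power2[of "cmod (coord (W l1 z) 0)"] by linarith
      then have "l1 / 2 * V (W l1 z) \<le> (l1 - c * \<epsilon>\<^sup>2) * V (W l1 z)" using ce by (intro mult_right_mono) auto
      also have "\<dots> \<le> y * cmod z" unfolding y_def using en[OF m] Im_le by (rule order_trans)
      finally show "l1 / 2 * V (W l1 z) \<le> y * cmod z" .
      show "0 \<le> 8 * E\<^sup>2 * l1 * sum_inv_cube" using l1 sum_inv_cube_nonneg by simp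
    qed
    finally have "cmod z * cmod z \<le> (8 * E\<^sup>2 * l1 * sum_inv_cube * y) * cmod z"
      by (simp add: power2_eq_square mult_ac)
    then have "cmod z \<le> 8 * E\<^sup>2 * l1 * sum_inv_cube * y" using False by simp
    also have "\<dots> = (16 * E\<^sup>2 * sum_inv_cube * \<tau>) * (\<bar>\<epsilon>\<bar> / 2 * y)" by (simp add: l1_def)
    also have "\<dots> \<le> K * (\<bar>q 1\<bar> * y)"
      using \<tau>(3) q1(1) K by (intro mult_mono mult_right_mono) (auto simp: y_def)
    also have "\<dots> = cmod (g l1 z)" using K by (simp add: g_def norm_mult abs_mult y_def)
    finally show ?thesis .
  qed simp
  obtain l z where lz: "l \<in> {l1..l2}" "z \<noteq> 0" "g l z = z"
  proof (rule planar_fixed_point[of l1 l2 g "q 1"])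
    show "l1 \<le> l2" by fact
    show "g l (Complex x y) = of_real x * g l 1 + of_real y * g l \<i>" for l x y
      by (simp add: g_def W_def scaleR_conv_of_real algebra_simps)
    have cc: "continuous_on {l1..l2} (\<lambda>l. coord (u l) 0)" if u: "continuous_on {l1..l2} u" for u :: "real \<Rightarrow> ell2"
      unfolding continuous_on_iff
    proof (intro ballI allI impI)
      fix x e :: real assume x: "x \<in> {l1..l2}" "e > 0"
      then obtain d where d: "d > 0" "\<forall>x'\<in>{l1..l2}. dist x' x < d \<longrightarrow> dist (u x') (u x) < e"
        using u[unfolded continuous_on_iff] by meson
      have "dist (coord (u x') 0) (coord (u x) 0) < e" if "x' \<in> {l1..l2}" "dist x' x < d" for x'
        using coord_le_norm[of "u x' - u x" 0] d(2)[rule_format, OF that] by (simp add: dist_norm)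
      then show "\<exists>d>0. \<forall>x'\<in>{l1..l2}. dist x' x < d \<longrightarrow> dist (coord (u x') 0) (coord (u x) 0) < e"
        using d(1) by blast
    qed
    show "continuous_on {l1..l2} (\<lambda>l. g l 1)" "continuous_on {l1..l2} (\<lambda>l. g l \<i>)"
      unfolding g_def W_def by (simp_all, intro continuous_intros cc w1(2), intro continuous_intros cc wi(2))
    show "cmod z \<le> cmod (g l1 z)" for z by (rule lower)
    \<comment> \<open>The energy inequality gives the imaginary part of \<open>cnj (w 0) * z\<close>
      a sign, and this is the orientation demanded by the planar lemma.\<close>
    show "q 1 * Im (z * g l1 z) > 0" if "z \<noteq> 0" for z
    proof -
      have m: "l1 \<in> {l1..l2}" using l12 by simp
      have "coord (W l1 z) 0 \<noteq> 0"
        using lower[of z] that by (auto simp: g_def)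
      then have "0 < 2 * (cmod (coord (W l1 z) 0))\<^sup>2" by simp
      then have "0 < V (W l1 z)" using V_ge[of "W l1 z"] by linarith
      then have "0 < (l1 - c * \<epsilon>\<^sup>2) * V (W l1 z)" using ce l1 by (intro mult_pos_pos) auto
      then have pos: "0 < Im (cnj (coord (W l1 z) 0) * z)" using en[OF m, of z] by linarith
      have "q 1 * Im (z * g l1 z) = (K * (q 1)\<^sup>2) * Im (cnj (coord (W l1 z) 0) * z)"
        by (simp add: g_def power2_eq_square algebra_simps)
      then show ?thesis using pos K q1n by simp
    qed
    show "cmod (g l2 z) \<le> cmod z" for z
    proof -
      define y where "y = cmod (coord (W l2 z) 0)"
      have m: "l2 \<in> {l1..l2}" using l12 by simp
      have "K * \<bar>\<epsilon>\<bar> * (2 * y\<^sup>2) \<le> (l2 - c * \<epsilon>\<^sup>2) * V (W l2 z)"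
      proof (rule mult_mono)
        show "K * \<bar>\<epsilon>\<bar> \<le> l2 - c * \<epsilon>\<^sup>2" using ce l12 K e unfolding l2_def l1_def by linarith
        then show "0 \<le> l2 - c * \<epsilon>\<^sup>2" using mult_nonneg_nonneg[OF less_imp_le[OF K] abs_ge_zero[of \<epsilon>]] by linarith
        show "2 * y\<^sup>2 \<le> V (W l2 z)" unfolding y_def by (rule V_ge)
      qed simp
      also have "\<dots> \<le> y * cmod z" unfolding y_def using en[OF m] Im_le by (rule order_trans)
      finally have le: "(2 * K * \<bar>\<epsilon>\<bar> * y) * y \<le> cmod z * y" by (simp add: power2_eq_square mult_ac)
      have "2 * K * \<bar>\<epsilon>\<bar> * y \<le> cmod z"
      proof (cases "y = 0")
        case False
        then show ?thesis using le by (simp add: y_def)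
      qed simp
      moreover have "cmod (g l2 z) \<le> 2 * K * \<bar>\<epsilon>\<bar> * y"
      proof -
        have "cmod (g l2 z) = K * \<bar>q 1\<bar> * y" using K by (simp add: g_def norm_mult abs_mult y_def)
        also have "\<dots> \<le> K * (2 * \<bar>\<epsilon>\<bar>) * y"
          using q1(2) K by (intro mult_right_mono mult_left_mono) (auto simp: y_def)
        finally show ?thesis by simp
      qed
      ultimately show ?thesis by simp
    qed
  qed
  define w where "w = W l z"
  have z: "z = of_real (K * q 1) * cnj (coord w 0)" using lz(3) by (simp add: g_def w_def)
  have sol: "mode_sol l z w" unfolding w_def by (rule W[OF lz(1)])
  have w0: "coord w 0 \<noteq> 0" using lz(2) z by auto
  \<comment> \<open>The corner entry is put back: the full Hankel sum is the \<open>Rk\<close> sum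
    plus \<open>q 1 * cnj (w 0)\<close> in row 0.\<close>
  have hank: "(\<Sum>m. of_real (q (int n + int m + 1)) * cnj (coord w m)) =
      coord (ell2_kernel Rk (ell2_cnj w)) n + (if n = 0 then of_real (q 1) * cnj (coord w 0) else 0)"
    "summable (\<lambda>m. of_real (q (int n + int m + 1)) * cnj (coord w m))" for n
  proof -
    let ?e = "\<lambda>m. if m = 0 then (if n = 0 then of_real (q 1) * cnj (coord w 0) else 0) else 0"
    have "(\<lambda>m. of_real (Rk n m) * coord (ell2_cnj w) m + ?e m) sums
        (coord (ell2_kernel Rk (ell2_cnj w)) n + (if n = 0 then of_real (q 1) * cnj (coord w 0) else 0))"
      unfolding coord_kernel[OF Rk_schur]
      by (intro sums_add summable_sums[OF kernel_summable[OF Rk_schur]] sums_single)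
    also have "(\<lambda>m. of_real (Rk n m) * coord (ell2_cnj w) m + ?e m) = (\<lambda>m. of_real (q (int n + int m + 1)) * cnj (coord w m))"
      by (auto simp: Rk_def algebra_simps)
    finally have s: "(\<lambda>m. of_real (q (int n + int m + 1)) * cnj (coord w m)) sums
        (coord (ell2_kernel Rk (ell2_cnj w)) n + (if n = 0 then of_real (q 1) * cnj (coord w 0) else 0))" .
    show "(\<Sum>m. of_real (q (int n + int m + 1)) * cnj (coord w m)) =
      coord (ell2_kernel Rk (ell2_cnj w)) n + (if n = 0 then of_real (q 1) * cnj (coord w 0) else 0)"
      using s by (rule sums_unique[symmetric])
    show "summable (\<lambda>m. of_real (q (int n + int m + 1)) * cnj (coord w m))" using s by (rule sums_summable)
  qed
  have toep: "coord (ell2_kernel Tk w) n = (\<Sum>m. of_real (q (int n - int m)) * coord w m)" for n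
    unfolding coord_kernel[OF Tk_schur] Tk_def ..
  have eq: "(of_real (D n) + \<i> * of_real (l / wavenum n)) * coord w n =
      of_real K * ((\<Sum>m. of_real (q (int n - int m)) * coord w m) + (\<Sum>m. of_real (q (int n + int m + 1)) * cnj (coord w m)))" for n
    using sol[unfolded mode_sol_def, rule_format, of n] z unfolding hank(1) toep[symmetric]
    by (cases "n = 0") (auto simp: algebra_simps)
  have "\<delta> * cmod (coord w n) \<le> K * (\<Sum>m. (\<bar>q (int n - int m)\<bar> + \<bar>q (int n + int m + 1)\<bar>) * cmod (coord w m))"
    if n: "n \<ge> L" for n
  proof -
    have t: "summable (\<lambda>m. \<bar>q (int n - int m)\<bar> * cmod (coord w m))"
      using kernel_abs_summable[OF Tk_schur, of n w] by (simp add: Tk_def)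
    have "summable (\<lambda>m. \<bar>Rk n m\<bar> * cmod (coord w m))" by (rule kernel_abs_summable[OF Rk_schur])
    also have "(\<lambda>m. \<bar>Rk n m\<bar> * cmod (coord w m)) = (\<lambda>m. \<bar>q (int n + int m + 1)\<bar> * cmod (coord w m))"
      using n L by (auto simp: Rk_def)
    finally have h: "summable (\<lambda>m. \<bar>q (int n + int m + 1)\<bar> * cmod (coord w m))" .
    have "\<delta> \<le> \<bar>Re (of_real (D n) + \<i> * of_real (l / wavenum n))\<bar>" using D_large[OF n] by simp
    also have "\<dots> \<le> cmod (of_real (D n) + \<i> * of_real (l / wavenum n))" by (rule abs_Re_le_cmod)
    finally have "\<delta> * cmod (coord w n) \<le> cmod (of_real (D n) + \<i> * of_real (l / wavenum n)) * cmod (coord w n)"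
      by (rule mult_right_mono) simp
    also have "\<dots> = K * cmod ((\<Sum>m. of_real (q (int n - int m)) * coord w m) + (\<Sum>m. of_real (q (int n + int m + 1)) * cnj (coord w m)))"
      unfolding norm_mult[symmetric] eq using K by (simp add: norm_mult)
    also have "\<dots> \<le> K * ((\<Sum>m. \<bar>q (int n - int m)\<bar> * cmod (coord w m)) + (\<Sum>m. \<bar>q (int n + int m + 1)\<bar> * cmod (coord w m)))"
    proof (intro mult_left_mono order_trans[OF norm_triangle_ineq] add_mono)
      show "cmod (\<Sum>m. of_real (q (int n - int m)) * coord w m) \<le> (\<Sum>m. \<bar>q (int n - int m)\<bar> * cmod (coord w m))"
        by (rule norm_suminf_le[OF _ t]) (simp add: norm_mult)
      show "cmod (\<Sum>m. of_real (q (int n + int m + 1)) * cnj (coord w m)) \<le> (\<Sum>m. \<bar>q (int n + int m + 1)\<bar> * cmod (coord w m))"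
        by (rule norm_suminf_le[OF _ h]) (simp add: norm_mult)
    qed (use K in simp)
    also have "\<dots> = K * (\<Sum>m. (\<bar>q (int n - int m)\<bar> + \<bar>q (int n + int m + 1)\<bar>) * cmod (coord w m))"
      by (simp add: suminf_add[OF t h] distrib_right)
    finally show ?thesis .
  qed
  then have dec: "(1 + real n) ^ r * cmod (coord w n) \<le> real L ^ r * norm w" for n
    by (intro decay small(5) coord_le_norm)
  have "l > 0" using lz(1) l1 by simp
  moreover have "\<exists>C. \<forall>n. (1 + real n) ^ r * cmod (coord w n) \<le> C" using dec by blast
  ultimately show ?thesis using w0 eq by meson
qed

end

section \<open>The approximate null vector on the resonant block and the choice of constants\<close>

section \<open>Instability near a resonant block\<close>

context
  fixes K Q t :: real and d :: "nat \<Rightarrow> real" and p r :: nat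
  assumes K: "K > 0" and Q: "Q \<ge> 0"
    and block: "\<And>n. n \<le> p \<Longrightarrow> d n = 0" "d (Suc p) \<noteq> 0"
    and t: "three_term (\<lambda>n. 1 / (wavenum n)\<^sup>2) t (Suc p) = 0"
begin

text \<open>At order \<epsilon> row \<open>m\<close> of the block reads t / s_m^2 v_m = v_{m-1} +
  v_{m+1}. The recursion solves it, and \<open>t\<close> being a root makes v vanish at
  \<open>Suc p\<close>, which cuts the block off.\<close>

definition block_vec :: "nat \<Rightarrow> real" where
  "block_vec = three_term (\<lambda>n. 1 / (wavenum n)\<^sup>2) t"

text \<open>The entry at \<open>Suc p\<close> is the one that cancels the coupling K \<epsilon> v_p
  in that row against the nonzero diagonal \<open>d (Suc p)\<close>; being O(\<epsilon>), it
  disturbs the block rows only at order \<epsilon>^2.\<close>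

definition null_vec :: "real \<Rightarrow> nat \<Rightarrow> real" where
  "null_vec \<epsilon> n = (if n \<le> p then block_vec n else if n = Suc p then K * \<epsilon> * block_vec p / d (Suc p) else 0)"

definition block_size :: real where
  "block_size = (\<Sum>n\<le>p. \<bar>block_vec n\<bar>) + K * \<bar>block_vec p\<bar> / \<bar>d (Suc p)\<bar>"

text \<open>The summands come from the error of \<open>D\<close> (Q), the entry at
  \<open>Suc p\<close> (K), the shift in that row where 1 / s^2 is at most 4 (4 K |t|), and the
  non-neighbour coefficients (2 K Q). The final 1 makes it bound \<open>null_vec\<close> too; (p +
  3)^2 covers the wavenumbers up to index \<open>p + 2\<close>.\<close>

definition block_const :: real where
  "block_const = (real p + 3)\<^sup>2 * block_size * (Q + K + 4 * K * \<bar>t\<bar> + 2 * K * Q + 1)"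

lemma block_vec_le: "n \<le> p \<Longrightarrow> \<bar>block_vec n\<bar> \<le> block_size"
  unfolding block_size_def using K
  by (intro order_trans[OF member_le_sum[of n "{..p}" "\<lambda>n. \<bar>block_vec n\<bar>"]]) auto

lemma block_size_ge: "1 \<le> block_size"
  using block_vec_le[of 0] by (simp add: block_vec_def)

lemma null_vec_last: "\<bar>null_vec \<epsilon> (Suc p)\<bar> \<le> \<bar>\<epsilon>\<bar> * block_size"
proof -
  have "\<bar>null_vec \<epsilon> (Suc p)\<bar> = \<bar>\<epsilon>\<bar> * (K * \<bar>block_vec p\<bar> / \<bar>d (Suc p)\<bar>)"
    using K by (simp add: null_vec_def abs_mult)
  also have "\<dots> \<le> \<bar>\<epsilon>\<bar> * block_size"
    unfolding block_size_def by (intro mult_left_mono) (auto intro: sum_nonneg)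
  finally show ?thesis .
qed

lemma null_vec_zero: "null_vec \<epsilon> 0 = 1"
  by (simp add: null_vec_def block_vec_def)

lemma null_vec_outside: "n > Suc p \<Longrightarrow> null_vec \<epsilon> n = 0"
  by (simp add: null_vec_def)

lemma null_vec_le:
  assumes "\<bar>\<epsilon>\<bar> \<le> 1"
  shows "\<bar>null_vec \<epsilon> n\<bar> \<le> block_size" "(\<Sum>n\<le>Suc p. \<bar>null_vec \<epsilon> n\<bar>) \<le> 2 * block_size"
proof -
  have last: "\<bar>null_vec \<epsilon> (Suc p)\<bar> \<le> block_size"
    using null_vec_last[of \<epsilon>] mult_right_mono[OF assms, of block_size] block_size_ge by linarith
  consider "n \<le> p" | "n = Suc p" | "n > Suc p" by linarith
  then show "\<bar>null_vec \<epsilon> n\<bar> \<le> block_size"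
    using block_vec_le[of n] last block_size_ge by cases (auto simp: null_vec_def)
  have "(\<Sum>n\<le>p. \<bar>null_vec \<epsilon> n\<bar>) = (\<Sum>n\<le>p. \<bar>block_vec n\<bar>)"
    by (rule sum.cong) (simp_all add: null_vec_def)
  also have "\<dots> \<le> block_size" unfolding block_size_def using K by simp
  finally show "(\<Sum>n\<le>Suc p. \<bar>null_vec \<epsilon> n\<bar>) \<le> 2 * block_size" using last by simp
qed

lemma null_vec_wavenum:
  assumes "\<bar>\<epsilon>\<bar> \<le> 1"
  shows "\<bar>null_vec \<epsilon> n\<bar> \<le> block_const / wavenum n"
proof (cases "n > Suc p")
  case True
  then show ?thesis
    using K Q block_size_ge by (simp add: null_vec_outside block_const_def)
next
  case False
  then have "wavenum n \<le> real p + 3" by (simp add: wavenum_def)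
  also have "\<dots> \<le> (real p + 3)\<^sup>2" by (simp add: power2_eq_square)
  finally have w: "wavenum n \<le> (real p + 3)\<^sup>2" .
  have "\<bar>null_vec \<epsilon> n\<bar> * wavenum n \<le> block_size * (real p + 3)\<^sup>2"
    using null_vec_le[OF assms] block_size_ge by (intro mult_mono w) auto
  also have "\<dots> = (real p + 3)\<^sup>2 * block_size * 1" by simp
  also have "\<dots> \<le> block_const"
    unfolding block_const_def using K Q block_size_ge by (intro mult_left_mono) auto
  finally show ?thesis by (simp add: pos_le_divide_eq)
qed

lemma block_vec_step:
  "t / (wavenum m)\<^sup>2 * block_vec m - (if m = 0 then 0 else block_vec (m - 1)) = block_vec (Suc m)"
  by (cases m) (simp_all add: block_vec_def)

lemma neighbour_sum:
  "(\<Sum>n\<le>Suc p. (if \<bar>int m - int n\<bar> = 1 then \<epsilon> else 0) * null_vec \<epsilon> n) =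
    \<epsilon> * ((if m = 0 then 0 else null_vec \<epsilon> (m - 1)) + null_vec \<epsilon> (Suc m))"
proof -
  have "(if \<bar>int m - int n\<bar> = 1 then \<epsilon> else 0) * null_vec \<epsilon> n =
      (if Suc m = n then \<epsilon> * null_vec \<epsilon> n else 0) + (if m - 1 = n then (if m = 0 then 0 else \<epsilon> * null_vec \<epsilon> n) else 0)" for n
    by auto
  then have "(\<Sum>n\<le>Suc p. (if \<bar>int m - int n\<bar> = 1 then \<epsilon> else 0) * null_vec \<epsilon> n) =
      (if Suc m \<in> {..Suc p} then \<epsilon> * null_vec \<epsilon> (Suc m) else 0) +
      (if m - 1 \<in> {..Suc p} then (if m = 0 then 0 else \<epsilon> * null_vec \<epsilon> (m - 1)) else 0)"
    by (simp only: sum.distrib sum.delta' finite_atMost)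
  then show ?thesis
    using null_vec_outside[of "Suc m" \<epsilon>] null_vec_outside[of "m - 1" \<epsilon>] by (auto simp: algebra_simps)
qed

text \<open>Block rows cancel by the recursion, row \<open>Suc p\<close> by its extra entry, and row
  \<open>p + 2\<close> sees only \<epsilon> times that O(\<epsilon>) entry. Further rows feel only
  the decaying coefficients; a further zero of \<open>d\<close> is harmless because the vector
  vanishes there.\<close>

lemma null_vec_residual:
  assumes eps: "\<bar>\<epsilon>\<bar> \<le> 1"
    and q: "\<And>l. \<bar>q l - (if \<bar>l\<bar> = 1 then \<epsilon> else 0)\<bar> \<le> Q * \<epsilon>\<^sup>2 / (1 + real_of_int \<bar>l\<bar>) ^ (r + 2)"
    and D: "\<And>n. \<bar>D n - d n - \<epsilon> * K * t / (wavenum n)\<^sup>2\<bar> \<le> Q * \<epsilon>\<^sup>2"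
  shows "\<bar>D m * null_vec \<epsilon> m - K * (\<Sum>n\<le>Suc p. q (int m - int n) * null_vec \<epsilon> n)\<bar>
    \<le> block_const * \<epsilon>\<^sup>2 / (wavenum m)\<^sup>2"
proof -
  let ?v = "null_vec \<epsilon>" and ?b = block_size
  define e where "e l = q l - (if \<bar>l\<bar> = 1 then \<epsilon> else 0)" for l
  define prev where "prev = (if m = 0 then 0 else ?v (m - 1))"
  define err where "err = D m - d m - \<epsilon> * K * t / (wavenum m)\<^sup>2"
  \<comment> \<open>Converts to the weight 1 / s_m^2: it is at least 1 for \<open>m\<close> up to
    \<open>p + 2\<close>, and farther out it dominates the inverse square of the distance from
    \<open>m\<close> to the support.\<close>
  define P where "P = (real p + 3)\<^sup>2 / (wavenum m)\<^sup>2"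
  have b: "?b \<ge> 1" by (rule block_size_ge)
  have P: "P \<ge> 0" by (simp add: P_def)
  have inv4: "1 / (wavenum m)\<^sup>2 \<le> 4"
  proof -
    have "(1 / 2)\<^sup>2 \<le> (wavenum m)\<^sup>2" by (intro power_mono wavenum_ge_half) simp
    then show ?thesis by (simp add: divide_le_eq power2_eq_square)
  qed
  have err: "\<bar>err\<bar> \<le> Q * \<epsilon>\<^sup>2" unfolding err_def by (rule D)
  have eps2: "\<epsilon>\<^sup>2 \<le> \<bar>\<epsilon>\<bar>"
    using mult_left_mono[OF eps, of "\<bar>\<epsilon>\<bar>"] by (simp add: power2_eq_square)
  have sum_q: "(\<Sum>n\<le>Suc p. q (int m - int n) * ?v n) =
      \<epsilon> * (prev + ?v (Suc m)) + (\<Sum>n\<le>Suc p. e (int m - int n) * ?v n)"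
    unfolding prev_def neighbour_sum[symmetric] sum.distrib[symmetric]
    by (rule sum.cong) (simp_all add: e_def left_diff_distrib)
  have far: "\<bar>\<Sum>n\<le>Suc p. e (int m - int n) * ?v n\<bar> \<le> 2 * Q * ?b * \<epsilon>\<^sup>2 * P"
  proof -
    have "\<bar>e (int m - int n) * ?v n\<bar> \<le> Q * \<epsilon>\<^sup>2 * P * \<bar>?v n\<bar>" if "n \<le> Suc p" for n
    proof -
      let ?x = "1 + real_of_int \<bar>int m - int n\<bar>"
      have x: "?x \<ge> 1" by simp
      have "real m \<le> real n + real_of_int \<bar>int m - int n\<bar>" by simp
      then have "1 + real m \<le> ?x * (1 + real n)" by (intro one_plus_le_mult) auto
      then have "wavenum m \<le> ?x * (1 + real n)" by (simp add: wavenum_def)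
      also have "\<dots> \<le> ?x * (real p + 3)" using that by (intro mult_left_mono) auto
      finally have "(wavenum m)\<^sup>2 \<le> (?x * (real p + 3))\<^sup>2" by (rule power_mono) simp
      then have "1 \<le> (?x * (real p + 3))\<^sup>2 / (wavenum m)\<^sup>2" by (simp only: le_divide_eq_1_pos zero_less_power wavenum_pos)
      also have "\<dots> = P * ?x\<^sup>2" by (simp add: P_def power_mult_distrib)
      finally have "1 \<le> P * ?x\<^sup>2" .
      moreover have "0 < ?x\<^sup>2" using x by (intro zero_less_power) linarith
      ultimately have "1 / ?x\<^sup>2 \<le> P" by (simp only: pos_divide_le_eq)
      have "\<bar>e (int m - int n)\<bar> \<le> Q * \<epsilon>\<^sup>2 / ?x ^ (r + 2)" unfolding e_def by (rule q)
      also have "\<dots> \<le> Q * \<epsilon>\<^sup>2 / ?x\<^sup>2"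
        using Q x by (intro divide_left_mono power_increasing) (auto intro!: mult_pos_pos zero_less_power)
      also have "\<dots> = Q * \<epsilon>\<^sup>2 * (1 / ?x\<^sup>2)" by simp
      also have "\<dots> \<le> Q * \<epsilon>\<^sup>2 * P" using Q \<open>1 / ?x\<^sup>2 \<le> P\<close> by (intro mult_left_mono) auto
      finally show ?thesis unfolding abs_mult by (rule mult_right_mono) simp
    qed
    then have "\<bar>\<Sum>n\<le>Suc p. e (int m - int n) * ?v n\<bar> \<le> (\<Sum>n\<le>Suc p. Q * \<epsilon>\<^sup>2 * P * \<bar>?v n\<bar>)"
      by (intro order_trans[OF sum_abs] sum_mono) auto
    also have "\<dots> = Q * \<epsilon>\<^sup>2 * P * (\<Sum>n\<le>Suc p. \<bar>?v n\<bar>)" by (simp only: sum_distrib_left)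
    also have "\<dots> \<le> Q * \<epsilon>\<^sup>2 * P * (2 * ?b)"
      using Q P by (intro mult_left_mono null_vec_le eps) auto
    finally show ?thesis by (simp add: mult_ac)
  qed
  have near: "\<bar>D m * ?v m - K * (\<epsilon> * (prev + ?v (Suc m)))\<bar> \<le> ?b * (Q + K + 4 * K * \<bar>t\<bar>) * \<epsilon>\<^sup>2 * P"
  proof (cases "m \<le> p + 2")
    case False
    then have "?v m = 0" "prev = 0" "?v (Suc m) = 0" by (auto simp: prev_def null_vec_outside)
    then show ?thesis using b K Q P by simp
  next
    case True
    then have "wavenum m \<le> real p + 3" by (simp add: wavenum_def)
    then have "(wavenum m)\<^sup>2 \<le> (real p + 3)\<^sup>2" by (intro power_mono) auto
    then have P1: "1 \<le> P" by (simp add: P_def)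
    have "\<bar>D m * ?v m - K * (\<epsilon> * (prev + ?v (Suc m)))\<bar> \<le> ?b * (Q + K + 4 * K * \<bar>t\<bar>) * \<epsilon>\<^sup>2"
    proof -
      consider "m \<le> p" | "m = Suc p" | "m = Suc (Suc p)" using True by linarith
      then show ?thesis
      proof cases
        case 1
        have vm: "?v m = block_vec m" and pv: "prev = (if m = 0 then 0 else block_vec (m - 1))"
          using 1 by (auto simp: null_vec_def prev_def)
        have Dm: "D m = \<epsilon> * K * (t / (wavenum m)\<^sup>2) + err" using block(1)[OF 1] by (simp add: err_def)
        have "D m * ?v m - K * (\<epsilon> * (prev + ?v (Suc m))) =
            err * block_vec m + \<epsilon> * K * ((t / (wavenum m)\<^sup>2 * block_vec m - prev) - ?v (Suc m))"
          unfolding Dm vm by (simp add: algebra_simps)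
        also have "t / (wavenum m)\<^sup>2 * block_vec m - prev = block_vec (Suc m)"
          unfolding pv by (rule block_vec_step)
        finally have eq: "D m * ?v m - K * (\<epsilon> * (prev + ?v (Suc m))) =
            err * block_vec m + \<epsilon> * K * (block_vec (Suc m) - ?v (Suc m))" .
        have "\<bar>block_vec (Suc m) - ?v (Suc m)\<bar> \<le> \<bar>\<epsilon>\<bar> * ?b"
        proof (cases "m = p")
          case True
          then show ?thesis using null_vec_last[of \<epsilon>] t by (simp add: block_vec_def)
        next
          case False
          then show ?thesis using 1 b by (simp add: null_vec_def)
        qed
        then have "\<bar>err * block_vec m\<bar> + \<bar>\<epsilon> * K * (block_vec (Suc m) - ?v (Suc m))\<bar> \<le> Q * \<epsilon>\<^sup>2 * ?b + \<bar>\<epsilon>\<bar> * K * (\<bar>\<epsilon>\<bar> * ?b)"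
          unfolding abs_mult using K Q by (intro add_mono mult_mono err block_vec_le 1) auto
        then have "\<bar>err * block_vec m + \<epsilon> * K * (block_vec (Suc m) - ?v (Suc m))\<bar> \<le> Q * \<epsilon>\<^sup>2 * ?b + \<bar>\<epsilon>\<bar> * K * (\<bar>\<epsilon>\<bar> * ?b)"
          by (rule order_trans[OF abs_triangle_ineq])
        also have "\<dots> = ?b * (Q + K) * \<epsilon>\<^sup>2" by (simp add: power2_eq_square algebra_simps)
        also have "\<dots> \<le> ?b * (Q + K + 4 * K * \<bar>t\<bar>) * \<epsilon>\<^sup>2"
          using b K by (intro mult_right_mono mult_left_mono) auto
        finally show ?thesis unfolding eq .
      next
        case 2
        have pv: "prev = block_vec p" and v0: "?v (Suc m) = 0" using 2 by (auto simp: prev_def null_vec_def)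
        have dv: "d m * ?v m = K * \<epsilon> * block_vec p" using 2 block(2) by (simp add: null_vec_def)
        have "D m * ?v m - K * (\<epsilon> * (prev + ?v (Suc m))) = (\<epsilon> * K * t * (1 / (wavenum m)\<^sup>2) + err) * ?v m"
          using dv unfolding pv v0 err_def by (simp add: algebra_simps)
        also have "\<bar>\<dots>\<bar> \<le> (\<bar>\<epsilon>\<bar> * K * \<bar>t\<bar> * 4 + Q * \<bar>\<epsilon>\<bar>) * (\<bar>\<epsilon>\<bar> * ?b)"
          unfolding abs_mult
        proof (intro mult_mono order_trans[OF abs_triangle_ineq] add_mono)
          show "\<bar>\<epsilon> * K * t * (1 / (wavenum m)\<^sup>2)\<bar> \<le> \<bar>\<epsilon>\<bar> * K * \<bar>t\<bar> * 4"
            unfolding abs_mult using K inv4 by (intro mult_mono) auto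
          show "\<bar>err\<bar> \<le> Q * \<bar>\<epsilon>\<bar>" using err mult_left_mono[OF eps2 Q] by linarith
          show "\<bar>?v m\<bar> \<le> \<bar>\<epsilon>\<bar> * ?b" unfolding 2 by (rule null_vec_last)
        qed (use K Q in auto)
        also have "\<dots> = ?b * (Q + 4 * K * \<bar>t\<bar>) * \<epsilon>\<^sup>2"
          by (simp add: power2_eq_square algebra_simps)
        also have "\<dots> \<le> ?b * (Q + K + 4 * K * \<bar>t\<bar>) * \<epsilon>\<^sup>2"
          using b K by (intro mult_right_mono mult_left_mono) auto
        finally show ?thesis .
      next
        case 3
        have "\<bar>D m * ?v m - K * (\<epsilon> * (prev + ?v (Suc m)))\<bar> = K * \<bar>\<epsilon>\<bar> * \<bar>?v (Suc p)\<bar>"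
          using 3 K by (simp add: prev_def null_vec_outside abs_mult)
        also have "\<dots> \<le> K * \<bar>\<epsilon>\<bar> * (\<bar>\<epsilon>\<bar> * ?b)" using K by (intro mult_left_mono null_vec_last) auto
        also have "\<dots> = ?b * K * \<epsilon>\<^sup>2" by (simp add: power2_eq_square)
        also have "\<dots> \<le> ?b * (Q + K + 4 * K * \<bar>t\<bar>) * \<epsilon>\<^sup>2"
          using b K Q by (intro mult_right_mono mult_left_mono) auto
        finally show ?thesis .
      qed
    qed
    also have "\<dots> = ?b * (Q + K + 4 * K * \<bar>t\<bar>) * \<epsilon>\<^sup>2 * 1" by simp
    also have "\<dots> \<le> ?b * (Q + K + 4 * K * \<bar>t\<bar>) * \<epsilon>\<^sup>2 * P"
      using b K Q P1 by (intro mult_left_mono) auto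
    finally show ?thesis .
  qed
  have "\<bar>D m * ?v m - K * (\<Sum>n\<le>Suc p. q (int m - int n) * ?v n)\<bar> \<le>
      \<bar>D m * ?v m - K * (\<epsilon> * (prev + ?v (Suc m)))\<bar> + K * \<bar>\<Sum>n\<le>Suc p. e (int m - int n) * ?v n\<bar>"
  proof -
    have "D m * ?v m - K * (\<Sum>n\<le>Suc p. q (int m - int n) * ?v n) =
      (D m * ?v m - K * (\<epsilon> * (prev + ?v (Suc m)))) - K * (\<Sum>n\<le>Suc p. e (int m - int n) * ?v n)"
      unfolding sum_q by (simp add: algebra_simps)
    then show ?thesis
      using abs_triangle_ineq4[of "D m * ?v m - K * (\<epsilon> * (prev + ?v (Suc m)))"
          "K * (\<Sum>n\<le>Suc p. e (int m - int n) * ?v n)"]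
      by (simp only: abs_mult[of K] abs_of_pos[OF K])
  qed
  also have "\<dots> \<le> ?b * (Q + K + 4 * K * \<bar>t\<bar>) * \<epsilon>\<^sup>2 * P + K * (2 * Q * ?b * \<epsilon>\<^sup>2 * P)"
    using K by (intro add_mono near mult_left_mono far) auto
  also have "\<dots> = ?b * (Q + K + 4 * K * \<bar>t\<bar> + 2 * K * Q) * (\<epsilon>\<^sup>2 * P)" by (simp add: algebra_simps)
  also have "\<dots> \<le> ?b * (Q + K + 4 * K * \<bar>t\<bar> + 2 * K * Q + 1) * (\<epsilon>\<^sup>2 * P)"
    using b P by (intro mult_right_mono mult_left_mono) auto
  also have "\<dots> = block_const * \<epsilon>\<^sup>2 / (wavenum m)\<^sup>2" by (simp add: block_const_def P_def)
  finally show ?thesis .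
qed

end

lemma eventually_mult_le_at_right:
  fixes A B :: real
  assumes "B > 0"
  shows "\<forall>\<^sub>F e in at_right 0. A * e \<le> B"
proof -
  have "((\<lambda>e. A * e) \<longlongrightarrow> A * 0) (at_right 0)" by (intro tendsto_intros)
  then have "\<forall>\<^sub>F e in at_right 0. A * e < B" using assms by (intro order_tendstoD(2)) auto
  then show ?thesis by (rule eventually_mono) simp
qed

text \<open>Every smallness condition can be put in a form linear in |\<epsilon>| with coefficients
  independent of \<epsilon>, \<open>q\<close> and \<open>D\<close>. That is why \<open>e0\<close>
  precedes these quantifiers.\<close>

lemma resonant_block_instability:
  fixes d :: "nat \<Rightarrow> real"
  assumes K: "K > 0" and Q: "Q \<ge> 0" and \<delta>: "\<delta> > 0" and r: "r \<ge> 2"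
    and block: "\<And>n. n \<le> p \<Longrightarrow> d n = 0" "d (Suc p) \<noteq> 0"
    and d_large: "\<And>n. n \<ge> L \<Longrightarrow> \<delta> \<le> \<bar>d n\<bar>"
    and t: "three_term (\<lambda>n. 1 / (wavenum n)\<^sup>2) t (Suc p) = 0"
  shows "\<exists>e0>0. \<forall>\<epsilon> q D. \<epsilon> \<noteq> 0 \<longrightarrow> \<bar>\<epsilon>\<bar> < e0 \<longrightarrow> (\<forall>l. q (- l) = q l) \<longrightarrow>
    (\<forall>l. \<bar>q l - (if \<bar>l\<bar> = 1 then \<epsilon> else 0)\<bar> \<le> Q * \<epsilon>\<^sup>2 / (1 + real_of_int \<bar>l\<bar>) ^ (r + 2)) \<longrightarrow>
    (\<forall>n. \<bar>D n - d n - \<epsilon> * K * t / (wavenum n)\<^sup>2\<bar> \<le> Q * \<epsilon>\<^sup>2) \<longrightarrow>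
    (\<exists>l>0. \<exists>w :: nat \<Rightarrow> complex. w 0 \<noteq> 0 \<and> (\<exists>C. \<forall>n. (1 + real n) ^ r * cmod (w n) \<le> C) \<and>
    (\<forall>n. (of_real (D n) + \<i> * of_real (l / wavenum n)) * w n =
      of_real K * ((\<Sum>m. of_real (q (int n - int m)) * w m) + (\<Sum>m. of_real (q (int n + int m + 1)) * cnj (w m)))))"
proof -
  define E where "E = block_const K Q t d p"
  define kap where "kap = 2 * (2 ^ r + Q * sum_inv_sq)"
  define G where "G = K * (1 + 1 / (\<delta> / 2)) * kap"
  \<comment> \<open>The largest value allowed by the two upper bounds, up to the 1 added to keep the
    denominator positive.\<close>
  define \<tau> where "\<tau> = min K (K / (16 * E\<^sup>2 * sum_inv_cube + 1))"
  have L: "L \<ge> 1" using d_large[of 0] block(1)[of 0] \<delta> by (cases L) auto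
  have pos: "16 * E\<^sup>2 * sum_inv_cube \<ge> 0" using sum_inv_cube_nonneg by simp
  have \<tau>: "\<tau> > 0" "\<tau> \<le> K" "16 * E\<^sup>2 * sum_inv_cube * \<tau> \<le> K"
  proof -
    show "\<tau> > 0" "\<tau> \<le> K" using K pos by (auto simp: \<tau>_def add_nonneg_pos)
    have "\<tau> \<le> K / (16 * E\<^sup>2 * sum_inv_cube + 1)" by (simp add: \<tau>_def)
    then have "\<tau> * (16 * E\<^sup>2 * sum_inv_cube + 1) \<le> K" using pos by (simp add: pos_le_divide_eq)
    then show "16 * E\<^sup>2 * sum_inv_cube * \<tau> \<le> K" using \<open>\<tau> > 0\<close> by (simp add: algebra_simps)
  qed
  have "\<forall>\<^sub>F e in at_right 0. (2 * G\<^sup>2 + G) * e \<le> \<tau> / real L / 2 \<and> 2 * G * e \<le> 1 / 4 \<and>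
      (1 + K * Q * sum_inv_cube) * e \<le> \<tau> / 2 \<and> Q * e \<le> 1 / 2 \<and> K * (3 / 2 * kap) * e \<le> \<delta> / 2 / 2 \<and>
      (4 * K * \<bar>t\<bar> + Q) * e \<le> \<delta> / 2 \<and> 1 * e \<le> 1"
    using \<tau> L \<delta> by (intro eventually_conj eventually_mult_le_at_right) auto
  then obtain e0 where e0: "e0 > 0" and small: "\<And>e. 0 < e \<Longrightarrow> e < e0 \<Longrightarrow> (2 * G\<^sup>2 + G) * e \<le> \<tau> / real L / 2 \<and>
      2 * G * e \<le> 1 / 4 \<and> (1 + K * Q * sum_inv_cube) * e \<le> \<tau> / 2 \<and> Q * e \<le> 1 / 2 \<and> K * (3 / 2 * kap) * e \<le> \<delta> / 2 / 2 \<and>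
      (4 * K * \<bar>t\<bar> + Q) * e \<le> \<delta> / 2 \<and> 1 * e \<le> 1"
    unfolding eventually_at_right_field by auto
  show ?thesis
  proof (rule exI[of _ e0], rule conjI[OF e0], intro allI impI)
    fix \<epsilon> :: real and q :: "int \<Rightarrow> real" and D :: "nat \<Rightarrow> real"
    assume eps: "\<epsilon> \<noteq> 0" "\<bar>\<epsilon>\<bar> < e0" and q_even: "\<forall>l. q (- l) = q l"
      and q: "\<forall>l. \<bar>q l - (if \<bar>l\<bar> = 1 then \<epsilon> else 0)\<bar> \<le> Q * \<epsilon>\<^sup>2 / (1 + real_of_int \<bar>l\<bar>) ^ (r + 2)"
      and D: "\<forall>n. \<bar>D n - d n - \<epsilon> * K * t / (wavenum n)\<^sup>2\<bar> \<le> Q * \<epsilon>\<^sup>2"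
    have sm: "(2 * G\<^sup>2 + G) * \<bar>\<epsilon>\<bar> \<le> \<tau> / real L / 2" "2 * G * \<bar>\<epsilon>\<bar> \<le> 1 / 4"
      "(1 + K * Q * sum_inv_cube) * \<bar>\<epsilon>\<bar> \<le> \<tau> / 2" "Q * \<bar>\<epsilon>\<bar> \<le> 1 / 2" "K * (3 / 2 * kap) * \<bar>\<epsilon>\<bar> \<le> \<delta> / 2 / 2"
      "(4 * K * \<bar>t\<bar> + Q) * \<bar>\<epsilon>\<bar> \<le> \<delta> / 2" "\<bar>\<epsilon>\<bar> \<le> 1"
      using small[of "\<bar>\<epsilon>\<bar>"] eps by auto
    \<comment> \<open>Passing from \<open>d\<close> to \<open>D\<close> uses up half of the gap, so
      the locale is entered with \<open>\<delta> / 2\<close>.\<close>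
    have D_large: "\<delta> / 2 \<le> \<bar>D n\<bar>" if "n \<ge> L" for n
    proof -
      have "(1 / 2)\<^sup>2 \<le> (wavenum n)\<^sup>2" by (intro power_mono wavenum_ge_half) simp
      then have inv4: "1 / (wavenum n)\<^sup>2 \<le> 4" by (simp add: divide_le_eq power2_eq_square)
      have "\<bar>\<epsilon> * K * t / (wavenum n)\<^sup>2\<bar> = K * \<bar>t\<bar> * \<bar>\<epsilon>\<bar> * (1 / (wavenum n)\<^sup>2)"
        using K by (simp add: abs_mult)
      also have "\<dots> \<le> K * \<bar>t\<bar> * \<bar>\<epsilon>\<bar> * 4" using K inv4 by (intro mult_left_mono) auto
      finally have 1: "\<bar>\<epsilon> * K * t / (wavenum n)\<^sup>2\<bar> \<le> 4 * K * \<bar>t\<bar> * \<bar>\<epsilon>\<bar>" by simp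
      have "\<epsilon>\<^sup>2 \<le> \<bar>\<epsilon>\<bar>" using mult_left_mono[OF sm(7), of "\<bar>\<epsilon>\<bar>"] by (simp add: power2_eq_square)
      then have 2: "Q * \<epsilon>\<^sup>2 \<le> Q * \<bar>\<epsilon>\<bar>" using Q by (intro mult_left_mono)
      have far: "\<delta> / 2 \<le> \<bar>y\<bar>" if "\<bar>y - z - x\<bar> \<le> a'" "\<bar>x\<bar> \<le> a" "\<delta> \<le> \<bar>z\<bar>" "a + a' \<le> \<delta> / 2" for x y z a a' :: real
        using that by linarith
      show ?thesis
        using far[OF order_trans[OF D[rule_format] 2] 1 d_large[OF that]] sm(6) unfolding distrib_right .
    qed
    interpret mode_equations K Q "\<delta> / 2" \<epsilon> q D L r
      by unfold_locales (use K Q \<delta> eps sm(7) q_even q r L D_large in auto)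
    have G: "K * Sg * mode_equations.\<kappa> Q r = G" unfolding G_def Sg_def mode_equations.\<kappa>_def[OF mode_equations_axioms] kap_def ..
    have k: "mode_equations.\<kappa> Q r = kap" unfolding mode_equations.\<kappa>_def[OF mode_equations_axioms] kap_def ..
    show "\<exists>l>0. \<exists>w :: nat \<Rightarrow> complex. w 0 \<noteq> 0 \<and> (\<exists>C. \<forall>n. (1 + real n) ^ r * cmod (w n) \<le> C) \<and>
    (\<forall>n. (of_real (D n) + \<i> * of_real (l / wavenum n)) * w n =
      of_real K * ((\<Sum>m. of_real (q (int n - int m)) * w m) + (\<Sum>m. of_real (q (int n + int m + 1)) * cnj (w m))))"
    proof (rule unstable_mode[where M = "Suc p" and v = "null_vec K t d p \<epsilon>" and E = E and \<tau> = \<tau>])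
      show "null_vec K t d p \<epsilon> n = 0" if "Suc p < n" for n
        by (rule null_vec_outside[where K = K and Q = Q and d = d and p = p and t = t]) (use K Q block t that in auto)
      show "null_vec K t d p \<epsilon> 0 = 1"
        by (rule null_vec_zero[where K = K and Q = Q and d = d and p = p and t = t]) (use K Q block t in auto)
      show "\<bar>null_vec K t d p \<epsilon> n\<bar> \<le> E / wavenum n" for n
        unfolding E_def by (rule null_vec_wavenum[where K = K and Q = Q and d = d and p = p and t = t]) (use K Q block t sm(7) in auto)
      show "\<bar>D m * null_vec K t d p \<epsilon> m - K * (\<Sum>n\<le>Suc p. q (int m - int n) * null_vec K t d p \<epsilon> n)\<bar>
          \<le> E * \<epsilon>\<^sup>2 / (wavenum m)\<^sup>2" for m
        unfolding E_def 
        by (rule null_vec_residual[where K = K and Q = Q and d = d and p = p and t = t and r = r])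
           (use K Q block t sm(7) q D in blast)+
      show "(2 * (K * Sg * mode_equations.\<kappa> Q r)\<^sup>2 + K * Sg * mode_equations.\<kappa> Q r) * \<epsilon>\<^sup>2 \<le> \<tau> * \<bar>\<epsilon>\<bar> / real L / 2"
        using mult_right_mono[OF sm(1), of "\<bar>\<epsilon>\<bar>"] unfolding G by (simp add: power2_eq_square mult_ac)
      show "2 * (K * Sg * mode_equations.\<kappa> Q r) * \<bar>\<epsilon>\<bar> \<le> 1 / 4" unfolding G by (rule sm)
      show "K * (3 / 2 * mode_equations.\<kappa> Q r * \<bar>\<epsilon>\<bar>) \<le> \<delta> / 2 / 2" using sm(5) unfolding k by (simp add: mult_ac)
    qed (rule \<tau> sm)+
  qed
qed

section \<open>Coefficients of products, Bessel's inequality and inversion\<close>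

section \<open>Fourier coefficients\<close>

lemma fourier_coeff_eq_integral:
  assumes "continuous_on {0..2 * pi} f"
  shows "fourier_coeff f n = integral {0..2 * pi} (\<lambda>z. cis (- (of_int n * z)) * f z) / of_real (2 * pi)"
  unfolding fourier_coeff_def
  by (subst set_borel_integral_eq_integral(2))
     (auto intro!: borel_integrable_atLeastAtMost' continuous_intros assms)

lemma cis_int_period: "cis (of_int m * (2 * pi)) = 1"
  by (subst mult.commute) (rule cis_multiple_2pi, simp)

lemma set_integrable_cis_mult:
  assumes g: "set_integrable lborel {0..2 * pi} g"
  shows "set_integrable lborel {0..2 * pi} (\<lambda>z. cis (a * z) * g z)"
proof -
  have "integrable lborel (\<lambda>z. cis (a * z) * (indicator {0..2 * pi} z *\<^sub>R g z))"
  proof (rule Bochner_Integration.integrable_bound[OF g[unfolded set_integrable_def]])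
    have "(\<lambda>z. indicator {0..2 * pi} z *\<^sub>R g z) \<in> borel_measurable lborel"
      using g[unfolded set_integrable_def] by (rule borel_measurable_integrable)
    moreover have "(\<lambda>z. cis (a * z)) \<in> borel_measurable lborel"
      by (simp, intro borel_measurable_continuous_onI continuous_intros)
    ultimately show "(\<lambda>z. cis (a * z) * (indicator {0..2 * pi} z *\<^sub>R g z)) \<in> borel_measurable lborel"
      by (rule borel_measurable_times[rotated])
  qed (simp add: norm_mult)
  then show ?thesis by (simp add: set_integrable_def)
qed

text \<open>Termwise integration, justified by the summability of |a m| times the integral of |g|.
  Enumerating the integers by \<open>int_decode\<close> gives the countable sum needed for
  this.\<close>

lemma fourier_coeff_series_mult:
  fixes a :: "int \<Rightarrow> complex"
  assumes a: "(\<lambda>m. cmod (a m)) summable_on UNIV" and g: "set_integrable lborel {0..2 * pi} g"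
  shows "fourier_coeff (\<lambda>z. (\<Sum>\<^sub>\<infinity>m. a m * cis (of_int m * z)) * g z) n = (\<Sum>\<^sub>\<infinity>m. a m * fourier_coeff g (n - m))"
    and "(\<lambda>m. cmod (a m * fourier_coeff g (n - m))) summable_on UNIV"
proof -
  let ?I = "indicator {0..2 * pi} :: real \<Rightarrow> real"
  define e where "e = int_decode"
  have e: "bij_betw e UNIV UNIV" unfolding e_def using bij_int_decode by (simp add: bij_def bij_betw_def)
  have sa: "summable (\<lambda>i. cmod (a (e i)))"
    using a summable_on_reindex_bij_betw[OF e, of "\<lambda>m. cmod (a m)"] by (simp add: summable_on_UNIV_nonneg_real_iff)
  have series: "(\<Sum>\<^sub>\<infinity>m. h m) = (\<Sum>i. h (e i))" if "(\<lambda>m. norm (h m)) summable_on UNIV" for h :: "int \<Rightarrow> complex"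
  proof -
    have "(h has_sum (\<Sum>\<^sub>\<infinity>m. h m)) UNIV" using abs_summable_summable[OF that] by (rule has_sum_infsum)
    then have "((\<lambda>i. h (e i)) has_sum (\<Sum>\<^sub>\<infinity>m. h m)) UNIV" unfolding has_sum_reindex_bij_betw[OF e] .
    then have "(\<lambda>i. h (e i)) sums (\<Sum>\<^sub>\<infinity>m. h m)" by (rule has_sum_imp_sums)
    then show ?thesis by (rule sums_unique)
  qed
  define f where "f i z = a (e i) * (?I z *\<^sub>R (cis (- (of_int (n - e i) * z)) * g z))" for i z
  have fi: "integrable lborel (f i)" for i
    unfolding f_def
    using set_integrable_cis_mult[OF g, of "- of_int (n - e i)", unfolded set_integrable_def mult_minus_left]
    by (rule integrable_mult_right)
  have nf: "norm (f i z) = cmod (a (e i)) * norm (?I z *\<^sub>R g z)" for i z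
    by (simp add: f_def norm_mult)
  have int_f: "integral\<^sup>L lborel (f i) = a (e i) * (of_real (2 * pi) * fourier_coeff g (n - e i))" for i
    unfolding f_def integral_mult_right_zero by (simp add: fourier_coeff_def set_lebesgue_integral_def)
  have "(\<lambda>i. integral\<^sup>L lborel (f i)) sums (\<integral>z. (\<Sum>i. f i z) \<partial>lborel)"
  proof (rule sums_integral[OF fi])
    show "AE z in lborel. summable (\<lambda>i. norm (f i z))"
      unfolding nf by (intro AE_I2 summable_mult2 sa)
    show "summable (\<lambda>i. \<integral>z. norm (f i z) \<partial>lborel)"
      unfolding nf by (simp only: integral_mult_right_zero) (intro summable_mult2 sa)
  qed
  moreover have "(\<Sum>i. f i z) = ?I z *\<^sub>R (cis (- (of_int n * z)) * ((\<Sum>\<^sub>\<infinity>m. a m * cis (of_int m * z)) * g z))" for z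
  proof -
    have "(\<lambda>m. norm (a m * cis (of_int m * z))) summable_on UNIV" using a by (simp add: norm_mult)
    then have ser: "(\<Sum>\<^sub>\<infinity>m. a m * cis (of_int m * z)) = (\<Sum>i. a (e i) * cis (of_int (e i) * z))"
      by (rule series)
    have sm: "summable (\<lambda>i. a (e i) * cis (of_int (e i) * z))"
      by (rule summable_norm_cancel) (simp add: norm_mult sa)
    have "f i z = (a (e i) * cis (of_int (e i) * z)) * (?I z *\<^sub>R (cis (- (of_int n * z)) * g z))" for i
    proof -
      have "cis (- (of_int (n - e i) * z)) = cis (of_int (e i) * z) * cis (- (of_int n * z))"
        by (simp add: cis_mult algebra_simps)
      then show ?thesis by (simp add: f_def)
    qed
    then have "(\<Sum>i. f i z) = (\<Sum>i. a (e i) * cis (of_int (e i) * z)) * (?I z *\<^sub>R (cis (- (of_int n * z)) * g z))"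
      by (simp only: suminf_mult2[OF sm])
    then show ?thesis unfolding ser by (simp add: mult_ac)
  qed
  ultimately have S: "(\<lambda>i. a (e i) * (of_real (2 * pi) * fourier_coeff g (n - e i))) sums
      (of_real (2 * pi) * fourier_coeff (\<lambda>z. (\<Sum>\<^sub>\<infinity>m. a m * cis (of_int m * z)) * g z) n)"
    unfolding int_f by (simp add: fourier_coeff_def set_lebesgue_integral_def)
  have bound: "cmod (fourier_coeff g m) \<le> (\<integral>z. norm (?I z *\<^sub>R g z) \<partial>lborel) / (2 * pi)" for m
  proof -
    have "cmod (LINT z:{0..2 * pi}|lborel. cis (- (of_int m * z)) * g z) \<le>
        (LINT z:{0..2 * pi}|lborel. norm (cis (- (of_int m * z)) * g z))"
      using set_integral_norm_bound[OF set_integrable_cis_mult[OF g, of "- of_int m"]] by simp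
    also have "\<dots> = (\<integral>z. norm (?I z *\<^sub>R g z) \<partial>lborel)"
      by (simp add: set_lebesgue_integral_def norm_mult)
    finally show ?thesis by (simp add: fourier_coeff_def norm_divide divide_right_mono)
  qed
  show abs: "(\<lambda>m. cmod (a m * fourier_coeff g (n - m))) summable_on UNIV"
    by (rule summable_on_comparison_test[OF summable_on_cmult_left[OF a]])
       (auto simp: norm_mult intro!: mult_left_mono bound)
  have "(\<lambda>i. of_real (2 * pi) * (a (e i) * fourier_coeff g (n - e i))) sums
      (of_real (2 * pi) * fourier_coeff (\<lambda>z. (\<Sum>\<^sub>\<infinity>m. a m * cis (of_int m * z)) * g z) n)"
    using S by (simp only: mult_ac)
  then have "(\<lambda>i. a (e i) * fourier_coeff g (n - e i)) sums
      fourier_coeff (\<lambda>z. (\<Sum>\<^sub>\<infinity>m. a m * cis (of_int m * z)) * g z) n"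
    by (subst (asm) sums_mult_iff) simp_all
  then show "fourier_coeff (\<lambda>z. (\<Sum>\<^sub>\<infinity>m. a m * cis (of_int m * z)) * g z) n = (\<Sum>\<^sub>\<infinity>m. a m * fourier_coeff g (n - m))"
    unfolding series[OF abs] by (rule sums_unique)
qed

lemma has_vector_derivative_cis:
  "((\<lambda>z. cis (c * z)) has_vector_derivative (\<i> * of_real c * cis (c * z))) (at z within S)"
proof -
  have "((\<lambda>w. exp (\<i> * of_real c * w)) has_field_derivative (exp (\<i> * of_real c * of_real z) * (\<i> * of_real c))) (at (of_real z))"
    by (auto intro!: derivative_eq_intros)
  then have "((\<lambda>z. exp (\<i> * of_real c * of_real z)) has_vector_derivative (exp (\<i> * of_real c * of_real z) * (\<i> * of_real c))) (at z)"
    by (rule has_vector_derivative_real_field)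
  then have "((\<lambda>z. cis (c * z)) has_vector_derivative (\<i> * of_real c * cis (c * z))) (at z)"
    by (simp add: cis_conv_exp mult_ac)
  then show ?thesis by (rule has_vector_derivative_at_within)
qed

lemma has_integral_cis_period:
  assumes "(n::int) \<noteq> 0"
  shows "((\<lambda>z. cis (of_int n * z)) has_integral 0) {0..2 * pi}"
proof -
  have "((\<lambda>z. cis (of_int n * z) / (\<i> * of_int n)) has_vector_derivative
      (\<i> * of_real (of_int n) * cis (of_int n * z) / (\<i> * of_int n))) (at z within {0..2 * pi})" for z
    by (rule has_vector_derivative_divide[OF has_vector_derivative_cis])
  then have "((\<lambda>z. cis (of_int n * z) / (\<i> * of_int n)) has_vector_derivative cis (of_int n * z)) (at z within {0..2 * pi})" for z
    using assms by simp
  then have "((\<lambda>z. cis (of_int n * z)) has_integral cis (of_int n * (2 * pi)) / (\<i> * of_int n) - cis (of_int n * 0) / (\<i> * of_int n)) {0..2 * pi}"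
    by (intro fundamental_theorem_of_calculus) auto
  then show ?thesis by (simp only: cis_int_period) (simp add: cis_zero)
qed

lemma fourier_coeff_one: "fourier_coeff (\<lambda>_. 1) n = (if n = 0 then 1 else 0)"
proof -
  have "fourier_coeff (\<lambda>_. 1) n = integral {0..2 * pi} (\<lambda>z. cis (of_int (- n) * z)) / of_real (2 * pi)"
    by (subst fourier_coeff_eq_integral) (auto intro: continuous_intros)
  also have "\<dots> = (if n = 0 then 1 else 0)"
    using integral_unique[OF has_integral_cis_period[of "- n"]] by (auto simp: cis_zero scaleR_conv_of_real)
  finally show ?thesis .
qed

text \<open>The product formula with the constant factor 1.\<close>

lemma fourier_coeff_series:
  fixes a :: "int \<Rightarrow> complex"
  assumes a: "(\<lambda>m. cmod (a m)) summable_on UNIV"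
  shows "fourier_coeff (\<lambda>z. \<Sum>\<^sub>\<infinity>m. a m * cis (of_int m * z)) n = a n"
proof -
  have "set_integrable lborel {0..2 * pi} (\<lambda>_. 1 :: complex)"
    by (intro borel_integrable_atLeastAtMost' continuous_intros)
  from fourier_coeff_series_mult(1)[OF a this, of n]
  have "fourier_coeff (\<lambda>z. \<Sum>\<^sub>\<infinity>m. a m * cis (of_int m * z)) n = (\<Sum>\<^sub>\<infinity>m. a m * (if n - m = 0 then 1 else 0))"
    by (simp only: mult_1_right fourier_coeff_one)
  also have "\<dots> = (\<Sum>\<^sub>\<infinity>m\<in>{n}. a m)"
    by (rule infsum_cong_neutral) auto
  finally show ?thesis by simp
qed

lemma continuous_series:
  fixes a :: "int \<Rightarrow> complex"
  assumes a: "(\<lambda>m. cmod (a m)) summable_on UNIV"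
  shows "continuous_on UNIV (\<lambda>z. \<Sum>\<^sub>\<infinity>m. a m * cis (of_int m * z))"
proof (rule uniform_limit_theorem)
  show "uniform_limit UNIV (\<lambda>X z. \<Sum>m\<in>X. a m * cis (of_int m * z)) (\<lambda>z. \<Sum>\<^sub>\<infinity>m. a m * cis (of_int m * z)) (finite_subsets_at_top UNIV)"
    by (rule Weierstrass_m_test_general[OF _ a]) (simp add: norm_mult)
qed (auto intro!: continuous_intros always_eventually)

lemma series_periodic: "periodic_2pi (\<lambda>z. \<Sum>\<^sub>\<infinity>m. a m * cis (of_int m * z))"
proof -
  have "cis (of_int m * (z + 2 * pi)) = cis (of_int m * z)" for m :: int and z
    by (simp only: distrib_left cis_mult[symmetric] cis_int_period mult_1_right)
  then show ?thesis by (simp add: periodic_2pi_def)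
qed

lemma continuous_imp_L2T:
  assumes "continuous_on UNIV f" "periodic_2pi f"
  shows "f \<in> L2T"
  using assms unfolding L2T_def
  by (auto intro!: borel_measurable_continuous_onI borel_integrable_atLeastAtMost' continuous_intros
      intro: continuous_on_subset)

lemma fourier_coeff_le:
  assumes f: "continuous_on {0..2 * pi} f" and B: "\<And>z. cmod (f z) \<le> B"
  shows "cmod (fourier_coeff f n) \<le> B"
proof -
  have "norm (integral {0..2 * pi} (\<lambda>z. cis (- (of_int n * z)) * f z)) \<le> integral {0..2 * pi} (\<lambda>_. B)"
  proof (rule integral_norm_bound_integral)
    show "(\<lambda>z. cis (- (of_int n * z)) * f z) integrable_on {0..2 * pi}"
      by (intro integrable_continuous_interval continuous_intros f)
    show "norm (cis (- (of_int n * z)) * f z) \<le> B" for z using B by (simp add: norm_mult)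
  qed auto
  then show ?thesis
    unfolding fourier_coeff_eq_integral[OF f] by (simp add: norm_divide divide_le_eq mult.commute)
qed

text \<open>Integration by parts; periodicity cancels the boundary terms.\<close>

lemma fourier_coeff_deriv:
  assumes f: "\<And>z. (f has_vector_derivative f' z) (at z)" and f': "continuous_on UNIV f'" and per: "periodic_2pi f"
  shows "fourier_coeff f' n = \<i> * of_int n * fourier_coeff f n"
proof -
  have cf: "continuous_on S f" for S
    using f by (intro continuous_at_imp_continuous_on ballI) (auto dest: has_vector_derivative_continuous)
  have cf': "continuous_on {0..2 * pi} f'" using f' by (rule continuous_on_subset) simp
  let ?e = "\<lambda>z. cis (- (of_int n * z))"
  have e': "(?e has_vector_derivative (- \<i> * of_int n * ?e z)) (at z within {0..2 * pi})" for z
    using has_vector_derivative_cis[of "- of_int n" z "{0..2 * pi}"] by simp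
  have "((\<lambda>z. ?e z * f z) has_vector_derivative (?e z * f' z + (- \<i> * of_int n * ?e z) * f z)) (at z within {0..2 * pi})" for z
    by (rule has_vector_derivative_mult[OF e' has_vector_derivative_at_within[OF f]])
  then have "((\<lambda>z. ?e z * f' z + (- \<i> * of_int n * ?e z) * f z) has_integral (?e (2 * pi) * f (2 * pi) - ?e 0 * f 0)) {0..2 * pi}"
    by (intro fundamental_theorem_of_calculus) auto
  moreover have "?e (2 * pi) * f (2 * pi) - ?e 0 * f 0 = 0"
    using per[unfolded periodic_2pi_def, rule_format, of 0] cis_int_period[of "- n"] by simp
  ultimately have "integral {0..2 * pi} (\<lambda>z. ?e z * f' z + (- \<i> * of_int n) * (?e z * f z)) = 0"
    by (simp add: integral_unique mult_ac)
  moreover have "integral {0..2 * pi} (\<lambda>z. ?e z * f' z + (- \<i> * of_int n) * (?e z * f z)) =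
      integral {0..2 * pi} (\<lambda>z. ?e z * f' z) + (- \<i> * of_int n) * integral {0..2 * pi} (\<lambda>z. ?e z * f z)"
    by (subst integral_add)
       (auto intro!: integrable_continuous_interval continuous_intros cf cf' integral_mult_right)
  ultimately show ?thesis
    unfolding fourier_coeff_eq_integral[OF cf'] fourier_coeff_eq_integral[OF cf] by (simp add: field_simps)
qed

lemma fourier_coeff_reflect:
  assumes "\<And>z. f (- z) = f z" "periodic_2pi f"
  shows "fourier_coeff f (- n) = fourier_coeff f n"
proof -
  have f: "f (2 * pi - z) = f z" for z
    using assms(1)[of "z"] assms(2)[unfolded periodic_2pi_def, rule_format, of "- z"] by (simp add: add.commute)
  have c: "cis (- (of_int n * (2 * pi - z))) = cis (of_int n * z)" for z
  proof -
    have "cis (- (of_int n * (2 * pi - z))) = cis (of_int (- n) * (2 * pi)) * cis (of_int n * z)"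
      by (simp add: cis_mult algebra_simps)
    then show ?thesis by (simp only: cis_int_period mult_1_left)
  qed
  have i: "indicator {0..2 * pi} (2 * pi - z) = (indicator {0..2 * pi} z :: real)" for z
    by (auto simp: indicator_def)
  have "(LINT z:{0..2 * pi}|lborel. cis (- (of_int n * z)) * f z) = (LINT z:{0..2 * pi}|lborel. cis (of_int n * z) * f z)"
    unfolding set_lebesgue_integral_def
    by (subst lborel_integral_real_affine[where c = "- 1" and t = "2 * pi"]) (simp_all add: f c i)
  then show ?thesis by (simp add: fourier_coeff_def)
qed

lemma fourier_coeff_cnj: "cnj (fourier_coeff f n) = fourier_coeff (\<lambda>z. cnj (f z)) (- n)"
proof -
  have "cnj (LINT z:{0..2 * pi}|lborel. cis (- (of_int n * z)) * f z) =
      (LINT z:{0..2 * pi}|lborel. cnj (cis (- (of_int n * z)) * f z))"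
    unfolding set_lebesgue_integral_def by (subst Bochner_Integration.integral_cnj[symmetric]) (simp only: complex_cnj_scaleR)
  then show ?thesis by (simp add: fourier_coeff_def cis_cnj)
qed

subsection \<open>Pointwise Fourier inversion\<close>

lemma fourier_coeff_diff:
  assumes "set_integrable lborel {0..2 * pi} f" "set_integrable lborel {0..2 * pi} g"
  shows "fourier_coeff (\<lambda>z. f z - g z) n = fourier_coeff f n - fourier_coeff g n"
  unfolding fourier_coeff_def
  using set_integral_diff(2)[OF set_integrable_cis_mult[OF assms(1), of "- of_int n"] set_integrable_cis_mult[OF assms(2), of "- of_int n"]]
  by (simp add: right_diff_distrib diff_divide_distrib)

lemma fourier_coeff_add:
  assumes "set_integrable lborel {0..2 * pi} f" "set_integrable lborel {0..2 * pi} g"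
  shows "fourier_coeff (\<lambda>z. f z + g z) n = fourier_coeff f n + fourier_coeff g n"
  unfolding fourier_coeff_def
  using set_integral_add(2)[OF set_integrable_cis_mult[OF assms(1), of "- of_int n"] set_integrable_cis_mult[OF assms(2), of "- of_int n"]]
  by (simp add: distrib_left add_divide_distrib)

lemma fourier_coeff_cmult: "fourier_coeff (\<lambda>z. a * f z) n = a * fourier_coeff f n"
  unfolding fourier_coeff_def mult.left_commute[of _ a] set_integral_mult_right by simp

lemma fourier_coeff_shift: "fourier_coeff (\<lambda>z. cis (of_int m * z) * f z) n = fourier_coeff f (n - m)"
proof -
  have "cis (- (of_int n * z)) * (cis (of_int m * z) * f z) = cis (- (of_int (n - m) * z)) * f z" for z
    unfolding mult.assoc[symmetric] cis_mult by (simp add: algebra_simps)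
  then show ?thesis unfolding fourier_coeff_def by (simp only:)
qed

lemma bounded_set_integrable:
  fixes g :: "real \<Rightarrow> 'a::{banach, second_countable_topology}"
  assumes g: "g \<in> borel_measurable borel" and G: "\<And>z. norm (g z) \<le> G"
  shows "set_integrable lborel {0..2 * pi} g"
proof (rule set_integrable_bound)
  show "set_integrable lborel {0..2 * pi} (\<lambda>_. G)"
    by (intro borel_integrable_atLeastAtMost' continuous_intros)
  show "set_borel_measurable lborel {0..2 * pi} g"
    unfolding set_borel_measurable_def using g by measurable
  show "AE z in lborel. z \<in> {0..2 * pi} \<longrightarrow> norm (g z) \<le> norm G"
    using G abs_ge_self[of G] by (auto intro: order_trans)
qed

lemma mean_trig_mult:
  assumes h: "set_integrable lborel {0..2 * pi} h" and A: "finite A"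
  shows "(LINT z:{0..2 * pi}|lborel. cnj (\<Sum>n\<in>A. s n * cis (of_int n * z)) * h z) / of_real (2 * pi) =
    (\<Sum>n\<in>A. cnj (s n) * fourier_coeff h n)"
proof -
  have eq: "indicator {0..2 * pi} z *\<^sub>R (cnj (\<Sum>n\<in>A. s n * cis (of_int n * z)) * h z) =
      (\<Sum>n\<in>A. cnj (s n) * (indicator {0..2 * pi} z *\<^sub>R (cis (- of_int n * z) * h z)))" for z
    by (simp add: sum_distrib_right sum_distrib_left scaleR_sum_right cis_cnj mult_ac)
  have I: "integrable lborel (\<lambda>z. indicator {0..2 * pi} z *\<^sub>R (cis (- of_int n * z) * h z))" for n
    using set_integrable_cis_mult[OF h] unfolding set_integrable_def .
  have "(LINT z:{0..2 * pi}|lborel. cnj (\<Sum>n\<in>A. s n * cis (of_int n * z)) * h z) =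
      (\<Sum>n\<in>A. cnj (s n) * (LINT z:{0..2 * pi}|lborel. cis (- of_int n * z) * h z))"
    unfolding set_lebesgue_integral_def eq
    by (subst Bochner_Integration.integral_sum) (rule integrable_mult_right[OF I], simp only: integral_mult_right_zero)
  then show ?thesis by (simp add: fourier_coeff_def sum_divide_distrib)
qed

text \<open>For the partial sum S, the means of |S|^2 and of Re (cnj S g) both equal the left side
  X. Averaging Re (cnj S g) \<le> (|S|^2 + G^2) / 2 gives X \<le> (X + G^2) / 2.\<close>

lemma bessel:
  assumes g: "g \<in> borel_measurable borel" and G: "\<And>z. cmod (g z) \<le> G" and A: "finite A"
  shows "(\<Sum>n\<in>A. (cmod (fourier_coeff g n))\<^sup>2) \<le> G\<^sup>2"
proof -
  define S where "S z = (\<Sum>n\<in>A. fourier_coeff g n * cis (of_int n * z))" for z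
  define X where "X = (\<Sum>n\<in>A. (cmod (fourier_coeff g n))\<^sup>2)"
  have cS: "continuous_on B S" for B unfolding S_def by (intro continuous_intros)
  have iS: "set_integrable lborel {0..2 * pi} S" by (intro borel_integrable_atLeastAtMost' cS)
  have ig: "set_integrable lborel {0..2 * pi} g" by (rule bounded_set_integrable[OF g G])
  have mSg: "(\<lambda>z. cnj (S z) * g z) \<in> borel_measurable borel"
    by (intro borel_measurable_times g borel_measurable_continuous_onI continuous_intros cS)
  have sq: "cnj z * z = of_real ((cmod z)\<^sup>2)" for z
    using complex_norm_square[of z] by (simp add: mult.commute)
  have coeff_S: "fourier_coeff S n = fourier_coeff g n" if "n \<in> A" for n
  proof -
    define a where "a m = (if m \<in> A then fourier_coeff g m else 0)" for m
    have "S = (\<lambda>z. \<Sum>\<^sub>\<infinity>m. a m * cis (of_int m * z))"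
    proof
      fix z
      have "(\<Sum>\<^sub>\<infinity>m. a m * cis (of_int m * z)) = (\<Sum>\<^sub>\<infinity>m\<in>A. fourier_coeff g m * cis (of_int m * z))"
        by (rule infsum_cong_neutral) (auto simp: a_def)
      then show "S z = (\<Sum>\<^sub>\<infinity>m. a m * cis (of_int m * z))" using A by (simp add: S_def)
    qed
    moreover have "(\<lambda>m. cmod (a m)) summable_on UNIV"
      using A by (intro summable_on_cong_neutral[THEN iffD1, OF _ _ _ summable_on_finite[of A "\<lambda>m. cmod (a m)"]]) (auto simp: a_def)
    ultimately have "fourier_coeff S n = a n"
      by (simp only: fourier_coeff_series)
    then show ?thesis using that by (simp add: a_def)
  qed
  have XS: "(LINT z:{0..2 * pi}|lborel. cnj (S z) * S z) / of_real (2 * pi) = of_real X"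
    using mean_trig_mult[OF iS A, of "fourier_coeff g"] coeff_S
    by (simp add: S_def[symmetric] X_def sq)
  have Xg: "(LINT z:{0..2 * pi}|lborel. cnj (S z) * g z) / of_real (2 * pi) = of_real X"
    using mean_trig_mult[OF ig A, of "fourier_coeff g"]
    by (simp add: S_def[symmetric] X_def sq)
  have SS: "(LINT z:{0..2 * pi}|lborel. (cmod (S z))\<^sup>2) = 2 * pi * X"
  proof -
    have "complex_of_real (LINT z:{0..2 * pi}|lborel. (cmod (S z))\<^sup>2) = (LINT z:{0..2 * pi}|lborel. cnj (S z) * S z)"
      unfolding sq by (rule set_integral_complex_of_real[symmetric])
    also have "\<dots> = of_real (2 * pi * X)" using XS by (simp add: field_simps)
    finally show ?thesis by (simp only: of_real_eq_iff)
  qed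
  have Sg: "(LINT z:{0..2 * pi}|lborel. Re (cnj (S z) * g z)) = 2 * pi * X"
  proof -
    have "set_integrable lborel {0..2 * pi} (\<lambda>z. cnj (S z) * g z)"
    proof (rule bounded_set_integrable)
      show "(\<lambda>z. cnj (S z) * g z) \<in> borel_measurable borel" by (rule mSg)
      have "cmod (S z) \<le> (\<Sum>n\<in>A. cmod (fourier_coeff g n))" for z
        unfolding S_def by (rule order_trans[OF norm_sum]) (simp add: norm_mult)
      then show "norm (cnj (S z) * g z) \<le> (\<Sum>n\<in>A. cmod (fourier_coeff g n)) * G" for z
        unfolding norm_mult complex_mod_cnj by (intro mult_mono G) (auto intro: sum_nonneg)
    qed
    then have "(LINT z:{0..2 * pi}|lborel. Re (cnj (S z) * g z)) = Re (LINT z:{0..2 * pi}|lborel. cnj (S z) * g z)"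
      unfolding set_lebesgue_integral_def set_integrable_def
      by (subst integral_Re[symmetric]) (simp_all del: integral_Re)
    also have "\<dots> = 2 * pi * X" using Xg by (simp add: field_simps)
    finally show ?thesis .
  qed
  have "(LINT z:{0..2 * pi}|lborel. Re (cnj (S z) * g z)) \<le> (LINT z:{0..2 * pi}|lborel. ((cmod (S z))\<^sup>2 + G\<^sup>2) / 2)"
  proof (rule set_integral_mono)
    show "set_integrable lborel {0..2 * pi} (\<lambda>z. Re (cnj (S z) * g z))"
    proof (rule bounded_set_integrable)
      show "(\<lambda>z. Re (cnj (S z) * g z)) \<in> borel_measurable borel"
        by (rule measurable_compose[OF mSg borel_measurable_continuous_onI[OF continuous_on_Re[OF continuous_on_id]]])
      have "cmod (S z) \<le> (\<Sum>n\<in>A. cmod (fourier_coeff g n))" for z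
        unfolding S_def by (rule order_trans[OF norm_sum]) (simp add: norm_mult)
      then have "cmod (cnj (S z) * g z) \<le> (\<Sum>n\<in>A. cmod (fourier_coeff g n)) * G" for z
        unfolding norm_mult complex_mod_cnj by (intro mult_mono G) (auto intro: sum_nonneg)
      then show "norm (Re (cnj (S z) * g z)) \<le> (\<Sum>n\<in>A. cmod (fourier_coeff g n)) * G" for z
        using abs_Re_le_cmod[of "cnj (S z) * g z"] unfolding real_norm_def by (rule order_trans[rotated])
    qed
    show "set_integrable lborel {0..2 * pi} (\<lambda>z. ((cmod (S z))\<^sup>2 + G\<^sup>2) / 2)"
      by (intro borel_integrable_atLeastAtMost' continuous_intros cS) auto
    fix z
    have "Re (cnj (S z) * g z) \<le> cmod (cnj (S z) * g z)" by (rule complex_Re_le_cmod)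
    also have "\<dots> = cmod (S z) * cmod (g z)" by (simp add: norm_mult)
    also have "\<dots> \<le> cmod (S z) * G" by (intro mult_left_mono G) simp
    also have "\<dots> \<le> ((cmod (S z))\<^sup>2 + G\<^sup>2) / 2" using sum_squares_bound[of "cmod (S z)" G] by simp
    finally show "Re (cnj (S z) * g z) \<le> ((cmod (S z))\<^sup>2 + G\<^sup>2) / 2" .
  qed
  also have "\<dots> = (2 * pi * X + 2 * pi * G\<^sup>2) / 2"
  proof -
    have "set_integrable lborel {0..2 * pi} (\<lambda>z. (cmod (S z))\<^sup>2)" "set_integrable lborel {0..2 * pi} (\<lambda>z. G\<^sup>2)"
      by (intro borel_integrable_atLeastAtMost' continuous_intros cS)+
    from set_integral_add(2)[OF this]
    have "(LINT z:{0..2 * pi}|lborel. (cmod (S z))\<^sup>2 + G\<^sup>2) = 2 * pi * X + (LINT z:{0..2 * pi}|lborel. G\<^sup>2)"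
      unfolding SS .
    also have "(LINT z:{0..2 * pi}|lborel. G\<^sup>2) = 2 * pi * G\<^sup>2"
      by (simp add: set_lebesgue_integral_def)
    finally show ?thesis by simp
  qed
  finally have "2 * pi * X \<le> 2 * pi * G\<^sup>2" unfolding Sg by simp
  then show ?thesis by (simp add: X_def)
qed

text \<open>Injectivity of \<open>u\<close> makes every partial sum of squares along it a sum over a
  finite set of frequencies, to which Bessel applies.\<close>

lemma fourier_coeff_tendsto_0:
  assumes g: "g \<in> borel_measurable borel" and G: "\<And>z. cmod (g z) \<le> G" and u: "inj u"
  shows "(\<lambda>N. fourier_coeff g (u N)) \<longlonglongrightarrow> 0"
proof -
  have "summable (\<lambda>N. (cmod (fourier_coeff g (u N)))\<^sup>2)"
  proof (rule bounded_imp_summable)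
    fix n
    have "(\<Sum>k\<le>n. (cmod (fourier_coeff g (u k)))\<^sup>2) = (\<Sum>m\<in>u ` {..n}. (cmod (fourier_coeff g m))\<^sup>2)"
      using u by (subst sum.reindex) (auto intro: inj_on_subset)
    also have "\<dots> \<le> G\<^sup>2" by (rule bessel[OF g G]) simp
    finally show "(\<Sum>k\<le>n. (cmod (fourier_coeff g (u k)))\<^sup>2) \<le> G\<^sup>2" .
  qed simp
  then have "(\<lambda>N. (cmod (fourier_coeff g (u N)))\<^sup>2) \<longlonglongrightarrow> 0" by (rule summable_LIMSEQ_zero)
  then have "(\<lambda>N. sqrt ((cmod (fourier_coeff g (u N)))\<^sup>2)) \<longlonglongrightarrow> sqrt 0" by (rule tendsto_real_sqrt)
  then show ?thesis by (simp add: tendsto_norm_zero_iff)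
qed

text \<open>The chord is 2 |sin (t / 2)|. With x = t / 2 and |x| \<le> 2, the cubic Taylor remainder
  |x|^3 / 6 is at most 2 |x| / 3, so |sin x| is at least |x| / 3.\<close>

lemma cis_minus_one_ge:
  assumes "\<bar>t\<bar> \<le> pi"
  shows "\<bar>t\<bar> / 3 \<le> cmod (cis t - 1)"
proof -
  define x where "x = t / 2"
  have x: "\<bar>x\<bar> \<le> 2" using assms pi_less_4 by (simp add: x_def)
  have "\<bar>sin x - (\<Sum>m<3. sin_coeff m * x ^ m)\<bar> \<le> inverse (fact 3) * \<bar>x\<bar> ^ 3" by (rule Maclaurin_sin_bound)
  moreover have "(\<Sum>m<3. sin_coeff m * x ^ m) = x" by (simp add: sin_coeff_def eval_nat_numeral)
  moreover have "inverse (fact 3) * \<bar>x\<bar> ^ 3 \<le> 2 / 3 * \<bar>x\<bar>"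
  proof -
    have "\<bar>x\<bar> ^ 3 = \<bar>x\<bar> * \<bar>x\<bar> * \<bar>x\<bar>" by (simp add: power3_eq_cube)
    also have "\<dots> \<le> 2 * 2 * \<bar>x\<bar>" using x by (intro mult_right_mono mult_mono) auto
    finally show ?thesis by (simp add: eval_nat_numeral)
  qed
  ultimately have "\<bar>x\<bar> / 3 \<le> \<bar>sin x\<bar>" by linarith
  moreover have "cmod (cis t - 1) = 2 * \<bar>sin x\<bar>"
  proof (rule power2_eq_imp_eq)
    have "(cmod (cis t - 1))\<^sup>2 = (cos t)\<^sup>2 + (sin t)\<^sup>2 + 1 - 2 * cos t"
      unfolding cmod_power2 by (simp add: power2_eq_square algebra_simps)
    also have "\<dots> = 2 - 2 * cos t" by simp
    also have "cos t = 1 - 2 * (sin x)\<^sup>2" using cos_double_sin[of x] by (simp add: x_def)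
    finally show "(cmod (cis t - 1))\<^sup>2 = (2 * \<bar>sin x\<bar>)\<^sup>2" by (simp add: power_mult_distrib)
  qed auto
  ultimately show ?thesis by (simp add: x_def)
qed

text \<open>Writing \<open>f z - f a = (cis (z - a) - 1) g z\<close> with \<open>g\<close> bounded makes the Fourier series of \<open>f\<close> at
  \<open>a\<close> telescope into coefficients of \<open>g\<close>, which tend to 0 by Bessel's inequality.\<close>

lemma fourier_inversion:
  assumes f: "continuous_on UNIV f" and per: "periodic_2pi f" and Lp: "\<And>x y. cmod (f x - f y) \<le> Lp * \<bar>x - y\<bar>"
    and sm: "(\<lambda>n. cmod (fourier_coeff f n)) summable_on UNIV"
  shows "f a = (\<Sum>\<^sub>\<infinity>n. fourier_coeff f n * cis (of_int n * a))"
proof -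
  define g where "g z = (if cis (z - a) = 1 then 0 else (f z - f a) / (cis (z - a) - 1))" for z
  have per_int: "f (z + 2 * pi * of_int m) = f z" for z and m :: int
  proof (induction m rule: int_induct[where k = 0])
    case (step1 i)
    then show ?case using per[unfolded periodic_2pi_def, rule_format, of "z + 2 * pi * of_int i"] by (simp add: algebra_simps)
  next
    case (step2 i)
    then show ?case using per[unfolded periodic_2pi_def, rule_format, of "z + 2 * pi * of_int (i - 1)"] by (simp add: algebra_simps)
  qed simp
  \<comment> \<open>Subtracting the nearest multiple of 2 pi brings \<open>z\<close> within pi of
    \<open>a\<close>, where the Lipschitz bound and the chord bound compare.\<close>
  have fa: "cmod (f z - f a) \<le> 3 * Lp * cmod (cis (z - a) - 1)" for z
  proof -
    define m where "m = round ((z - a) / (2 * pi))"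
    define t where "t = z - a - 2 * pi * of_int m"
    have "\<bar>of_int m - (z - a) / (2 * pi)\<bar> \<le> 1 / 2" unfolding m_def by (rule of_int_round_abs_le)
    then have "\<bar>of_int m - (z - a) / (2 * pi)\<bar> * (2 * pi) \<le> 1 / 2 * (2 * pi)" by (intro mult_right_mono) auto
    also have "\<bar>of_int m - (z - a) / (2 * pi)\<bar> * (2 * pi) = \<bar>(of_int m - (z - a) / (2 * pi)) * (2 * pi)\<bar>"
      by (simp add: abs_mult)
    also have "(of_int m - (z - a) / (2 * pi)) * (2 * pi) = - t" by (simp add: t_def field_simps)
    finally have t: "\<bar>t\<bar> \<le> pi" by simp
    have "cis (z - a) = cis t * cis (of_int m * (2 * pi))" by (simp add: cis_mult t_def mult_ac)
    then have c: "cis (z - a) = cis t" by (simp add: cis_int_period)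
    have L0: "Lp \<ge> 0" using order_trans[OF norm_ge_zero Lp[of 1 0]] by simp
    have "f z = f (a + t)" using per_int[of "a + t" m] by (simp add: t_def)
    then have "cmod (f z - f a) \<le> Lp * \<bar>t\<bar>" using Lp[of "a + t" a] by simp
    also have "\<dots> \<le> Lp * (3 * cmod (cis t - 1))" using cis_minus_one_ge[OF t] L0 by (intro mult_left_mono) auto
    finally show ?thesis by (simp add: c)
  qed
  have mult_g: "(cis (z - a) - 1) * g z = f z - f a" for z
    using fa[of z] by (auto simp: g_def)
  have bound_g: "cmod (g z) \<le> 3 * Lp" for z
  proof (cases "cis (z - a) = 1")
    case True
    then show ?thesis using order_trans[OF norm_ge_zero Lp[of 1 0]] by (simp add: g_def)
  next
    case False
    then have "0 < cmod (cis (z - a) - 1)" by simp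
    then show ?thesis using fa[of z] False by (simp add: g_def norm_divide divide_le_eq)
  qed
  have meas_g: "g \<in> borel_measurable borel"
  proof -
    have [measurable]: "f \<in> borel_measurable borel" by (rule borel_measurable_continuous_onI[OF f])
    have [measurable]: "(\<lambda>z. cis (z - a)) \<in> borel_measurable borel"
      by (intro borel_measurable_continuous_onI continuous_intros)
    show ?thesis unfolding g_def by measurable
  qed
  have ig: "set_integrable lborel {0..2 * pi} g" by (rule bounded_set_integrable[OF meas_g bound_g])
  have if_: "set_integrable lborel {0..2 * pi} f"
    by (intro borel_integrable_atLeastAtMost' continuous_on_subset[OF f]) simp
  have i1: "set_integrable lborel {0..2 * pi} (\<lambda>_. f a)"
    by (intro borel_integrable_atLeastAtMost' continuous_intros)
  \<comment> \<open>Taking coefficients in (cis (z - a) - 1) g = f - f a shifts the index of one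
    copy of \<open>g\<close>; after multiplication by the phase at \<open>a\<close> the two terms
    become consecutive values of \<open>U\<close>.\<close>
  define U where "U n = cis (of_int n * a) * fourier_coeff g n" for n :: int
  have step: "fourier_coeff f n * cis (of_int n * a) - (if n = 0 then f a else 0) = U (n - 1) - U n" for n
  proof -
    have "fourier_coeff (\<lambda>z. cis (- a) * (cis (of_int 1 * z) * g z) - g z) n = cis (- a) * fourier_coeff g (n - 1) - fourier_coeff g n"
    proof (subst fourier_coeff_diff)
      have "set_integrable lborel {0..2 * pi} (\<lambda>z. cis (1 * z) * g z)" by (rule set_integrable_cis_mult[OF ig])
      then show "set_integrable lborel {0..2 * pi} (\<lambda>z. cis (- a) * (cis (of_int 1 * z) * g z))" by simp
    qed (simp_all only: ig fourier_coeff_cmult fourier_coeff_shift)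
    also have "(\<lambda>z. cis (- a) * (cis (of_int 1 * z) * g z) - g z) = (\<lambda>z. f z - f a)"
    proof
      fix z
      have "cis (- a) * cis (of_int 1 * z) = cis (z - a)" by (simp add: cis_mult)
      then have eq: "cis (- a) * (cis (of_int 1 * z) * g z) = cis (z - a) * g z" by (simp only: mult.assoc[symmetric])
      show "cis (- a) * (cis (of_int 1 * z) * g z) - g z = f z - f a"
        unfolding eq using mult_g[of z] by (simp only: left_diff_distrib mult_1_left)
    qed
    also have "fourier_coeff (\<lambda>z. f z - f a) n = fourier_coeff f n - (if n = 0 then f a else 0)"
      using fourier_coeff_diff[OF if_ i1, of n] fourier_coeff_cmult[of "f a" "\<lambda>_. 1" n] by (simp add: fourier_coeff_one)
    finally have eq: "fourier_coeff f n - (if n = 0 then f a else 0) = cis (- a) * fourier_coeff g (n - 1) - fourier_coeff g n" .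
    have "cis (of_int n * a) * cis (- a) = cis (of_int (n - 1) * a)" by (simp add: cis_mult algebra_simps)
    then have "cis (of_int n * a) * (cis (- a) * fourier_coeff g (n - 1) - fourier_coeff g n) = U (n - 1) - U n"
      by (simp add: U_def right_diff_distrib mult.assoc[symmetric])
    moreover have "cis (of_int n * a) * (fourier_coeff f n - (if n = 0 then f a else 0)) =
        fourier_coeff f n * cis (of_int n * a) - (if n = 0 then f a else 0)"
      by (simp add: algebra_simps)
    ultimately show ?thesis unfolding eq by simp
  qed
  let ?A = "\<lambda>N. {- int N<..int N}"
  have tele: "(\<Sum>n\<in>?A N. U (n - 1) - U n) = U (- int N) - U (int N)" for N
  proof (induction N)
    case (Suc N)
    have "?A (Suc N) = insert (int N + 1) (insert (- int N) (?A N))" by auto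
    moreover have "- int (Suc N) = - int N - 1" "int (Suc N) = int N + 1" by simp_all
    ultimately show ?case using Suc by (simp only:) simp
  qed simp
  have partial: "(\<Sum>n\<in>?A (Suc N). fourier_coeff f n * cis (of_int n * a)) = f a + (U (- int (Suc N)) - U (int (Suc N)))" for N
  proof -
    have "(\<Sum>n\<in>?A (Suc N). fourier_coeff f n * cis (of_int n * a)) - (\<Sum>n\<in>?A (Suc N). if n = 0 then f a else 0)
        = U (- int (Suc N)) - U (int (Suc N))"
      unfolding sum_subtractf[symmetric] step tele ..
    then show ?thesis by (simp add: sum.delta algebra_simps)
  qed
  have U0: "(\<lambda>N. U (u N)) \<longlonglongrightarrow> 0" if "inj u" for u :: "nat \<Rightarrow> int"
  proof -
    have "(\<lambda>N. cmod (fourier_coeff g (u N))) \<longlonglongrightarrow> 0"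
      using fourier_coeff_tendsto_0[OF meas_g bound_g that] by (rule tendsto_norm_zero)
    then have "(\<lambda>N. cmod (U (u N))) \<longlonglongrightarrow> 0" by (simp add: U_def norm_mult)
    then show ?thesis by (rule tendsto_norm_zero_cancel)
  qed
  have "(\<lambda>N. f a + (U (- int (Suc N)) - U (int (Suc N)))) \<longlonglongrightarrow> f a + (0 - 0)"
    by (intro tendsto_add tendsto_diff tendsto_const U0) (auto simp: inj_def)
  then have lim1: "(\<lambda>N. \<Sum>n\<in>?A (Suc N). fourier_coeff f n * cis (of_int n * a)) \<longlonglongrightarrow> f a"
    unfolding partial by simp
  have "(\<lambda>n. cmod (fourier_coeff f n * cis (of_int n * a))) summable_on UNIV" using sm by (simp add: norm_mult)
  then have "((\<lambda>n. fourier_coeff f n * cis (of_int n * a)) has_sum (\<Sum>\<^sub>\<infinity>n. fourier_coeff f n * cis (of_int n * a))) UNIV"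
    by (rule has_sum_infsum[OF abs_summable_summable])
  then have "(sum (\<lambda>n. fourier_coeff f n * cis (of_int n * a)) \<longlongrightarrow> (\<Sum>\<^sub>\<infinity>n. fourier_coeff f n * cis (of_int n * a))) (finite_subsets_at_top UNIV)"
    by (simp add: has_sum_def)
  \<comment> \<open>Symmetric windows eventually contain any finite set, so their sums converge to
    the unordered sum.\<close>
  moreover have "filterlim (\<lambda>N. ?A (Suc N)) (finite_subsets_at_top UNIV) sequentially"
    unfolding filterlim_finite_subsets_at_top
  proof (intro allI impI)
    fix X :: "int set" assume X: "finite X \<and> X \<subseteq> UNIV"
    define B where "B = (\<Sum>x\<in>X. nat \<bar>x\<bar>)"
    have "\<bar>x\<bar> \<le> int B" if "x \<in> X" for x
    proof -
      have "nat \<bar>x\<bar> \<le> B" unfolding B_def using X that by (intro member_le_sum) auto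
      then show ?thesis by simp
    qed
    then have "X \<subseteq> ?A (Suc N)" if "N \<ge> B" for N using that by fastforce
    then show "\<forall>\<^sub>F N in sequentially. finite (?A (Suc N)) \<and> X \<subseteq> ?A (Suc N) \<and> ?A (Suc N) \<subseteq> UNIV"
      unfolding eventually_sequentially by auto
  qed
  ultimately have "(\<lambda>N. \<Sum>n\<in>?A (Suc N). fourier_coeff f n * cis (of_int n * a)) \<longlonglongrightarrow> (\<Sum>\<^sub>\<infinity>n. fourier_coeff f n * cis (of_int n * a))"
    by (rule filterlim_compose)
  then show ?thesis by (rule LIMSEQ_unique[OF lim1])
qed

section \<open>From analyticity in the amplitude to the coefficients of the potential\<close>

section \<open>Coefficients of the wave profile\<close>

lemma summable_int_inv_sq: "(\<lambda>n::int. 1 / (1 + real_of_int \<bar>n\<bar>)\<^sup>2) summable_on UNIV"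
proof -
  let ?f = "\<lambda>n::int. 1 / (1 + real_of_int \<bar>n\<bar>)\<^sup>2"
  have s: "(\<lambda>n. 1 / (1 + real n)\<^sup>2) summable_on UNIV"
    using summable_inv_sq by (subst summable_on_UNIV_nonneg_real_iff) auto
  have "?f summable_on range int" "?f summable_on range (\<lambda>n. - int n)"
    by (subst summable_on_reindex; use s in \<open>simp add: inj_on_def o_def\<close>)+
  then have "?f summable_on (range int \<union> range (\<lambda>n. - int n))"
    by (rule summable_on_union)
  also have "range int \<union> range (\<lambda>n. - int n) = UNIV"
    by (auto simp: image_iff) (metis int_cases2)
  finally show ?thesis .
qed

text \<open>A function carried together with all its derivatives. Sums and products are then handled
  on families, without computing iterated \<open>deriv\<close> of compound expressions.\<close>

definition deriv_family :: "(nat \<Rightarrow> real \<Rightarrow> real) \<Rightarrow> bool" where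
  "deriv_family F \<longleftrightarrow> (\<forall>m z. (F m has_real_derivative F (Suc m) z) (at z))"

lemma deriv_familyD: "deriv_family F \<Longrightarrow> (F m has_real_derivative F (Suc m) z) (at z)"
  by (simp add: deriv_family_def)

lemma smooth_deriv_family: "smooth f \<Longrightarrow> deriv_family (\<lambda>m. (deriv ^^ m) f)"
  unfolding smooth_def deriv_family_def by (simp add: DERIV_deriv_iff_real_differentiable)

lemma deriv_family_shift: "deriv_family F \<Longrightarrow> deriv_family (\<lambda>m. F (Suc m))"
  by (simp add: deriv_family_def)

lemma deriv_family_lin:
  "deriv_family F \<Longrightarrow> deriv_family G \<Longrightarrow> deriv_family (\<lambda>m z. a * F m z + b * G m z)"
  unfolding deriv_family_def by (auto intro!: derivative_eq_intros)

text \<open>The m-th derivative of the product F G as the unexpanded Leibniz rule: 2^m terms and no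
  binomial coefficients, which is enough for the bound below.\<close>

fun prod_family :: "nat \<Rightarrow> (nat \<Rightarrow> real \<Rightarrow> real) \<Rightarrow> (nat \<Rightarrow> real \<Rightarrow> real) \<Rightarrow> real \<Rightarrow> real" where
  "prod_family 0 F G z = F 0 z * G 0 z"
| "prod_family (Suc m) F G z = prod_family m (\<lambda>i. F (Suc i)) G z + prod_family m F (\<lambda>i. G (Suc i)) z"

lemma prod_family_deriv:
  assumes "deriv_family F" "deriv_family G"
  shows "(prod_family m F G has_real_derivative prod_family (Suc m) F G z) (at z)"
  using assms
proof (induction m arbitrary: F G)
  case 0
  show ?case
    using DERIV_mult[OF deriv_familyD[OF 0(1), of 0 z] deriv_familyD[OF 0(2), of 0 z]]
    by (simp add: mult.commute add.commute)
next
  case (Suc m)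
  have "((\<lambda>z. prod_family m (\<lambda>i. F (Suc i)) G z + prod_family m F (\<lambda>i. G (Suc i)) z) has_real_derivative
      prod_family (Suc m) (\<lambda>i. F (Suc i)) G z + prod_family (Suc m) F (\<lambda>i. G (Suc i)) z) (at z)"
    by (intro DERIV_add Suc.IH Suc.prems deriv_family_shift)
  then show ?case by simp
qed

lemma prod_family_le:
  assumes "\<And>i. i \<le> m \<Longrightarrow> \<bar>F i z\<bar> \<le> A" "\<And>i. i \<le> m \<Longrightarrow> \<bar>G i z\<bar> \<le> B"
  shows "\<bar>prod_family m F G z\<bar> \<le> 2 ^ m * (A * B)"
  using assms
proof (induction m arbitrary: F G)
  case 0
  have "\<bar>F 0 z\<bar> * \<bar>G 0 z\<bar> \<le> A * B"
    using 0(1)[of 0] 0(2)[of 0] by (intro mult_mono) (auto intro: order_trans[OF abs_ge_zero])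
  then show ?case by (simp add: abs_mult)
next
  case (Suc m)
  have "\<bar>prod_family m (\<lambda>i. F (Suc i)) G z\<bar> \<le> 2 ^ m * (A * B)" "\<bar>prod_family m F (\<lambda>i. G (Suc i)) z\<bar> \<le> 2 ^ m * (A * B)"
    by (rule Suc.IH; use Suc.prems in simp)+
  then show ?case by simp
qed

lemma deriv_family_continuous: "deriv_family F \<Longrightarrow> continuous_on S (F m)"
  by (intro continuous_at_imp_continuous_on ballI DERIV_isCont) (auto dest: deriv_familyD)

lemma deriv_family_periodic:
  assumes F: "deriv_family F" and per: "periodic_2pi (F 0)"
  shows "periodic_2pi (F m)"
proof (induction m)
  case (Suc m)
  show ?case
    unfolding periodic_2pi_def
  proof
    fix z
    have "((\<lambda>z. F m (z + 2 * pi)) has_real_derivative F (Suc m) (z + 2 * pi)) (at z)"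
      using deriv_familyD[OF F, of m "z + 2 * pi"] by (simp add: DERIV_shift)
    moreover have "(\<lambda>z. F m (z + 2 * pi)) = F m" using Suc by (auto simp: periodic_2pi_def)
    ultimately have "(F m has_real_derivative F (Suc m) (z + 2 * pi)) (at z)" by simp
    then show "F (Suc m) (z + 2 * pi) = F (Suc m) z" using deriv_familyD[OF F] by (rule DERIV_unique)
  qed
qed (rule per)

lemma deriv_family_fourier:
  assumes F: "deriv_family F" and per: "periodic_2pi (F 0)"
  shows "fourier_coeff (\<lambda>z. of_real (F m z)) n = (\<i> * of_int n) ^ m * fourier_coeff (\<lambda>z. of_real (F 0 z)) n"
proof (induction m)
  case (Suc m)
  have "fourier_coeff (\<lambda>z. complex_of_real (F (Suc m) z)) n = \<i> * of_int n * fourier_coeff (\<lambda>z. of_real (F m z)) n"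
  proof (rule fourier_coeff_deriv)
    show "((\<lambda>z. complex_of_real (F m z)) has_vector_derivative complex_of_real (F (Suc m) z)) (at z)" for z
      using deriv_familyD[OF F, of m z]
      by (intro has_vector_derivative_of_real) (simp add: has_real_derivative_iff_has_vector_derivative)
    show "continuous_on UNIV (\<lambda>z. complex_of_real (F (Suc m) z))"
      by (intro continuous_intros deriv_family_continuous F)
    show "periodic_2pi (\<lambda>z. complex_of_real (F m z))"
      using deriv_family_periodic[OF F per, of m] by (simp add: periodic_2pi_def)
  qed
  then show ?case using Suc by simp
qed simp

text \<open>M integrations by parts give |n|^M; the factor \<open>2 ^ M\<close> pays for replacing
  |n| by 1 + |n|.\<close>

lemma deriv_family_decay:
  assumes F: "deriv_family F" and per: "periodic_2pi (F 0)" and B: "\<And>m z. m \<le> M \<Longrightarrow> \<bar>F m z\<bar> \<le> B"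
  shows "cmod (fourier_coeff (\<lambda>z. of_real (F 0 z)) n) \<le> 2 ^ M * B / (1 + real_of_int \<bar>n\<bar>) ^ M"
proof -
  have le: "cmod (fourier_coeff (\<lambda>z. of_real (F m z)) n) \<le> B" if "m \<le> M" for m
    using B[OF that] by (intro fourier_coeff_le continuous_intros deriv_family_continuous F) simp
  let ?c = "cmod (fourier_coeff (\<lambda>z. of_real (F 0 z)) n)"
  have B0: "B \<ge> 0" using order_trans[OF abs_ge_zero B[of 0 0]] by simp
  have "(1 + real_of_int \<bar>n\<bar>) ^ M * ?c \<le> 2 ^ M * B"
  proof (cases "n = 0")
    case True
    have "1 * B \<le> 2 ^ M * B" using B0 by (intro mult_right_mono) auto
    then show ?thesis using le[of 0] True by simp
  next
    case False
    then have "1 \<le> real_of_int \<bar>n\<bar>" by linarith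
    then have "(1 + real_of_int \<bar>n\<bar>) ^ M \<le> (2 * real_of_int \<bar>n\<bar>) ^ M" by (intro power_mono) auto
    then have "(1 + real_of_int \<bar>n\<bar>) ^ M * ?c \<le> (2 * real_of_int \<bar>n\<bar>) ^ M * ?c" by (rule mult_right_mono) simp
    also have "\<dots> = 2 ^ M * cmod (fourier_coeff (\<lambda>z. of_real (F M z)) n)"
      unfolding deriv_family_fourier[OF F per, of M] by (simp add: norm_mult norm_power power_mult_distrib)
    also have "\<dots> \<le> 2 ^ M * B" using le[of M] by (intro mult_left_mono) auto
    finally show ?thesis .
  qed
  moreover have "0 < (1 + real_of_int \<bar>n\<bar>) ^ M" by (intro zero_less_power) (simp add: add_pos_nonneg)
  ultimately show ?thesis by (simp add: pos_le_divide_eq mult.commute)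
qed

lemma fourier_coeff_cos:
  "fourier_coeff (\<lambda>z. of_real (2 * cos z)) n = (if \<bar>n\<bar> = 1 then 1 else 0)"
proof -
  have i: "set_integrable lborel {0..2 * pi} (\<lambda>z. cis (of_int m * z) * 1)" for m :: int
    by (intro borel_integrable_atLeastAtMost' continuous_intros)
  have "(\<lambda>z. complex_of_real (2 * cos z)) = (\<lambda>z. cis (of_int 1 * z) * 1 + cis (of_int (- 1) * z) * 1)"
    by (auto simp: complex_eq_iff)
  then have "fourier_coeff (\<lambda>z. of_real (2 * cos z)) n = fourier_coeff (\<lambda>_. 1) (n - 1) + fourier_coeff (\<lambda>_. 1) (n - (- 1))"
    by (simp only: fourier_coeff_add[OF i i] fourier_coeff_shift)
  then show ?thesis by (auto simp: fourier_coeff_one)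
qed

text \<open>Beyond the linear term successive terms are dominated by a geometric series of ratio
  1/2, since |\<epsilon>| is at most r / 2; its sum is the factor 2.\<close>

lemma power_series_remainder:
  fixes a :: "nat \<Rightarrow> real"
  assumes sums: "(\<lambda>n. \<epsilon> ^ n * a n) sums s" and B: "\<And>n. \<bar>a n\<bar> * r ^ n \<le> B" and r: "r > 0" "\<bar>\<epsilon>\<bar> \<le> r / 2"
  shows "\<bar>s - a 0 - \<epsilon> * a 1\<bar> \<le> 2 * B / r\<^sup>2 * \<epsilon>\<^sup>2"
proof -
  have "(\<lambda>n. \<epsilon> ^ (n + 2) * a (n + 2)) sums (s - (\<Sum>i<2. \<epsilon> ^ i * a i))"
    using sums by (rule sums_split_initial_segment)
  also have "(\<Sum>i<2. \<epsilon> ^ i * a i) = a 0 + \<epsilon> * a 1" by (simp add: eval_nat_numeral)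
  finally have s: "(\<lambda>n. \<epsilon> ^ (n + 2) * a (n + 2)) sums (s - (a 0 + \<epsilon> * a 1))" .
  have le: "norm (\<epsilon> ^ (n + 2) * a (n + 2)) \<le> B / r\<^sup>2 * \<epsilon>\<^sup>2 * (1 / 2) ^ n" for n
  proof -
    have "\<bar>\<epsilon>\<bar> ^ n \<le> (r / 2) ^ n" using r by (intro power_mono) auto
    then have "\<bar>\<epsilon>\<bar> ^ n * (\<epsilon>\<^sup>2 * \<bar>a (n + 2)\<bar>) \<le> (r / 2) ^ n * (\<epsilon>\<^sup>2 * \<bar>a (n + 2)\<bar>)"
      by (rule mult_right_mono) simp
    also have "\<dots> = \<epsilon>\<^sup>2 * (1 / 2) ^ n / r\<^sup>2 * (\<bar>a (n + 2)\<bar> * r ^ (n + 2))"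
      using r by (simp add: power_divide power_add power2_eq_square)
    also have "\<dots> \<le> \<epsilon>\<^sup>2 * (1 / 2) ^ n / r\<^sup>2 * B"
      using r by (intro mult_left_mono B) auto
    finally have "\<bar>\<epsilon>\<bar> ^ n * (\<epsilon>\<^sup>2 * \<bar>a (n + 2)\<bar>) \<le> \<epsilon>\<^sup>2 * (1 / 2) ^ n / r\<^sup>2 * B" .
    moreover have "norm (\<epsilon> ^ (n + 2) * a (n + 2)) = \<bar>\<epsilon>\<bar> ^ n * (\<epsilon>\<^sup>2 * \<bar>a (n + 2)\<bar>)"
      unfolding real_norm_def abs_mult power_abs power_add by simp
    ultimately show ?thesis by (simp add: mult_ac)
  qed
  have g: "summable (\<lambda>n. B / r\<^sup>2 * \<epsilon>\<^sup>2 * (1 / 2) ^ n)" by (intro summable_mult summable_geometric) simp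
  have "norm (s - (a 0 + \<epsilon> * a 1)) \<le> (\<Sum>n. B / r\<^sup>2 * \<epsilon>\<^sup>2 * (1 / 2) ^ n)"
    unfolding sums_unique[OF s] by (rule norm_suminf_le[OF le g])
  also have "\<dots> = B / r\<^sup>2 * \<epsilon>\<^sup>2 * (\<Sum>n. (1 / 2) ^ n)" by (rule suminf_mult) (intro summable_geometric, simp)
  also have "(\<Sum>n. (1 / 2 :: real) ^ n) = 2" using suminf_geometric[of "1 / 2 :: real"] by simp
  finally show ?thesis by (simp add: algebra_simps)
qed

lemma zero_if_le_linear:
  fixes x :: real
  assumes "e > 0" "\<And>\<epsilon>. 0 < \<epsilon> \<Longrightarrow> \<epsilon> < e \<Longrightarrow> \<bar>x\<bar> \<le> C * \<epsilon>"
  shows "x = 0"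
proof -
  have "\<forall>\<^sub>F \<epsilon> in at_right 0. \<bar>x\<bar> \<le> C * \<epsilon>"
    unfolding eventually_at_right_field using assms by auto
  moreover have "((\<lambda>\<epsilon>. C * \<epsilon>) \<longlongrightarrow> C * 0) (at_right 0)" by (intro tendsto_intros)
  ultimately have "\<bar>x\<bar> \<le> C * 0" by (intro tendsto_lowerbound) auto
  then show ?thesis by simp
qed

text \<open>The given asymptotics hold only for values, not derivatives. They serve to identify the
  first two power series coefficients as 0 and \<open>cos\<close>; the power series then expands
  every derivative uniformly in \<open>z\<close>.\<close>

lemma wave_profile_expansion:
  assumes wf: "wave_family j \<gamma> \<alpha>\<^sub>1 \<alpha>\<^sub>2 k \<eta> c"
  obtains h1 where "deriv_family h1" "h1 0 = cos"
    "\<And>m. \<exists>e>0. \<exists>B\<ge>0. \<forall>\<epsilon> z. \<bar>\<epsilon>\<bar> < e \<longrightarrow> \<bar>(deriv ^^ m) (\<eta> \<epsilon>) z - \<epsilon> * h1 m z\<bar> \<le> B * \<epsilon>\<^sup>2 \<and> \<bar>(deriv ^^ m) (\<eta> \<epsilon>) z\<bar> \<le> B * \<bar>\<epsilon>\<bar>"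
proof -
  from wf obtain e1 C where e1: "e1 > 0" and C: "\<And>\<epsilon> z. \<bar>\<epsilon>\<bar> < e1 \<Longrightarrow>
      \<bar>\<eta> \<epsilon> z - (\<epsilon> * cos z + \<epsilon>\<^sup>2 * wave_eta2 j \<gamma> \<alpha>\<^sub>1 k * cos (2 * z)
                 + \<epsilon> ^ 3 * wave_eta3 j \<gamma> \<alpha>\<^sub>1 \<alpha>\<^sub>2 k * cos (3 * z))\<bar> \<le> C * \<epsilon> ^ 4"
    unfolding wave_family_def by blast
  from wf have "analytic_profile \<eta>" by (simp add: wave_family_def)
  then obtain h where h: "\<And>n. smooth (h n)" and an: "\<And>m. \<exists>r > 0. \<exists>B.
        (\<forall>n z. \<bar>(deriv ^^ m) (h n) z\<bar> * r ^ n \<le> B) \<and>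
        (\<forall>\<epsilon> z. \<bar>\<epsilon>\<bar> < r \<longrightarrow> (\<lambda>n. \<epsilon> ^ n * (deriv ^^ m) (h n) z) sums (deriv ^^ m) (\<eta> \<epsilon>) z)"
    unfolding analytic_profile_def by meson
  obtain r0 B0 where r0: "r0 > 0" "\<And>n z. \<bar>h n z\<bar> * r0 ^ n \<le> B0"
      "\<And>\<epsilon> z. \<bar>\<epsilon>\<bar> < r0 \<Longrightarrow> (\<lambda>n. \<epsilon> ^ n * h n z) sums \<eta> \<epsilon> z"
    using an[of 0] unfolding funpow_0 by blast
  \<comment> \<open>The asymptotics at \<epsilon> = 0 say that the wave vanishes there.\<close>
  have h0: "h 0 = (\<lambda>_. 0)"
  proof
    fix z
    have "(\<lambda>n. 0 ^ n * h n z) sums \<eta> 0 z" using r0(1) r0(3)[of 0 z] by simp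
    moreover have "(\<lambda>n. 0 ^ n * h n z) sums h 0 z"
      using sums_single[of 0 "\<lambda>n. h n z"] by (rule back_subst[of "\<lambda>f. f sums h 0 z"]) auto
    ultimately have "h 0 z = \<eta> 0 z" by (rule sums_unique2[symmetric])
    also have "\<eta> 0 z = 0" using C[of 0 z] e1 by simp
    finally show "h 0 z = 0" .
  qed
  \<comment> \<open>Both expansions hold up to O(\<epsilon>^2), so after division by \<epsilon> the
    linear coefficients differ by O(\<epsilon>).\<close>
  have h1: "h 1 = cos"
  proof
    fix z
    let ?W = "\<bar>wave_eta2 j \<gamma> \<alpha>\<^sub>1 k\<bar> + \<bar>wave_eta3 j \<gamma> \<alpha>\<^sub>1 \<alpha>\<^sub>2 k\<bar> + \<bar>C\<bar>"
    have "h 1 z - cos z = 0"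
    proof (rule zero_if_le_linear)
      show "min (min e1 (r0 / 2)) 1 > 0" using e1 r0 by simp
      fix \<epsilon> :: real assume \<epsilon>: "0 < \<epsilon>" "\<epsilon> < min (min e1 (r0 / 2)) 1"
      have p: "\<epsilon> ^ 3 \<le> \<epsilon>\<^sup>2" "\<epsilon> ^ 4 \<le> \<epsilon>\<^sup>2" using \<epsilon> by (auto intro!: power_decreasing)
      have 1: "\<bar>\<epsilon>\<^sup>2 * wave_eta2 j \<gamma> \<alpha>\<^sub>1 k * cos (2 * z)\<bar> \<le> \<epsilon>\<^sup>2 * \<bar>wave_eta2 j \<gamma> \<alpha>\<^sub>1 k\<bar>"
        by (simp add: abs_mult mult_left_le)
      have "\<bar>\<epsilon> ^ 3 * wave_eta3 j \<gamma> \<alpha>\<^sub>1 \<alpha>\<^sub>2 k * cos (3 * z)\<bar> \<le> \<epsilon> ^ 3 * \<bar>wave_eta3 j \<gamma> \<alpha>\<^sub>1 \<alpha>\<^sub>2 k\<bar>"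
        using \<epsilon> by (simp add: abs_mult mult_left_le)
      also have "\<dots> \<le> \<epsilon>\<^sup>2 * \<bar>wave_eta3 j \<gamma> \<alpha>\<^sub>1 \<alpha>\<^sub>2 k\<bar>" using p by (intro mult_right_mono) auto
      finally have 2: "\<bar>\<epsilon> ^ 3 * wave_eta3 j \<gamma> \<alpha>\<^sub>1 \<alpha>\<^sub>2 k * cos (3 * z)\<bar> \<le> \<epsilon>\<^sup>2 * \<bar>wave_eta3 j \<gamma> \<alpha>\<^sub>1 \<alpha>\<^sub>2 k\<bar>" .
      have "C * \<epsilon> ^ 4 \<le> \<bar>C\<bar> * \<epsilon> ^ 4" by (intro mult_right_mono) auto
      also have "\<dots> \<le> \<bar>C\<bar> * \<epsilon>\<^sup>2" using p by (intro mult_left_mono) auto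
      finally have 3: "C * \<epsilon> ^ 4 \<le> \<epsilon>\<^sup>2 * \<bar>C\<bar>" by (simp add: mult.commute)
      have "\<bar>\<epsilon>\<bar> < e1" using \<epsilon> by simp
      have tri: "\<bar>u - x\<bar> \<le> a + b + d" if "\<bar>u - (x + y + w)\<bar> \<le> d" "\<bar>y\<bar> \<le> a" "\<bar>w\<bar> \<le> b" for u x y w a b d :: real
        using that by linarith
      have "\<bar>\<eta> \<epsilon> z - \<epsilon> * cos z\<bar> \<le> \<epsilon>\<^sup>2 * \<bar>wave_eta2 j \<gamma> \<alpha>\<^sub>1 k\<bar> + \<epsilon>\<^sup>2 * \<bar>wave_eta3 j \<gamma> \<alpha>\<^sub>1 \<alpha>\<^sub>2 k\<bar> + C * \<epsilon> ^ 4"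
        by (rule tri[OF C[OF \<open>\<bar>\<epsilon>\<bar> < e1\<close>] 1 2])
      also have "\<dots> \<le> \<epsilon>\<^sup>2 * ?W" using 3 by (simp add: distrib_left)
      finally have A: "\<bar>\<eta> \<epsilon> z - \<epsilon> * cos z\<bar> \<le> \<epsilon>\<^sup>2 * ?W" .
      have A': "\<bar>\<eta> \<epsilon> z - h 0 z - \<epsilon> * h 1 z\<bar> \<le> 2 * B0 / r0\<^sup>2 * \<epsilon>\<^sup>2"
        using \<epsilon> r0 by (intro power_series_remainder r0(3)) auto
      have "\<epsilon> * (h 1 z - cos z) = (\<eta> \<epsilon> z - \<epsilon> * cos z) - (\<eta> \<epsilon> z - h 0 z - \<epsilon> * h 1 z)"
        by (simp add: h0 right_diff_distrib)
      then have "\<bar>\<epsilon> * (h 1 z - cos z)\<bar> \<le> \<epsilon>\<^sup>2 * ?W + 2 * B0 / r0\<^sup>2 * \<epsilon>\<^sup>2"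
        using order_trans[OF abs_triangle_ineq4 add_mono[OF A A']] by simp
      also have "\<dots> = \<epsilon> * ((2 * B0 / r0\<^sup>2 + ?W) * \<epsilon>)" by (simp add: power2_eq_square distrib_left distrib_right)
      finally have "\<epsilon> * \<bar>h 1 z - cos z\<bar> \<le> \<epsilon> * ((2 * B0 / r0\<^sup>2 + ?W) * \<epsilon>)"
        using \<epsilon> by (simp only: abs_mult abs_of_pos)
      then show "\<bar>h 1 z - cos z\<bar> \<le> (2 * B0 / r0\<^sup>2 + ?W) * \<epsilon>"
        using \<epsilon>(1) by (simp only: mult_le_cancel_left_pos)
    qed
    then show "h 1 z = cos z" by simp
  qed
  have D0: "(deriv ^^ m) (h 0) z = 0" for m z
  proof -
    have "(deriv ^^ m) (\<lambda>_. 0 :: real) = (\<lambda>_. 0)" by (induction m) simp_all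
    then show ?thesis by (simp add: h0)
  qed
  show ?thesis
  proof (rule that[of "\<lambda>m. (deriv ^^ m) (h 1)"])
    show "deriv_family (\<lambda>m. (deriv ^^ m) (h 1))" by (rule smooth_deriv_family[OF h])
    show "(deriv ^^ 0) (h 1) = cos" using h1 by simp
    fix m
    obtain r B where r: "r > 0" "\<And>n z. \<bar>(deriv ^^ m) (h n) z\<bar> * r ^ n \<le> B"
      "\<And>\<epsilon> z. \<bar>\<epsilon>\<bar> < r \<Longrightarrow> (\<lambda>n. \<epsilon> ^ n * (deriv ^^ m) (h n) z) sums (deriv ^^ m) (\<eta> \<epsilon>) z"
      using an[of m] by blast
    have B: "B \<ge> 0" using order_trans[OF abs_ge_zero, of "(deriv ^^ m) (h 0) 0" B] r(2)[of 0 0] by simp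
    define B' where "B' = 2 * B / r\<^sup>2 + B / r"
    have "\<bar>(deriv ^^ m) (\<eta> \<epsilon>) z - \<epsilon> * (deriv ^^ m) (h 1) z\<bar> \<le> B' * \<epsilon>\<^sup>2 \<and> \<bar>(deriv ^^ m) (\<eta> \<epsilon>) z\<bar> \<le> B' * \<bar>\<epsilon>\<bar>"
      if \<epsilon>: "\<bar>\<epsilon>\<bar> < min (r / 2) 1" for \<epsilon> z
    proof
      have "\<bar>(deriv ^^ m) (\<eta> \<epsilon>) z - (deriv ^^ m) (h 0) z - \<epsilon> * (deriv ^^ m) (h 1) z\<bar> \<le> 2 * B / r\<^sup>2 * \<epsilon>\<^sup>2"
        using \<epsilon> r by (intro power_series_remainder r(3)) auto
      then have A: "\<bar>(deriv ^^ m) (\<eta> \<epsilon>) z - \<epsilon> * (deriv ^^ m) (h 1) z\<bar> \<le> 2 * B / r\<^sup>2 * \<epsilon>\<^sup>2" by (simp add: D0)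
      have pB: "B / r \<ge> 0" "2 * B / r\<^sup>2 \<ge> 0" using B r by auto
      then have "2 * B / r\<^sup>2 * \<epsilon>\<^sup>2 \<le> B' * \<epsilon>\<^sup>2" unfolding B'_def by (intro mult_right_mono) auto
      then show "\<bar>(deriv ^^ m) (\<eta> \<epsilon>) z - \<epsilon> * (deriv ^^ m) (h 1) z\<bar> \<le> B' * \<epsilon>\<^sup>2" using A by linarith
      have "\<bar>(deriv ^^ m) (h 1) z\<bar> \<le> B / r" using r(2)[of 1 z] r(1) by (simp add: pos_le_divide_eq)
      then have "\<bar>\<epsilon> * (deriv ^^ m) (h 1) z\<bar> \<le> \<bar>\<epsilon>\<bar> * (B / r)" unfolding abs_mult by (intro mult_left_mono) auto
      moreover have "2 * B / r\<^sup>2 * \<epsilon>\<^sup>2 \<le> 2 * B / r\<^sup>2 * \<bar>\<epsilon>\<bar>"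
      proof (rule mult_left_mono[OF _ pB(2)])
        have "\<bar>\<epsilon>\<bar> * \<bar>\<epsilon>\<bar> \<le> \<bar>\<epsilon>\<bar> * 1" using \<epsilon> by (intro mult_left_mono) auto
        then show "\<epsilon>\<^sup>2 \<le> \<bar>\<epsilon>\<bar>" by (simp add: power2_eq_square)
      qed
      ultimately have "\<bar>(deriv ^^ m) (\<eta> \<epsilon>) z\<bar> \<le> 2 * B / r\<^sup>2 * \<bar>\<epsilon>\<bar> + \<bar>\<epsilon>\<bar> * (B / r)" using A by linarith
      also have "\<dots> = B' * \<bar>\<epsilon>\<bar>" by (simp add: B'_def algebra_simps)
      finally show "\<bar>(deriv ^^ m) (\<eta> \<epsilon>) z\<bar> \<le> B' * \<bar>\<epsilon>\<bar>" .
    qed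
    moreover have "B' \<ge> 0" using B r by (simp add: B'_def)
    ultimately show "\<exists>e>0. \<exists>B\<ge>0. \<forall>\<epsilon> z. \<bar>\<epsilon>\<bar> < e \<longrightarrow> \<bar>(deriv ^^ m) (\<eta> \<epsilon>) z - \<epsilon> * (deriv ^^ m) (h 1) z\<bar> \<le> B * \<epsilon>\<^sup>2 \<and> \<bar>(deriv ^^ m) (\<eta> \<epsilon>) z\<bar> \<le> B * \<bar>\<epsilon>\<bar>"
      using r(1) by (intro exI[of _ "min (r / 2) 1"] exI[of _ B'] conjI allI impI) auto
  qed
qed

lemma wave_speed_expansion:
  assumes wf: "wave_family j \<gamma> \<alpha>\<^sub>1 \<alpha>\<^sub>2 k \<eta> c"
  shows "\<exists>e>0. \<exists>B\<ge>0. \<forall>\<epsilon>. \<bar>\<epsilon>\<bar> < e \<longrightarrow> \<bar>c \<epsilon> - wave_c0 j \<gamma> k\<bar> \<le> B * \<epsilon>\<^sup>2"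
proof -
  from wf obtain e1 C where e1: "e1 > 0" and C: "\<And>\<epsilon>. \<bar>\<epsilon>\<bar> < e1 \<Longrightarrow>
      \<bar>c \<epsilon> - (wave_c0 j \<gamma> k + \<epsilon>\<^sup>2 * wave_c2 j \<gamma> \<alpha>\<^sub>1 \<alpha>\<^sub>2 k)\<bar> \<le> C * \<epsilon> ^ 4"
    unfolding wave_family_def by blast
  have "\<bar>c \<epsilon> - wave_c0 j \<gamma> k\<bar> \<le> (\<bar>C\<bar> + \<bar>wave_c2 j \<gamma> \<alpha>\<^sub>1 \<alpha>\<^sub>2 k\<bar>) * \<epsilon>\<^sup>2" if \<epsilon>: "\<bar>\<epsilon>\<bar> < min e1 1" for \<epsilon>
  proof -
    have "\<bar>\<epsilon>\<bar> ^ 4 \<le> \<bar>\<epsilon>\<bar>\<^sup>2" using \<epsilon> by (intro power_decreasing) auto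
    then have "\<epsilon> ^ 4 \<le> \<epsilon>\<^sup>2" by simp
    have "C * \<epsilon> ^ 4 \<le> \<bar>C\<bar> * \<epsilon> ^ 4" by (intro mult_right_mono) auto
    also have "\<dots> \<le> \<bar>C\<bar> * \<epsilon>\<^sup>2" using \<open>\<epsilon> ^ 4 \<le> \<epsilon>\<^sup>2\<close> by (intro mult_left_mono) auto
    finally have "C * \<epsilon> ^ 4 \<le> \<bar>C\<bar> * \<epsilon>\<^sup>2" .
    moreover have "\<bar>\<epsilon>\<^sup>2 * wave_c2 j \<gamma> \<alpha>\<^sub>1 \<alpha>\<^sub>2 k\<bar> \<le> \<bar>wave_c2 j \<gamma> \<alpha>\<^sub>1 \<alpha>\<^sub>2 k\<bar> * \<epsilon>\<^sup>2" by (simp add: abs_mult)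
    moreover have "\<bar>\<epsilon>\<bar> < e1" using \<epsilon> by simp
    moreover have "\<bar>u - x\<bar> \<le> b + a" if "\<bar>u - (x + y)\<bar> \<le> d" "d \<le> b" "\<bar>y\<bar> \<le> a" for u x y a b d :: real
      using that by linarith
    ultimately show ?thesis using C[of \<epsilon>] unfolding distrib_right by blast
  qed
  then show ?thesis using e1
    by (intro exI[of _ "min e1 1"] exI[of _ "\<bar>C\<bar> + \<bar>wave_c2 j \<gamma> \<alpha>\<^sub>1 \<alpha>\<^sub>2 k\<bar>"] conjI allI impI) auto
qed

lemma wave_profile_uniform:
  fixes h1 :: "nat \<Rightarrow> real \<Rightarrow> real" and \<eta> :: "real \<Rightarrow> real \<Rightarrow> real"
  assumes "\<And>m. \<exists>e>0. \<exists>B\<ge>0. \<forall>\<epsilon> z. \<bar>\<epsilon>\<bar> < e \<longrightarrow> \<bar>(deriv ^^ m) (\<eta> \<epsilon>) z - \<epsilon> * h1 m z\<bar> \<le> B * \<epsilon>\<^sup>2 \<and> \<bar>(deriv ^^ m) (\<eta> \<epsilon>) z\<bar> \<le> B * \<bar>\<epsilon>\<bar>"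
  shows "\<exists>e>0. \<exists>B\<ge>0. \<forall>m\<le>M. \<forall>\<epsilon> z. \<bar>\<epsilon>\<bar> < e \<longrightarrow> \<bar>(deriv ^^ m) (\<eta> \<epsilon>) z - \<epsilon> * h1 m z\<bar> \<le> B * \<epsilon>\<^sup>2 \<and> \<bar>(deriv ^^ m) (\<eta> \<epsilon>) z\<bar> \<le> B * \<bar>\<epsilon>\<bar>"
proof (induction M)
  case 0
  show ?case using assms[of 0] by simp
next
  case (Suc M)
  obtain e B where e: "e > 0" "B \<ge> 0" "\<And>m \<epsilon> z. m \<le> M \<Longrightarrow> \<bar>\<epsilon>\<bar> < e \<Longrightarrow> \<bar>(deriv ^^ m) (\<eta> \<epsilon>) z - \<epsilon> * h1 m z\<bar> \<le> B * \<epsilon>\<^sup>2 \<and> \<bar>(deriv ^^ m) (\<eta> \<epsilon>) z\<bar> \<le> B * \<bar>\<epsilon>\<bar>"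
    using Suc by blast
  obtain e' B' where e': "e' > 0" "B' \<ge> 0" "\<And>\<epsilon> z. \<bar>\<epsilon>\<bar> < e' \<Longrightarrow> \<bar>(deriv ^^ Suc M) (\<eta> \<epsilon>) z - \<epsilon> * h1 (Suc M) z\<bar> \<le> B' * \<epsilon>\<^sup>2 \<and> \<bar>(deriv ^^ Suc M) (\<eta> \<epsilon>) z\<bar> \<le> B' * \<bar>\<epsilon>\<bar>"
    using assms[of "Suc M"] by blast
  have "\<bar>(deriv ^^ m) (\<eta> \<epsilon>) z - \<epsilon> * h1 m z\<bar> \<le> max B B' * \<epsilon>\<^sup>2 \<and> \<bar>(deriv ^^ m) (\<eta> \<epsilon>) z\<bar> \<le> max B B' * \<bar>\<epsilon>\<bar>"
    if m: "m \<le> Suc M" and \<epsilon>: "\<bar>\<epsilon>\<bar> < min e e'" for m \<epsilon> z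
  proof -
    have mono: "B * \<epsilon>\<^sup>2 \<le> max B B' * \<epsilon>\<^sup>2" "B * \<bar>\<epsilon>\<bar> \<le> max B B' * \<bar>\<epsilon>\<bar>"
      "B' * \<epsilon>\<^sup>2 \<le> max B B' * \<epsilon>\<^sup>2" "B' * \<bar>\<epsilon>\<bar> \<le> max B B' * \<bar>\<epsilon>\<bar>"
      by (intro mult_right_mono; simp)+
    show ?thesis
    proof (cases "m = Suc M")
      case True
      show ?thesis using e'(3)[of \<epsilon> z] \<epsilon> mono unfolding True by (auto intro: order_trans)
    next
      case False
      then show ?thesis using e(3)[of m \<epsilon> z] m \<epsilon> mono by (auto intro: order_trans)
    qed
  qed
  then show ?case using e e'
    by (intro exI[of _ "min e e'"] exI[of _ "max B B'"] conjI allI impI) auto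
qed

text \<open>The potential differs from 2 \<epsilon> cos by O(\<epsilon>^2) together with its
  derivatives up to order \<open>M\<close>; integrating by parts turns this into decay with the
  factor \<epsilon>^2. Evenness and reality of the profile make \<open>q\<close> even and
  real.\<close>

lemma potential_coefficients:
  assumes wf: "wave_family j \<gamma> 1 \<alpha>\<^sub>2 k \<eta> c" and M: "M \<ge> 2"
  obtains e Q where "e > 0" "Q \<ge> 0"
    "\<And>\<epsilon>. \<bar>\<epsilon>\<bar> < e \<Longrightarrow> \<bar>c \<epsilon> - wave_c0 j \<gamma> k\<bar> \<le> Q * \<epsilon>\<^sup>2"
    "\<And>\<epsilon>. \<bar>\<epsilon>\<bar> < e \<Longrightarrow> continuous_on UNIV (\<lambda>z. 2 * 1 * \<eta> \<epsilon> z + 3 * \<alpha>\<^sub>2 * (\<eta> \<epsilon> z)\<^sup>2)"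
    "\<And>\<epsilon>. \<bar>\<epsilon>\<bar> < e \<Longrightarrow> \<exists>q. (\<forall>n. fourier_coeff (\<lambda>z. of_real (2 * 1 * \<eta> \<epsilon> z + 3 * \<alpha>\<^sub>2 * (\<eta> \<epsilon> z)\<^sup>2)) n = of_real (q n)) \<and>
      (\<forall>n. q (- n) = q n) \<and>
      (\<forall>n. \<bar>q n - (if \<bar>n\<bar> = 1 then \<epsilon> else 0)\<bar> \<le> Q * \<epsilon>\<^sup>2 / (1 + real_of_int \<bar>n\<bar>) ^ M) \<and>
      (\<forall>z. of_real (2 * 1 * \<eta> \<epsilon> z + 3 * \<alpha>\<^sub>2 * (\<eta> \<epsilon> z)\<^sup>2) = (\<Sum>\<^sub>\<infinity>n. complex_of_real (q n) * cis (of_int n * z)))"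
proof -
  obtain h1 where h1: "deriv_family h1" "h1 0 = cos"
    and he: "\<And>m. \<exists>e>0. \<exists>B\<ge>0. \<forall>\<epsilon> z. \<bar>\<epsilon>\<bar> < e \<longrightarrow> \<bar>(deriv ^^ m) (\<eta> \<epsilon>) z - \<epsilon> * h1 m z\<bar> \<le> B * \<epsilon>\<^sup>2 \<and> \<bar>(deriv ^^ m) (\<eta> \<epsilon>) z\<bar> \<le> B * \<bar>\<epsilon>\<bar>"
    using wave_profile_expansion[OF wf] by blast
  obtain e0 B where e0: "e0 > 0" "B \<ge> 0" and eB: "\<And>m \<epsilon> z. m \<le> M \<Longrightarrow> \<bar>\<epsilon>\<bar> < e0 \<Longrightarrow> \<bar>(deriv ^^ m) (\<eta> \<epsilon>) z - \<epsilon> * h1 m z\<bar> \<le> B * \<epsilon>\<^sup>2 \<and> \<bar>(deriv ^^ m) (\<eta> \<epsilon>) z\<bar> \<le> B * \<bar>\<epsilon>\<bar>"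
    using wave_profile_uniform[OF he, of M] by blast
  obtain e1 where e1: "e1 > 0" and wave: "\<And>\<epsilon>. \<bar>\<epsilon>\<bar> < e1 \<Longrightarrow> periodic_2pi (\<eta> \<epsilon>) \<and> smooth (\<eta> \<epsilon>) \<and> (\<forall>z. \<eta> \<epsilon> (- z) = \<eta> \<epsilon> z)"
    using wf unfolding wave_family_def by blast
  obtain e2 B2 where e2: "e2 > 0" "B2 \<ge> 0" and c: "\<And>\<epsilon>. \<bar>\<epsilon>\<bar> < e2 \<Longrightarrow> \<bar>c \<epsilon> - wave_c0 j \<gamma> k\<bar> \<le> B2 * \<epsilon>\<^sup>2"
    using wave_speed_expansion[OF wf] by blast
  define e where "e = min e0 (min e1 e2)"
  define B3 where "B3 = 2 * B + 3 * \<bar>\<alpha>\<^sub>2\<bar> * (2 ^ M * B\<^sup>2)"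
  define Q where "Q = max B2 (2 ^ M * B3)"
  have B3: "B3 \<ge> 0" using e0 by (simp add: B3_def)
  show ?thesis
  proof (rule that[of e Q])
    show "e > 0" using e0 e1 e2 by (simp add: e_def)
    show "Q \<ge> 0" using e2 by (simp add: Q_def le_max_iff_disj)
    fix \<epsilon> assume "\<bar>\<epsilon>\<bar> < e"
    then have \<epsilon>: "\<bar>\<epsilon>\<bar> < e0" "\<bar>\<epsilon>\<bar> < e1" "\<bar>\<epsilon>\<bar> < e2" by (auto simp: e_def)
    have "B2 * \<epsilon>\<^sup>2 \<le> Q * \<epsilon>\<^sup>2" unfolding Q_def by (intro mult_right_mono) auto
    then show "\<bar>c \<epsilon> - wave_c0 j \<gamma> k\<bar> \<le> Q * \<epsilon>\<^sup>2" using c[OF \<epsilon>(3)] by linarith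
    define H where "H m = (deriv ^^ m) (\<eta> \<epsilon>)" for m
    define p where "p z = 2 * 1 * \<eta> \<epsilon> z + 3 * \<alpha>\<^sub>2 * (\<eta> \<epsilon> z)\<^sup>2" for z
    have H: "deriv_family H" unfolding H_def using wave[OF \<epsilon>(2)] by (intro smooth_deriv_family) simp
    have H0: "H 0 = \<eta> \<epsilon>" by (simp add: H_def)
    have per: "\<eta> \<epsilon> (z + 2 * pi) = \<eta> \<epsilon> z" and even: "\<eta> \<epsilon> (- z) = \<eta> \<epsilon> z" for z
      using wave[OF \<epsilon>(2)] by (auto simp: periodic_2pi_def)
    have HH: "deriv_family (\<lambda>m. prod_family m H H)"
      unfolding deriv_family_def using prod_family_deriv[OF H H] by blast
    define P where "P m z = 2 * H m z + (3 * \<alpha>\<^sub>2) * prod_family m H H z" for m z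
    have P: "deriv_family P" unfolding P_def by (rule deriv_family_lin[OF H HH])
    have P0: "P 0 = p" by (auto simp: P_def p_def H0 power2_eq_square)
    have perp: "periodic_2pi p" by (simp add: periodic_2pi_def p_def per)
    have cp: "continuous_on S p" for S using deriv_family_continuous[OF P, of S 0] by (simp add: P0)
    then show "continuous_on UNIV (\<lambda>z. 2 * 1 * \<eta> \<epsilon> z + 3 * \<alpha>\<^sub>2 * (\<eta> \<epsilon> z)\<^sup>2)" by (simp add: p_def[abs_def])
    \<comment> \<open>The potential minus its leading part 2 \<epsilon> cos, whose coefficients at
      -1 and 1 are exactly \<epsilon>.\<close>
    define R where "R m z = 1 * P m z + (- 2 * \<epsilon>) * h1 m z" for m z
    have R: "deriv_family R" unfolding R_def by (rule deriv_family_lin[OF P h1(1)])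
    have R0: "R 0 z = p z - \<epsilon> * (2 * cos z)" for z by (simp add: R_def P0 h1)
    have perR: "periodic_2pi (R 0)" using perp by (simp add: periodic_2pi_def R0)
    have Rle: "\<bar>R m z\<bar> \<le> B3 * \<epsilon>\<^sup>2" if m: "m \<le> M" for m z
    proof -
      have "\<bar>prod_family m H H z\<bar> \<le> 2 ^ m * ((B * \<bar>\<epsilon>\<bar>) * (B * \<bar>\<epsilon>\<bar>))"
        using m eB \<epsilon>(1) by (intro prod_family_le) (auto simp: H_def)
      also have "\<dots> \<le> 2 ^ M * ((B * \<bar>\<epsilon>\<bar>) * (B * \<bar>\<epsilon>\<bar>))"
        using m e0 by (intro mult_right_mono power_increasing) auto
      also have "\<dots> = 2 ^ M * B\<^sup>2 * \<epsilon>\<^sup>2" by (simp add: power2_eq_square)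
      finally have "\<bar>(3 * \<alpha>\<^sub>2) * prod_family m H H z\<bar> \<le> 3 * \<bar>\<alpha>\<^sub>2\<bar> * (2 ^ M * B\<^sup>2 * \<epsilon>\<^sup>2)"
        unfolding abs_mult by (intro mult_mono) auto
      moreover have "\<bar>H m z - \<epsilon> * h1 m z\<bar> \<le> B * \<epsilon>\<^sup>2" using eB[OF m \<epsilon>(1)] by (simp add: H_def)
      moreover have "\<bar>2 * x + y\<bar> \<le> 2 * a + b" if "\<bar>y\<bar> \<le> b" "\<bar>x\<bar> \<le> a" for x y a b :: real using that by linarith
      ultimately have "\<bar>2 * (H m z - \<epsilon> * h1 m z) + (3 * \<alpha>\<^sub>2) * prod_family m H H z\<bar> \<le>
          2 * (B * \<epsilon>\<^sup>2) + 3 * \<bar>\<alpha>\<^sub>2\<bar> * (2 ^ M * B\<^sup>2 * \<epsilon>\<^sup>2)" by blast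
      also have "\<dots> = B3 * \<epsilon>\<^sup>2" by (simp add: B3_def algebra_simps)
      also have "2 * (H m z - \<epsilon> * h1 m z) + (3 * \<alpha>\<^sub>2) * prod_family m H H z = R m z"
        by (simp add: R_def P_def algebra_simps)
      finally show ?thesis .
    qed
    define q where "q n = Re (fourier_coeff (\<lambda>z. of_real (p z)) n)" for n
    have refl: "fourier_coeff (\<lambda>z. of_real (p z)) (- n) = fourier_coeff (\<lambda>z. of_real (p z)) n" for n
      by (rule fourier_coeff_reflect) (simp_all add: p_def even per periodic_2pi_def)
    have real: "fourier_coeff (\<lambda>z. of_real (p z)) n = of_real (q n)" for n
      using fourier_coeff_cnj[of "\<lambda>z. of_real (p z)" n] refl[of n]
      by (simp add: q_def complex_eq_iff)
    have dec: "\<bar>q n - (if \<bar>n\<bar> = 1 then \<epsilon> else 0)\<bar> \<le> Q * \<epsilon>\<^sup>2 / (1 + real_of_int \<bar>n\<bar>) ^ M" for n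
    proof -
      have i: "set_integrable lborel {0..2 * pi} (\<lambda>z. complex_of_real (p z))"
        "set_integrable lborel {0..2 * pi} (\<lambda>z. complex_of_real \<epsilon> * complex_of_real (2 * cos z))"
        by (intro borel_integrable_atLeastAtMost' continuous_intros cp)+
      have "fourier_coeff (\<lambda>z. of_real (R 0 z)) n = fourier_coeff (\<lambda>z. of_real (p z) - of_real \<epsilon> * of_real (2 * cos z)) n"
        by (simp add: R0)
      also have "\<dots> = of_real (q n) - of_real \<epsilon> * (if \<bar>n\<bar> = 1 then 1 else 0)"
        by (simp only: fourier_coeff_diff[OF i] fourier_coeff_cmult fourier_coeff_cos real)
      also have "\<dots> = of_real (q n - (if \<bar>n\<bar> = 1 then \<epsilon> else 0))" by simp
      finally have "\<bar>q n - (if \<bar>n\<bar> = 1 then \<epsilon> else 0)\<bar> = cmod (fourier_coeff (\<lambda>z. of_real (R 0 z)) n)"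
        by (simp only: norm_of_real)
      also have "\<dots> \<le> 2 ^ M * (B3 * \<epsilon>\<^sup>2) / (1 + real_of_int \<bar>n\<bar>) ^ M"
        by (rule deriv_family_decay[OF R perR Rle])
      also have "\<dots> \<le> Q * \<epsilon>\<^sup>2 / (1 + real_of_int \<bar>n\<bar>) ^ M"
      proof (rule divide_right_mono)
        have "(2 ^ M * B3) * \<epsilon>\<^sup>2 \<le> Q * \<epsilon>\<^sup>2" unfolding Q_def by (intro mult_right_mono) auto
        then show "2 ^ M * (B3 * \<epsilon>\<^sup>2) \<le> Q * \<epsilon>\<^sup>2" by (simp add: mult.assoc)
      qed simp
      finally show ?thesis .
    qed
    have "\<exists>Lp. \<forall>z. \<bar>P 1 z\<bar> \<le> Lp"
    proof -
      have "\<bar>P 1 z\<bar> \<le> 2 * (B * \<bar>\<epsilon>\<bar>) + 3 * \<bar>\<alpha>\<^sub>2\<bar> * (2 ^ 1 * ((B * \<bar>\<epsilon>\<bar>) * (B * \<bar>\<epsilon>\<bar>)))" for z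
      proof -
        have "\<bar>prod_family 1 H H z\<bar> \<le> 2 ^ 1 * ((B * \<bar>\<epsilon>\<bar>) * (B * \<bar>\<epsilon>\<bar>))"
          using M eB \<epsilon>(1) by (intro prod_family_le) (auto simp: H_def)
        then have "\<bar>(3 * \<alpha>\<^sub>2) * prod_family 1 H H z\<bar> \<le> 3 * \<bar>\<alpha>\<^sub>2\<bar> * (2 ^ 1 * ((B * \<bar>\<epsilon>\<bar>) * (B * \<bar>\<epsilon>\<bar>)))"
          unfolding abs_mult by (intro mult_mono) auto
        moreover have "\<bar>H 1 z\<bar> \<le> B * \<bar>\<epsilon>\<bar>" using eB[of 1 \<epsilon> z] M \<epsilon>(1) by (simp add: H_def)
        ultimately show ?thesis unfolding P_def by linarith
      qed
      then show ?thesis by blast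
    qed
    then obtain Lp where Lp: "\<And>z. \<bar>P 1 z\<bar> \<le> Lp" by blast
    have lips: "\<bar>p x - p y\<bar> \<le> Lp * \<bar>x - y\<bar>" for x y
      using field_differentiable_bound[of UNIV p "P 1" Lp x y] deriv_familyD[OF P, of 0] Lp
      by (simp add: P0 norm_minus_commute)
    have summ: "(\<lambda>n. cmod (fourier_coeff (\<lambda>z. of_real (p z)) n)) summable_on UNIV"
    proof (rule summable_on_comparison_test[OF summable_on_cmult_right[OF summable_int_inv_sq, of "4 * \<bar>\<epsilon>\<bar> + Q * \<epsilon>\<^sup>2"]])
      fix n :: int
      let ?x = "1 + real_of_int \<bar>n\<bar>"
      have x: "?x \<ge> 1" by simp
      have "?x\<^sup>2 \<le> ?x ^ M" using M x by (intro power_increasing)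
      then have "Q * \<epsilon>\<^sup>2 / ?x ^ M \<le> Q * \<epsilon>\<^sup>2 / ?x\<^sup>2"
        using x e2 by (intro divide_left_mono) (auto simp: Q_def le_max_iff_disj intro!: mult_pos_pos zero_less_power)
      moreover have "\<bar>if \<bar>n\<bar> = 1 then \<epsilon> else 0\<bar> \<le> 4 * \<bar>\<epsilon>\<bar> / ?x\<^sup>2"
      proof (cases "\<bar>n\<bar> = 1")
        case True
        then have "?x = 2" by linarith
        then show ?thesis using True by simp
      qed simp
      ultimately have "\<bar>q n\<bar> \<le> 4 * \<bar>\<epsilon>\<bar> / ?x\<^sup>2 + Q * \<epsilon>\<^sup>2 / ?x\<^sup>2" using dec[of n] by linarith
      then show "cmod (fourier_coeff (\<lambda>z. of_real (p z)) n) \<le> (4 * \<bar>\<epsilon>\<bar> + Q * \<epsilon>\<^sup>2) * (1 / ?x\<^sup>2)"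
        unfolding real norm_of_real by (simp add: add_divide_distrib)
    qed simp
    have inv: "of_real (p z) = (\<Sum>\<^sub>\<infinity>n. complex_of_real (q n) * cis (of_int n * z))" for z
      unfolding real[symmetric]
    proof (rule fourier_inversion[OF _ _ _ summ])
      show "continuous_on UNIV (\<lambda>z. complex_of_real (p z))" by (intro continuous_intros cp)
      show "periodic_2pi (\<lambda>z. complex_of_real (p z))" using perp by (simp add: periodic_2pi_def)
      show "cmod (of_real (p x) - of_real (p y)) \<le> Lp * \<bar>x - y\<bar>" for x y
        using lips[of x y] by (simp flip: of_real_diff)
    qed
    have "q (- n) = q n" for n by (simp add: q_def refl)
    with real dec inv show "\<exists>q. (\<forall>n. fourier_coeff (\<lambda>z. of_real (2 * 1 * \<eta> \<epsilon> z + 3 * \<alpha>\<^sub>2 * (\<eta> \<epsilon> z)\<^sup>2)) n = of_real (q n)) \<and>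
      (\<forall>n. q (- n) = q n) \<and>
      (\<forall>n. \<bar>q n - (if \<bar>n\<bar> = 1 then \<epsilon> else 0)\<bar> \<le> Q * \<epsilon>\<^sup>2 / (1 + real_of_int \<bar>n\<bar>) ^ M) \<and>
      (\<forall>z. of_real (2 * 1 * \<eta> \<epsilon> z + 3 * \<alpha>\<^sub>2 * (\<eta> \<epsilon> z)\<^sup>2) = (\<Sum>\<^sub>\<infinity>n. complex_of_real (q n) * cis (of_int n * z)))"
      unfolding p_def by blast
  qed
qed

section \<open>From a solution of the mode equations to a kernel of the operator\<close>

section \<open>Eigenfunctions and failure of invertibility\<close>

lemma fourier_coeff_zero [simp]: "fourier_coeff (\<lambda>_. 0) n = 0"
  by (simp add: fourier_coeff_def)

text \<open>Invertibility contains uniqueness up to null sets. With right side 0 both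
  \<open>\<phi>\<close> and 0 would be solutions, so every Fourier coefficient of
  \<open>\<phi>\<close> would vanish.\<close>

lemma kernel_not_invertible:
  assumes \<phi>: "\<phi> \<in> HsT (2 + max b 0)" and ker: "G_op j \<gamma> \<alpha>\<^sub>1 \<alpha>\<^sub>2 k p c \<xi> lam \<rho> \<phi> (\<lambda>_. 0)"
    and nz: "fourier_coeff \<phi> n \<noteq> 0"
  shows "\<not> G_invertible j b \<gamma> \<alpha>\<^sub>1 \<alpha>\<^sub>2 k p c \<xi> lam \<rho>"
proof
  assume inv: "G_invertible j b \<gamma> \<alpha>\<^sub>1 \<alpha>\<^sub>2 k p c \<xi> lam \<rho>"
  have L2: "(\<lambda>_. 0) \<in> L2T" by (intro continuous_imp_L2T) (auto simp: periodic_2pi_def)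
  then obtain \<phi>' where u: "\<And>\<phi>''. \<phi>'' \<in> HsT (2 + max b 0) \<Longrightarrow> G_op j \<gamma> \<alpha>\<^sub>1 \<alpha>\<^sub>2 k p c \<xi> lam \<rho> \<phi>'' (\<lambda>_. 0) \<Longrightarrow>
      AE z in lborel. \<phi>'' z = \<phi>' z"
    using inv unfolding G_invertible_def by blast
  have "AE z in lborel. 0 = \<phi>' z"
    by (rule u) (auto simp: HsT_def L2 G_op_def)
  with u[OF \<phi> ker] have ae: "AE z in lborel. \<phi> z = 0" by eventually_elim simp
  have "(LINT z:{0..2 * pi}|lborel. cis (- (of_int n * z)) * \<phi> z) = 0"
    unfolding set_lebesgue_integral_def
    by (rule integral_eq_zero_AE) (use ae in eventually_elim, simp)
  then show False using nz by (simp add: fourier_coeff_def)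
qed

text \<open>As \<open>r \<ge> s + 1\<close>, the Sobolev weight is at most (1 + |n|)^(2 (r - 1)),
  leaving the summable bound C^2 / (1 + |n|)^2.\<close>

lemma HsT_series:
  fixes a :: "int \<Rightarrow> complex"
  assumes a: "\<And>n. cmod (a n) \<le> C / (1 + real_of_int \<bar>n\<bar>) ^ r" and r: "real r \<ge> s + 1" and s: "s \<ge> 2"
  shows "(\<lambda>n. cmod (a n)) summable_on UNIV" "(\<lambda>z. \<Sum>\<^sub>\<infinity>m. a m * cis (of_int m * z)) \<in> HsT s"
proof -
  have C: "C \<ge> 0" using order_trans[OF norm_ge_zero a[of 0]] by simp
  have r2: "r \<ge> 2" using r s by linarith
  show sm: "(\<lambda>n. cmod (a n)) summable_on UNIV"
  proof (rule summable_on_comparison_test[OF summable_on_cmult_right[OF summable_int_inv_sq, of C]])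
    fix n :: int
    let ?x = "1 + real_of_int \<bar>n\<bar>"
    have "?x\<^sup>2 \<le> ?x ^ r" using r2 by (intro power_increasing) auto
    then have "C / ?x ^ r \<le> C / ?x\<^sup>2"
      using C by (intro divide_left_mono) (auto intro!: mult_pos_pos zero_less_power add_pos_nonneg)
    then show "cmod (a n) \<le> C * (1 / ?x\<^sup>2)" using a[of n] by simp
  qed simp
  have "(\<lambda>n. (1 + (real_of_int n)\<^sup>2) powr s * (cmod (a n))\<^sup>2) summable_on UNIV"
  proof (rule summable_on_comparison_test[OF summable_on_cmult_right[OF summable_int_inv_sq, of "C\<^sup>2"]])
    fix n :: int
    let ?x = "1 + real_of_int \<bar>n\<bar>"
    have x: "?x \<ge> 1" by simp
    then have xr: "0 < ?x ^ (r - 1)" by (intro zero_less_power) linarith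
    have "1 + (real_of_int n)\<^sup>2 \<le> ?x\<^sup>2" by (simp add: power2_sum)
    then have "(1 + (real_of_int n)\<^sup>2) powr s \<le> (?x\<^sup>2) powr s" using s by (intro powr_mono2) auto
    also have "\<dots> = ?x powr (2 * s)" using x by (simp add: powr_powr powr_numeral[symmetric] del: powr_numeral)
    also have "\<dots> \<le> ?x powr real (2 * (r - 1))" using r r2 x by (intro powr_mono) (auto simp: of_nat_diff)
    also have "\<dots> = (?x ^ (r - 1))\<^sup>2" using x by (subst powr_realpow) (simp_all add: mult.commute flip: power_mult)
    finally have 1: "(1 + (real_of_int n)\<^sup>2) powr s \<le> (?x ^ (r - 1))\<^sup>2" .
    have "?x ^ r = ?x ^ (r - 1) * ?x" using r2 by (cases r) auto
    then have "cmod (a n) \<le> C / (?x ^ (r - 1) * ?x)" using a[of n] by simp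
    then have "(cmod (a n))\<^sup>2 \<le> (C / (?x ^ (r - 1) * ?x))\<^sup>2" by (rule power_mono) simp
    with 1 have "(1 + (real_of_int n)\<^sup>2) powr s * (cmod (a n))\<^sup>2 \<le> (?x ^ (r - 1))\<^sup>2 * (C / (?x ^ (r - 1) * ?x))\<^sup>2"
      by (intro mult_mono) auto
    also have "\<dots> = (?x ^ (r - 1) * (C / (?x ^ (r - 1) * ?x)))\<^sup>2" by (rule power_mult_distrib[symmetric])
    also have "?x ^ (r - 1) * (C / (?x ^ (r - 1) * ?x)) = C / ?x" using xr by simp
    also have "(C / ?x)\<^sup>2 = C\<^sup>2 * (1 / ?x\<^sup>2)" by (simp add: power_divide)
    finally show "(1 + (real_of_int n)\<^sup>2) powr s * (cmod (a n))\<^sup>2 \<le> C\<^sup>2 * (1 / ?x\<^sup>2)" .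
  qed simp
  then show "(\<lambda>z. \<Sum>\<^sub>\<infinity>m. a m * cis (of_int m * z)) \<in> HsT s"
    unfolding HsT_def mem_Collect_eq fourier_coeff_series[OF sm]
    by (intro conjI continuous_imp_L2T continuous_series sm series_periodic)
qed

text \<open>The negative integers are listed as \<open>- m - 1\<close>, the index paired with
  \<open>m\<close> by the reflection at Floquet exponent 1/2.\<close>

lemma infsum_int_split:
  fixes f :: "int \<Rightarrow> complex"
  assumes "(\<lambda>n. cmod (f n)) summable_on UNIV"
  shows "infsum f UNIV = (\<Sum>m. f (int m)) + (\<Sum>m. f (- int m - 1))"
proof -
  have sub: "(\<lambda>n. cmod (f n)) summable_on A" for A
    by (rule summable_on_subset_banach[OF assms]) simp
  have part: "infsum f (range h) = (\<Sum>m. f (h m))" if h: "inj h" for h :: "nat \<Rightarrow> int"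
  proof -
    have "(f has_sum infsum f (range h)) (range h)"
      by (rule has_sum_infsum[OF abs_summable_summable[OF sub]])
    then have "((\<lambda>m. f (h m)) has_sum infsum f (range h)) UNIV"
      using has_sum_reindex[OF h, of f "infsum f (range h)"] by (simp add: o_def)
    then show ?thesis by (intro sums_unique has_sum_imp_sums)
  qed
  have U: "UNIV = range int \<union> range (\<lambda>m. - int m - 1)"
  proof (intro equalityI subsetI)
    fix n :: int assume "n \<in> UNIV"
    show "n \<in> range int \<union> range (\<lambda>m. - int m - 1)"
    proof (cases "n \<ge> 0")
      case True
      then show ?thesis by (auto intro!: image_eqI[of _ _ "nat n"])
    next
      case False
      then show ?thesis by (auto intro!: image_eqI[of _ _ "nat (- n - 1)"])
    qed
  qed simp
  have "infsum f UNIV = infsum f (range int) + infsum f (range (\<lambda>m. - int m - 1))"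
    by (subst U, rule infsum_Un_disjoint) (auto intro!: abs_summable_summable[OF sub])
  then show ?thesis by (simp add: part inj_def)
qed

text \<open>The sequence is extended by \<open>a (- m - 1) = cnj (w m)\<close>. Since
  \<open>q\<close> is real and even and \<open>j\<close> is even, the equation of mode
  \<open>- m - 1\<close> is the conjugate of that of mode \<open>m\<close>.\<close>

lemma unstable_mode_not_invertible:
  fixes w :: "nat \<Rightarrow> complex" and p :: "real \<Rightarrow> real"
  assumes w0: "w 0 \<noteq> 0" and wC: "\<And>n. (1 + real n) ^ r * cmod (w n) \<le> C"
    and r: "real r \<ge> 3 + max b 0" and k: "k \<noteq> 0" and j_even: "\<And>x. j (- x) = j x"
    and cont: "continuous_on UNIV (\<lambda>z. 2 * \<alpha>\<^sub>1 * p z + 3 * \<alpha>\<^sub>2 * (p z)\<^sup>2)"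
    and q: "\<And>n. fourier_coeff (\<lambda>z. of_real (2 * \<alpha>\<^sub>1 * p z + 3 * \<alpha>\<^sub>2 * (p z)\<^sup>2)) n = of_real (q n)"
    and q_even: "\<And>n. q (- n) = q n"
    and eq: "\<And>n. (of_real (k\<^sup>2 * (c - j (k * wavenum n)) - (\<rho>\<^sup>2 + \<gamma>) / (wavenum n)\<^sup>2) + \<i> * of_real (l / wavenum n)) * w n =
      of_real (k\<^sup>2) * ((\<Sum>m. of_real (q (int n - int m)) * w m) + (\<Sum>m. of_real (q (int n + int m + 1)) * cnj (w m)))"
  shows "\<not> G_invertible j b \<gamma> \<alpha>\<^sub>1 \<alpha>\<^sub>2 k p c (1 / 2) (of_real l) \<rho>"
proof -
  define a where "a n = (if n \<ge> 0 then w (nat n) else cnj (w (nat (- n - 1))))" for n :: int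
  have a1: "a (int m) = w m" and a2: "a (- int m - 1) = cnj (w m)" for m by (auto simp: a_def)
  have C: "C \<ge> 0" using order_trans[OF _ wC[of 0]] by simp
  have a_le: "cmod (a n) \<le> (2 ^ r * C) / (1 + real_of_int \<bar>n\<bar>) ^ r" for n
  proof -
    obtain m where m: "cmod (a n) = cmod (w m)" "1 + real_of_int \<bar>n\<bar> \<le> 2 * (1 + real m)"
    proof (cases "n \<ge> 0")
      case True
      then show ?thesis by (intro that[of "nat n"]) (auto simp: a_def)
    next
      case False
      then show ?thesis by (intro that[of "nat (- n - 1)"]) (auto simp: a_def)
    qed
    have "cmod (a n) * (1 + real_of_int \<bar>n\<bar>) ^ r \<le> cmod (w m) * (2 * (1 + real m)) ^ r"
      unfolding m(1) using m(2) by (intro mult_left_mono power_mono) auto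
    also have "\<dots> = 2 ^ r * ((1 + real m) ^ r * cmod (w m))"
      unfolding power_mult_distrib by (simp only: mult_ac)
    also have "\<dots> \<le> 2 ^ r * C" by (intro mult_left_mono wC) simp
    finally show ?thesis by (simp add: pos_le_divide_eq add_pos_nonneg)
  qed
  define \<phi> where "\<phi> = (\<lambda>z. \<Sum>\<^sub>\<infinity>m. a m * cis (of_int m * z))"
  have sm: "(\<lambda>n. cmod (a n)) summable_on UNIV" and \<phi>: "\<phi> \<in> HsT (2 + max b 0)"
    using HsT_series[OF a_le, of "2 + max b 0"] r unfolding \<phi>_def by auto
  have co: "fourier_coeff \<phi> n = a n" for n unfolding \<phi>_def by (rule fourier_coeff_series[OF sm])
  let ?P = "\<lambda>z. complex_of_real (2 * \<alpha>\<^sub>1 * p z + 3 * \<alpha>\<^sub>2 * (p z)\<^sup>2)"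
  have iP: "set_integrable lborel {0..2 * pi} ?P"
    by (intro borel_integrable_atLeastAtMost' continuous_on_of_real continuous_on_subset[OF cont]) simp
  define S where "S n = (\<Sum>m. of_real (q (int n - int m)) * w m) + (\<Sum>m. of_real (q (int n + int m + 1)) * cnj (w m))" for n
  have split: "fourier_coeff (\<lambda>z. ?P z * \<phi> z) n = (\<Sum>m. w m * of_real (q (n - int m))) + (\<Sum>m. cnj (w m) * of_real (q (n + int m + 1)))" for n
  proof -
    have "fourier_coeff (\<lambda>z. ?P z * \<phi> z) n = (\<Sum>\<^sub>\<infinity>m. a m * fourier_coeff ?P (n - m))"
      unfolding \<phi>_def using fourier_coeff_series_mult(1)[OF sm iP, of n] by (simp only: mult.commute[of "?P _"])
    also have "\<dots> = (\<Sum>m. a (int m) * fourier_coeff ?P (n - int m)) + (\<Sum>m. a (- int m - 1) * fourier_coeff ?P (n - (- int m - 1)))"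
      by (rule infsum_int_split[OF fourier_coeff_series_mult(2)[OF sm iP]])
    also have "\<dots> = (\<Sum>m. w m * of_real (q (n - int m))) + (\<Sum>m. cnj (w m) * of_real (q (n + int m + 1)))"
      unfolding a1 a2 q by (simp add: algebra_simps)
    finally show ?thesis .
  qed
  have summ: "summable (\<lambda>m. w m * of_real (q (n - int m)))" "summable (\<lambda>m. cnj (w m) * of_real (q (n + int m + 1)))" for n
  proof -
    have *: "summable (\<lambda>m. a (h m) * fourier_coeff ?P (n - h m))" if h: "inj h" for h :: "nat \<Rightarrow> int"
    proof -
      have "(\<lambda>m. cmod (a m * fourier_coeff ?P (n - m))) summable_on range h"
        by (rule summable_on_subset_banach[OF fourier_coeff_series_mult(2)[OF sm iP]]) simp
      then have "(\<lambda>m. cmod (a (h m) * fourier_coeff ?P (n - h m))) summable_on UNIV"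
        unfolding summable_on_reindex[OF h] o_def .
      then have "summable (\<lambda>m. cmod (a (h m) * fourier_coeff ?P (n - h m)))" by (rule summable_on_imp_summable)
      then show ?thesis by (rule summable_norm_cancel)
    qed
    show "summable (\<lambda>m. w m * of_real (q (n - int m)))" using *[of int] unfolding a1 q by (simp add: inj_def)
    have e: "n - (- int m - 1) = n + int m + 1" for m by simp
    show "summable (\<lambda>m. cnj (w m) * of_real (q (n + int m + 1)))"
      using *[of "\<lambda>m. - int m - 1"] unfolding a2 q e by (simp add: inj_def)
  qed
  have conv1: "fourier_coeff (\<lambda>z. ?P z * \<phi> z) (int n) = S n" for n
    unfolding split S_def by (simp add: mult.commute)
  have conv2: "fourier_coeff (\<lambda>z. ?P z * \<phi> z) (- int n - 1) = cnj (S n)" for n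
  proof -
    have e: "q (- int n - 1 - int m) = q (int n + int m + 1)" "q (- int n - 1 + int m + 1) = q (int n - int m)" for m
    proof -
      have "- int n - 1 - int m = - (int n + int m + 1)" "- int n - 1 + int m + 1 = - (int n - int m)" by simp_all
      then show "q (- int n - 1 - int m) = q (int n + int m + 1)" "q (- int n - 1 + int m + 1) = q (int n - int m)"
        by (simp_all only: q_even)
    qed
    have "cnj (S n) = (\<Sum>m. cnj (w m * of_real (q (int n - int m)))) + (\<Sum>m. cnj (cnj (w m) * of_real (q (int n + int m + 1))))"
      unfolding S_def by (simp add: bounded_linear.suminf[OF bounded_linear_cnj summ(1)] bounded_linear.suminf[OF bounded_linear_cnj summ(2)] mult.commute)
    then show ?thesis unfolding split e by simp
  qed
  define T where "T n = k\<^sup>2 * (c - j (k * wavenum n)) - (\<rho>\<^sup>2 + \<gamma>) / (wavenum n)\<^sup>2" for n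
  \<comment> \<open>Undoes the division by s^2: as (\<open>\<i>\<close> s)^2 = - s^2, the eigenvalue
    equation is s^2 times the mode equation.\<close>
  have alg: "0 = of_real l * (\<i> * of_real s) * y - (of_real k)\<^sup>2 * (\<i> * of_real s)\<^sup>2 * (of_real (c - J) * y - Z) - of_real (\<rho>\<^sup>2 + \<gamma>) * y"
    if e: "(of_real (k\<^sup>2 * (c - J) - (\<rho>\<^sup>2 + \<gamma>) / s\<^sup>2) + \<i> * of_real (l / s)) * y = of_real (k\<^sup>2) * Z" and s: "s \<noteq> 0"
    for s J :: real and y Z :: complex
  proof -
    have "of_real l * (\<i> * of_real s) * y - (of_real k)\<^sup>2 * (\<i> * of_real s)\<^sup>2 * (of_real (c - J) * y - Z) - of_real (\<rho>\<^sup>2 + \<gamma>) * y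
        = (of_real s)\<^sup>2 * ((of_real (k\<^sup>2 * (c - J) - (\<rho>\<^sup>2 + \<gamma>) / s\<^sup>2) + \<i> * of_real (l / s)) * y - of_real (k\<^sup>2) * Z)"
      using s by (simp add: field_simps power2_eq_square)
    then show ?thesis using e by simp
  qed
  have "G_op j \<gamma> \<alpha>\<^sub>1 \<alpha>\<^sub>2 k p c (1 / 2) (of_real l) \<rho> \<phi> (\<lambda>_. 0)"
    unfolding G_op_def Let_def co fourier_coeff_zero
  proof (intro conjI allI)
    show "(\<lambda>_. 0) \<in> L2T" by (intro continuous_imp_L2T) (auto simp: periodic_2pi_def)
    fix n :: int
    show "0 = of_real l * (\<i> * of_real (of_int n + 1 / 2)) * a n
          - (of_real k)\<^sup>2 * (\<i> * of_real (of_int n + 1 / 2))\<^sup>2 *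
              (of_real (c - j (k * (of_int n + 1 / 2))) * a n - fourier_coeff (\<lambda>z. ?P z * \<phi> z) n)
          - of_real (\<rho>\<^sup>2 + \<gamma>) * a n"
    proof (cases "n \<ge> 0")
      case True
      then obtain m where n: "n = int m" by (metis nonneg_int_cases)
      have s: "real_of_int n + 1 / 2 = wavenum m" by (simp add: n wavenum_def)
      show ?thesis unfolding s unfolding n a1 conv1
        by (rule alg[OF eq[of m, folded S_def]]) simp
    next
      case False
      define m where "m = nat (- n - 1)"
      have n: "n = - int m - 1" using False by (simp add: m_def)
      have s: "real_of_int n + 1 / 2 = - wavenum m" by (simp add: n wavenum_def)
      have j: "j (k * - wavenum m) = j (k * wavenum m)" using j_even[of "k * wavenum m"] by simp
      have "cnj ((of_real (T m) + \<i> * of_real (l / wavenum m)) * w m) = cnj (of_real (k\<^sup>2) * S m)"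
        using eq[of m, folded S_def] by (simp only: T_def)
      then have "(of_real (k\<^sup>2 * (c - j (k * - wavenum m)) - (\<rho>\<^sup>2 + \<gamma>) / (- wavenum m)\<^sup>2) + \<i> * of_real (l / - wavenum m)) * cnj (w m) = of_real (k\<^sup>2) * cnj (S m)"
        unfolding j T_def by simp
      then show ?thesis unfolding s unfolding n a2 conv2 by (rule alg) simp
    qed
  qed
  then show ?thesis
    using \<phi> co[of 0] w0 by (intro kernel_not_invertible[of \<phi> _ _ _ _ _ _ _ _ _ _ _ 0]) (auto simp: a_def)
qed

text \<open>\<open>\<mu>\<close> is the value of \<rho>^2 + \<gamma> that makes mode 0 resonant at
  zero amplitude. At amplitude \<epsilon> it is replaced by
  \<open>\<mu> - \<epsilon> * k^2 * t\<close>, which gives the diagonal the shift required on the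
  block; for a block of one mode \<open>t\<close> is 0.\<close>

lemma instability_of_nonresonant_tail:
  fixes j :: "real \<Rightarrow> real" and b \<gamma> \<alpha>\<^sub>2 k :: real
  assumes \<gamma>: "\<gamma> > 0" and k: "k > 0" and j_even: "\<And>x. j (- x) = j x"
    and unst: "k\<^sup>2 * (j k - j (k / 2)) > 3 * \<gamma>"
    and wf: "wave_family j \<gamma> 1 \<alpha>\<^sub>2 k \<eta> c"
  defines "\<mu> \<equiv> k\<^sup>2 / 4 * (wave_c0 j \<gamma> k - j (k / 2))"
  defines "d \<equiv> \<lambda>n. k\<^sup>2 * (wave_c0 j \<gamma> k - j (k * wavenum n)) - \<mu> / (wavenum n)\<^sup>2"
  assumes tail: "\<delta> > 0" "\<And>n. n \<ge> L \<Longrightarrow> \<delta> \<le> \<bar>d n\<bar>"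
  shows "\<exists>\<rho>0 > 0. \<exists>\<epsilon>0 > 0. \<forall>\<epsilon>. 0 < \<bar>\<epsilon>\<bar> \<and> \<bar>\<epsilon>\<bar> < \<epsilon>0 \<longrightarrow>
           (\<exists>\<rho>. \<bar>\<rho>\<bar> \<ge> \<rho>0 \<and> nonperiodic_instability j b \<gamma> 1 \<alpha>\<^sub>2 k (\<eta> \<epsilon>) (c \<epsilon>) \<rho>)"
proof -
  \<comment> \<open>One more than the Sobolev exponent 2 + max b 0 of the domain, rounded
    up.\<close>
  define r where "r = nat \<lceil>3 + max b 0\<rceil>"
  have r: "real r \<ge> 3 + max b 0" unfolding r_def by (rule real_nat_ceiling_ge)
  then have r2: "r \<ge> 2" by linarith
  have kk: "k\<^sup>2 > 0" using k by simp
  have \<mu>: "\<mu> - \<gamma> > 0"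
  proof -
    have "4 * (\<mu> - \<gamma>) = k\<^sup>2 * (j k - j (k / 2)) - 3 * \<gamma>"
      using k by (simp add: \<mu>_def wave_c0_def field_simps)
    also have "\<dots> > 0" using unst by simp
    finally show ?thesis by simp
  qed
  have d0: "d 0 = 0" by (simp add: d_def \<mu>_def wavenum_def power2_eq_square)
  \<comment> \<open>The resonant block consists of the modes before the first nonzero
    \<open>d n\<close>; it contains mode 0, and the gap at \<open>L\<close> makes it finite.\<close>
  define n0 where "n0 = (LEAST n. d n \<noteq> 0)"
  have "d L \<noteq> 0" using tail(2)[of L] tail(1) by auto
  then have n0: "d n0 \<noteq> 0" unfolding n0_def by (rule LeastI)
  then obtain p where p: "n0 = Suc p" using d0 by (cases n0) auto
  have block: "d n = 0" if "n \<le> p" for n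
    using not_less_Least[of n "\<lambda>n. d n \<noteq> 0"] that p unfolding n0_def by fastforce
  have dp: "d (Suc p) \<noteq> 0" using n0 p by simp
  obtain t where t: "three_term (\<lambda>n. 1 / (wavenum n)\<^sup>2) t (Suc p) = 0"
    using three_term_root[of "\<lambda>n. 1 / (wavenum n)\<^sup>2" p] by auto
  have "r + 2 \<ge> 2" by simp
  from potential_coefficients[OF wf this] obtain e1 Q0 where e1: "e1 > 0" and Q0: "Q0 \<ge> 0"
    and cQ: "\<And>\<epsilon>. \<bar>\<epsilon>\<bar> < e1 \<Longrightarrow> \<bar>c \<epsilon> - wave_c0 j \<gamma> k\<bar> \<le> Q0 * \<epsilon>\<^sup>2"
    and cont: "\<And>\<epsilon>. \<bar>\<epsilon>\<bar> < e1 \<Longrightarrow> continuous_on UNIV (\<lambda>z. 2 * 1 * \<eta> \<epsilon> z + 3 * \<alpha>\<^sub>2 * (\<eta> \<epsilon> z)\<^sup>2)"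
    and qex: "\<And>\<epsilon>. \<bar>\<epsilon>\<bar> < e1 \<Longrightarrow> \<exists>q. (\<forall>n. fourier_coeff (\<lambda>z. of_real (2 * 1 * \<eta> \<epsilon> z + 3 * \<alpha>\<^sub>2 * (\<eta> \<epsilon> z)\<^sup>2)) n = of_real (q n)) \<and>
      (\<forall>n. q (- n) = q n) \<and>
      (\<forall>n. \<bar>q n - (if \<bar>n\<bar> = 1 then \<epsilon> else 0)\<bar> \<le> Q0 * \<epsilon>\<^sup>2 / (1 + real_of_int \<bar>n\<bar>) ^ (r + 2)) \<and>
      (\<forall>z. of_real (2 * 1 * \<eta> \<epsilon> z + 3 * \<alpha>\<^sub>2 * (\<eta> \<epsilon> z)\<^sup>2) = (\<Sum>\<^sub>\<infinity>n. complex_of_real (q n) * cis (of_int n * z)))"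
    by blast
  define Q where "Q = max Q0 (k\<^sup>2 * Q0)"
  have Q: "Q \<ge> 0" using Q0 by (simp add: Q_def le_max_iff_disj)
  have "\<exists>e0>0. \<forall>\<epsilon> q D. \<epsilon> \<noteq> 0 \<longrightarrow> \<bar>\<epsilon>\<bar> < e0 \<longrightarrow> (\<forall>l. q (- l) = q l) \<longrightarrow>
    (\<forall>l. \<bar>q l - (if \<bar>l\<bar> = 1 then \<epsilon> else 0)\<bar> \<le> Q * \<epsilon>\<^sup>2 / (1 + real_of_int \<bar>l\<bar>) ^ (r + 2)) \<longrightarrow>
    (\<forall>n. \<bar>D n - d n - \<epsilon> * k\<^sup>2 * t / (wavenum n)\<^sup>2\<bar> \<le> Q * \<epsilon>\<^sup>2) \<longrightarrow>
    (\<exists>l>0. \<exists>w :: nat \<Rightarrow> complex. w 0 \<noteq> 0 \<and> (\<exists>C. \<forall>n. (1 + real n) ^ r * cmod (w n) \<le> C) \<and>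
    (\<forall>n. (of_real (D n) + \<i> * of_real (l / wavenum n)) * w n =
      of_real (k\<^sup>2) * ((\<Sum>m. of_real (q (int n - int m)) * w m) + (\<Sum>m. of_real (q (int n + int m + 1)) * cnj (w m)))))"
    by (rule resonant_block_instability[where L = L and \<delta> = \<delta> and p = p]) (use kk Q tail r2 block dp t in \<open>simp_all\<close>)
  then obtain e2 where e2: "e2 > 0" and
    main: "\<And>\<epsilon> q D. \<epsilon> \<noteq> 0 \<Longrightarrow> \<bar>\<epsilon>\<bar> < e2 \<Longrightarrow> (\<forall>l. q (- l) = q l) \<Longrightarrow>
    (\<forall>l. \<bar>q l - (if \<bar>l\<bar> = 1 then \<epsilon> else 0)\<bar> \<le> Q * \<epsilon>\<^sup>2 / (1 + real_of_int \<bar>l\<bar>) ^ (r + 2)) \<Longrightarrow>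
    (\<forall>n. \<bar>D n - d n - \<epsilon> * k\<^sup>2 * t / (wavenum n)\<^sup>2\<bar> \<le> Q * \<epsilon>\<^sup>2) \<Longrightarrow>
    (\<exists>l>0. \<exists>w :: nat \<Rightarrow> complex. w 0 \<noteq> 0 \<and> (\<exists>C. \<forall>n. (1 + real n) ^ r * cmod (w n) \<le> C) \<and>
    (\<forall>n. (of_real (D n) + \<i> * of_real (l / wavenum n)) * w n =
      of_real (k\<^sup>2) * ((\<Sum>m. of_real (q (int n - int m)) * w m) + (\<Sum>m. of_real (q (int n + int m + 1)) * cnj (w m)))))"
    by blast
  have "\<forall>\<^sub>F e in at_right 0. (k\<^sup>2 * \<bar>t\<bar>) * e \<le> (\<mu> - \<gamma>) / 2"
    using \<mu> by (intro eventually_mult_le_at_right) simp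
  then obtain e3 where e3: "e3 > 0" "\<And>e. 0 < e \<Longrightarrow> e < e3 \<Longrightarrow> (k\<^sup>2 * \<bar>t\<bar>) * e \<le> (\<mu> - \<gamma>) / 2"
    unfolding eventually_at_right_field by auto
  have "\<exists>\<rho>. \<bar>\<rho>\<bar> \<ge> sqrt ((\<mu> - \<gamma>) / 2) \<and> nonperiodic_instability j b \<gamma> 1 \<alpha>\<^sub>2 k (\<eta> \<epsilon>) (c \<epsilon>) \<rho>"
    if \<epsilon>: "0 < \<bar>\<epsilon>\<bar>" "\<bar>\<epsilon>\<bar> < min e1 (min e2 e3)" for \<epsilon>
  proof -
    have lt: "\<bar>\<epsilon>\<bar> < e1" "\<bar>\<epsilon>\<bar> < e2" "\<bar>\<epsilon>\<bar> < e3" using \<epsilon> by auto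
    obtain q where q: "\<And>n. fourier_coeff (\<lambda>z. of_real (2 * 1 * \<eta> \<epsilon> z + 3 * \<alpha>\<^sub>2 * (\<eta> \<epsilon> z)\<^sup>2)) n = of_real (q n)"
      and q_even: "\<And>n. q (- n) = q n"
      and q_le: "\<And>n. \<bar>q n - (if \<bar>n\<bar> = 1 then \<epsilon> else 0)\<bar> \<le> Q0 * \<epsilon>\<^sup>2 / (1 + real_of_int \<bar>n\<bar>) ^ (r + 2)"
      using qex[OF lt(1)] by blast
    \<comment> \<open>The value imposed on \<rho>^2 + \<gamma>. For small \<epsilon> it keeps at
      least half of the distance \<open>\<mu> - \<gamma>\<close>, which yields the uniform lower
      bound on \<rho>.\<close>
    define m where "m = \<mu> - \<epsilon> * k\<^sup>2 * t"
    have h: "(u - v) / 2 \<le> u - x - v" if "\<bar>x\<bar> \<le> (u - v) / 2" for u v x :: real using abs_le_D1[OF that] by (simp add: field_simps)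
    have mg: "m - \<gamma> \<ge> (\<mu> - \<gamma>) / 2"
      unfolding m_def by (rule h) (use e3(2)[OF \<epsilon>(1) lt(3)] in \<open>simp add: abs_mult mult_ac\<close>)
    define \<rho> where "\<rho> = sqrt (m - \<gamma>)"
    have \<rho>: "\<rho>\<^sup>2 + \<gamma> = m" using mg \<mu> by (simp add: \<rho>_def)
    define D where "D n = k\<^sup>2 * (c \<epsilon> - j (k * wavenum n)) - (\<rho>\<^sup>2 + \<gamma>) / (wavenum n)\<^sup>2" for n
    have q_le': "\<bar>q l - (if \<bar>l\<bar> = 1 then \<epsilon> else 0)\<bar> \<le> Q * \<epsilon>\<^sup>2 / (1 + real_of_int \<bar>l\<bar>) ^ (r + 2)" for l
    proof -
      have "Q0 * \<epsilon>\<^sup>2 \<le> Q * \<epsilon>\<^sup>2" unfolding Q_def by (intro mult_right_mono) auto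
      then have "Q0 * \<epsilon>\<^sup>2 / (1 + real_of_int \<bar>l\<bar>) ^ (r + 2) \<le> Q * \<epsilon>\<^sup>2 / (1 + real_of_int \<bar>l\<bar>) ^ (r + 2)"
        by (rule divide_right_mono) simp
      then show ?thesis using q_le[of l] by linarith
    qed
    have D: "\<bar>D n - d n - \<epsilon> * k\<^sup>2 * t / (wavenum n)\<^sup>2\<bar> \<le> Q * \<epsilon>\<^sup>2" for n
    proof -
      have "D n - d n - \<epsilon> * k\<^sup>2 * t / (wavenum n)\<^sup>2 = k\<^sup>2 * (c \<epsilon> - wave_c0 j \<gamma> k)"
        unfolding D_def d_def \<rho> m_def by (simp add: algebra_simps diff_divide_distrib)
      then have "\<bar>D n - d n - \<epsilon> * k\<^sup>2 * t / (wavenum n)\<^sup>2\<bar> = k\<^sup>2 * \<bar>c \<epsilon> - wave_c0 j \<gamma> k\<bar>" by (simp add: abs_mult)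
      also have "\<dots> \<le> k\<^sup>2 * (Q0 * \<epsilon>\<^sup>2)" by (intro mult_left_mono cQ lt) simp
      also have "\<dots> \<le> Q * \<epsilon>\<^sup>2"
        unfolding Q_def mult.assoc[symmetric] by (intro mult_right_mono) auto
      finally show ?thesis .
    qed
    have "\<epsilon> \<noteq> 0" using \<epsilon> by auto
    from main[OF this lt(2), of q D] q_even q_le' D obtain l w C where l: "l > 0" and w: "w 0 \<noteq> (0 :: complex)"
      "\<And>n. (1 + real n) ^ r * cmod (w n) \<le> C"
      "\<And>n. (of_real (D n) + \<i> * of_real (l / wavenum n)) * w n =
      of_real (k\<^sup>2) * ((\<Sum>m. of_real (q (int n - int m)) * w m) + (\<Sum>m. of_real (q (int n + int m + 1)) * cnj (w m)))"
      by blast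
    have "\<not> G_invertible j b \<gamma> 1 \<alpha>\<^sub>2 k (\<eta> \<epsilon>) (c \<epsilon>) (1 / 2) (of_real l) \<rho>"
      using k by (intro unstable_mode_not_invertible[OF w(1,2) r _ j_even cont[OF lt(1)] q q_even w(3)[unfolded D_def]]) simp
    moreover have "\<bar>\<rho>\<bar> \<ge> sqrt ((\<mu> - \<gamma>) / 2)" using mg \<mu> unfolding \<rho>_def by simp
    ultimately show ?thesis
      using l unfolding nonperiodic_instability_def
      by (intro exI[of _ \<rho>] conjI bexI[of _ "1 / 2"] exI[of _ "of_real l"]) auto
  qed
  moreover have "sqrt ((\<mu> - \<gamma>) / 2) > 0" using \<mu> by simp
  moreover have "min e1 (min e2 e3) > 0" using e1 e2 e3 by simp
  ultimately show ?thesis by blast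
qed

section \<open>Failure of surjectivity, detected by modulated windows far out\<close>

section \<open>The degenerate tail\<close>

text \<open>A window centred at \<open>N\<close> with support of half-width \<open>M\<close>. Its
  Lipschitz constant 1 / M makes it almost invariant under the shifts in a convolution.\<close>

definition triangle :: "nat \<Rightarrow> nat \<Rightarrow> int \<Rightarrow> real" where
  "triangle N M n = max 0 (1 - \<bar>real_of_int n - real N\<bar> / real M)"

lemma triangle_bounds: "0 \<le> triangle N M n" "triangle N M n \<le> 1"
  by (auto simp: triangle_def)

lemma triangle_outside:
  assumes "M > 0" "n \<notin> {int N - int M<..<int N + int M}"
  shows "triangle N M n = 0"
proof -
  have "real_of_int n \<le> real N - real M \<or> real N + real M \<le> real_of_int n" using assms(2) by auto
  then have "real M \<le> \<bar>real_of_int n - real N\<bar>" by linarith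
  then have "1 \<le> \<bar>real_of_int n - real N\<bar> / real M" using assms(1) by simp
  then show ?thesis by (simp add: triangle_def)
qed

lemma triangle_lipschitz: "\<bar>triangle N M m - triangle N M n\<bar> \<le> \<bar>real_of_int (m - n)\<bar> / real M"
proof -
  have "\<bar>max 0 (1 - x) - max 0 (1 - y)\<bar> \<le> \<bar>x - y\<bar>" for x y :: real by (simp add: max_def abs_minus_commute)
  then have "\<bar>triangle N M m - triangle N M n\<bar> \<le> \<bar>\<bar>real_of_int m - real N\<bar> / real M - \<bar>real_of_int n - real N\<bar> / real M\<bar>"
    unfolding triangle_def .
  also have "\<dots> = \<bar>\<bar>real_of_int m - real N\<bar> - \<bar>real_of_int n - real N\<bar>\<bar> / real M"
    by (simp add: diff_divide_distrib[symmetric])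
  also have "\<dots> \<le> \<bar>real_of_int (m - n)\<bar> / real M"
    by (intro divide_right_mono) auto
  finally show ?thesis .
qed

lemma sum_cmod_le:
  assumes "finite J" "real (card J) \<le> c" "(\<Sum>m\<in>J. (cmod (f m))\<^sup>2) \<le> e\<^sup>2" "e \<ge> 0"
  shows "(\<Sum>m\<in>J. cmod (f m)) \<le> sqrt c * e"
proof (rule power2_le_imp_le)
  have c: "c \<ge> 0" using assms(2) of_nat_0_le_iff[of "card J"] by linarith
  have "(\<Sum>m\<in>J. cmod (f m))\<^sup>2 \<le> (\<Sum>m\<in>J. (cmod (f m))\<^sup>2) * real (card J)"
    by (rule sum_squared_le_sum_of_squares)
  also have "\<dots> \<le> e\<^sup>2 * c" using assms by (intro mult_mono) auto
  also have "\<dots> = (sqrt c * e)\<^sup>2" using c by (simp add: power_mult_distrib)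
  finally show "(\<Sum>m\<in>J. cmod (f m))\<^sup>2 \<le> (sqrt c * e)\<^sup>2" .
  show "0 \<le> sqrt c * e" using c assms by simp
qed

lemma infsum_finite_sum:
  fixes f :: "'i \<Rightarrow> 'a \<Rightarrow> 'b::{topological_comm_monoid_add, t2_space}"
  assumes "finite I" "\<And>i. i \<in> I \<Longrightarrow> f i summable_on A"
  shows "(\<Sum>i\<in>I. infsum (f i) A) = (\<Sum>\<^sub>\<infinity>x\<in>A. \<Sum>i\<in>I. f i x)"
proof -
  have "((\<lambda>x. \<Sum>i\<in>I. f i x) has_sum (\<Sum>i\<in>I. infsum (f i) A)) A"
    using assms by (induction I rule: finite_induct) (auto intro!: has_sum_add has_sum_0)
  then show ?thesis by (rule infsumI[symmetric])
qed

text \<open>On a window of width \<open>M\<close> far out, the symbol multiplier is nearly constant and the convolution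
  with \<open>A\<close>, whose symbol vanishes at \<open>z0\<close>, nearly annihilates the modulated triangle.\<close>

lemma window_estimate:
  fixes f :: "int \<Rightarrow> complex" and A :: "int \<Rightarrow> real"
  assumes E: "\<And>J. finite J \<Longrightarrow> (\<Sum>m\<in>J. (1 + (real_of_int m)\<^sup>2)\<^sup>2 * (cmod (f m))\<^sup>2) \<le> E\<^sup>2" "E \<ge> 0"
    and A: "\<And>l. \<bar>A l\<bar> \<le> CA / (1 + real_of_int \<bar>l\<bar>) ^ 5" "(\<Sum>\<^sub>\<infinity>l. of_real (A l) * cis (of_int l * z0)) = 0"
    and NM: "M \<ge> 1" "N \<ge> 4 * M" and K: "K \<ge> 0"
    and \<tau>: "\<And>n. real_of_int n \<ge> real N / 2 \<Longrightarrow> cmod (\<tau> n) \<le> 1 / real M"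
    and Af: "\<And>n. (\<lambda>l. cmod (of_real (A l) * f (n - l))) summable_on UNIV"
    and eq: "\<And>n. y n = of_real K * (\<Sum>\<^sub>\<infinity>l. of_real (A l) * f (n - l)) + \<tau> n * f n"
  shows "cmod (\<Sum>n\<in>{int N - int M<..<int N + int M}. of_real (triangle N M n) * cis (of_int n * z0) * y n)
    \<le> (200 * K * CA * (\<Sum>\<^sub>\<infinity>l::int. 1 / (1 + real_of_int \<bar>l\<bar>)\<^sup>2) + 8) * E / ((real N)\<^sup>2 * sqrt (real M))"
proof -
  let ?I = "{int N - int M<..<int N + int M}" and ?t = "triangle N M"
  let ?S2 = "\<Sum>\<^sub>\<infinity>l::int. 1 / (1 + real_of_int \<bar>l\<bar>)\<^sup>2"
  let ?c = "\<lambda>n::int. cis (of_int n * z0)"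
  define B where "B = E / ((real N)\<^sup>2 * sqrt (real M))"
  have M: "real M \<ge> 1" and N: "real N \<ge> 4 * real M" using NM by auto
  have sM: "sqrt (real M) > 0" "sqrt (real M) * sqrt (real M) = real M" using M by auto
  have Npos: "real N > 0" using M N by linarith
  have B0: "B \<ge> 0" using E(2) by (simp add: B_def)
  have BE: "sqrt (real M) * (E / (real N)\<^sup>2) = real M * B"
  proof -
    have "q * (e / n) = (q * q) * (e / (n * q))" if "q > 0" for q e n :: real using that by simp
    from this[OF sM(1)] show ?thesis unfolding sM(2) B_def .
  qed
  have cardI: "real (card ?I) \<le> 2 * real M" using NM by simp
  have all_le: "(\<Sum>m\<in>J. cmod (f m)) \<le> sqrt c * E" if J: "finite J" "real (card J) \<le> c" for J c
  proof (rule sum_cmod_le[OF J _ E(2)])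
    have "(cmod (f m))\<^sup>2 \<le> (1 + (real_of_int m)\<^sup>2)\<^sup>2 * (cmod (f m))\<^sup>2" for m
      using mult_right_mono[of 1 "(1 + (real_of_int m)\<^sup>2)\<^sup>2" "(cmod (f m))\<^sup>2"] by (simp add: one_le_power)
    then have "(\<Sum>m\<in>J. (cmod (f m))\<^sup>2) \<le> (\<Sum>m\<in>J. (1 + (real_of_int m)\<^sup>2)\<^sup>2 * (cmod (f m))\<^sup>2)" by (rule sum_mono)
    also have "\<dots> \<le> E\<^sup>2" by (rule E(1)[OF J(1)])
    finally show "(\<Sum>m\<in>J. (cmod (f m))\<^sup>2) \<le> E\<^sup>2" .
  qed
  have far_le: "(\<Sum>m\<in>J. cmod (f m)) \<le> sqrt c * (4 * E / (real N)\<^sup>2)"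
    if J: "finite J" "real (card J) \<le> c" "\<And>m. m \<in> J \<Longrightarrow> real_of_int m \<ge> real N / 2" for J c
  proof (rule sum_cmod_le[OF J(1,2)])
    have "(cmod (f m))\<^sup>2 \<le> 16 / (real N) ^ 4 * ((1 + (real_of_int m)\<^sup>2)\<^sup>2 * (cmod (f m))\<^sup>2)" if "m \<in> J" for m
    proof -
      have "(real N / 2)\<^sup>2 \<le> (real_of_int m)\<^sup>2" using J(3)[OF that] by (intro power_mono) auto
      then have "((real N / 2)\<^sup>2)\<^sup>2 \<le> (1 + (real_of_int m)\<^sup>2)\<^sup>2" by (intro power_mono) auto
      then have "(real N) ^ 4 / 16 \<le> (1 + (real_of_int m)\<^sup>2)\<^sup>2" by (simp add: power_divide flip: power_mult)
      then have "1 \<le> 16 / (real N) ^ 4 * (1 + (real_of_int m)\<^sup>2)\<^sup>2" using Npos by (simp add: field_simps)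
      from mult_right_mono[OF this, of "(cmod (f m))\<^sup>2"] show ?thesis by (simp add: mult.assoc)
    qed
    then have "(\<Sum>m\<in>J. (cmod (f m))\<^sup>2) \<le> (\<Sum>m\<in>J. 16 / (real N) ^ 4 * ((1 + (real_of_int m)\<^sup>2)\<^sup>2 * (cmod (f m))\<^sup>2))"
      by (rule sum_mono)
    also have "\<dots> = 16 / (real N) ^ 4 * (\<Sum>m\<in>J. (1 + (real_of_int m)\<^sup>2)\<^sup>2 * (cmod (f m))\<^sup>2)"
      by (simp only: sum_distrib_left)
    also have "\<dots> \<le> 16 / (real N) ^ 4 * E\<^sup>2" by (intro mult_left_mono E(1) J) auto
    also have "\<dots> = (4 * E / (real N)\<^sup>2)\<^sup>2" by (simp add: power_divide power_mult_distrib flip: power_mult)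
    finally show "(\<Sum>m\<in>J. (cmod (f m))\<^sup>2) \<le> (4 * E / (real N)\<^sup>2)\<^sup>2" .
    show "0 \<le> 4 * E / (real N)\<^sup>2" using E(2) by simp
  qed
  define F where "F m = ?c m * f m" for m
  have Fn: "cmod (F m) = cmod (f m)" for m by (simp add: F_def norm_mult)
  \<comment> \<open>The change of the windowed sum under a shift by \<open>l\<close>. The unshifted
    sum drops out of the convolution because the symbol vanishes at \<open>z0\<close>.\<close>
  define \<Delta> where "\<Delta> l = (\<Sum>n\<in>?I. of_real (?t n) * F (n - l)) - (\<Sum>n\<in>?I. of_real (?t n) * F n)" for l
  have \<Delta>_le: "cmod (\<Delta> l) \<le> 200 * (1 + real_of_int \<bar>l\<bar>) ^ 3 * B" for l
  \<comment> \<open>For |l| up to N / 4 the shifted window stays beyond N / 2, where the Sobolev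
    bound is worth a factor of order 1 / N^2, and the Lipschitz bound of the triangle
    applies.\<close>
  proof (cases "4 * real_of_int \<bar>l\<bar> \<le> real N")
    case True
    define J where "J = ?I \<union> (\<lambda>n. n - l) ` ?I"
    have J: "finite J" by (simp add: J_def)
    have cJ: "real (card J) \<le> 4 * real M"
    proof -
      have "card J \<le> card ?I + card ((\<lambda>n. n - l) ` ?I)" unfolding J_def by (rule card_Un_le)
      also have "card ((\<lambda>n. n - l) ` ?I) \<le> card ?I" by (rule card_image_le) simp
      finally have "real (card J) \<le> real (card ?I) + real (card ?I)" by (simp only: of_nat_add[symmetric] of_nat_le_iff)
      then show ?thesis using cardI by linarith
    qed
    have "real_of_int m \<ge> real N / 2" if mJ: "m \<in> J" for m
    proof -
      consider "m \<in> ?I" | n where "n \<in> ?I" "m = n - l" using mJ unfolding J_def by (elim UnE imageE) blast+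
      then have "real N - real M - real_of_int \<bar>l\<bar> \<le> real_of_int m" by cases auto
      then show ?thesis using True N by linarith
    qed
    note fJ = far_le[OF J cJ this]
    have 1: "(\<Sum>n\<in>?I. of_real (?t n) * F (n - l)) = (\<Sum>m\<in>J. of_real (?t (m + l)) * F m)"
    proof -
      have "(\<Sum>n\<in>?I. of_real (?t n) * F (n - l)) = (\<Sum>m\<in>(\<lambda>n. n - l) ` ?I. of_real (?t (m + l)) * F m)"
        by (subst sum.reindex) (auto simp: inj_on_def)
      also have "\<dots> = (\<Sum>m\<in>J. of_real (?t (m + l)) * F m)"
      proof (rule sum.mono_neutral_left)
        show "\<forall>m\<in>J - (\<lambda>n. n - l) ` ?I. of_real (?t (m + l)) * F m = 0"
        proof
          fix m assume m: "m \<in> J - (\<lambda>n. n - l) ` ?I"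
          have "m + l \<notin> ?I"
          proof
            assume "m + l \<in> ?I"
            then have "(m + l) - l \<in> (\<lambda>n. n - l) ` ?I" by (rule imageI)
            then show False using m by simp
          qed
          then have "?t (m + l) = 0" using NM by (intro triangle_outside) auto
          then show "of_real (?t (m + l)) * F m = 0" by simp
        qed
      qed (use J in \<open>auto simp: J_def\<close>)
      finally show ?thesis .
    qed
    have 2: "(\<Sum>n\<in>?I. of_real (?t n) * F n) = (\<Sum>m\<in>J. of_real (?t m) * F m)"
    proof (rule sum.mono_neutral_left)
      show "\<forall>m\<in>J - ?I. of_real (?t m) * F m = 0"
      proof
        fix m assume "m \<in> J - ?I"
        then have "?t m = 0" using NM by (intro triangle_outside) auto
        then show "of_real (?t m) * F m = 0" by simp
      qed
    qed (use J in \<open>auto simp: J_def\<close>)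
    have "\<Delta> l = (\<Sum>m\<in>J. of_real (?t (m + l) - ?t m) * F m)"
      unfolding \<Delta>_def 1 2 by (simp add: sum_subtractf left_diff_distrib)
    also have "cmod \<dots> \<le> (\<Sum>m\<in>J. real_of_int \<bar>l\<bar> / real M * cmod (f m))"
    proof (rule sum_norm_le)
      fix m
      have "\<bar>?t (m + l) - ?t m\<bar> \<le> real_of_int \<bar>l\<bar> / real M" using triangle_lipschitz[of N M "m + l" m] by simp
      then show "cmod (of_real (?t (m + l) - ?t m) * F m) \<le> real_of_int \<bar>l\<bar> / real M * cmod (f m)"
        unfolding norm_mult norm_of_real Fn by (rule mult_right_mono) simp
    qed
    also have "\<dots> = real_of_int \<bar>l\<bar> / real M * (\<Sum>m\<in>J. cmod (f m))" by (simp only: sum_distrib_left)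
    also have "\<dots> \<le> real_of_int \<bar>l\<bar> / real M * (sqrt (4 * real M) * (4 * E / (real N)\<^sup>2))"
      by (intro mult_left_mono fJ) auto
    also have "sqrt (4 * real M) * (4 * E / (real N)\<^sup>2) = 8 * (sqrt (real M) * (E / (real N)\<^sup>2))"
      by (simp add: real_sqrt_mult)
    also have "real_of_int \<bar>l\<bar> / real M * (8 * (sqrt (real M) * (E / (real N)\<^sup>2))) = 8 * real_of_int \<bar>l\<bar> * B"
      unfolding BE using M by simp
    also have "\<dots> \<le> 200 * (1 + real_of_int \<bar>l\<bar>) ^ 3 * B"
    proof (rule mult_right_mono[OF _ B0])
      have "real_of_int \<bar>l\<bar> \<le> (1 + real_of_int \<bar>l\<bar>) ^ 1" by simp
      also have "\<dots> \<le> (1 + real_of_int \<bar>l\<bar>) ^ 3" by (rule power_increasing) auto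
      finally show "8 * real_of_int \<bar>l\<bar> \<le> 200 * (1 + real_of_int \<bar>l\<bar>) ^ 3" by simp
    qed
    finally show ?thesis .
  next
    \<comment> \<open>For larger shifts the crude bound loses M N^2, at most N^3 / 4. This is
      absorbed by (1 + |l|)^3, which the fifth-power decay of \<open>A\<close> can afford.\<close>
    case False
    have tF: "cmod (\<Sum>n\<in>?I. of_real (?t n) * F (n - i)) \<le> sqrt (2 * real M) * E" for i
    proof -
      have "cmod (\<Sum>n\<in>?I. of_real (?t n) * F (n - i)) \<le> (\<Sum>n\<in>?I. cmod (f (n - i)))"
        by (rule sum_norm_le) (use triangle_bounds in \<open>simp add: norm_mult Fn mult_left_le_one_le\<close>)
      also have "\<dots> = (\<Sum>m\<in>(\<lambda>n. n - i) ` ?I. cmod (f m))" by (subst sum.reindex) (auto simp: inj_on_def)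
      also have "\<dots> \<le> sqrt (2 * real M) * E"
        by (rule all_le) (use cardI in \<open>simp_all add: card_image inj_on_def\<close>)
      finally show ?thesis .
    qed
    have "cmod (\<Delta> l) \<le> sqrt (2 * real M) * E + sqrt (2 * real M) * E"
      unfolding \<Delta>_def using order_trans[OF norm_triangle_ineq4 add_mono[OF tF[of l] tF[of 0]]] by simp
    also have "\<dots> = 2 * sqrt 2 * (sqrt (real M) * (E / (real N)\<^sup>2)) * (real N)\<^sup>2"
      using Npos by (simp add: real_sqrt_mult)
    also have "\<dots> = 2 * sqrt 2 * (real M * (real N)\<^sup>2) * B" unfolding BE by simp
    also have "\<dots> \<le> 200 * (1 + real_of_int \<bar>l\<bar>) ^ 3 * B"
    proof (rule mult_right_mono[OF _ B0])
      have "sqrt 2 \<le> (2::real)" using real_sqrt_le_mono[of 2 4] by simp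
      then have "2 * sqrt 2 * (real M * (real N)\<^sup>2) \<le> 2 * 2 * (real N / 4 * (real N)\<^sup>2)"
        using N by (intro mult_mono) auto
      also have "\<dots> = (real N) ^ 3" by (simp add: power3_eq_cube power2_eq_square)
      also have "\<dots> \<le> (4 * (1 + real_of_int \<bar>l\<bar>)) ^ 3" using False by (intro power_mono) auto
      also have "\<dots> \<le> 200 * (1 + real_of_int \<bar>l\<bar>) ^ 3" by (simp only: power_mult_distrib) simp
      finally show "2 * sqrt 2 * (real M * (real N)\<^sup>2) \<le> 200 * (1 + real_of_int \<bar>l\<bar>) ^ 3" .
    qed
    finally show ?thesis .
  qed
  have CA: "CA \<ge> 0" using order_trans[OF abs_ge_zero A(1)[of 0]] by simp
  have first: "cmod (\<Sum>n\<in>?I. of_real (?t n) * ?c n * (\<Sum>\<^sub>\<infinity>l. of_real (A l) * f (n - l))) \<le> 200 * CA * ?S2 * B"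
  proof -
    define T0 where "T0 = (\<Sum>n\<in>?I. of_real (?t n) * F n)"
    have sAc: "(\<lambda>l. cmod (of_real (A l) * ?c l)) summable_on UNIV"
    proof (rule summable_on_comparison_test[OF summable_on_cmult_right[OF summable_int_inv_sq, of CA]])
      fix l :: int
      let ?x = "1 + real_of_int \<bar>l\<bar>"
      have "?x\<^sup>2 \<le> ?x ^ 5" by (intro power_increasing) auto
      then have "CA / ?x ^ 5 \<le> CA / ?x\<^sup>2"
        using CA by (intro divide_left_mono) (auto intro!: mult_pos_pos zero_less_power add_pos_nonneg)
      then show "cmod (of_real (A l) * ?c l) \<le> CA * (1 / ?x\<^sup>2)" using A(1)[of l] by (simp add: norm_mult)
    qed simp
    have shift: "?c n * f (n - l) = ?c l * F (n - l)" for n l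
      unfolding F_def by (simp add: cis_mult left_diff_distrib flip: mult.assoc)
    have eql: "(\<Sum>n\<in>?I. of_real (?t n) * ?c n * (of_real (A l) * f (n - l))) =
        of_real (A l) * ?c l * \<Delta> l + of_real (A l) * ?c l * T0" for l
    proof -
      have "(\<Sum>n\<in>?I. of_real (?t n) * ?c n * (of_real (A l) * f (n - l))) = (\<Sum>n\<in>?I. of_real (A l) * ?c l * (of_real (?t n) * F (n - l)))"
      proof (rule sum.cong[OF refl])
        fix n
        have "of_real (?t n) * ?c n * (of_real (A l) * f (n - l)) = of_real (A l) * of_real (?t n) * (?c n * f (n - l))" by simp
        then show "of_real (?t n) * ?c n * (of_real (A l) * f (n - l)) = of_real (A l) * ?c l * (of_real (?t n) * F (n - l))"
          unfolding shift by simp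
      qed
      also have "\<dots> = of_real (A l) * ?c l * (\<Sum>n\<in>?I. of_real (?t n) * F (n - l))" by (simp only: sum_distrib_left)
      also have "\<dots> = of_real (A l) * ?c l * \<Delta> l + of_real (A l) * ?c l * T0" by (simp add: \<Delta>_def T0_def flip: distrib_left)
      finally show ?thesis .
    qed
    have le: "cmod (of_real (A l) * ?c l * \<Delta> l) \<le> (200 * CA * B) * (1 / (1 + real_of_int \<bar>l\<bar>)\<^sup>2)" for l
    proof -
      let ?x = "1 + real_of_int \<bar>l\<bar>"
      have x: "?x > 0" by (simp add: add_pos_nonneg)
      have "cmod (of_real (A l) * ?c l * \<Delta> l) = \<bar>A l\<bar> * cmod (\<Delta> l)" by (simp add: norm_mult)
      also have "\<dots> \<le> CA / ?x ^ 5 * (200 * ?x ^ 3 * B)" using CA by (intro mult_mono A \<Delta>_le) auto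
      also have "?x ^ 5 = ?x\<^sup>2 * ?x ^ 3" by (simp add: power_add[symmetric])
      also have "CA / (?x\<^sup>2 * ?x ^ 3) * (200 * ?x ^ 3 * B) = (200 * CA * B) * (1 / ?x\<^sup>2)"
      proof -
        have "CA / (u * v) * (200 * v * B) = (200 * CA * B) * (1 / u)" if "v > 0" for u v :: real using that by simp
        from this[OF zero_less_power[OF x, of 3]] show ?thesis .
      qed
      finally show ?thesis .
    qed
    have s: "(\<lambda>l. cmod (of_real (A l) * ?c l * \<Delta> l)) summable_on UNIV"
      by (rule summable_on_comparison_test[OF summable_on_cmult_right[OF summable_int_inv_sq, of "200 * CA * B"] le]) simp
    have "(\<Sum>n\<in>?I. of_real (?t n) * ?c n * (\<Sum>\<^sub>\<infinity>l. of_real (A l) * f (n - l)))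
        = (\<Sum>n\<in>?I. \<Sum>\<^sub>\<infinity>l. of_real (?t n) * ?c n * (of_real (A l) * f (n - l)))"
      by (intro sum.cong refl infsum_cmult_right[symmetric] abs_summable_summable[OF Af])
    also have "\<dots> = (\<Sum>\<^sub>\<infinity>l. \<Sum>n\<in>?I. of_real (?t n) * ?c n * (of_real (A l) * f (n - l)))"
      by (rule infsum_finite_sum) (simp, intro summable_on_cmult_right abs_summable_summable[OF Af])
    also have "\<dots> = (\<Sum>\<^sub>\<infinity>l. of_real (A l) * ?c l * \<Delta> l) + (\<Sum>\<^sub>\<infinity>l. of_real (A l) * ?c l * T0)"
      unfolding eql by (intro infsum_add abs_summable_summable[OF s] summable_on_cmult_left abs_summable_summable[OF sAc])
    also have "(\<Sum>\<^sub>\<infinity>l. of_real (A l) * ?c l * T0) = 0"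
      using A(2) by (subst infsum_cmult_left) (simp_all add: abs_summable_summable[OF sAc])
    finally have eq1: "(\<Sum>n\<in>?I. of_real (?t n) * ?c n * (\<Sum>\<^sub>\<infinity>l. of_real (A l) * f (n - l))) = (\<Sum>\<^sub>\<infinity>l. of_real (A l) * ?c l * \<Delta> l)" by simp
    have "cmod (\<Sum>\<^sub>\<infinity>l. of_real (A l) * ?c l * \<Delta> l) \<le> (\<Sum>\<^sub>\<infinity>l. cmod (of_real (A l) * ?c l * \<Delta> l))"
      by (rule norm_infsum_bound[OF s])
    also have "\<dots> \<le> (\<Sum>\<^sub>\<infinity>l. (200 * CA * B) * (1 / (1 + real_of_int \<bar>l\<bar>)\<^sup>2))"
      by (rule infsum_mono[OF s summable_on_cmult_right[OF summable_int_inv_sq] le])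
    also have "\<dots> = (200 * CA * B) * ?S2" by (rule infsum_cmult_right) (rule summable_int_inv_sq)
    finally show ?thesis unfolding eq1 by (simp add: mult_ac)
  qed
  have second: "cmod (\<Sum>n\<in>?I. of_real (?t n) * ?c n * (\<tau> n * f n)) \<le> 8 * B"
  proof -
    have half: "real_of_int n \<ge> real N / 2" if "n \<in> ?I" for n
    proof -
      have "real N - real M < real_of_int n" using that by auto
      then show ?thesis using N M by linarith
    qed
    have "cmod (\<Sum>n\<in>?I. of_real (?t n) * ?c n * (\<tau> n * f n)) \<le> (\<Sum>n\<in>?I. 1 / real M * cmod (f n))"
    proof (rule sum_norm_le)
      fix n assume n: "n \<in> ?I"
      have "cmod (of_real (?t n) * ?c n * (\<tau> n * f n)) = ?t n * (cmod (\<tau> n) * cmod (f n))"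
        using triangle_bounds by (simp add: norm_mult)
      also have "\<dots> \<le> 1 * (1 / real M * cmod (f n))"
        using triangle_bounds by (intro mult_mono mult_right_mono \<tau> half n) auto
      finally show "cmod (of_real (?t n) * ?c n * (\<tau> n * f n)) \<le> 1 / real M * cmod (f n)" by simp
    qed
    also have "\<dots> = 1 / real M * (\<Sum>n\<in>?I. cmod (f n))" by (simp only: sum_distrib_left)
    also have "\<dots> \<le> 1 / real M * (sqrt (4 * real M) * (4 * E / (real N)\<^sup>2))"
      using cardI by (intro mult_left_mono far_le half) auto
    also have "sqrt (4 * real M) * (4 * E / (real N)\<^sup>2) = 8 * (sqrt (real M) * (E / (real N)\<^sup>2))"
      by (simp add: real_sqrt_mult)
    also have "1 / real M * (8 * (sqrt (real M) * (E / (real N)\<^sup>2))) = 8 * B"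
      unfolding BE using M by simp
    finally show ?thesis .
  qed
  have "(\<Sum>n\<in>?I. of_real (?t n) * ?c n * y n) = of_real K * (\<Sum>n\<in>?I. of_real (?t n) * ?c n * (\<Sum>\<^sub>\<infinity>l. of_real (A l) * f (n - l)))
      + (\<Sum>n\<in>?I. of_real (?t n) * ?c n * (\<tau> n * f n))"
    unfolding eq sum_distrib_left sum.distrib[symmetric] by (intro sum.cong refl) (simp add: algebra_simps)
  then have "cmod (\<Sum>n\<in>?I. of_real (?t n) * ?c n * y n) \<le>
      cmod (of_real K * (\<Sum>n\<in>?I. of_real (?t n) * ?c n * (\<Sum>\<^sub>\<infinity>l. of_real (A l) * f (n - l)))) + 8 * B"
    using order_trans[OF norm_triangle_ineq add_left_mono[OF second]] by simp
  also have "\<dots> \<le> K * (200 * CA * ?S2 * B) + 8 * B"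
    unfolding norm_mult norm_of_real abs_of_nonneg[OF K] by (intro add_right_mono mult_left_mono first K)
  also have "\<dots> = (200 * K * CA * ?S2 + 8) * B" by (simp add: algebra_simps)
  finally show ?thesis by (simp add: B_def)
qed

text \<open>P stays within B times the series of 2 \<epsilon> cos, so its values at 0 and pi lie on
  opposite sides of \<open>C\<close> and the intermediate value theorem applies.\<close>

lemma symbol_zero:
  fixes P :: "real \<Rightarrow> real" and q :: "int \<Rightarrow> real"
  assumes P: "continuous_on UNIV P" and inv: "\<And>z. of_real (P z) = (\<Sum>\<^sub>\<infinity>n. complex_of_real (q n) * cis (of_int n * z))"
    and q: "\<And>n. \<bar>q n - (if \<bar>n\<bar> = 1 then \<epsilon> else 0)\<bar> \<le> B * (1 / (1 + real_of_int \<bar>n\<bar>)\<^sup>2)"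
    and C: "\<bar>C\<bar> + B * (\<Sum>\<^sub>\<infinity>n::int. 1 / (1 + real_of_int \<bar>n\<bar>)\<^sup>2) \<le> 2 * \<bar>\<epsilon>\<bar>"
  shows "\<exists>z. P z = C"
proof -
  let ?S = "\<Sum>\<^sub>\<infinity>n::int. 1 / (1 + real_of_int \<bar>n\<bar>)\<^sup>2"
  let ?e = "\<lambda>n::int. if \<bar>n\<bar> = 1 then \<epsilon> else 0"
  have P_cos: "\<bar>P z - 2 * \<epsilon> * cos z\<bar> \<le> B * ?S" for z
  proof -
    let ?r = "\<lambda>n. complex_of_real (q n - ?e n) * cis (of_int n * z)"
    have le: "cmod (?r n) \<le> B * (1 / (1 + real_of_int \<bar>n\<bar>)\<^sup>2)" for n
      using q[of n] by (simp only: norm_mult norm_cis norm_of_real mult_1_right)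
    have s: "(\<lambda>n. cmod (?r n)) summable_on UNIV"
      by (rule summable_on_comparison_test[OF summable_on_cmult_right[OF summable_int_inv_sq, of B] le]) simp
    have e: "((\<lambda>n. complex_of_real (?e n) * cis (of_int n * z)) has_sum of_real (2 * \<epsilon> * cos z)) UNIV"
    proof (rule has_sum_finite_neutralI[of "{- 1, 1}"])
      fix n :: int assume "n \<in> UNIV - {- 1, 1}"
      then have "\<bar>n\<bar> \<noteq> 1" by auto
      then show "complex_of_real (?e n) * cis (of_int n * z) = 0" by simp
    qed (auto simp: complex_eq_iff)
    have "((\<lambda>n. ?r n + complex_of_real (?e n) * cis (of_int n * z)) has_sum (infsum ?r UNIV + of_real (2 * \<epsilon> * cos z))) UNIV"
      by (intro has_sum_add e has_sum_infsum abs_summable_summable[OF s])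
    then have "((\<lambda>n. complex_of_real (q n) * cis (of_int n * z)) has_sum (infsum ?r UNIV + of_real (2 * \<epsilon> * cos z))) UNIV"
      by (simp add: distrib_right[symmetric] of_real_add[symmetric] del: of_real_add of_real_diff)
    then have "of_real (P z) = infsum ?r UNIV + of_real (2 * \<epsilon> * cos z)" unfolding inv by (rule infsumI)
    then have "complex_of_real (P z - 2 * \<epsilon> * cos z) = infsum ?r UNIV" by simp
    then have "\<bar>P z - 2 * \<epsilon> * cos z\<bar> = cmod (infsum ?r UNIV)" by (metis norm_of_real)
    also have "\<dots> \<le> (\<Sum>\<^sub>\<infinity>n. cmod (?r n))" by (rule norm_infsum_bound[OF s])
    also have "\<dots> \<le> (\<Sum>\<^sub>\<infinity>n. B * (1 / (1 + real_of_int \<bar>n\<bar>)\<^sup>2))"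
      by (rule infsum_mono[OF s summable_on_cmult_right[OF summable_int_inv_sq] le])
    also have "\<dots> = B * ?S" by (rule infsum_cmult_right) (rule summable_int_inv_sq)
    finally show ?thesis .
  qed
  have cont: "continuous_on {0..pi} P" by (rule continuous_on_subset[OF P]) simp
  have p0: "\<bar>P 0 - 2 * \<epsilon>\<bar> \<le> B * ?S" and p1: "\<bar>P pi + 2 * \<epsilon>\<bar> \<le> B * ?S" using P_cos[of 0] P_cos[of pi] by simp_all
  have abs: "C \<le> X \<and> Y \<le> C" if "\<bar>X - 2 * e\<bar> \<le> S" "\<bar>Y + 2 * e\<bar> \<le> S" "\<bar>C\<bar> + S \<le> 2 * \<bar>e\<bar>" "e \<ge> 0" for X Y e S :: real
    using that by linarith
  show ?thesis
  proof (cases "\<epsilon> \<ge> 0")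
    case True
    from abs[OF p0 p1 C True] show ?thesis using IVT2'[of P pi C 0] cont by auto
  next
    case False
    have "C \<le> P pi \<and> P 0 \<le> C"
      by (rule abs[of _ "- \<epsilon>" "B * ?S"]) (use p0 p1 C False in auto)
    then show ?thesis using IVT'[of P 0 C pi] cont by auto
  qed
qed

section \<open>A right-hand side assembled from triangles of growing width\<close>

lemma triangle_sum_le: "finite F \<Longrightarrow> M > 0 \<Longrightarrow> (\<Sum>n\<in>F. triangle N M n) \<le> 2 * real M"
proof -
  assume F: "finite F" and M: "M > 0"
  let ?I = "{int N - int M<..<int N + int M}"
  have "(\<Sum>n\<in>F. triangle N M n) = (\<Sum>n\<in>F \<inter> ?I. triangle N M n)"
    using F triangle_outside[OF M] by (intro sum.mono_neutral_right) auto
  also have "\<dots> \<le> (\<Sum>n\<in>F \<inter> ?I. 1)" by (intro sum_mono triangle_bounds)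
  also have "\<dots> = real (card (F \<inter> ?I))" by simp
  also have "\<dots> \<le> real (card ?I)" by (intro of_nat_mono card_mono) auto
  also have "\<dots> \<le> 2 * real M" by simp
  finally show ?thesis .
qed

text \<open>Growth is tuned to the contradiction: the window estimate gains the inverse square root
  of the width, of order 4^(-i), while the pairing below is of order 2^(-i).\<close>

definition hump_width :: "nat \<Rightarrow> nat" where
  "hump_width i = 4 * 16 ^ i"

lemma hump_width_pos [simp]: "0 < hump_width i" "1 \<le> hump_width i"
  by (simp_all add: hump_width_def Suc_le_eq)

text \<open>Normalised so that the i-th hump has total mass at most 2 (1/2)^i. The resulting Fourier
  series then converges absolutely.\<close>

definition hump_coeff :: "nat \<Rightarrow> real" where
  "hump_coeff i = (1 / 2) ^ i / real (hump_width i)"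

lemma hump_coeff_bounds: "0 < hump_coeff i" "hump_coeff i \<le> (1 / 2) ^ i"
  by (simp_all add: hump_coeff_def divide_le_eq_1 field_simps Suc_le_eq)

definition humps :: "(nat \<Rightarrow> nat) \<Rightarrow> int \<Rightarrow> real" where
  "humps N n = (\<Sum>i. hump_coeff i * triangle (N i) (hump_width i) n)"

lemma hump_term_bounds: "0 \<le> hump_coeff i * triangle N M n" "hump_coeff i * triangle N M n \<le> (1 / 2) ^ i"
proof -
  show "0 \<le> hump_coeff i * triangle N M n"
    using hump_coeff_bounds(1)[of i] triangle_bounds(1) by (intro mult_nonneg_nonneg) auto
  have "hump_coeff i * triangle N M n \<le> (1 / 2) ^ i * 1"
    using triangle_bounds by (intro mult_mono hump_coeff_bounds) auto
  then show "hump_coeff i * triangle N M n \<le> (1 / 2) ^ i" by simp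
qed

lemma summable_half_power: "summable (\<lambda>i. (1 / 2 :: real) ^ i)"
  by (rule summable_geometric) simp

lemma summable_humps: "summable (\<lambda>i. hump_coeff i * triangle (N i) (hump_width i) n)"
  by (rule summable_comparison_test'[OF summable_half_power])
     (simp only: real_norm_def abs_of_nonneg[OF hump_term_bounds(1)] hump_term_bounds(2))

lemma hump_le_humps: "hump_coeff i * triangle (N i) (hump_width i) n \<le> humps N n"
  unfolding humps_def using sum_le_suminf[OF summable_humps, of "{i}" N n] hump_term_bounds(1) by simp

lemma humps_nonneg: "0 \<le> humps N n"
  unfolding humps_def by (intro suminf_nonneg summable_humps hump_term_bounds)

text \<open>Finite sums are bounded by interchanging them with the sum over humps and adding up the
  masses 2 (1/2)^i.\<close>

lemma humps_summable_on: "humps N summable_on UNIV"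
proof (rule nonneg_bdd_above_summable_on[OF humps_nonneg])
  have "(\<Sum>n\<in>F. humps N n) \<le> (\<Sum>i. 2 * (1 / 2) ^ i)" if F: "finite F" for F
  proof -
    have "(\<Sum>n\<in>F. humps N n) = (\<Sum>i. \<Sum>n\<in>F. hump_coeff i * triangle (N i) (hump_width i) n)"
      unfolding humps_def by (rule suminf_sum[symmetric]) (rule summable_humps)
    also have "\<dots> \<le> (\<Sum>i. 2 * (1 / 2) ^ i)"
    proof (rule suminf_le)
      fix i
      have "(\<Sum>n\<in>F. hump_coeff i * triangle (N i) (hump_width i) n) = hump_coeff i * (\<Sum>n\<in>F. triangle (N i) (hump_width i) n)"
        by (simp only: sum_distrib_left)
      also have "\<dots> \<le> hump_coeff i * (2 * real (hump_width i))"
        using hump_coeff_bounds(1)[of i] by (intro mult_left_mono triangle_sum_le F) auto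
      also have "\<dots> = 2 * (1 / 2) ^ i" using hump_width_pos(1)[of i] by (simp add: hump_coeff_def)
      finally show "(\<Sum>n\<in>F. hump_coeff i * triangle (N i) (hump_width i) n) \<le> 2 * (1 / 2) ^ i" .
    qed (intro summable_sum summable_humps summable_mult summable_half_power)+
    finally show ?thesis .
  qed
  then show "bdd_above (sum (humps N) ` {F. F \<subseteq> UNIV \<and> finite F})"
    by (intro bdd_aboveI2) blast
qed

text \<open>The humps may overlap: all terms are nonnegative, so the i-th hump alone gives the lower
  bound.\<close>

lemma humps_pairing_ge:
  assumes N: "N i \<ge> 4 * hump_width i"
  defines "M \<equiv> hump_width i"
  shows "(1 / 2) ^ i / (32 * (real (N i))\<^sup>2) \<le>
    (\<Sum>n\<in>{int (N i) - int M<..<int (N i) + int M}. triangle (N i) M n * humps N n / (real_of_int n + 1 / 2)\<^sup>2)"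
proof -
  let ?N = "N i"
  let ?I = "{int ?N - int M<..<int ?N + int M}" and ?t = "\<lambda>n. triangle ?N M n * humps N n / (real_of_int n + 1 / 2)\<^sup>2"
  define h :: nat where "h = 2 * 16 ^ i"
  have M: "M = 2 * h" "M > 0" by (simp_all add: M_def h_def hump_width_def)
  have h: "h > 0" by (simp add: h_def)
  then have h1: "real h \<ge> 1" by simp
  have N8: "real ?N \<ge> 8 * real h" using of_nat_mono[OF N, where 'a = real] unfolding M_def[symmetric] M(1) by simp
  have N4: "real ?N \<ge> 4 * real M" using of_nat_mono[OF N, where 'a = real] unfolding M_def by simp
  have Npos: "real ?N > 0" using N4 M(2) by linarith
  \<comment> \<open>On this quarter of the window the triangle is at least 1/2 and n + 1/2 is at
    most 2 N. Its h = M / 2 points therefore contribute M times the coefficient over 32 N^2.\<close>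
  define J where "J = {int ?N..<int ?N + int h}"
  have JI: "J \<subseteq> ?I" using h by (auto simp: J_def M)
  have "(1 / 2) * (hump_coeff i * (1 / 2)) / (4 * (real ?N)\<^sup>2) \<le> ?t n" if "n \<in> J" for n
  proof -
    have n: "real ?N \<le> real_of_int n" "real_of_int n < real ?N + real h" using that unfolding J_def by auto
    have "\<bar>real_of_int n - real ?N\<bar> / real M \<le> 1 / 2" using n M(2) by (simp add: M(1) divide_le_eq)
    then have t: "1 / 2 \<le> triangle ?N M n" unfolding triangle_def by linarith
    have "hump_coeff i * (1 / 2) \<le> hump_coeff i * triangle ?N M n"
      using t hump_coeff_bounds(1)[of i] by (intro mult_left_mono) auto
    then have g: "hump_coeff i * (1 / 2) \<le> humps N n" using hump_le_humps[of i N n] unfolding M_def by linarith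
    have "real_of_int n + 1 / 2 \<le> 2 * real ?N" using n N8 h1 by linarith
    then have "(real_of_int n + 1 / 2)\<^sup>2 \<le> (2 * real ?N)\<^sup>2" using n Npos by (intro power_mono) auto
    then have s: "(real_of_int n + 1 / 2)\<^sup>2 \<le> 4 * (real ?N)\<^sup>2" by (simp add: power_mult_distrib)
    have s0: "0 < (real_of_int n + 1 / 2)\<^sup>2" using n Npos by (intro zero_less_power) linarith
    show ?thesis
      using t g s s0 hump_coeff_bounds(1)[of i] by (intro frac_le mult_mono mult_nonneg_nonneg humps_nonneg triangle_bounds) auto
  qed
  then have "(\<Sum>n\<in>J. (1 / 2) * (hump_coeff i * (1 / 2)) / (4 * (real ?N)\<^sup>2)) \<le> sum ?t J" by (rule sum_mono)
  also have "(\<Sum>n\<in>J. (1 / 2) * (hump_coeff i * (1 / 2)) / (4 * (real ?N)\<^sup>2)) = (1 / 2) ^ i / (32 * (real ?N)\<^sup>2)"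
    using h Npos by (simp add: J_def hump_coeff_def M_def[symmetric] M(1) field_simps)
  also have "sum ?t J \<le> sum ?t ?I"
    by (rule sum_mono2[OF _ JI]) (auto intro!: divide_nonneg_nonneg mult_nonneg_nonneg triangle_bounds humps_nonneg)
  finally show ?thesis .
qed

lemma L2T_set_integrable:
  assumes "\<phi> \<in> L2T"
  shows "set_integrable lborel {0..2 * pi} \<phi>"
proof (rule set_integrable_bound)
  have m: "\<phi> \<in> borel_measurable borel" and i: "set_integrable lborel {0..2 * pi} (\<lambda>z. (norm (\<phi> z))\<^sup>2)"
    using assms by (simp_all add: L2T_def)
  show "set_integrable lborel {0..2 * pi} (\<lambda>z. 1 + (norm (\<phi> z))\<^sup>2)"
    by (intro set_integral_add(1) i borel_integrable_atLeastAtMost' continuous_intros)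
  show "set_borel_measurable lborel {0..2 * pi} \<phi>"
    unfolding set_borel_measurable_def using m by measurable
  have "x \<le> 1 + x\<^sup>2" for x :: real
    using sum_squares_ge_zero[of "x - 1" x] by (simp add: power2_eq_square algebra_simps)
  then show "AE z in lborel. z \<in> {0..2 * pi} \<longrightarrow> norm (\<phi> z) \<le> norm (1 + (norm (\<phi> z))\<^sup>2)"
    by simp
qed

lemma HsT_sum_le:
  assumes \<phi>: "\<phi> \<in> HsT s" and s: "s \<ge> 2"
  obtains E where "E \<ge> 0"
    "\<And>J. finite J \<Longrightarrow> (\<Sum>m\<in>J. (1 + (real_of_int m)\<^sup>2)\<^sup>2 * (cmod (fourier_coeff \<phi> m))\<^sup>2) \<le> E\<^sup>2"
proof -
  let ?h = "\<lambda>n::int. (1 + (real_of_int n)\<^sup>2) powr s * (norm (fourier_coeff \<phi> n))\<^sup>2"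
  have sm: "?h summable_on UNIV" using \<phi> by (simp add: HsT_def)
  have nn: "infsum ?h UNIV \<ge> 0" by (rule infsum_nonneg) simp
  have "(\<Sum>m\<in>J. (1 + (real_of_int m)\<^sup>2)\<^sup>2 * (cmod (fourier_coeff \<phi> m))\<^sup>2) \<le> (sqrt (infsum ?h UNIV))\<^sup>2" if J: "finite J" for J
  proof -
    have "(1 + (real_of_int m)\<^sup>2)\<^sup>2 \<le> (1 + (real_of_int m)\<^sup>2) powr s" for m
    proof -
      have pos: "0 < 1 + (real_of_int m)\<^sup>2" by (simp add: add_pos_nonneg)
      have "(1 + (real_of_int m)\<^sup>2)\<^sup>2 = (1 + (real_of_int m)\<^sup>2) powr 2" using pos by (simp add: powr_numeral)
      also have "\<dots> \<le> (1 + (real_of_int m)\<^sup>2) powr s" using s by (intro powr_mono) auto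
      finally show ?thesis .
    qed
    then have "(\<Sum>m\<in>J. (1 + (real_of_int m)\<^sup>2)\<^sup>2 * (cmod (fourier_coeff \<phi> m))\<^sup>2) \<le> sum ?h J"
      by (intro sum_mono mult_right_mono) auto
    also have "\<dots> \<le> infsum ?h UNIV" by (rule finite_sum_le_infsum[OF sm J]) auto
    finally show ?thesis using nn by simp
  qed
  then show ?thesis using nn by (intro that[of "sqrt (infsum ?h UNIV)"]) auto
qed

text \<open>The multiplier tends to the constant \<open>c0\<close>, so far out the operator is close to the one with
  symbol \<open>c - c0 - P z\<close>, which vanishes at \<open>z0\<close>. A series of modulated triangles at \<open>z0\<close> is therefore
  outside the range.\<close>

lemma degenerate_tail_not_invertible:
  fixes p :: "real \<Rightarrow> real" and q :: "int \<Rightarrow> real" and \<alpha>\<^sub>1 \<alpha>\<^sub>2 :: real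
  defines "P \<equiv> \<lambda>z. 2 * \<alpha>\<^sub>1 * p z + 3 * \<alpha>\<^sub>2 * (p z)\<^sup>2"
  assumes q: "\<And>n. fourier_coeff (\<lambda>z. of_real (P z)) n = of_real (q n)"
    and inv: "\<And>z. of_real (P z) = (\<Sum>\<^sub>\<infinity>n. complex_of_real (q n) * cis (of_int n * z))"
    and q_le: "\<And>n. \<bar>q n\<bar> \<le> Cq / (1 + real_of_int \<bar>n\<bar>) ^ 5"
    and z0: "P z0 = c - c0"
    and lim: "(\<lambda>n. j (k * wavenum n)) \<longlonglongrightarrow> c0"
  shows "\<not> G_invertible j b \<gamma> \<alpha>\<^sub>1 \<alpha>\<^sub>2 k p c (1 / 2) 1 \<rho>"
proof
  assume invertible: "G_invertible j b \<gamma> \<alpha>\<^sub>1 \<alpha>\<^sub>2 k p c (1 / 2) 1 \<rho>"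
  define s where "s n = real_of_int n + 1 / 2" for n
  have s0: "s n \<noteq> 0" for n
  proof
    assume "s n = 0"
    then have "real_of_int (2 * n + 1) = 0" by (simp add: s_def)
    then have "2 * n + 1 = 0" by (simp only: of_int_eq_0_iff)
    then show False by presburger
  qed
  \<comment> \<open>What remains of the symbol, divided by s^2, after the constant limit
    \<open>c0\<close> is extracted; it tends to 0 at plus infinity.\<close>
  define \<tau> where "\<tau> n = of_real (k\<^sup>2 * (c0 - j (k * s n)) - (\<rho>\<^sup>2 + \<gamma>) / (s n)\<^sup>2) + \<i> * of_real (1 / s n)" for n
  have \<tau>_lim: "(\<lambda>n. \<tau> (int n)) \<longlonglongrightarrow> 0"
  proof -
    have w: "(\<lambda>n. 1 / wavenum n) \<longlonglongrightarrow> 0" 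
      by (intro real_tendsto_divide_at_top[OF tendsto_const] filterlim_at_top_mono[OF filterlim_real_sequentially])
         (simp add: wavenum_def)
    have "(\<lambda>n. of_real (k\<^sup>2 * (c0 - j (k * wavenum n)) - (\<rho>\<^sup>2 + \<gamma>) * (1 / wavenum n)\<^sup>2) + \<i> * of_real (1 / wavenum n))
        \<longlonglongrightarrow> of_real (k\<^sup>2 * (c0 - c0) - (\<rho>\<^sup>2 + \<gamma>) * 0\<^sup>2) + \<i> * of_real 0"
      by (intro tendsto_intros lim w)
    then show ?thesis by (simp add: \<tau>_def s_def wavenum_def power_divide)
  qed
  \<comment> \<open>The hump is placed so far out that the remaining symbol is at most 1 / M from
    half of the centre on, as the window estimate requires.\<close>
  have "\<exists>N. N \<ge> 4 * hump_width i \<and> (\<forall>n. real_of_int n \<ge> real N / 2 \<longrightarrow> cmod (\<tau> n) \<le> 1 / real (hump_width i))" for i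
  proof -
    have "1 / real (hump_width i) > 0" by simp
    from LIMSEQ_D[OF \<tau>_lim this] obtain N0 where N0: "\<And>n. n \<ge> N0 \<Longrightarrow> cmod (\<tau> (int n)) < 1 / real (hump_width i)" by auto
    have "cmod (\<tau> n) \<le> 1 / real (hump_width i)" if "real_of_int n \<ge> real (max (4 * hump_width i) (2 * N0)) / 2" for n
    proof -
      have "real (2 * N0) / 2 \<le> real_of_int n" using that by (rule order_trans[rotated]) (intro divide_right_mono of_nat_mono, auto)
      then have n: "int N0 \<le> n" by simp
      then have "cmod (\<tau> (int (nat n))) < 1 / real (hump_width i)" by (intro N0) simp
      then show ?thesis using n by simp
    qed
    then show ?thesis by (intro exI[of _ "max (4 * hump_width i) (2 * N0)"]) auto
  qed
  then obtain N where N: "\<And>i. N i \<ge> 4 * hump_width i"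
    and \<tau>_le: "\<And>i n. real_of_int n \<ge> real (N i) / 2 \<Longrightarrow> cmod (\<tau> n) \<le> 1 / real (hump_width i)"
    by metis
  \<comment> \<open>The phase cancels the one in the window estimate, so that pairing the humps with
    a triangle leaves a sum of nonnegative numbers.\<close>
  define a where "a n = of_real (humps N n) * cis (- (of_int n * z0))" for n
  have sa: "(\<lambda>n. cmod (a n)) summable_on UNIV"
    unfolding a_def norm_mult norm_cis norm_of_real abs_of_nonneg[OF humps_nonneg] mult_1_right by (rule humps_summable_on)
  define \<psi> where "\<psi> = (\<lambda>z. \<Sum>\<^sub>\<infinity>m. a m * cis (of_int m * z))"
  have \<psi>: "\<psi> \<in> L2T" unfolding \<psi>_def by (intro continuous_imp_L2T continuous_series sa series_periodic)
  have \<psi>_co: "fourier_coeff \<psi> n = a n" for n unfolding \<psi>_def by (rule fourier_coeff_series[OF sa])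
  obtain \<phi> where \<phi>: "\<phi> \<in> HsT (2 + max b 0)" and G: "G_op j \<gamma> \<alpha>\<^sub>1 \<alpha>\<^sub>2 k p c (1 / 2) 1 \<rho> \<phi> \<psi>"
    using invertible \<psi> unfolding G_invertible_def by blast
  define f where "f = fourier_coeff \<phi>"
  obtain E where E0: "E \<ge> 0" and E: "\<And>J. finite J \<Longrightarrow> (\<Sum>m\<in>J. (1 + (real_of_int m)\<^sup>2)\<^sup>2 * (cmod (f m))\<^sup>2) \<le> E\<^sup>2"
    using HsT_sum_le[OF \<phi>] unfolding f_def by auto
  have i\<phi>: "set_integrable lborel {0..2 * pi} \<phi>" using \<phi> by (intro L2T_set_integrable) (simp add: HsT_def)
  have Cq: "Cq \<ge> 0" using order_trans[OF abs_ge_zero q_le[of 0]] by simp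
  have le5: "1 / (1 + real_of_int \<bar>n\<bar>) ^ 5 \<le> 1 / (1 + real_of_int \<bar>n\<bar>)\<^sup>2" for n
  proof -
    have "(1 + real_of_int \<bar>n\<bar>)\<^sup>2 \<le> (1 + real_of_int \<bar>n\<bar>) ^ 5" by (intro power_increasing) auto
    then show ?thesis by (intro divide_left_mono) (auto intro!: mult_pos_pos zero_less_power add_pos_nonneg)
  qed
  have sq: "(\<lambda>n. cmod (of_real (q n))) summable_on UNIV"
  proof (rule summable_on_comparison_test[OF summable_on_cmult_right[OF summable_int_inv_sq, of Cq]])
    fix n :: int
    show "cmod (of_real (q n)) \<le> Cq * (1 / (1 + real_of_int \<bar>n\<bar>)\<^sup>2)"
      using order_trans[OF q_le[of n, folded times_divide_eq_right[of Cq 1, unfolded mult_1_right]] mult_left_mono[OF le5 Cq]] by simp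
  qed simp
  have conv: "fourier_coeff (\<lambda>z. of_real (P z) * \<phi> z) n = (\<Sum>\<^sub>\<infinity>l. of_real (q l) * f (n - l))"
    and sconv: "(\<lambda>l. cmod (of_real (q l) * f (n - l))) summable_on UNIV" for n
    unfolding inv f_def by (rule fourier_coeff_series_mult[OF sq i\<phi>])+
  \<comment> \<open>The Fourier coefficients of \<open>c - c0 - P\<close>; their series vanishes at
    \<open>z0\<close>.\<close>
  define A where "A l = (if l = 0 then c - c0 else 0) - q l" for l
  have single: "((\<lambda>l. of_real (if l = 0 then c - c0 else 0) * h l) has_sum of_real (c - c0) * h 0) UNIV" for h :: "int \<Rightarrow> complex"
    by (rule has_sum_finite_neutralI[of "{0}"]) auto
  have A_sum: "((\<lambda>l. of_real (A l) * h l) has_sum of_real (c - c0) * h 0 - (\<Sum>\<^sub>\<infinity>l. of_real (q l) * h l)) UNIV"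
    if "(\<lambda>l. cmod (of_real (q l) * h l)) summable_on UNIV" for h :: "int \<Rightarrow> complex"
  proof -
    have "((\<lambda>l. of_real (if l = 0 then c - c0 else 0) * h l + - (of_real (q l) * h l)) has_sum
        of_real (c - c0) * h 0 + - (\<Sum>\<^sub>\<infinity>l. of_real (q l) * h l)) UNIV"
      by (intro has_sum_add single has_sum_uminusI has_sum_infsum abs_summable_summable[OF that])
    moreover have "of_real (if l = 0 then c - c0 else 0) * h l + - (of_real (q l) * h l) = of_real (A l) * h l" for l
      by (simp add: A_def algebra_simps)
    ultimately show ?thesis by simp
  qed
  have A_le: "\<bar>A l\<bar> \<le> (\<bar>c - c0\<bar> + Cq) / (1 + real_of_int \<bar>l\<bar>) ^ 5" for l
  proof -
    have "\<bar>if l = 0 then c - c0 else 0\<bar> \<le> \<bar>c - c0\<bar> / (1 + real_of_int \<bar>l\<bar>) ^ 5" by simp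
    then show ?thesis using q_le[of l] unfolding A_def add_divide_distrib by linarith
  qed
  have A0: "(\<Sum>\<^sub>\<infinity>l. of_real (A l) * cis (of_int l * z0)) = 0"
  proof -
    have "(\<lambda>l. cmod (of_real (q l) * cis (of_int l * z0))) summable_on UNIV" using sq by (simp add: norm_mult)
    from infsumI[OF A_sum[OF this]] show ?thesis unfolding inv[symmetric] z0 by (simp add: cis_zero)
  qed
  have Af: "(\<lambda>l. cmod (of_real (A l) * f (n - l))) summable_on UNIV" for n
  proof -
    have "(\<lambda>l. of_real (A l) * f (n - l)) summable_on UNIV" using A_sum[OF sconv] by (rule has_sum_imp_summable)
    then show ?thesis by (simp only: summable_on_iff_abs_summable_on_complex[symmetric])
  qed
  define y where "y n = a n / of_real ((s n)\<^sup>2)" for n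
  have eq: "y n = of_real (k\<^sup>2) * (\<Sum>\<^sub>\<infinity>l. of_real (A l) * f (n - l)) + \<tau> n * f n" for n
  proof -
    have alg: "u / of_real (x\<^sup>2) = of_real (k\<^sup>2) * (of_real (c - c0) * v - Z) + (of_real (k\<^sup>2 * (c0 - J) - m / x\<^sup>2) + \<i> * of_real (1 / x)) * v"
      if "u = 1 * (\<i> * of_real x) * v - (of_real k)\<^sup>2 * (\<i> * of_real x)\<^sup>2 * (of_real (c - J) * v - Z) - of_real m * v" "x \<noteq> 0"
      for x J m :: real and u v Z :: complex
      using that(2) unfolding that(1) by (simp add: field_simps power2_eq_square)
    have "a n = 1 * (\<i> * of_real (s n)) * f n - (of_real k)\<^sup>2 * (\<i> * of_real (s n))\<^sup>2 *
        (of_real (c - j (k * s n)) * f n - (\<Sum>\<^sub>\<infinity>l. of_real (q l) * f (n - l))) - of_real (\<rho>\<^sup>2 + \<gamma>) * f n"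
      using G unfolding G_op_def Let_def \<psi>_co s_def[symmetric] f_def[symmetric] conv[unfolded P_def] by blast
    from alg[OF this s0] show ?thesis unfolding infsumI[OF A_sum[OF sconv]] y_def \<tau>_def by simp
  qed
  define W where "W = (200 * k\<^sup>2 * (\<bar>c - c0\<bar> + Cq) * (\<Sum>\<^sub>\<infinity>l::int. 1 / (1 + real_of_int \<bar>l\<bar>)\<^sup>2) + 8) * E"
  \<comment> \<open>Upper and lower bound share the factor 1 / N^2, which cancels. Thus the distance
    of the hump does not matter, only its width, and letting \<open>i\<close> grow contradicts the
    fixed Sobolev size of a preimage.\<close>
  have "2 ^ i \<le> 16 * W" for i
  proof -
    let ?M = "hump_width i"
    let ?I = "{int (N i) - int ?M<..<int (N i) + int ?M}"
    have Npos: "real (N i) > 0" using N[of i] hump_width_pos(2)[of i] by linarith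
    have sqrtM: "sqrt (real ?M) = 2 * 4 ^ i"
    proof -
      have "(4 :: real) ^ i * 4 ^ i = 16 ^ i" by (simp flip: power_mult_distrib)
      then have "real ?M = (2 * 4 ^ i)\<^sup>2" by (simp add: hump_width_def power2_eq_square)
      then show ?thesis by (simp only: real_sqrt_abs) simp
    qed
    let ?X = "\<Sum>n\<in>?I. triangle (N i) ?M n * humps N n / (s n)\<^sup>2"
    have "(1 / 2) ^ i / (32 * (real (N i))\<^sup>2) \<le> ?X" unfolding s_def by (rule humps_pairing_ge[of i N, OF N])
    also have "\<dots> \<le> cmod (of_real ?X)" by (simp only: norm_of_real abs_ge_self)
    also have "complex_of_real ?X = (\<Sum>n\<in>?I. of_real (triangle (N i) ?M n) * cis (of_int n * z0) * y n)"
      unfolding of_real_sum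
    proof (rule sum.cong[OF refl])
      fix n
      have "cis (of_int n * z0) * cis (- (of_int n * z0)) = 1" by (simp add: cis_mult cis_zero)
      then have "of_real t * cis (of_int n * z0) * (of_real h * cis (- (of_int n * z0)) / of_real x) = of_real (t * h / x)" for t h x
        by (simp add: field_simps)
      then show "complex_of_real (triangle (N i) ?M n * humps N n / (s n)\<^sup>2) = of_real (triangle (N i) ?M n) * cis (of_int n * z0) * y n"
        unfolding y_def a_def by simp
    qed
    also have "cmod \<dots> \<le> W / ((real (N i))\<^sup>2 * sqrt (real ?M))"
      unfolding W_def by (rule window_estimate[OF E E0 A_le A0 hump_width_pos(2) N zero_le_power2 \<tau>_le Af eq])
    also have "\<dots> = W / (2 * 4 ^ i) / (real (N i))\<^sup>2" unfolding sqrtM by (simp add: mult_ac)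
    finally have "(1 / 2) ^ i / 32 / (real (N i))\<^sup>2 \<le> W / (2 * 4 ^ i) / (real (N i))\<^sup>2" by simp
    moreover have "u \<le> v" if "u / x \<le> v / x" "x > 0" for u v x :: real using that by (simp add: divide_le_cancel)
    ultimately have "(1 / 2) ^ i / 32 \<le> W / (2 * 4 ^ i)" using Npos by (meson zero_less_power)
    then have "4 ^ i * (1 / 2) ^ i \<le> 16 * W" by (simp add: field_simps)
    then show ?thesis by (simp flip: power_mult_distrib)
  qed
  moreover obtain i where "16 * W < 2 ^ i" using real_arch_pow[of 2 "16 * W"] by auto
  ultimately show False by (simp add: linorder_not_less[symmetric])
qed

text \<open>The required value \<open>c - c0\<close> is O(\<epsilon>^2), while the potential
  oscillates with amplitude about 2 |\<epsilon>|, so a suitable \<open>z0\<close> exists for all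
  small nonzero \<epsilon>.\<close>

lemma instability_of_degenerate_tail:
  fixes j :: "real \<Rightarrow> real" and b \<gamma> \<alpha>\<^sub>2 k :: real
  assumes wf: "wave_family j \<gamma> 1 \<alpha>\<^sub>2 k \<eta> c" and lim: "(\<lambda>n. j (k * wavenum n)) \<longlonglongrightarrow> wave_c0 j \<gamma> k"
  shows "\<exists>\<rho>0 > 0. \<exists>\<epsilon>0 > 0. \<forall>\<epsilon>. 0 < \<bar>\<epsilon>\<bar> \<and> \<bar>\<epsilon>\<bar> < \<epsilon>0 \<longrightarrow>
           (\<exists>\<rho>. \<bar>\<rho>\<bar> \<ge> \<rho>0 \<and> nonperiodic_instability j b \<gamma> 1 \<alpha>\<^sub>2 k (\<eta> \<epsilon>) (c \<epsilon>) \<rho>)"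
proof -
  let ?S = "\<Sum>\<^sub>\<infinity>n::int. 1 / (1 + real_of_int \<bar>n\<bar>)\<^sup>2"
  have "(5::nat) \<ge> 2" by simp
  from potential_coefficients[OF wf this] obtain e1 Q where e1: "e1 > 0" and Q: "Q \<ge> 0"
    and cQ: "\<And>\<epsilon>. \<bar>\<epsilon>\<bar> < e1 \<Longrightarrow> \<bar>c \<epsilon> - wave_c0 j \<gamma> k\<bar> \<le> Q * \<epsilon>\<^sup>2"
    and cont: "\<And>\<epsilon>. \<bar>\<epsilon>\<bar> < e1 \<Longrightarrow> continuous_on UNIV (\<lambda>z. 2 * 1 * \<eta> \<epsilon> z + 3 * \<alpha>\<^sub>2 * (\<eta> \<epsilon> z)\<^sup>2)"
    and qex: "\<And>\<epsilon>. \<bar>\<epsilon>\<bar> < e1 \<Longrightarrow> \<exists>q. (\<forall>n. fourier_coeff (\<lambda>z. of_real (2 * 1 * \<eta> \<epsilon> z + 3 * \<alpha>\<^sub>2 * (\<eta> \<epsilon> z)\<^sup>2)) n = of_real (q n)) \<and>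
      (\<forall>n. q (- n) = q n) \<and>
      (\<forall>n. \<bar>q n - (if \<bar>n\<bar> = 1 then \<epsilon> else 0)\<bar> \<le> Q * \<epsilon>\<^sup>2 / (1 + real_of_int \<bar>n\<bar>) ^ 5) \<and>
      (\<forall>z. of_real (2 * 1 * \<eta> \<epsilon> z + 3 * \<alpha>\<^sub>2 * (\<eta> \<epsilon> z)\<^sup>2) = (\<Sum>\<^sub>\<infinity>n. complex_of_real (q n) * cis (of_int n * z)))"
    by blast
  have "\<forall>\<^sub>F e in at_right 0. (Q + Q * ?S) * e \<le> 2" by (intro eventually_mult_le_at_right) simp
  then obtain e2 where e2: "e2 > 0" "\<And>e. 0 < e \<Longrightarrow> e < e2 \<Longrightarrow> (Q + Q * ?S) * e \<le> 2"
    unfolding eventually_at_right_field by auto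
  have "nonperiodic_instability j b \<gamma> 1 \<alpha>\<^sub>2 k (\<eta> \<epsilon>) (c \<epsilon>) 1" if \<epsilon>: "0 < \<bar>\<epsilon>\<bar>" "\<bar>\<epsilon>\<bar> < min e1 e2" for \<epsilon>
  proof -
    have lt: "\<bar>\<epsilon>\<bar> < e1" "\<bar>\<epsilon>\<bar> < e2" using \<epsilon> by auto
    let ?P = "\<lambda>z. 2 * 1 * \<eta> \<epsilon> z + 3 * \<alpha>\<^sub>2 * (\<eta> \<epsilon> z)\<^sup>2"
    obtain q where q: "\<And>n. fourier_coeff (\<lambda>z. of_real (?P z)) n = of_real (q n)"
      and q_le: "\<And>n. \<bar>q n - (if \<bar>n\<bar> = 1 then \<epsilon> else 0)\<bar> \<le> Q * \<epsilon>\<^sup>2 / (1 + real_of_int \<bar>n\<bar>) ^ 5"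
      and inv: "\<And>z. of_real (?P z) = (\<Sum>\<^sub>\<infinity>n. complex_of_real (q n) * cis (of_int n * z))"
      using qex[OF lt(1)] by blast
    have "\<exists>z. ?P z = c \<epsilon> - wave_c0 j \<gamma> k"
    proof (rule symbol_zero[OF cont[OF lt(1)] inv])
      fix n :: int
      have "(1 + real_of_int \<bar>n\<bar>)\<^sup>2 \<le> (1 + real_of_int \<bar>n\<bar>) ^ 5" by (intro power_increasing) auto
      then have "Q * \<epsilon>\<^sup>2 / (1 + real_of_int \<bar>n\<bar>) ^ 5 \<le> Q * \<epsilon>\<^sup>2 / (1 + real_of_int \<bar>n\<bar>)\<^sup>2"
        using Q by (intro divide_left_mono) (auto intro!: mult_pos_pos zero_less_power add_pos_nonneg)
      then show "\<bar>q n - (if \<bar>n\<bar> = 1 then \<epsilon> else 0)\<bar> \<le> (Q * \<epsilon>\<^sup>2) * (1 / (1 + real_of_int \<bar>n\<bar>)\<^sup>2)"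
        using order_trans[OF q_le[of n]] by simp
      have "((Q + Q * ?S) * \<bar>\<epsilon>\<bar>) * \<bar>\<epsilon>\<bar> \<le> 2 * \<bar>\<epsilon>\<bar>" by (intro mult_right_mono e2(2)[OF \<epsilon>(1) lt(2)]) simp
      also have "((Q + Q * ?S) * \<bar>\<epsilon>\<bar>) * \<bar>\<epsilon>\<bar> = Q * \<epsilon>\<^sup>2 + Q * \<epsilon>\<^sup>2 * ?S"
        by (simp add: mult.assoc power2_eq_square distrib_right)
      finally show "\<bar>c \<epsilon> - wave_c0 j \<gamma> k\<bar> + Q * \<epsilon>\<^sup>2 * ?S \<le> 2 * \<bar>\<epsilon>\<bar>" using cQ[OF lt(1)] by linarith
    qed
    then obtain z0 where z0: "?P z0 = c \<epsilon> - wave_c0 j \<gamma> k" by blast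
    have q_le': "\<bar>q n\<bar> \<le> (32 * \<bar>\<epsilon>\<bar> + Q * \<epsilon>\<^sup>2) / (1 + real_of_int \<bar>n\<bar>) ^ 5" for n
    proof -
      have "\<bar>if \<bar>n\<bar> = 1 then \<epsilon> else 0\<bar> \<le> 32 * \<bar>\<epsilon>\<bar> / (1 + real_of_int \<bar>n\<bar>) ^ 5"
      proof (cases "\<bar>n\<bar> = 1")
        case True
        then show ?thesis by simp
      next
        case False
        then show ?thesis by (simp add: divide_nonneg_nonneg)
      qed
      then show ?thesis using q_le[of n] unfolding add_divide_distrib by linarith
    qed
    have "\<not> G_invertible j b \<gamma> 1 \<alpha>\<^sub>2 k (\<eta> \<epsilon>) (c \<epsilon>) (1 / 2) 1 1"
      by (rule degenerate_tail_not_invertible[OF q inv q_le' z0 lim])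
    then show ?thesis unfolding nonperiodic_instability_def by (intro bexI[of _ "1 / 2"] exI[of _ 1]) auto
  qed
  moreover have "min e1 e2 > 0" using e1 e2 by simp
  ultimately show ?thesis
    by (intro exI[of _ "1 :: real"] conjI zero_less_one exI[of _ "min e1 e2"] allI impI exI[of _ "1 :: real"]) auto
qed

text \<open>The values increase with \<open>n\<close>. Once above \<open>c0\<close> they stay away
  from it; otherwise they converge to some limit at most \<open>c0\<close>, and a strictly smaller
  limit leaves a gap.\<close>

lemma limit_or_gap:
  assumes "strict_mono_on {0<..} (j :: real \<Rightarrow> real)" "k > 0"
  obtains "(\<lambda>n. j (k * wavenum n)) \<longlonglongrightarrow> c0"
    | e L where "e > 0" "\<And>n. n \<ge> L \<Longrightarrow> e \<le> \<bar>c0 - j (k * wavenum n)\<bar>"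
proof -
  let ?x = "\<lambda>n. j (k * wavenum n)"
  have lt: "?x m < ?x n" if "m < n" for m n
    by (rule strict_mono_onD[OF assms(1)]) (use that assms(2) in \<open>auto simp: wavenum_def\<close>)
  show thesis
  proof (cases "\<exists>m. c0 < ?x m")
    case True
    then obtain m where m: "c0 < ?x m" by blast
    have "?x m - c0 \<le> \<bar>c0 - ?x n\<bar>" if "n \<ge> m" for n
      using lt[of m n] that by (cases "n = m") auto
    then show thesis using m that(2)[of "?x m - c0" m] by simp
  next
    case False
    then have le: "?x n \<le> c0" for n by (simp add: not_less)
    have "incseq ?x" by (intro incseq_SucI less_imp_le lt) simp
    from incseq_convergent[OF this, of c0] le obtain l where l: "?x \<longlonglongrightarrow> l" "\<And>n. ?x n \<le> l" by auto
    have "l \<le> c0" by (rule LIMSEQ_le_const2[OF l(1)]) (use le in blast)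
    show thesis
    proof (cases "l = c0")
      case True
      then show thesis using l that(1) by simp
    next
      case False
      have "c0 - l \<le> \<bar>c0 - ?x n\<bar>" for n using l(2)[of n] by linarith
      then show thesis using that(2)[of "c0 - l" 0] False \<open>l \<le> c0\<close> by simp
    qed
  qed
qed

theorem theorem1p8:
  fixes j :: "real \<Rightarrow> real" and b \<gamma> \<alpha>\<^sub>1 \<alpha>\<^sub>2 k :: real
    and \<eta> :: "real \<Rightarrow> real \<Rightarrow> real" and c :: "real \<Rightarrow> real"
  assumes "\<gamma> > 0"
    and "\<alpha>\<^sub>1 \<in> {0, 1}" and "\<alpha>\<^sub>2 \<in> {- 1, 0}"
    and "\<alpha>\<^sub>1 \<noteq> 0"
    and "hyp_J1 j" and "hyp_J2 j b" and "hyp_J3 j"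
    and "strict_mono_on {0<..} j"
    and "admissible j \<gamma> k"
    and "k\<^sup>2 * (j k - j (k / 2)) > 3 * \<gamma>"
    and "wave_family j \<gamma> \<alpha>\<^sub>1 \<alpha>\<^sub>2 k \<eta> c"
  shows "\<exists>\<rho>0 > 0. \<exists>\<epsilon>0 > 0. \<forall>\<epsilon>. 0 < \<bar>\<epsilon>\<bar> \<and> \<bar>\<epsilon>\<bar> < \<epsilon>0 \<longrightarrow>
           (\<exists>\<rho>. \<bar>\<rho>\<bar> \<ge> \<rho>0 \<and>
              nonperiodic_instability j b \<gamma> \<alpha>\<^sub>1 \<alpha>\<^sub>2 k (\<eta> \<epsilon>) (c \<epsilon>) \<rho>)"
proof -
  \<comment> \<open>With this value the term \<open>2 * \<alpha>\<^sub>1 * \<eta>\<close> supplies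
    the first Fourier coefficient \<epsilon> that couples the two resonant modes.\<close>
  have \<alpha>: "\<alpha>\<^sub>1 = 1" using assms(2,4) by simp
  have wf: "wave_family j \<gamma> 1 \<alpha>\<^sub>2 k \<eta> c" using assms(11) \<alpha> by simp
  have k: "k > 0" using assms(9) by (simp add: admissible_def)
  have j_even: "j (- x) = j x" for x using assms(5) by (simp add: hyp_J1_def)
  from limit_or_gap[OF assms(8) k, of "wave_c0 j \<gamma> k"] show ?thesis
  proof cases
    case 1
    then show ?thesis unfolding \<alpha> by (rule instability_of_degenerate_tail[OF wf])
  next
    case (2 e L)
    define \<mu> where "\<mu> = k\<^sup>2 / 4 * (wave_c0 j \<gamma> k - j (k / 2))"
    let ?x = "\<lambda>n. wave_c0 j \<gamma> k - j (k * wavenum n)"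
    \<comment> \<open>Half of the gap \<open>k^2 * e\<close> is kept; the other half absorbs the
      term with \<open>\<mu>\<close>, which tends to 0.\<close>
    have ke: "k\<^sup>2 * e / 2 > 0" using 2(1) k by simp
    have "(\<lambda>n. \<mu> / (wavenum n)\<^sup>2) \<longlonglongrightarrow> 0"
    proof -
      have "filterlim wavenum at_top sequentially"
        by (rule filterlim_at_top_mono[OF filterlim_real_sequentially]) (simp add: wavenum_def)
      then show ?thesis
        by (intro real_tendsto_divide_at_top[OF tendsto_const] filterlim_pow_at_top) auto
    qed
    from LIMSEQ_D[OF this ke] obtain L' where L': "\<And>n. n \<ge> L' \<Longrightarrow> \<bar>\<mu> / (wavenum n)\<^sup>2\<bar> < k\<^sup>2 * e / 2" by auto
    have "k\<^sup>2 * e / 2 \<le> \<bar>k\<^sup>2 * ?x n - \<mu> / (wavenum n)\<^sup>2\<bar>" if n: "n \<ge> max L L'" for n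
    proof -
      have "k\<^sup>2 * e \<le> k\<^sup>2 * \<bar>?x n\<bar>" using 2(2)[of n] n by (intro mult_left_mono) auto
      then have "k\<^sup>2 * e \<le> \<bar>k\<^sup>2 * ?x n\<bar>" by (simp add: abs_mult)
      moreover have "\<bar>\<mu> / (wavenum n)\<^sup>2\<bar> < k\<^sup>2 * e / 2" using n by (intro L') simp
      moreover have "h / 2 \<le> \<bar>u - v\<bar>" if "h \<le> \<bar>u\<bar>" "\<bar>v\<bar> < h / 2" for h u v :: real using that by linarith
      ultimately show ?thesis by blast
    qed
    then show ?thesis unfolding \<alpha>
      by (intro instability_of_nonresonant_tail[OF assms(1) k j_even assms(10) wf ke, folded \<mu>_def]) blast
  qed
qed

end
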